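(* Let $\mathbb{K}$ be an algebraically closed field of characteristic zero and let $Z\subset X\subset\mathbb{P}^N$ be irreducible projective varieties over $\mathbb{K}$, with $X\neq\mathbb{P}^N$. Assume that $X$ is dual regular relative to $Z$. Then the following properties are equivalent: (1) $\mathrm{def}(X,Z)=\mathrm{def}(X)$; (2) $X$ is reflexive relative to $Z$, i.e. $W_{X,Z}=W_{X^\vee,X_Z^\vee}$ (under the exchange of factors $\mathbb{P}^N\times(\mathbb{P}^N)^\vee\cong(\mathbb{P}^N)^\vee\times\mathbb{P}^N$); (3) $X$ is reciprocal relative to $Z$, i.e. $(X^\vee)^\vee_{X_Z^\vee}=Z$.
   Context: Varieties are reduced. $(\mathbb{P}^N)^\vee$ is the dual projective space of hyperplanes of $\mathbb{P}^N$, and $((\mathbb{P}^N)^\vee)^\vee$ is identified with $\mathbb{P}^N$. $X_{\rm sm}$ and $X_{\rm sing}$ are the smooth and singular loci of $X$; for $x\in X_{\rm sm}$, $T_xX\subset\mathbb{P}^N$ is the embedded projective tangent space. A hyperplane $H$ is tangent to $X$ at $x\in X_{\rm sm}$ if $H\supset T_xX$. The conormal variety of $X$ is $W_X=\overline{\{(x,H)\in\mathbb{P}^N\times(\mathbb{P}^N)^\vee\mid x\in X_{\rm sm},\ H\supset T_xX\}}$ (Zariski closure), and the dual variety is $X^\vee=\mathrm{pr}_2(W_X)\subset(\mathbb{P}^N)^\vee$. For a subvariety $Z\subset X$, the conormal variety of $X$ relative to $Z$ is $W_{X,Z}=\overline{\{(x,H)\mid x\in X_{\rm sm}\cap Z,\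 H\supset T_xX\}}$, and the dual variety of $X$ relative to $Z$ is $X_Z^\vee=\mathrm{pr}_2(W_{X,Z})\subset X^\vee$. The same definitions applied to the pair $X_Z^\vee\subset X^\vee\subset(\mathbb{P}^N)^\vee$ give $W_{X^\vee,X_Z^\vee}\subset(\mathbb{P}^N)^\vee\times\mathbb{P}^N$ and $(X^\vee)^\vee_{X_Z^\vee}\subset\mathbb{P}^N$. Defects: $\mathrm{def}(X)$ is the dimension of the contact locus $\mathrm{Cont}(H,X)=\mathrm{pr}_1(\mathrm{pr}_2^{-1}(H)\cap W_X)$ for generic $H\in X^\vee$; $\mathrm{def}(X,Z)$ is the dimension of the relative contact locus $\mathrm{Cont}(H,X,Z)=\mathrm{pr}_1(\mathrm{pr}_2^{-1}(H)\cap W_{X,Z})$ for generic $H\in X_Z^\vee$. $X$ is dual regular relative to $Z$ if there exists $(x,H)\in W_{X,Z}$ with $x\in X_{\rm sm}$ and $H\in(X^\vee)_{\rm sm}$. *)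

theory Defs
  imports
    "HOL-Analysis.Analysis"
    "HOL-Library.Poly_Mapping"
    "HOL-Library.Extended_Nat"
    "HOL-Computational_Algebra.Polynomial"
begin

type_synonym ('k, 'i) mpoly = "('i \<Rightarrow>\<^sub>0 nat) \<Rightarrow>\<^sub>0 'k"

definition mon_eval :: "('i::finite \<Rightarrow> 'k::comm_ring_1) \<Rightarrow> ('i \<Rightarrow>\<^sub>0 nat) \<Rightarrow> 'k" where
  "mon_eval x m = (\<Prod>i\<in>UNIV. x i ^ Poly_Mapping.lookup m i)"

definition mp_eval :: "('k::comm_ring_1, 'i::finite) mpoly \<Rightarrow> ('i \<Rightarrow> 'k) \<Rightarrow> 'k" where
  "mp_eval f x = (\<Sum>m\<in>Poly_Mapping.keys f. Poly_Mapping.lookup f m * mon_eval x m)"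

definition mp_pderiv :: "'i \<Rightarrow> ('k::comm_ring_1, 'i::finite) mpoly \<Rightarrow> ('k, 'i) mpoly" where
  "mp_pderiv i f =
    (\<Sum>m\<in>Poly_Mapping.keys f.
       Poly_Mapping.single (m - Poly_Mapping.single i 1)
         (of_nat (Poly_Mapping.lookup m i) * Poly_Mapping.lookup f m))"

definition homogeneous_in :: "'i set \<Rightarrow> nat \<Rightarrow> ('k::comm_ring_1, 'i::finite) mpoly \<Rightarrow> bool" where
  "homogeneous_in A d f \<longleftrightarrow>
    (\<forall>m\<in>Poly_Mapping.keys f. (\<Sum>i\<in>A. Poly_Mapping.lookup m i) = d)"

definition homogeneous :: "('k::comm_ring_1, 'i::finite) mpoly \<Rightarrow> bool" where
  "homogeneous f \<longleftrightarrow> (\<exists>d. homogeneous_in UNIV d f)"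

definition bihomogeneous :: "('k::comm_ring_1, 'i::finite + 'j::finite) mpoly \<Rightarrow> bool" where
  "bihomogeneous f \<longleftrightarrow>
    (\<exists>d e. homogeneous_in (range Inl) d f \<and> homogeneous_in (range Inr) e f)"

lemma mp_eval_superset:
  assumes "finite A" "Poly_Mapping.keys f \<subseteq> A"
  shows "mp_eval f x = (\<Sum>m\<in>A. Poly_Mapping.lookup f m * mon_eval x m)"
  unfolding mp_eval_def using assms
  by (intro sum.mono_neutral_left) (auto simp: in_keys_iff)

lemma mp_eval_add: "mp_eval (f + g) x = mp_eval f x + mp_eval g x"
proof -
  let ?A = "Poly_Mapping.keys f \<union> Poly_Mapping.keys g"
  have k: "Poly_Mapping.keys (f + g) \<subseteq> ?A" by (rule keys_add)
  have "mp_eval (f + g) x = (\<Sum>m\<in>?A. Poly_Mapping.lookup (f + g) m * mon_eval x m)"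
    by (rule mp_eval_superset) (use k in auto)
  also have "\<dots> = (\<Sum>m\<in>?A. Poly_Mapping.lookup f m * mon_eval x m)
      + (\<Sum>m\<in>?A. Poly_Mapping.lookup g m * mon_eval x m)"
    by (simp add: lookup_add distrib_right sum.distrib)
  also have "\<dots> = mp_eval f x + mp_eval g x"
    by (subst (1 2) mp_eval_superset[of ?A, symmetric]) auto
  finally show ?thesis .
qed

lemma mp_eval_zero [simp]: "mp_eval 0 x = 0"
  by (simp add: mp_eval_def)

lemma mp_eval_sum: "mp_eval (\<Sum>a\<in>A. f a) x = (\<Sum>a\<in>A. mp_eval (f a) x)"
  by (induction A rule: infinite_finite_induct) (auto simp: mp_eval_add)

lemma mp_eval_single: "mp_eval (Poly_Mapping.single m c) x = c * mon_eval x m"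
  by (simp add: mp_eval_def)

lemma mp_eval_one [simp]: "mp_eval 1 x = 1"
  by (simp add: mp_eval_def mon_eval_def)

lemma mon_eval_add: "mon_eval x (m + m') = mon_eval x m * mon_eval x m'"
  by (simp add: mon_eval_def lookup_add power_add prod.distrib)

lemma mpoly_eq_sum_single:
  "(f :: ('k::comm_ring_1, 'i) mpoly)
    = (\<Sum>m\<in>Poly_Mapping.keys f. Poly_Mapping.single m (Poly_Mapping.lookup f m))"
  by (rule poly_mapping_eqI)
    (simp add: lookup_sum lookup_single when_def sum.delta in_keys_iff)

lemma mp_eval_mult: "mp_eval (f * g) x = mp_eval f x * mp_eval g x"
proof -
  have "f * g = (\<Sum>m\<in>Poly_Mapping.keys f. \<Sum>m'\<in>Poly_Mapping.keys g.
      Poly_Mapping.single (m + m') (Poly_Mapping.lookup f m * Poly_Mapping.lookup g m'))"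
    by (subst mpoly_eq_sum_single[of f], subst mpoly_eq_sum_single[of g])
      (simp add: sum_product mult_single)
  then show ?thesis
    by (simp add: mp_eval_sum mp_eval_single mon_eval_add)
      (simp add: mp_eval_def sum_product mult_ac)
qed

lemma homogeneous_in_mult:
  assumes "homogeneous_in A d f" "homogeneous_in A e g"
  shows "homogeneous_in A (d + e) (f * g)"
  unfolding homogeneous_in_def
proof
  fix m assume "m \<in> Poly_Mapping.keys (f * g)"
  then obtain a b where "m = a + b" "a \<in> Poly_Mapping.keys f" "b \<in> Poly_Mapping.keys g"
    using keys_mult[of f g] by blast
  then show "(\<Sum>i\<in>A. Poly_Mapping.lookup m i) = d + e"
    using assms by (simp add: homogeneous_in_def lookup_add sum.distrib)
qed

lemma homogeneous_mult: "homogeneous f \<Longrightarrow> homogeneous g \<Longrightarrow> homogeneous (f * g)"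
  unfolding homogeneous_def using homogeneous_in_mult by blast

lemma bihomogeneous_mult: "bihomogeneous f \<Longrightarrow> bihomogeneous g \<Longrightarrow> bihomogeneous (f * g)"
  unfolding bihomogeneous_def using homogeneous_in_mult by blast

lemma homogeneous_one: "homogeneous 1"
  by (auto simp: homogeneous_def homogeneous_in_def)

lemma bihomogeneous_one: "bihomogeneous 1"
  by (auto simp: bihomogeneous_def homogeneous_in_def)

lemma mp_eval_scale:
  assumes "homogeneous_in A d f"
  shows "mp_eval f (\<lambda>i. if i \<in> A then c * x i else x i) = c ^ d * mp_eval f x"
proof -
  have "mon_eval (\<lambda>i. if i \<in> A then c * x i else x i) m = c ^ d * mon_eval x m"
    if "m \<in> Poly_Mapping.keys f" for m
  proof -
    have "mon_eval (\<lambda>i. if i \<in> A then c * x i else x i) m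
        = (\<Prod>i\<in>UNIV. (if i \<in> A then c ^ Poly_Mapping.lookup m i else 1)
            * x i ^ Poly_Mapping.lookup m i)"
      unfolding mon_eval_def by (intro prod.cong) (auto simp: power_mult_distrib)
    also have "\<dots> = (\<Prod>i\<in>A. c ^ Poly_Mapping.lookup m i) * mon_eval x m"
      by (simp add: prod.distrib mon_eval_def prod.If_cases)
    also have "(\<Prod>i\<in>A. c ^ Poly_Mapping.lookup m i) = c ^ d"
      using assms that by (simp add: homogeneous_in_def power_sum[symmetric])
    finally show ?thesis .
  qed
  then show ?thesis
    by (simp add: mp_eval_def sum_distrib_left mult_ac)
qed

text \<open>
  A point of \<open>P\<^sup>N\<close>, where \<open>N + 1 = CARD('n)\<close>, is a line through the origin of \<open>'k ^ 'n\<close>.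
  The same type serves as the dual projective space: \<open>[h]\<close> is the hyperplane \<open>\<Sum>\<^sub>i h\<^sub>i x\<^sub>i = 0\<close>.
  With this choice the identification of the bidual with \<open>P\<^sup>N\<close> is the identity.
\<close>

typedef (overloaded) ('k, 'n) proj_space =
  "{vec.span {v} | v :: 'k::field ^ 'n::finite. v \<noteq> 0}"
proof -
  have "(1 :: 'k ^ 'n) \<noteq> 0"
    by (simp add: vec_eq_iff)
  then show ?thesis by blast
qed

definition hcoords :: "('k::field, 'n::finite) proj_space \<Rightarrow> ('k ^ 'n) set" where
  "hcoords p = Rep_proj_space p - {0}"

lemma hcoords_nonempty: "\<exists>a. a \<in> hcoords p"
proof -
  obtain v where "Rep_proj_space p = vec.span {v}" "v \<noteq> 0"
    using Rep_proj_space[of p] by auto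
  then show ?thesis
    by (auto simp: hcoords_def intro!: exI[of _ v] vec.span_base)
qed

lemma hcoords_multiple:
  assumes "a \<in> hcoords p" "b \<in> hcoords p"
  shows "\<exists>c. c \<noteq> 0 \<and> b = c *s a"
proof -
  obtain v where v: "Rep_proj_space p = vec.span {v}" "v \<noteq> 0"
    using Rep_proj_space[of p] by auto
  obtain s t where "a = s *s v" "b = t *s v"
    using assms v by (auto simp: hcoords_def vec.span_singleton)
  moreover have "s \<noteq> 0" "t \<noteq> 0"
    using assms calculation by (auto simp: hcoords_def)
  ultimately show ?thesis
    by (intro exI[of _ "t / s"]) simp
qed

definition vanishes :: "('k::field, 'n::finite) mpoly \<Rightarrow> ('k, 'n) proj_space \<Rightarrow> bool" where
  "vanishes f p \<longleftrightarrow> (\<forall>a\<in>hcoords p. mp_eval f (($) a) = 0)"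

definition bivanishes ::
  "('k::field, 'n::finite + 'm::finite) mpoly \<Rightarrow>
    ('k, 'n) proj_space \<times> ('k, 'm) proj_space \<Rightarrow> bool" where
  "bivanishes f q \<longleftrightarrow>
    (\<forall>a\<in>hcoords (fst q). \<forall>b\<in>hcoords (snd q). mp_eval f (case_sum (($) a) (($) b)) = 0)"

lemma vanishes_iff:
  assumes "homogeneous f" "a \<in> hcoords p"
  shows "vanishes f p \<longleftrightarrow> mp_eval f (($) a) = 0"
proof -
  obtain d where d: "homogeneous_in UNIV d f"
    using assms by (auto simp: homogeneous_def)
  have "mp_eval f (($) b) = 0" if b: "b \<in> hcoords p" "mp_eval f (($) a) = 0" for b
  proof -
    obtain c where "b = c *s a"
      using hcoords_multiple[OF assms(2) b(1)] by auto
    then have "(($) b) = (\<lambda>i. if i \<in> UNIV then c * (a $ i) else a $ i)"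
      by auto
    then show ?thesis
      using mp_eval_scale[OF d, of c "($) a"] b by simp
  qed
  then show ?thesis
    using assms(2) by (auto simp: vanishes_def)
qed

lemma bivanishes_iff:
  assumes "bihomogeneous f" "a \<in> hcoords (fst q)" "b \<in> hcoords (snd q)"
  shows "bivanishes f q \<longleftrightarrow> mp_eval f (case_sum (($) a) (($) b)) = 0"
proof -
  obtain d e where d: "homogeneous_in (range Inl) d f" and e: "homogeneous_in (range Inr) e f"
    using assms by (auto simp: bihomogeneous_def)
  have "mp_eval f (case_sum (($) a') (($) b')) = 0"
    if ab: "a' \<in> hcoords (fst q)" "b' \<in> hcoords (snd q)"
      "mp_eval f (case_sum (($) a) (($) b)) = 0" for a' b'
  proof -
    obtain c c' where c: "a' = c *s a" "b' = c' *s b"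
      using hcoords_multiple[OF assms(2) ab(1)] hcoords_multiple[OF assms(3) ab(2)] by auto
    let ?x = "case_sum (($) a) (($) b)" and ?y = "case_sum (($) a') (($) b)"
    have 1: "?y = (\<lambda>i. if i \<in> range Inl then c * ?x i else ?x i)"
      using c by (auto split: sum.splits)
    have 2: "case_sum (($) a') (($) b') = (\<lambda>i. if i \<in> range Inr then c' * ?y i else ?y i)"
      using c by (auto split: sum.splits)
    show ?thesis
      unfolding 2 mp_eval_scale[OF e] unfolding 1 mp_eval_scale[OF d] using ab by simp
  qed
  then show ?thesis
    using assms(2,3) by (auto simp: bivanishes_def)
qed

lemma vanishes_mult:
  assumes "homogeneous f" "homogeneous g"
  shows "vanishes (f * g) p \<longleftrightarrow> vanishes f p \<or> vanishes g p"
proof -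
  obtain a where a: "a \<in> hcoords p" using hcoords_nonempty by blast
  show ?thesis
    using assms by (simp add: vanishes_iff[OF _ a] homogeneous_mult mp_eval_mult)
qed

lemma bivanishes_mult:
  assumes "bihomogeneous f" "bihomogeneous g"
  shows "bivanishes (f * g) q \<longleftrightarrow> bivanishes f q \<or> bivanishes g q"
proof -
  obtain a b where ab: "a \<in> hcoords (fst q)" "b \<in> hcoords (snd q)"
    using hcoords_nonempty[of "fst q"] hcoords_nonempty[of "snd q"] by blast
  show ?thesis
    using assms by (simp add: bivanishes_iff[OF _ ab] bihomogeneous_mult mp_eval_mult)
qed

lemma istopology_zero_loci:
  assumes mult: "\<And>f g. P f \<Longrightarrow> P g \<Longrightarrow> P (m f g)"
    and van: "\<And>f g p. P f \<Longrightarrow> P g \<Longrightarrow> van (m f g) p \<longleftrightarrow> van f p \<or> van g p"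
  shows "istopology (\<lambda>U. \<exists>F. (\<forall>f\<in>F. P f) \<and> U = - {p. \<forall>f\<in>F. van f p})"
  unfolding istopology_def
proof (intro conjI allI impI; (elim exE conjE)?)
  fix S T F G
  assume F: "\<forall>f\<in>F. P f" "S = - {p. \<forall>f\<in>F. van f p}"
    and G: "\<forall>f\<in>G. P f" "T = - {p. \<forall>f\<in>G. van f p}"
  let ?H = "{m f g | f g. f \<in> F \<and> g \<in> G}"
  have "\<forall>h\<in>?H. P h" using F(1) G(1) mult by auto
  moreover have "p \<in> S \<inter> T \<longleftrightarrow> p \<in> - {p. \<forall>h\<in>?H. van h p}" for p
  proof -
    have "p \<in> S \<inter> T \<longleftrightarrow> (\<exists>f\<in>F. \<exists>g\<in>G. \<not> van f p \<and> \<not> van g p)"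
      unfolding F(2) G(2) by auto
    also have "\<dots> \<longleftrightarrow> (\<exists>f\<in>F. \<exists>g\<in>G. \<not> van (m f g) p)"
      using F(1) G(1) van by (intro bex_cong refl) simp
    finally show ?thesis by auto
  qed
  then have "S \<inter> T = - {p. \<forall>h\<in>?H. van h p}"
    by (rule set_eqI)
  ultimately show "\<exists>F. (\<forall>f\<in>F. P f) \<and> S \<inter> T = - {p. \<forall>f\<in>F. van f p}"
    by (intro exI conjI)
next
  fix \<K> assume K: "\<forall>K\<in>\<K>. \<exists>F. (\<forall>f\<in>F. P f) \<and> K = - {p. \<forall>f\<in>F. van f p}"
  define F where "F K = (SOME F. (\<forall>f\<in>F. P f) \<and> K = - {p. \<forall>f\<in>F. van f p})" for K
  have F: "(\<forall>f\<in>F K. P f) \<and> K = - {p. \<forall>f\<in>F K. van f p}" if "K \<in> \<K>" for K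
    unfolding F_def by (rule someI_ex) (use K that in blast)
  have "p \<in> \<Union>\<K> \<longleftrightarrow> p \<in> - {p. \<forall>f\<in>\<Union>(F ` \<K>). van f p}" for p
  proof -
    have "p \<in> K \<longleftrightarrow> (\<exists>f\<in>F K. \<not> van f p)" if "K \<in> \<K>" for K
      by (subst conjunct2[OF F[OF that]]) simp
    then show ?thesis by simp
  qed
  then have "\<Union>\<K> = - {p. \<forall>f\<in>\<Union>(F ` \<K>). van f p}"
    by (rule set_eqI)
  moreover have "\<forall>f\<in>\<Union>(F ` \<K>). P f"
    using F by simp
  ultimately show "\<exists>F. (\<forall>f\<in>F. P f) \<and> \<Union>\<K> = - {p. \<forall>f\<in>F. van f p}"
    by (intro exI conjI)
qed

definition zariski :: "('k::field, 'n::finite) proj_space topology" where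
  "zariski = topology (\<lambda>U. \<exists>F. (\<forall>f\<in>F. homogeneous f) \<and> U = - {p. \<forall>f\<in>F. vanishes f p})"

text \<open>The Zariski topology of \<open>P\<^sup>N \<times> P\<^sup>M\<close>, which is finer than the product topology.\<close>

definition bizariski ::
  "(('k::field, 'n::finite) proj_space \<times> ('k, 'm::finite) proj_space) topology" where
  "bizariski =
    topology (\<lambda>U. \<exists>F. (\<forall>f\<in>F. bihomogeneous f) \<and> U = - {q. \<forall>f\<in>F. bivanishes f q})"

lemma openin_zariski:
  fixes U :: "(('k::field, 'n::finite) proj_space) set"
  shows "openin zariski U \<longleftrightarrow> (\<exists>F. (\<forall>f\<in>F. homogeneous f) \<and> U = - {p. \<forall>f\<in>F. vanishes f p})"
proof -
  have "istopology (\<lambda>U :: (('k::field, 'n::finite) proj_space) set.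
      \<exists>F. (\<forall>f\<in>F. homogeneous f) \<and> U = - {p. \<forall>f\<in>F. vanishes f p})"
    by (rule istopology_zero_loci[where m = "(*)"]) (simp_all add: homogeneous_mult vanishes_mult)
  from topology_inverse'[OF this] show ?thesis
    by (simp only: zariski_def)
qed

lemma openin_bizariski:
  fixes U :: "(('k::field, 'n::finite) proj_space \<times> ('k, 'm::finite) proj_space) set"
  shows "openin bizariski U \<longleftrightarrow> (\<exists>F. (\<forall>f\<in>F. bihomogeneous f) \<and> U = - {q. \<forall>f\<in>F. bivanishes f q})"
proof -
  have "istopology (\<lambda>U :: (('k::field, 'n::finite) proj_space \<times> ('k, 'm::finite) proj_space) set.
      \<exists>F. (\<forall>f\<in>F. bihomogeneous f) \<and> U = - {q. \<forall>f\<in>F. bivanishes f q})"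
    by (rule istopology_zero_loci[where m = "(*)"]) (simp_all add: bihomogeneous_mult bivanishes_mult)
  from topology_inverse'[OF this] show ?thesis
    by (simp only: bizariski_def)
qed

lemma topspace_zariski [simp]: "topspace (zariski :: (('k::field, 'n::finite) proj_space) topology) = UNIV"
proof -
  have "\<not> vanishes 1 p" for p :: "('k::field, 'n::finite) proj_space"
    using hcoords_nonempty[of p] by (auto simp: vanishes_def)
  then have "openin zariski (UNIV :: (('k::field, 'n::finite) proj_space) set)"
    unfolding openin_zariski by (intro exI[of _ "{1}"]) (auto simp: homogeneous_one)
  from openin_subset[OF this] show ?thesis
    by auto
qed

lemma topspace_bizariski [simp]: "topspace (bizariski :: (('k::field, 'n::finite) proj_space \<times> ('k, 'm::finite) proj_space) topology) = UNIV"
proof -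
  have "\<not> bivanishes 1 q" for q :: "('k::field, 'n::finite) proj_space \<times> ('k, 'm::finite) proj_space"
    using hcoords_nonempty[of "fst q"] hcoords_nonempty[of "snd q"] by (auto simp: bivanishes_def)
  then have "openin bizariski (UNIV :: (('k::field, 'n::finite) proj_space \<times> ('k, 'm::finite) proj_space) set)"
    unfolding openin_bizariski by (intro exI[of _ "{1}"]) (auto simp: bihomogeneous_one)
  from openin_subset[OF this] show ?thesis
    by auto
qed

lemma closedin_zariski:
  fixes S :: "(('k::field, 'n::finite) proj_space) set"
  shows "closedin zariski S \<longleftrightarrow> (\<exists>F. (\<forall>f\<in>F. homogeneous f) \<and> S = {p. \<forall>f\<in>F. vanishes f p})"
proof -
  have "UNIV - S = - A \<longleftrightarrow> S = A" for A
    by blast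
  then show ?thesis
    by (simp only: closedin_def openin_zariski topspace_zariski) simp
qed

lemma closedin_bizariski:
  fixes S :: "(('k::field, 'n::finite) proj_space \<times> ('k, 'm::finite) proj_space) set"
  shows "closedin bizariski S \<longleftrightarrow> (\<exists>F. (\<forall>f\<in>F. bihomogeneous f) \<and> S = {q. \<forall>f\<in>F. bivanishes f q})"
proof -
  have "UNIV - S = - A \<longleftrightarrow> S = A" for A
    by blast
  then show ?thesis
    by (simp only: closedin_def openin_bizariski topspace_bizariski) simp
qed

definition irreducible_in :: "'a topology \<Rightarrow> 'a set \<Rightarrow> bool" where
  "irreducible_in T S \<longleftrightarrow> S \<subseteq> topspace T \<and> S \<noteq> {} \<and>
    (\<forall>C D. closedin T C \<and> closedin T D \<and> S \<subseteq> C \<union> D \<longrightarrow> S \<subseteq> C \<or> S \<subseteq> D)"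

definition irred_chain :: "'a topology \<Rightarrow> 'a set \<Rightarrow> nat \<Rightarrow> (nat \<Rightarrow> 'a set) \<Rightarrow> bool" where
  "irred_chain T S n V \<longleftrightarrow>
    (\<forall>i\<le>n. closedin (subtopology T S) (V i) \<and> irreducible_in T (V i)) \<and>
    (\<forall>i<n. V i \<subset> V (Suc i))"

text \<open>Krull dimension; in \<^typ>\<open>enat\<close> the empty set gets the value 0.\<close>

definition krull_dim :: "'a topology \<Rightarrow> 'a set \<Rightarrow> enat" where
  "krull_dim T S = Sup {enat n | n. \<exists>V. irred_chain T S n V}"

text \<open>
  The irreducible closed subsets of \<open>S\<close> through \<open>x\<close> correspond to the primes of the local ring
  of \<open>S\<close> at \<open>x\<close>, so this is the dimension of that ring.
\<close>

definition local_dim :: "'a topology \<Rightarrow> 'a set \<Rightarrow> 'a \<Rightarrow> enat" where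
  "local_dim T S x = Sup {enat n | n. \<exists>V. irred_chain T S n V \<and> x \<in> V 0}"

text \<open>"Generic" means on a dense open subset; for irreducible \<open>Y\<close>, on a nonempty open one.\<close>

definition generically_on :: "'a topology \<Rightarrow> 'a set \<Rightarrow> ('a \<Rightarrow> bool) \<Rightarrow> bool" where
  "generically_on T Y P \<longleftrightarrow>
    (\<exists>U. openin (subtopology T Y) U \<and> Y \<subseteq> T closure_of U \<and> (\<forall>y\<in>U. P y))"

definition projective_variety :: "('k::field, 'n::finite) proj_space set \<Rightarrow> bool" where
  "projective_variety X \<longleftrightarrow> closedin zariski X"

definition irreducible_variety :: "('k::field, 'n::finite) proj_space set \<Rightarrow> bool" where
  "irreducible_variety X \<longleftrightarrow> projective_variety X \<and> irreducible_in zariski X"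

text \<open>The linear subspace of \<open>'k ^ 'n\<close> whose projectivization is the embedded tangent space.\<close>

definition tangent_lin ::
  "('k::field, 'n::finite) proj_space set \<Rightarrow> ('k, 'n) proj_space \<Rightarrow> ('k ^ 'n) set" where
  "tangent_lin X x =
    {v. \<forall>f. homogeneous f \<and> (\<forall>p\<in>X. vanishes f p) \<longrightarrow>
      (\<forall>a\<in>hcoords x. (\<Sum>i\<in>UNIV. mp_eval (mp_pderiv i f) (($) a) * v $ i) = 0)}"

definition tangent_space ::
  "('k::field, 'n::finite) proj_space set \<Rightarrow> ('k, 'n) proj_space \<Rightarrow> ('k, 'n) proj_space set" where
  "tangent_space X x = {y. hcoords y \<subseteq> tangent_lin X x}"

text \<open>The condition below reads: the projective dimension of \<open>T\<^sub>xX\<close> is the dimension of \<open>X\<close> at \<open>x\<close>.\<close>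

definition smooth_locus ::
  "('k::field, 'n::finite) proj_space set \<Rightarrow> ('k, 'n) proj_space set" where
  "smooth_locus X = {x\<in>X. enat (vec.dim (tangent_lin X x)) = local_dim zariski X x + 1}"

definition hyperplane :: "('k::field, 'n::finite) proj_space \<Rightarrow> ('k, 'n) proj_space set" where
  "hyperplane H = {x. \<forall>h\<in>hcoords H. \<forall>a\<in>hcoords x. (\<Sum>i\<in>UNIV. h $ i * a $ i) = 0}"

definition conormal ::
  "('k::field, 'n::finite) proj_space set \<Rightarrow> (('k, 'n) proj_space \<times> ('k, 'n) proj_space) set" where
  "conormal X =
    bizariski closure_of {(x, H). x \<in> smooth_locus X \<and> tangent_space X x \<subseteq> hyperplane H}"

definition dual_variety ::
  "('k::field, 'n::finite) proj_space set \<Rightarrow> ('k, 'n) proj_space set" where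
  "dual_variety X = snd ` conormal X"

definition rel_conormal ::
  "('k::field, 'n::finite) proj_space set \<Rightarrow> ('k, 'n) proj_space set \<Rightarrow>
    (('k, 'n) proj_space \<times> ('k, 'n) proj_space) set" where
  "rel_conormal X Z =
    bizariski closure_of
      {(x, H). x \<in> smooth_locus X \<inter> Z \<and> tangent_space X x \<subseteq> hyperplane H}"

definition rel_dual ::
  "('k::field, 'n::finite) proj_space set \<Rightarrow> ('k, 'n) proj_space set \<Rightarrow>
    ('k, 'n) proj_space set" where
  "rel_dual X Z = snd ` rel_conormal X Z"

definition contact_locus ::
  "('k::field, 'n::finite) proj_space \<Rightarrow> ('k, 'n) proj_space set \<Rightarrow> ('k, 'n) proj_space set" where
  "contact_locus H X = fst ` (snd -` {H} \<inter> conormal X)"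

definition rel_contact_locus ::
  "('k::field, 'n::finite) proj_space \<Rightarrow> ('k, 'n) proj_space set \<Rightarrow> ('k, 'n) proj_space set \<Rightarrow>
    ('k, 'n) proj_space set" where
  "rel_contact_locus H X Z = fst ` (snd -` {H} \<inter> rel_conormal X Z)"

text \<open>
  The defects are the generic dimensions of contact loci. At most one value is generic when the
  dual is nonempty.
\<close>

definition defect :: "('k::field, 'n::finite) proj_space set \<Rightarrow> enat" where
  "defect X =
    (THE d. generically_on zariski (dual_variety X)
       (\<lambda>H. krull_dim zariski (contact_locus H X) = d))"

definition rel_defect ::
  "('k::field, 'n::finite) proj_space set \<Rightarrow> ('k, 'n) proj_space set \<Rightarrow> enat" where
  "rel_defect X Z =
    (THE d. generically_on zariski (rel_dual X Z)
       (\<lambda>H. krull_dim zariski (rel_contact_locus H X Z) = d))"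

definition dual_regular_rel ::
  "('k::field, 'n::finite) proj_space set \<Rightarrow> ('k, 'n) proj_space set \<Rightarrow> bool" where
  "dual_regular_rel X Z \<longleftrightarrow>
    (\<exists>(x, H)\<in>rel_conormal X Z. x \<in> smooth_locus X \<and> H \<in> smooth_locus (dual_variety X))"

definition reflexive_rel ::
  "('k::field, 'n::finite) proj_space set \<Rightarrow> ('k, 'n) proj_space set \<Rightarrow> bool" where
  "reflexive_rel X Z \<longleftrightarrow>
    rel_conormal X Z = prod.swap ` rel_conormal (dual_variety X) (rel_dual X Z)"

definition reciprocal_rel ::
  "('k::field, 'n::finite) proj_space set \<Rightarrow> ('k, 'n) proj_space set \<Rightarrow> bool" where
  "reciprocal_rel X Z \<longleftrightarrow> rel_dual (dual_variety X) (rel_dual X Z) = Z"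

end

theory Submission
  imports Defs "HOL-Computational_Algebra.Formal_Laurent_Series"
begin

text \<open>
  Generic points live in an ultrapower \<open>'k omega\<close> of the ground field, which is saturated enough to
  realize every irreducible variety as the locus of a point. The dimension of a variety is then the
  dimension of the space of derivations at its generic point; places and formal curves relate it to
  Krull dimension and show that projections are closed.

  Let \<open>Y\<close> be the dual of \<open>X\<close> and \<open>Y\<^sub>Z\<close> the relative dual. Biduality (this needs characteristic zero)
  makes the conormal conditions on \<open>X\<close> and \<open>Y\<close> equivalent over pairs of smooth points. So dual
  regularity gives \<open>W(X, Z) \<subseteq> W(Y, Y\<^sub>Z)\<close>, where both sides are irreducible. Reciprocity says that the
  generic point of the right side lies over \<open>Z\<close>, which puts it into the left side. Over a smooth
  point \<open>H \<in> Y\<^sub>Z\<close> of \<open>Y\<close> the fibre of the right side is the linear contact locus of \<open>X\<close>, of dimension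
  \<open>def(X)\<close>; the left fibre is a closed subset, so for generic \<open>H\<close> the two fibres coincide if and only
  if \<open>def(X, Z) = def(X)\<close>.
\<close>

section \<open>Evaluation of polynomials along ring homomorphisms\<close>

text \<open>Two definitions force the detours. \<open>smooth_locus\<close> compares the tangent
  space with the length of chains that start at the given point; so identifying it with the open set
  where the gradients have their generic rank needs a chain of full length at every such point, and
  the formal flows supply it. The defects are Krull dimensions of fibres; their semicontinuity is
  obtained by replacing "dimension at least \<open>k\<close>" by "meets every linear space cut out
  by \<open>k\<close> forms", which elimination shows to be a closed condition on the fibre.
  Derivations replace transcendence degree because in characteristic zero a derivation given on some
  coordinates extends to the whole big field: dimensions become ranks, and incidence relations can
  simply be differentiated. Dual regularity enters through a single pair \<open>(x0, H0)\<close>. It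
  shows that neither of the two irreducible conormal varieties lies over the singular loci, so
  inclusions between them may be tested over smooth points.\<close>

definition rhom :: "('a::comm_ring_1 \<Rightarrow> 'b::comm_ring_1) \<Rightarrow> bool" where
  "rhom h \<longleftrightarrow> h 1 = 1 \<and> (\<forall>x y. h (x + y) = h x + h y) \<and> (\<forall>x y. h (x * y) = h x * h y)"

lemma rhom_1: "rhom h \<Longrightarrow> h 1 = 1"
  and rhom_add: "rhom h \<Longrightarrow> h (x + y) = h x + h y"
  and rhom_mult: "rhom h \<Longrightarrow> h (x * y) = h x * h y"
  by (auto simp: rhom_def)

lemma rhom_0: "rhom h \<Longrightarrow> h 0 = 0"
  using rhom_add[of h 0 0] by simp

lemma rhom_uminus: "rhom h \<Longrightarrow> h (- x) = - h x"
  using rhom_add[of h x "- x"] rhom_0[of h] by (simp add: eq_neg_iff_add_eq_0 add.commute)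

lemma rhom_diff: "rhom h \<Longrightarrow> h (x - y) = h x - h y"
  using rhom_add[of h x "- y"] rhom_uminus[of h y] by simp

lemma rhom_sum: "rhom h \<Longrightarrow> h (sum f A) = (\<Sum>a\<in>A. h (f a))"
  by (induction A rule: infinite_finite_induct) (auto simp: rhom_0 rhom_add)

lemma rhom_prod: "rhom h \<Longrightarrow> h (prod f A) = (\<Prod>a\<in>A. h (f a))"
  by (induction A rule: infinite_finite_induct) (auto simp: rhom_1 rhom_mult)

lemma rhom_power: "rhom h \<Longrightarrow> h (x ^ n) = h x ^ n"
  by (induction n) (auto simp: rhom_1 rhom_mult)

lemma rhom_of_nat: "rhom h \<Longrightarrow> h (of_nat n) = of_nat n"
  by (induction n) (auto simp: rhom_0 rhom_1 rhom_add)

lemma rhom_of_int: "rhom h \<Longrightarrow> h (of_int n) = of_int n"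
  by (cases n) (auto simp: rhom_of_nat rhom_diff rhom_uminus rhom_1)

lemma rhom_id [simp]: "rhom (\<lambda>x. x)"
  by (simp add: rhom_def)

lemma rhom_comp: "rhom h \<Longrightarrow> rhom g \<Longrightarrow> rhom (\<lambda>x. h (g x))"
  by (simp add: rhom_def)

lemma rhom_eq_0_iff:
  fixes h :: "'a::field \<Rightarrow> 'b::comm_ring_1"
  assumes "rhom h"
  shows "h x = 0 \<longleftrightarrow> x = 0"
proof
  assume "h x = 0"
  then show "x = 0"
    using rhom_mult[OF assms, of x "inverse x"] rhom_1[OF assms] by (cases "x = 0") auto
qed (simp add: rhom_0 assms)

text \<open>The coefficients stay in the ground field while the point may live in the ultrapower, in
  Laurent series or in another polynomial ring; every base change is an instance with a different
  \<open>h\<close>.\<close>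

definition ev :: "('k::comm_ring_1 \<Rightarrow> 'r::comm_ring_1) \<Rightarrow> ('k, 'i::finite) mpoly \<Rightarrow> ('i \<Rightarrow> 'r) \<Rightarrow> 'r" where
  "ev h f z = (\<Sum>m\<in>Poly_Mapping.keys f. h (Poly_Mapping.lookup f m) * mon_eval z m)"

definition mp_const :: "'k \<Rightarrow> ('k::comm_ring_1, 'i::finite) mpoly" where
  "mp_const c = Poly_Mapping.single 0 c"

definition mp_var :: "'i \<Rightarrow> ('k::comm_ring_1, 'i::finite) mpoly" where
  "mp_var i = Poly_Mapping.single (Poly_Mapping.single i 1) 1"

lemma mp_eval_ev: "mp_eval f z = ev (\<lambda>x. x) f z"
  by (simp add: mp_eval_def ev_def)

lemma ev_superset:
  assumes "rhom h" "finite A" "Poly_Mapping.keys f \<subseteq> A"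
  shows "ev h f z = (\<Sum>m\<in>A. h (Poly_Mapping.lookup f m) * mon_eval z m)"
  unfolding ev_def using assms
  by (intro sum.mono_neutral_left) (auto simp: in_keys_iff rhom_0)

lemma ev_add: assumes h: "rhom h" shows "ev h (f + g) z = ev h f z + ev h g z"
proof -
  let ?A = "Poly_Mapping.keys f \<union> Poly_Mapping.keys g"
  have k: "Poly_Mapping.keys (f + g) \<subseteq> ?A" by (rule keys_add)
  show ?thesis
    by (subst (1 2 3) ev_superset[OF h, of ?A])
      (use k in \<open>auto simp: lookup_add rhom_add[OF h] distrib_right sum.distrib\<close>)
qed

lemma ev_0 [simp]: "ev h 0 z = 0"
  by (simp add: ev_def)

lemma ev_single: "rhom h \<Longrightarrow> ev h (Poly_Mapping.single m c) z = h c * mon_eval z m"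
  by (simp add: ev_def rhom_0)

lemma ev_sum: "rhom h \<Longrightarrow> ev h (\<Sum>a\<in>A. f a) z = (\<Sum>a\<in>A. ev h (f a) z)"
  by (induction A rule: infinite_finite_induct) (auto simp: ev_add)

lemma ev_mult: assumes h: "rhom h" shows "ev h (f * g) z = ev h f z * ev h g z"
proof -
  have "f * g = (\<Sum>m\<in>Poly_Mapping.keys f. \<Sum>m'\<in>Poly_Mapping.keys g.
      Poly_Mapping.single (m + m') (Poly_Mapping.lookup f m * Poly_Mapping.lookup g m'))"
    by (subst mpoly_eq_sum_single[of f], subst mpoly_eq_sum_single[of g])
      (simp add: sum_product mult_single)
  then show ?thesis
    by (simp add: ev_sum[OF h] ev_single[OF h] mon_eval_add rhom_mult[OF h])
      (simp add: ev_def sum_product mult_ac)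
qed

lemma ev_const: "rhom h \<Longrightarrow> ev h (mp_const c) z = h c"
  by (simp add: mp_const_def ev_single mon_eval_def)

lemma ev_1: "rhom h \<Longrightarrow> ev h 1 z = 1"
  using ev_const[of h 1 z] by (simp add: mp_const_def rhom_1)

lemma ev_var: "rhom h \<Longrightarrow> ev h (mp_var i) z = z i"
proof -
  assume h: "rhom h"
  have "mon_eval z (Poly_Mapping.single i 1) = (\<Prod>j\<in>UNIV. if j = i then z i else 1)"
    unfolding mon_eval_def by (intro prod.cong) (auto simp: lookup_single when_def)
  then show ?thesis
    by (simp add: mp_var_def ev_single[OF h] rhom_1[OF h] prod.delta)
qed

lemma rhom_ev: "rhom h \<Longrightarrow> rhom (\<lambda>f. ev h f z)"
  by (simp add: rhom_def[of "\<lambda>f. ev h f z"] ev_add ev_mult ev_1)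

lemma rhom_mp_const: "rhom (mp_const :: 'k::comm_ring_1 \<Rightarrow> ('k, 'i::finite) mpoly)"
  by (simp add: rhom_def mp_const_def single_add mult_single)

lemma ev_uminus: "rhom h \<Longrightarrow> ev h (- f) z = - ev h f z"
  using rhom_uminus[OF rhom_ev] .

lemma ev_diff: "rhom h \<Longrightarrow> ev h (f - g) z = ev h f z - ev h g z"
  using rhom_diff[OF rhom_ev] .

lemma ev_power: "rhom h \<Longrightarrow> ev h (f ^ n) z = ev h f z ^ n"
  using rhom_power[OF rhom_ev] .

lemma ev_prod: "rhom h \<Longrightarrow> ev h (prod f A) z = (\<Prod>a\<in>A. ev h (f a) z)"
  using rhom_prod[OF rhom_ev] .

lemmas ev_simps = ev_add ev_mult ev_const ev_var ev_1 ev_uminus ev_diff ev_sum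

lemma mp_var_power: "mp_var i ^ n = Poly_Mapping.single (Poly_Mapping.single i n) (1::'k::comm_ring_1)"
  by (induction n) (simp_all add: mp_var_def mult_single single_add[symmetric])

lemma single_eq_prod:
  fixes m :: "'i::finite \<Rightarrow>\<^sub>0 nat"
  shows "Poly_Mapping.single m c = mp_const c * (\<Prod>i\<in>UNIV. mp_var i ^ Poly_Mapping.lookup m i)"
proof -
  have *: "(\<Prod>i\<in>A. mp_var i ^ Poly_Mapping.lookup m i)
      = Poly_Mapping.single (\<Sum>i\<in>A. Poly_Mapping.single i (Poly_Mapping.lookup m i)) (1::'k::comm_ring_1)"
    if "finite A" for A :: "'i set"
    using that by (induction A) (auto simp: mp_var_power mult_single)
  have "(\<Sum>i\<in>UNIV. Poly_Mapping.single i (Poly_Mapping.lookup m i)) = m"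
    by (rule poly_mapping_eqI) (simp add: lookup_sum lookup_single when_def sum.delta)
  then show ?thesis
    by (simp add: * mp_const_def mult_single)
qed

lemma mp_induct [case_names single add]:
  assumes "\<And>m c. P (Poly_Mapping.single m c)" "\<And>f g. P f \<Longrightarrow> P g \<Longrightarrow> P (f + g)"
  shows "P (f :: ('k::comm_ring_1, 'i) mpoly)"
proof -
  have "P (\<Sum>m\<in>A. Poly_Mapping.single m (Poly_Mapping.lookup f m))" for A
    using assms(1)[of 0 0] by (induction A rule: infinite_finite_induct) (auto intro: assms)
  then show ?thesis
    by (subst mpoly_eq_sum_single)
qed

lemma mp_ring_induct [case_names const var add mult]:
  fixes f :: "('k::comm_ring_1, 'i::finite) mpoly"
  assumes "\<And>c. P (mp_const c)" "\<And>i. P (mp_var i)"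
    "\<And>f g. P f \<Longrightarrow> P g \<Longrightarrow> P (f + g)" "\<And>f g. P f \<Longrightarrow> P g \<Longrightarrow> P (f * g)"
  shows "P f"
proof (induction f rule: mp_induct)
  case (single m c)
  have 1: "P 1" using assms(1)[of 1] by (simp add: mp_const_def)
  have p: "P (f ^ n)" if "P f" for f n
    using that 1 by (induction n) (auto intro: assms)
  have "P (\<Prod>i\<in>A. mp_var i ^ Poly_Mapping.lookup m i)" for A
    by (induction A rule: infinite_finite_induct) (auto intro: assms 1 p)
  then show ?case
    by (subst single_eq_prod) (intro assms)
qed (rule assms)

lemma rhom_ev_comp:
  assumes "rhom g" "rhom h"
  shows "g (ev h f z) = ev (\<lambda>c. g (h c)) f (\<lambda>i. g (z i))"
proof -
  have gh: "rhom (\<lambda>c. g (h c))" using assms by (rule rhom_comp)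
  show ?thesis
    by (induction f rule: mp_ring_induct) (simp_all add: ev_simps assms gh rhom_add[OF assms(1)] rhom_mult[OF assms(1)])
qed

definition mp_subst :: "('j \<Rightarrow> ('k, 'i) mpoly) \<Rightarrow> ('k::comm_ring_1, 'j::finite) mpoly \<Rightarrow> ('k, 'i::finite) mpoly" where
  "mp_subst \<sigma> f = ev mp_const f \<sigma>"

lemma ev_subst: "rhom h \<Longrightarrow> ev h (mp_subst \<sigma> f) z = ev h f (\<lambda>j. ev h (\<sigma> j) z)"
  unfolding mp_subst_def
  by (subst rhom_ev_comp[OF rhom_ev rhom_mp_const]) (simp_all add: ev_const)

section \<open>Partial derivatives\<close>

text \<open>The truncated subtraction of exponents in \<open>mp_pderiv\<close> does no harm: where
  truncation occurs the coefficient is zero. Read on coefficients, linearity is immediate.\<close>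

lemma lookup_pderiv:
  "Poly_Mapping.lookup (mp_pderiv i f) m =
    of_nat (Suc (Poly_Mapping.lookup m i)) * Poly_Mapping.lookup f (m + Poly_Mapping.single i 1)"
proof -
  let ?e = "Poly_Mapping.single i (1::nat)"
  have 1: "Poly_Mapping.lookup (Poly_Mapping.single (n - ?e)
      (of_nat (Poly_Mapping.lookup n i) * Poly_Mapping.lookup f n)) m =
      (if n = m + ?e then of_nat (Poly_Mapping.lookup n i) * Poly_Mapping.lookup f n else 0)" for n
  proof (cases "Poly_Mapping.lookup n i = 0")
    case True
    then have "n \<noteq> m + ?e" by (auto simp: lookup_add)
    then show ?thesis using True by simp
  next
    case False
    then have "n - ?e + ?e = n"
      by (intro poly_mapping_eqI) (auto simp: lookup_add lookup_minus lookup_single when_def)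
    then have "n - ?e = m \<longleftrightarrow> n = m + ?e" by auto
    then show ?thesis by (auto simp: lookup_single when_def)
  qed
  have "Poly_Mapping.lookup (mp_pderiv i f) m = (\<Sum>n\<in>Poly_Mapping.keys f.
      if n = m + ?e then of_nat (Poly_Mapping.lookup n i) * Poly_Mapping.lookup f n else 0)"
    unfolding mp_pderiv_def lookup_sum 1 ..
  then show ?thesis
    by (auto simp: sum.delta in_keys_iff lookup_add)
qed

lemma mp_pderiv_add: "mp_pderiv i (f + g) = mp_pderiv i f + mp_pderiv i g"
  by (rule poly_mapping_eqI) (simp add: lookup_pderiv lookup_add algebra_simps)

lemma mp_pderiv_0 [simp]: "mp_pderiv i 0 = 0"
  by (simp add: mp_pderiv_def)

lemma mp_pderiv_sum: "mp_pderiv i (\<Sum>a\<in>A. f a) = (\<Sum>a\<in>A. mp_pderiv i (f a))"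
  by (induction A rule: infinite_finite_induct) (auto simp: mp_pderiv_add)

lemma mp_pderiv_single:
  "mp_pderiv i (Poly_Mapping.single m c) =
    Poly_Mapping.single (m - Poly_Mapping.single i 1) (of_nat (Poly_Mapping.lookup m i) * c)"
  by (simp add: mp_pderiv_def)

lemma mp_pderiv_mult:
  fixes f g :: "('k::comm_ring_1, 'i::finite) mpoly"
  shows "mp_pderiv i (f * g) = f * mp_pderiv i g + g * mp_pderiv i f"
proof -
  let ?e = "Poly_Mapping.single i (1::nat)"
  have e: "m + n - ?e = m + (n - ?e)" if "Poly_Mapping.lookup n i \<noteq> 0" for m n
    using that by (intro poly_mapping_eqI) (auto simp: lookup_add lookup_minus lookup_single when_def)
  have s: "Poly_Mapping.single (m + n - ?e) (of_nat (Poly_Mapping.lookup n i) * (c * d))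
      = Poly_Mapping.single (m + (n - ?e)) (c * (of_nat (Poly_Mapping.lookup n i) * d))"
    for m n and c d :: 'k
    by (cases "Poly_Mapping.lookup n i = 0") (simp_all add: e mult_ac del: One_nat_def)
  have 1: "mp_pderiv i (Poly_Mapping.single m c * Poly_Mapping.single n d) =
      Poly_Mapping.single m c * mp_pderiv i (Poly_Mapping.single n d)
      + Poly_Mapping.single n d * mp_pderiv i (Poly_Mapping.single m c)" for m n and c d :: 'k
    using s[of m n c d] s[of n m d c]
    by (simp add: mult_single mp_pderiv_single lookup_add distrib_right distrib_left single_add add.commute mult_ac)
  have 2: "mp_pderiv i (Poly_Mapping.single m c * g) =
      Poly_Mapping.single m c * mp_pderiv i g + g * mp_pderiv i (Poly_Mapping.single m c)" for m c
    by (induction g rule: mp_induct) (simp_all add: 1 algebra_simps mp_pderiv_add)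
  show ?thesis
  proof (induction f rule: mp_induct)
    case (add f f')
    then show ?case by (simp add: algebra_simps mp_pderiv_add)
  qed (rule 2)
qed

lemma mp_pderiv_const [simp]: "mp_pderiv i (mp_const c) = 0"
  by (simp add: mp_const_def mp_pderiv_single)

lemma mp_pderiv_var: "mp_pderiv i (mp_var j) = (if i = j then 1 else 0)"
  by (auto simp: mp_var_def mp_pderiv_single lookup_single when_def)

text \<open>Vanishing on the ground field is stated separately as \<open>D (h c) = 0\<close>, since
  the notion serves for fields as well as for polynomial rings.\<close>

definition derivation :: "('r::comm_ring_1 \<Rightarrow> 'r) \<Rightarrow> bool" where
  "derivation D \<longleftrightarrow> (\<forall>x y. D (x + y) = D x + D y) \<and> (\<forall>x y. D (x * y) = x * D y + y * D x)"

lemma der_add: "derivation D \<Longrightarrow> D (x + y) = D x + D y"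
  and der_mult: "derivation D \<Longrightarrow> D (x * y) = x * D y + y * D x"
  by (auto simp: derivation_def)

lemma der_0: "derivation D \<Longrightarrow> D 0 = 0"
  using der_add[of D 0 0] by simp

lemma der_1: "derivation D \<Longrightarrow> D 1 = 0"
  using der_mult[of D 1 1] by simp

lemma der_sum: "derivation D \<Longrightarrow> D (\<Sum>a\<in>A. f a) = (\<Sum>a\<in>A. D (f a))"
  by (induction A rule: infinite_finite_induct) (auto simp: der_0 der_add)

lemma der_ev:
  assumes D: "derivation D" and h: "rhom h" and h0: "\<And>c. D (h c) = 0"
  shows "D (ev h f z) = (\<Sum>i\<in>UNIV. ev h (mp_pderiv i f) z * D (z i))"
proof (induction f rule: mp_ring_induct)
  case (var j)
  have "(\<Sum>i\<in>UNIV. ev h (mp_pderiv i (mp_var j)) z * D (z i)) = (\<Sum>i\<in>UNIV. if i = j then D (z i) else 0)"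
    by (intro sum.cong) (auto simp: mp_pderiv_var ev_1[OF h])
  then show ?case by (simp add: ev_var[OF h] sum.delta)
qed (simp_all add: ev_simps[OF h] h0 mp_pderiv_add mp_pderiv_mult der_add[OF D] der_mult[OF D]
    algebra_simps sum.distrib sum_distrib_left)

section \<open>An ultrapower of the ground field\<close>

definition ultra :: "'j filter \<Rightarrow> bool" where
  "ultra F \<longleftrightarrow> F \<noteq> bot \<and> (\<forall>P. eventually P F \<or> eventually (\<lambda>j. \<not> P j) F)"

text \<open>The ultrafilter lemma. By Zorn the family extends to a maximal one with the finite
  intersection property; maximality puts each set or its complement into it, and the filter axioms
  follow from this dichotomy.\<close>

lemma ultra_exists:
  fixes C :: "'j set set"
  assumes fip: "\<And>C0. finite C0 \<Longrightarrow> C0 \<subseteq> C \<Longrightarrow> \<Inter>C0 \<noteq> {}"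
  shows "\<exists>F. ultra F \<and> (\<forall>A\<in>C. eventually (\<lambda>j. j \<in> A) F)"
proof -
  define fam where "fam = {M. C \<subseteq> M \<and> (\<forall>C0. finite C0 \<and> C0 \<subseteq> M \<longrightarrow> \<Inter>C0 \<noteq> {})}"
  have "\<exists>M\<in>fam. \<forall>X\<in>fam. M \<subseteq> X \<longrightarrow> X = M"
  proof (rule subset_Zorn_nonempty)
    have "C \<in> fam" using fip by (auto simp: fam_def)
    then show "fam \<noteq> {}" by auto
  next
    fix \<C> assume ne: "\<C> \<noteq> {}" and ch: "subset.chain fam \<C>"
    then have sub: "\<C> \<subseteq> fam" by (simp add: subset_chain_def)
    have "\<Inter>C0 \<noteq> {}" if C0: "finite C0" "C0 \<subseteq> \<Union>\<C>" for C0
    proof -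
      obtain B where "B \<in> \<C>" "C0 \<subseteq> B"
        by (rule finite_subset_Union_chain[OF C0 ne ch])
      then show ?thesis using sub C0(1) by (auto simp: fam_def)
    qed
    moreover have "C \<subseteq> \<Union>\<C>"
    proof -
      obtain X where "X \<in> \<C>" using ne by blast
      moreover from this have "C \<subseteq> X" using sub by (auto simp: fam_def)
      ultimately show ?thesis by blast
    qed
    ultimately show "\<Union>\<C> \<in> fam" unfolding fam_def by blast
  qed
  then obtain M where M: "M \<in> fam" and max: "\<And>X. X \<in> fam \<Longrightarrow> M \<subseteq> X \<Longrightarrow> X = M" by blast
  have M_fip: "\<Inter>C0 \<noteq> {}" if "finite C0" "C0 \<subseteq> M" for C0
    using M that by (auto simp: fam_def)
  have split: "\<exists>C0. finite C0 \<and> C0 \<subseteq> M \<and> \<Inter>C0 \<inter> A = {}" if "A \<notin> M" for A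
  proof (rule ccontr)
    assume no: "\<not> ?thesis"
    have "\<Inter>C0 \<noteq> {}" if C0: "finite C0" "C0 \<subseteq> insert A M" for C0
    proof -
      have "finite (C0 - {A})" "C0 - {A} \<subseteq> M" using C0 by auto
      then have "\<Inter>(C0 - {A}) \<inter> A \<noteq> {}" using no by blast
      then show ?thesis by auto
    qed
    then have "insert A M \<in> fam" using M by (auto simp: fam_def)
    then show False using max[of "insert A M"] that by blast
  qed
  have dich: "A \<in> M \<or> - A \<in> M" for A
  proof (rule ccontr)
    assume "\<not> ?thesis"
    then obtain C1 C2 where C: "finite C1" "C1 \<subseteq> M" "\<Inter>C1 \<inter> A = {}"
      "finite C2" "C2 \<subseteq> M" "\<Inter>C2 \<inter> - A = {}"
      using split[of A] split[of "- A"] by blast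
    have "\<Inter>(C1 \<union> C2) = \<Inter>C1 \<inter> \<Inter>C2" by (rule Inter_Un_distrib)
    with C have "\<Inter>(C1 \<union> C2) = {}" by blast
    then show False using M_fip[of "C1 \<union> C2"] C by simp
  qed
  have up: "B \<in> M" if "A \<in> M" "A \<subseteq> B" for A B
    using dich[of B] M_fip[of "{A, - B}"] that by auto
  have int: "A \<inter> B \<in> M" if "A \<in> M" "B \<in> M" for A B
    using dich[of "A \<inter> B"] M_fip[of "{A, B, - (A \<inter> B)}"] that by auto
  have fil: "is_filter (\<lambda>P. Collect P \<in> M)"
  proof
    show "Collect (\<lambda>x. True) \<in> M"
      using dich[of UNIV] M_fip[of "{{}}"] by auto
    show "Collect P \<in> M \<Longrightarrow> Collect Q \<in> M \<Longrightarrow> Collect (\<lambda>x. P x \<and> Q x) \<in> M" for P Q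
      using int[of "Collect P" "Collect Q"] by (simp add: Int_def)
    show "\<forall>x. P x \<longrightarrow> Q x \<Longrightarrow> Collect P \<in> M \<Longrightarrow> Collect Q \<in> M" for P Q
      using up[of "Collect P" "Collect Q"] by auto
  qed
  define F where "F = Abs_filter (\<lambda>P. Collect P \<in> M)"
  have ev: "eventually P F \<longleftrightarrow> Collect P \<in> M" for P
    unfolding F_def by (rule eventually_Abs_filter[OF fil])
  have "F \<noteq> bot"
    using M_fip[of "{{}}"] by (auto simp: trivial_limit_def ev)
  moreover have "eventually P F \<or> eventually (\<lambda>j. \<not> P j) F" for P
    using dich[of "Collect P"] by (simp add: ev Collect_neg_eq)
  ultimately show ?thesis
    using M by (intro exI[of _ F]) (auto simp: ultra_def ev fam_def)
qed

text \<open>An index is a set of codes of polynomials. The codes mention only \<open>'k\<close>, not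
  the type of variables, so that one ultrapower serves all numbers of variables at once.\<close>

type_synonym 'k oidx = "('k \<times> nat list) list set"

text \<open>Almost every index is a finite set containing a prescribed code. This is the source of
  saturation.\<close>

definition oF :: "'k oidx filter" where
  "oF = (SOME F. ultra F \<and> (\<forall>A\<in>range (\<lambda>u. {j. finite j \<and> u \<in> j}). eventually (\<lambda>j. j \<in> A) F))"

lemma oF: "ultra (oF :: 'k oidx filter)"
  "eventually (\<lambda>j. finite j \<and> u \<in> j) (oF :: 'k oidx filter)"
proof -
  let ?C = "range (\<lambda>u. {j :: 'k oidx. finite j \<and> u \<in> j})"
  have "\<Inter>C0 \<noteq> {}" if C0: "finite C0" "C0 \<subseteq> ?C" for C0
  proof -
    obtain V where V: "finite V" "C0 = (\<lambda>u. {j :: 'k oidx. finite j \<and> u \<in> j}) ` V"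
      using finite_subset_image[OF C0] by auto
    have "V \<in> \<Inter>C0" using V by auto
    then show ?thesis by blast
  qed
  then have "\<exists>F. ultra F \<and> (\<forall>A\<in>?C. eventually (\<lambda>j. j \<in> A) F)"
    by (rule ultra_exists)
  from someI_ex[OF this] have *: "ultra (oF :: 'k oidx filter) \<and> (\<forall>A\<in>?C. eventually (\<lambda>j. j \<in> A) oF)"
    unfolding oF_def .
  then show "ultra (oF :: 'k oidx filter)" by simp
  from * have "eventually (\<lambda>j. j \<in> {j :: 'k oidx. finite j \<and> u \<in> j}) oF" by blast
  then show "eventually (\<lambda>j. finite j \<and> u \<in> j) (oF :: 'k oidx filter)" by simp
qed

lemma oF_not: "(\<not> eventually P (oF :: 'k oidx filter)) \<longleftrightarrow> eventually (\<lambda>j. \<not> P j) oF"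
proof -
  have "\<not> (eventually P (oF :: 'k oidx filter) \<and> eventually (\<lambda>j. \<not> P j) oF)"
  proof
    assume "eventually P (oF :: 'k oidx filter) \<and> eventually (\<lambda>j. \<not> P j) oF"
    then have "eventually (\<lambda>j. False) (oF :: 'k oidx filter)"
      by (auto elim: eventually_elim2)
    moreover have "(oF :: 'k oidx filter) \<noteq> bot" by (rule conjunct1[OF oF(1)[unfolded ultra_def]])
    ultimately show False by (simp add: trivial_limit_def)
  qed
  moreover have "eventually P (oF :: 'k oidx filter) \<or> eventually (\<lambda>j. \<not> P j) oF"
    by (rule spec[OF conjunct2[OF oF(1)[unfolded ultra_def]]])
  ultimately show ?thesis by argo
qed

lemma oF_const [simp]: "eventually (\<lambda>j. P) (oF :: 'k oidx filter) \<longleftrightarrow> P"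
  using oF_not[of "\<lambda>j. \<not> P"] oF_not[of "\<lambda>j. P"] by (cases P) auto

definition omega_rel :: "('k oidx \<Rightarrow> 'k) \<Rightarrow> ('k oidx \<Rightarrow> 'k) \<Rightarrow> bool" where
  "omega_rel s t \<longleftrightarrow> eventually (\<lambda>j. s j = t j) oF"

quotient_type 'k omega = "'k oidx \<Rightarrow> 'k" / omega_rel
proof (rule equivpI)
  show "reflp omega_rel" by (auto simp: reflp_def omega_rel_def)
  show "symp omega_rel" by (auto simp: symp_def omega_rel_def elim: eventually_mono)
  show "transp omega_rel" by (auto simp: transp_def omega_rel_def elim: eventually_elim2)
qed

instantiation omega :: (field) field
begin

lift_definition zero_omega :: "'a omega" is "\<lambda>j. 0" .
lift_definition one_omega :: "'a omega" is "\<lambda>j. 1" .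
lift_definition plus_omega :: "'a omega \<Rightarrow> 'a omega \<Rightarrow> 'a omega" is "\<lambda>s t j. s j + t j"
  unfolding omega_rel_def by (auto elim: eventually_elim2)
lift_definition minus_omega :: "'a omega \<Rightarrow> 'a omega \<Rightarrow> 'a omega" is "\<lambda>s t j. s j - t j"
  unfolding omega_rel_def by (auto elim: eventually_elim2)
lift_definition times_omega :: "'a omega \<Rightarrow> 'a omega \<Rightarrow> 'a omega" is "\<lambda>s t j. s j * t j"
  unfolding omega_rel_def by (auto elim: eventually_elim2)
lift_definition uminus_omega :: "'a omega \<Rightarrow> 'a omega" is "\<lambda>s j. - s j"
  unfolding omega_rel_def by (auto elim: eventually_mono)
lift_definition inverse_omega :: "'a omega \<Rightarrow> 'a omega" is "\<lambda>s j. inverse (s j)"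
  unfolding omega_rel_def by (auto elim: eventually_mono)
lift_definition divide_omega :: "'a omega \<Rightarrow> 'a omega \<Rightarrow> 'a omega" is "\<lambda>s t j. s j / t j"
  unfolding omega_rel_def by (auto elim: eventually_elim2)

instance
proof
  fix a b c :: "'a omega"
  show "a * b * c = a * (b * c)" by transfer (simp add: omega_rel_def mult.assoc)
  show "a * b = b * a" by transfer (simp add: omega_rel_def mult.commute)
  show "1 * a = a" by transfer (simp add: omega_rel_def)
  show "a + b + c = a + (b + c)" by transfer (simp add: omega_rel_def add.assoc)
  show "a + b = b + a" by transfer (simp add: omega_rel_def add.commute)
  show "0 + a = a" by transfer (simp add: omega_rel_def)
  show "- a + a = 0" by transfer (simp add: omega_rel_def)
  show "a - b = a + - b" by transfer (simp add: omega_rel_def)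
  show "(a + b) * c = a * c + b * c" by transfer (simp add: omega_rel_def distrib_right)
  show "(0 :: 'a omega) \<noteq> 1" by transfer (simp add: omega_rel_def)
  show "inverse (0 :: 'a omega) = 0" by transfer (simp add: omega_rel_def)
  show "a div b = a * inverse b" by transfer (simp add: omega_rel_def divide_inverse)
  show "inverse a * a = 1" if "a \<noteq> 0"
    using that by transfer (auto simp: omega_rel_def oF_not elim: eventually_mono)
qed

end

abbreviation st :: "('k oidx \<Rightarrow> 'k) \<Rightarrow> 'k omega" where "st \<equiv> abs_omega"

text \<open>The diagonal embedding of the ground field into its ultrapower.\<close>

definition om :: "'k \<Rightarrow> 'k omega" where "om c = st (\<lambda>j. c)"

lemma st_eq: "st s = st t \<longleftrightarrow> eventually (\<lambda>j. s j = t j) oF"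
  unfolding omega.abs_eq_iff omega_rel_def ..

lemma st_surj: "\<exists>s. x = st s"
  by (rule exI[of _ "rep_omega x"]) (rule Quotient_abs_rep[OF Quotient_omega, symmetric])

lemmas st_add = plus_omega.abs_eq
lemmas st_mult = times_omega.abs_eq
lemmas st_1 = one_omega.abs_eq

lemma st_eq_0: "st s = 0 \<longleftrightarrow> eventually (\<lambda>j. s j = 0) oF"
  unfolding zero_omega.abs_eq st_eq ..

lemma rhom_om: "rhom (om :: 'k::field \<Rightarrow> 'k omega)"
  by (simp add: rhom_def om_def st_add st_mult st_1)

instance omega :: (field_char_0) field_char_0
proof
  show "inj (of_nat :: nat \<Rightarrow> 'a omega)"
  proof (rule injI)
    fix m n assume "(of_nat m :: 'a omega) = of_nat n"
    then have "(om (of_nat m) :: 'a omega) = om (of_nat n)"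
      by (simp only: rhom_of_nat[OF rhom_om])
    then show "m = n" by (simp add: om_def st_eq)
  qed
qed

text \<open>Los's theorem for polynomials; with \<open>st_eq_0\<close> an equation holds at a class
  if and only if it holds at almost all members of the family.\<close>

lemma st_ev: "ev om f (\<lambda>i. st (s i)) = st (\<lambda>j. mp_eval f (\<lambda>i. s i j))"
proof (induction f rule: mp_ring_induct)
  case (const c)
  show ?case by (simp add: mp_eval_ev ev_const rhom_om) (simp add: om_def)
qed (simp_all only: mp_eval_ev ev_simps[OF rhom_om] ev_simps[OF rhom_id] st_add st_mult)

text \<open>The list \<open>is\<close> of variables is chosen once for the type, so the code
  determines the polynomial even though the order of the monomials is arbitrary.\<close>

definition mp_code :: "('k::zero, 'i::finite) mpoly \<Rightarrow> ('k \<times> nat list) list" where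
  "mp_code f = (let xs = (SOME xs. set xs = Poly_Mapping.keys f); is = (SOME is. set is = (UNIV :: 'i set))
    in map (\<lambda>m. (Poly_Mapping.lookup f m, map (Poly_Mapping.lookup m) is)) xs)"

lemma inj_mp_code: "inj (mp_code :: ('k::zero, 'i::finite) mpoly \<Rightarrow> _)"
proof (rule injI)
  fix f g :: "('k, 'i) mpoly" assume eq: "mp_code f = mp_code g"
  define L where "L = (SOME is. set is = (UNIV :: 'i set))"
  have L: "set L = UNIV"
    unfolding L_def by (rule someI_ex) (simp add: finite_list)
  have s: "set (mp_code f) = (\<lambda>m. (Poly_Mapping.lookup f m, map (Poly_Mapping.lookup m) L)) ` Poly_Mapping.keys f"
    for f :: "('k, 'i) mpoly"
  proof -
    have "set (SOME xs. set xs = Poly_Mapping.keys f) = Poly_Mapping.keys f"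
      by (rule someI_ex) (simp add: finite_list)
    then show ?thesis by (simp add: mp_code_def Let_def L_def)
  qed
  have inj: "m = n" if "map (Poly_Mapping.lookup m) L = map (Poly_Mapping.lookup n) L" for m n :: "'i \<Rightarrow>\<^sub>0 nat"
    using that L by (intro poly_mapping_eqI) (auto simp: map_eq_conv)
  have lk: "(c, map (Poly_Mapping.lookup m) L) \<in> set (mp_code f) \<longleftrightarrow> c \<noteq> 0 \<and> Poly_Mapping.lookup f m = c"
    for c m and f :: "('k, 'i) mpoly"
  proof
    assume "(c, map (Poly_Mapping.lookup m) L) \<in> set (mp_code f)"
    then obtain n where n: "n \<in> Poly_Mapping.keys f" "c = Poly_Mapping.lookup f n"
      "map (Poly_Mapping.lookup m) L = map (Poly_Mapping.lookup n) L"
      unfolding s by blast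
    from inj[OF n(3)] n(1,2) show "c \<noteq> 0 \<and> Poly_Mapping.lookup f m = c" by (simp add: in_keys_iff)
  next
    assume "c \<noteq> 0 \<and> Poly_Mapping.lookup f m = c"
    then show "(c, map (Poly_Mapping.lookup m) L) \<in> set (mp_code f)"
      unfolding s by (auto simp: in_keys_iff)
  qed
  show "f = g"
  proof (rule poly_mapping_eqI)
    fix m
    show "Poly_Mapping.lookup f m = Poly_Mapping.lookup g m"
    proof (cases "Poly_Mapping.lookup f m = 0")
      case True
      show ?thesis
        using lk[of "Poly_Mapping.lookup g m" m f] lk[of "Poly_Mapping.lookup g m" m g] eq True by auto
    next
      case False
      show ?thesis
        using lk[of "Poly_Mapping.lookup f m" m f] lk[of "Poly_Mapping.lookup f m" m g] eq False by auto
    qed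
  qed
qed

text \<open>\<open>inst S z\<close>: the point \<open>z\<close> with coordinates in the ultrapower is the class of a family of
  points almost all of which lie in \<open>S\<close>.\<close>

definition inst :: "('i \<Rightarrow> 'k) set \<Rightarrow> ('i \<Rightarrow> 'k omega) \<Rightarrow> bool" where
  "inst S z \<longleftrightarrow> (\<exists>s. z = (\<lambda>i. st (s i)) \<and> eventually (\<lambda>j. (\<lambda>i. s i j) \<in> S) oF)"

text \<open>An index that is a finite set asks for a point satisfying the finitely many conditions
  coded in it. Finite satisfiability provides one, and a single condition is coded in almost every
  index.\<close>

lemma saturation:
  fixes S :: "('i \<Rightarrow> 'k::zero) set" and Q :: "('k, 'm::finite) mpoly \<Rightarrow> ('i \<Rightarrow> 'k) \<Rightarrow> bool"
  assumes "\<And>G. finite G \<Longrightarrow> \<exists>s\<in>S. \<forall>g\<in>G. Q g s"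
  shows "\<exists>s. (\<forall>j. (\<lambda>i. s i j) \<in> S) \<and> (\<forall>g. eventually (\<lambda>j. Q g (\<lambda>i. s i j)) (oF :: 'k oidx filter))"
proof -
  have "\<exists>s. s \<in> S \<and> (finite j \<longrightarrow> (\<forall>g. mp_code g \<in> j \<longrightarrow> Q g s))" for j
  proof (cases "finite j")
    case True
    then have "finite (mp_code -` j :: ('k, 'm) mpoly set)"
      by (intro finite_vimageI inj_mp_code)
    from assms[OF this] show ?thesis by blast
  next
    case False
    then show ?thesis using assms[of "{}"] by blast
  qed
  then have "\<exists>s. \<forall>j. s j \<in> S \<and> (finite j \<longrightarrow> (\<forall>g. mp_code g \<in> j \<longrightarrow> Q g (s j)))"
    by (intro choice) blast
  then obtain s where s: "\<And>j. s j \<in> S" "\<And>j g. finite j \<Longrightarrow> mp_code g \<in> j \<Longrightarrow> Q g (s j)"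
    by blast
  have "eventually (\<lambda>j. Q g (s j)) oF" for g
    using oF(2)[of "mp_code g"] by (rule eventually_mono) (simp add: s)
  then show ?thesis
    using s(1) by (intro exI[of _ "\<lambda>i j. s j i"]) simp
qed

lemma inst_ev_0:
  assumes "inst S z" "\<And>s. s \<in> S \<Longrightarrow> mp_eval f s = 0"
  shows "ev om f z = 0"
proof -
  obtain s where s: "z = (\<lambda>i. st (s i))" "eventually (\<lambda>j. (\<lambda>i. s i j) \<in> S) oF"
    using assms(1) by (auto simp: inst_def)
  have "eventually (\<lambda>j. mp_eval f (\<lambda>i. s i j) = 0) oF"
    using s(2) by (rule eventually_mono) (use assms(2) in auto)
  then show ?thesis by (simp add: s(1) st_ev st_eq_0)
qed

section \<open>Extension of homomorphisms to places\<close>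

text \<open>A partial homomorphism to \<open>'k\<close> is given by its graph, a subring of \<open>'f \<times> 'k\<close>.\<close>

definition pgraph :: "('k::field \<Rightarrow> 'f::field) \<Rightarrow> ('f \<times> 'k) set \<Rightarrow> bool" where
  "pgraph h G \<longleftrightarrow> (\<forall>c. (h c, c) \<in> G) \<and>
    (\<forall>a b a' b'. (a, b) \<in> G \<longrightarrow> (a', b') \<in> G \<longrightarrow> (a + a', b + b') \<in> G \<and> (a * a', b * b') \<in> G) \<and>
    (\<forall>b. (0, b) \<in> G \<longrightarrow> b = 0)"

definition ppair :: "('f \<times> 'k) set \<Rightarrow> 'f::zero poly \<Rightarrow> 'k::zero poly \<Rightarrow> bool" where
  "ppair G p q \<longleftrightarrow> (\<forall>i. (coeff p i, coeff q i) \<in> G)"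

text \<open>The candidate for the extension that sends \<open>t\<close> to \<open>c\<close>. It is
  the graph of a function only under the hypothesis of \<open>padjoin_pgraph\<close>.\<close>

definition padjoin :: "('f::comm_ring_1 \<times> 'k::comm_ring_1) set \<Rightarrow> 'f \<Rightarrow> 'k \<Rightarrow> ('f \<times> 'k) set" where
  "padjoin G t c = {(poly p t, poly q c) | p q. ppair G p q}"

context
  fixes h :: "'k::field \<Rightarrow> 'f::field" and G
  assumes h: "rhom h" and G: "pgraph h G"
begin

lemma pg_const: "(h c, c) \<in> G"
  and pg_add: "(a, b) \<in> G \<Longrightarrow> (a', b') \<in> G \<Longrightarrow> (a + a', b + b') \<in> G"
  and pg_mult: "(a, b) \<in> G \<Longrightarrow> (a', b') \<in> G \<Longrightarrow> (a * a', b * b') \<in> G"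
  and pg_0D: "(0, b) \<in> G \<Longrightarrow> b = 0"
  using G by (auto simp: pgraph_def)

lemma pg_0: "(0, 0) \<in> G"
  using pg_const[of 0] by (simp add: rhom_0[OF h])

lemma pg_1: "(1, 1) \<in> G"
  using pg_const[of 1] by (simp add: rhom_1[OF h])

lemma pg_uminus: "(a, b) \<in> G \<Longrightarrow> (- a, - b) \<in> G"
  using pg_mult[OF pg_const[of "- 1"], of a b] by (simp add: rhom_uminus[OF h] rhom_1[OF h])

lemma pg_diff: "(a, b) \<in> G \<Longrightarrow> (a', b') \<in> G \<Longrightarrow> (a - a', b - b') \<in> G"
  using pg_add[OF _ pg_uminus, of a b a' b'] by simp

lemma pg_unique: "(a, b) \<in> G \<Longrightarrow> (a, b') \<in> G \<Longrightarrow> b = b'"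
  using pg_diff[of a b a b'] pg_0D[of "b - b'"] by simp

lemma pg_sum: "(\<And>i. i \<in> A \<Longrightarrow> (f i, g i) \<in> G) \<Longrightarrow> (sum f A, sum g A) \<in> G"
  by (induction A rule: infinite_finite_induct) (auto simp: pg_0 intro: pg_add)

lemma pg_power: "(a, b) \<in> G \<Longrightarrow> (a ^ n, b ^ n) \<in> G"
  by (induction n) (auto simp: pg_1 intro: pg_mult)

lemma pg_ev: "(\<And>i. (z i, b i) \<in> G) \<Longrightarrow> (ev h f z, mp_eval f b) \<in> G"
  by (induction f rule: mp_ring_induct)
    (simp_all add: mp_eval_ev ev_simps h pg_const pg_add pg_mult)

lemma ppair_0: "ppair G 0 0"
  by (simp add: ppair_def pg_0)

lemma ppair_pCons: "(a, b) \<in> G \<Longrightarrow> ppair G p q \<Longrightarrow> ppair G (pCons a p) (pCons b q)"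
  by (auto simp: ppair_def coeff_pCons split: nat.split)

lemma ppair_add: "ppair G p q \<Longrightarrow> ppair G p' q' \<Longrightarrow> ppair G (p + p') (q + q')"
  by (simp add: ppair_def pg_add)

lemma ppair_diff: "ppair G p q \<Longrightarrow> ppair G p' q' \<Longrightarrow> ppair G (p - p') (q - q')"
  by (simp add: ppair_def pg_diff)

lemma ppair_mult: "ppair G p q \<Longrightarrow> ppair G p' q' \<Longrightarrow> ppair G (p * p') (q * q')"
  by (auto simp: ppair_def coeff_mult intro!: pg_sum pg_mult)

lemma ppair_smult: "(a, b) \<in> G \<Longrightarrow> ppair G p q \<Longrightarrow> ppair G (smult a p) (smult b q)"
  by (simp add: ppair_def pg_mult)

lemma ppair_monom: "(a, b) \<in> G \<Longrightarrow> ppair G (monom a n) (monom b n)"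
  by (simp add: ppair_def pg_0)

lemma ppair_sum: "(\<And>i. i \<in> A \<Longrightarrow> ppair G (f i) (g i)) \<Longrightarrow> ppair G (sum f A) (sum g A)"
  by (induction A rule: infinite_finite_induct) (auto simp: ppair_0 intro: ppair_add)

lemma ppair_lift: "ppair G (map_poly h q) q"
  by (simp add: ppair_def coeff_map_poly rhom_0[OF h] pg_const)

lemma ppair_exists:
  assumes "\<And>i. \<exists>b. (coeff p i, b) \<in> G"
  shows "\<exists>q. ppair G p q"
proof -
  obtain b where b: "\<And>i. (coeff p i, b i) \<in> G" using assms by metis
  have "ppair G (\<Sum>i\<le>degree p. monom (coeff p i) i) (\<Sum>i\<le>degree p. monom (b i) i)"
    by (intro ppair_sum ppair_monom b)
  then show ?thesis by (auto simp: poly_as_sum_of_monoms)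
qed

lemma padjoin_pgraph:
  assumes "\<And>p q. ppair G p q \<Longrightarrow> poly p t = 0 \<Longrightarrow> poly q c = 0"
  shows "pgraph h (padjoin G t c)"
  unfolding pgraph_def
proof (intro conjI allI impI)
  fix d show "(h d, d) \<in> padjoin G t c"
    unfolding padjoin_def using ppair_pCons[OF pg_const ppair_0, of d] by force
next
  fix a b a' b' assume "(a, b) \<in> padjoin G t c" "(a', b') \<in> padjoin G t c"
  then obtain p q p' q' where *: "a = poly p t" "b = poly q c" "ppair G p q"
      "a' = poly p' t" "b' = poly q' c" "ppair G p' q'"
    by (auto simp: padjoin_def)
  show "(a + a', b + b') \<in> padjoin G t c"
    unfolding padjoin_def using * ppair_add[of p q p' q'] by (force intro: exI[of _ "p + p'"])
  show "(a * a', b * b') \<in> padjoin G t c"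
    unfolding padjoin_def using * ppair_mult[of p q p' q'] by (force intro: exI[of _ "p * p'"])
next
  fix b assume "(0, b) \<in> padjoin G t c"
  then show "b = 0" using assms by (auto simp: padjoin_def)
qed

lemma padjoin_superset: "G \<subseteq> padjoin G t c"
proof
  fix x assume "x \<in> G"
  then have "ppair G [:fst x:] [:snd x:]" by (intro ppair_pCons ppair_0) simp
  then show "x \<in> padjoin G t c" unfolding padjoin_def by (cases x) force
qed

lemma padjoin_member: "(t, c) \<in> padjoin G t c"
proof -
  have "ppair G [:0, 1:] [:0, 1:]" by (intro ppair_pCons ppair_0 pg_0 pg_1)
  then show ?thesis unfolding padjoin_def by force
qed

end

lemma poly_sum_atMost:
  fixes p :: "'a::comm_ring_1 poly"
  shows "degree p \<le> n \<Longrightarrow> poly p x = (\<Sum>i\<le>n. coeff p i * x ^ i)"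
  unfolding poly_altdef by (rule sum.mono_neutral_left) (auto simp: coeff_eq_0)

text \<open>The reciprocal polynomial: it turns an algebraic relation for \<open>t\<close> into one
  for its inverse \<open>s\<close>.\<close>

lemma poly_reverse_sum:
  fixes p :: "'a::field poly"
  assumes "degree p \<le> n" "t * s = 1"
  shows "(\<Sum>i\<le>n. coeff p i * s ^ (n - i)) = s ^ n * poly p t"
proof -
  have *: "s ^ n * t ^ i = s ^ (n - i)" if "i \<le> n" for i
  proof -
    have "s ^ n * t ^ i = s ^ (n - i) * (t * s) ^ i"
      using that by (simp add: power_add[symmetric] power_mult_distrib mult_ac)
    then show ?thesis by (simp add: assms)
  qed
  have "(\<Sum>i\<le>n. coeff p i * s ^ (n - i)) = (\<Sum>i\<le>n. coeff p i * (s ^ n * t ^ i))"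
    by (intro sum.cong refl) (simp add: *)
  then show ?thesis
    by (simp add: poly_sum_atMost[OF assms(1)] sum_distrib_left mult.left_commute)
qed

text \<open>\<open>J\<close> is an ideal in a principal ideal domain. A nonzero element of least
  degree generates it and is not constant, since otherwise 1 would lie in \<open>J\<close>; its root
  works for all of \<open>J\<close>.\<close>

lemma common_root:
  fixes J :: "'k::alg_closed_field poly set"
  assumes add: "\<And>p q. p \<in> J \<Longrightarrow> q \<in> J \<Longrightarrow> p + q \<in> J"
    and mult: "\<And>p q. p \<in> J \<Longrightarrow> q * p \<in> J"
    and one: "1 \<notin> J"
  shows "\<exists>c. \<forall>q\<in>J. poly q c = 0"
proof (cases "J \<subseteq> {0}")
  case False
  define g where "g = arg_min degree (\<lambda>q. q \<in> J \<and> q \<noteq> 0)"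
  obtain q0 where "q0 \<in> J" "q0 \<noteq> 0" using False by blast
  then have g: "g \<in> J" "g \<noteq> 0" and min: "\<And>q. q \<in> J \<Longrightarrow> q \<noteq> 0 \<Longrightarrow> degree g \<le> degree q"
    unfolding g_def using arg_min_natI[of "\<lambda>q. q \<in> J \<and> q \<noteq> 0" q0 degree]
      arg_min_nat_le[of "\<lambda>q. q \<in> J \<and> q \<noteq> 0" _ degree] by auto
  have dv: "g dvd q" if "q \<in> J" for q
  proof (rule ccontr)
    assume "\<not> g dvd q"
    then have nz: "q mod g \<noteq> 0" by (simp add: dvd_eq_mod_eq_0)
    have "q + - (q div g) * g \<in> J" using that g by (intro add mult)
    then have "q mod g \<in> J" by (simp add: minus_div_mult_eq_mod[symmetric])
    then show False using min[of "q mod g"] nz degree_mod_less'[OF g(2) nz] by simp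
  qed
  have "degree g > 0"
  proof (rule ccontr)
    assume "\<not> ?thesis"
    then obtain a where a: "g = [:a:]" by (auto elim: degree_eq_zeroE)
    with g have "[:inverse a:] * g = 1" by (simp add: one_pCons)
    then show False using mult[OF g(1), of "[:inverse a:]"] one by simp
  qed
  then obtain c where c: "poly g c = 0" using alg_closed_imp_poly_has_root by blast
  have "poly q c = 0" if "q \<in> J" for q
    using dv[OF that] c by (auto elim!: dvdE)
  then show ?thesis by blast
next
  case True
  then have "poly q 0 = 0" if "q \<in> J" for q using that by auto
  then show ?thesis by blast
qed

lemma chain_two:
  assumes ch: "subset.chain \<A> \<C>" and "x \<in> \<Union>\<C>" "y \<in> \<Union>\<C>"
  shows "\<exists>C\<in>\<C>. x \<in> C \<and> y \<in> C"
proof -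
  obtain X Y where XY: "X \<in> \<C>" "x \<in> X" "Y \<in> \<C>" "y \<in> Y" using assms by blast
  then have "X \<subseteq> Y \<or> Y \<subseteq> X" using ch unfolding subset_chain_def by blast
  then show ?thesis using XY by blast
qed

text \<open>Chevalley's extension theorem. A Zorn-maximal graph is a valuation ring with its residue
  map: an element without a value satisfies a relation expressing 1 by coefficients of residue 0,
  and such relations for both \<open>t\<close> and its inverse can be played off against each other
  until a contradiction remains.\<close>

theorem place_exists:
  fixes h :: "'k::alg_closed_field \<Rightarrow> 'f::field"
  assumes h: "rhom h" and G0: "pgraph h G0"
  shows "\<exists>G. G0 \<subseteq> G \<and> pgraph h G \<and> (\<forall>t. t \<noteq> 0 \<longrightarrow> (\<exists>c. (t, c) \<in> G) \<or> (inverse t, 0) \<in> G)"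
proof -
  define fam where "fam = {G. G0 \<subseteq> G \<and> pgraph h G}"
  have "\<exists>M\<in>fam. \<forall>X\<in>fam. M \<subseteq> X \<longrightarrow> X = M"
  proof (rule subset_Zorn_nonempty)
    show "fam \<noteq> {}" using G0 by (auto simp: fam_def)
  next
    fix \<C> assume ne: "\<C> \<noteq> {}" and ch: "subset.chain fam \<C>"
    then have sub: "\<And>C. C \<in> \<C> \<Longrightarrow> G0 \<subseteq> C \<and> pgraph h C"
      by (auto simp: subset_chain_def fam_def)
    note two = chain_two[OF ch]
    have "pgraph h (\<Union>\<C>)"
      unfolding pgraph_def
    proof (intro conjI allI impI)
      show "(h c, c) \<in> \<Union>\<C>" for c using ne sub pg_const[OF h] by blast
      fix a b a' b' assume "(a, b) \<in> \<Union>\<C>" "(a', b') \<in> \<Union>\<C>"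
      then obtain C where C: "C \<in> \<C>" "(a, b) \<in> C" "(a', b') \<in> C" using two by blast
      then have "pgraph h C" using sub by blast
      then show "(a + a', b + b') \<in> \<Union>\<C>" "(a * a', b * b') \<in> \<Union>\<C>"
        using C pg_add[OF h] pg_mult[OF h] by blast+
    next
      show "b = 0" if "(0, b) \<in> \<Union>\<C>" for b using that sub pg_0D[OF h] by blast
    qed
    then show "\<Union>\<C> \<in> fam" using ne sub by (auto simp: fam_def)
  qed
  then obtain G where G: "G0 \<subseteq> G" "pgraph h G"
    and max: "\<And>X. G0 \<subseteq> X \<Longrightarrow> pgraph h X \<Longrightarrow> G \<subseteq> X \<Longrightarrow> X = G"
    by (auto simp: fam_def)
  note pg = pg_const[OF h G(2)] pg_add[OF h G(2)] pg_mult[OF h G(2)] pg_0[OF h G(2)] pg_1[OF h G(2)]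
    pg_diff[OF h G(2)] pg_power[OF h G(2)]
  have adj: "(t, c) \<in> G" if "\<And>p q. ppair G p q \<Longrightarrow> poly p t = 0 \<Longrightarrow> poly q c = 0" for t c
  proof -
    have "padjoin G t c = G"
      using padjoin_superset[OF h G(2), of t c] G(1) padjoin_pgraph[OF h G(2), of t c] that
      by (intro max) auto
    then show ?thesis using padjoin_member[OF h G(2), of t c] by simp
  qed
  \<comment> \<open>If \<open>t\<close> admits no value, the residues of the polynomials vanishing
    at \<open>t\<close> have no common root, so they generate the unit ideal.\<close>
  have rel: "\<exists>u. ppair G u 0 \<and> poly u t = 1" if t: "\<not> (\<exists>c. (t, c) \<in> G)" for t
  proof -
    define J where "J = {q. \<exists>p. ppair G p q \<and> poly p t = 0}"
    have "1 \<in> J"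
    proof (rule ccontr)
      assume "1 \<notin> J"
      have "\<exists>c. \<forall>q\<in>J. poly q c = 0"
      proof (rule common_root)
        show "p + q \<in> J" if "p \<in> J" "q \<in> J" for p q
          using that ppair_add[OF h G(2)] unfolding J_def by fastforce
        show "q * p \<in> J" if "p \<in> J" for p q
          using that ppair_mult[OF h G(2) ppair_lift[OF h G(2), of q]] unfolding J_def by fastforce
      qed fact
      then obtain c where "\<And>q. q \<in> J \<Longrightarrow> poly q c = 0" by blast
      then have "(t, c) \<in> G" by (intro adj) (auto simp: J_def)
      with t show False by blast
    qed
    then obtain p where p: "ppair G p 1" "poly p t = 0" by (auto simp: J_def)
    have "ppair G 1 1"
      using ppair_pCons[OF h G(2) pg(5) ppair_0[OF h G(2)]] by (simp add: one_pCons)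
    then show ?thesis
      using ppair_diff[OF h G(2) _ p(1)] p(2) by (intro exI[of _ "1 - p"]) force
  qed
  have no: False if "t * s = 1" "ppair G u 0" "ppair G w 0" "poly u t = 1" "poly w s = 1" for t s u w
    using that
  proof (induction "degree u + degree w" arbitrary: u w t s rule: less_induct)
    case less
    have main: False if ih: "\<And>u'. degree u' < degree u \<Longrightarrow> ppair G u' 0 \<Longrightarrow> poly u' t = 1 \<Longrightarrow> False"
      and le: "degree w \<le> degree u" and ts: "t * s = 1" and u: "ppair G u 0" "poly u t = 1"
      and w: "ppair G w 0" "poly w s = 1" for u w t s
    proof (cases "degree u = 0")
      case True
      then obtain a where "u = [:a:]" by (auto elim: degree_eq_zeroE)
      with u have "u = 1" by (simp add: one_pCons)
      with u have "(1, 0) \<in> G" by (auto simp: ppair_def dest: spec[of _ 0])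
      then show False using pg_unique[OF h G(2) pg(5)] by force
    next
      case False
      define n where "n = degree u"
      let ?w0 = "coeff w 0" and ?un = "coeff u n"
      have co: "(coeff u i, 0) \<in> G" "(coeff w i, 0) \<in> G" for i
        using u w by (auto simp: ppair_def)
      \<comment> \<open>Because \<open>poly w s = 1\<close>, the polynomial \<open>r\<close> of
        degree below \<open>n\<close> takes the value \<open>t ^ n * (1 - ?w0)\<close> at
        \<open>t\<close>. Substituting it for the leading term of \<open>u\<close>, after
        multiplication by \<open>1 - ?w0\<close>, yields \<open>u'\<close> of smaller degree, still
        with value 1 at \<open>t\<close> and with coefficients of residue 0.\<close>
      define r where "r = (\<Sum>i\<in>{1..n}. monom (coeff w i) (n - i))"
      define u' where "u' = smult (1 - ?w0) (u - monom ?un n) + smult ?un r + [:?w0:]"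
      have pr: "ppair G r 0"
        using ppair_sum[OF h G(2), of "{1..n}" "\<lambda>i. monom (coeff w i) (n - i)" "\<lambda>i. 0"]
          ppair_monom[OF h G(2) co(2)] by (auto simp: r_def)
      have "(1 - ?w0, 1) \<in> G" using pg(6)[OF pg(5) co(2)[of 0]] by simp
      then have pu': "ppair G u' 0"
        using ppair_add[OF h G(2) ppair_add[OF h G(2)
            ppair_smult[OF h G(2) _ ppair_diff[OF h G(2) u(1) ppair_monom[OF h G(2) co(1)[of n]]]]
            ppair_smult[OF h G(2) co(1)[of n] pr]] ppair_pCons[OF h G(2) co(2)[of 0] ppair_0[OF h G(2)]]]
        unfolding u'_def by force
      have "poly r t = t ^ n * (\<Sum>i\<in>{1..n}. coeff w i * s ^ i)"
      proof -
        have *: "t ^ n * s ^ i = t ^ (n - i)" if "i \<le> n" for i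
        proof -
          have "t ^ n * s ^ i = t ^ (n - i) * (t * s) ^ i"
            using that by (simp add: power_add[symmetric] power_mult_distrib mult_ac)
          then show ?thesis by (simp add: ts)
        qed
        have "poly r t = (\<Sum>i\<in>{1..n}. coeff w i * (t ^ n * s ^ i))"
          unfolding r_def poly_sum poly_monom by (intro sum.cong refl) (simp add: *)
        then show ?thesis by (simp add: sum_distrib_left mult.left_commute)
      qed
      also have "(\<Sum>i\<in>{1..n}. coeff w i * s ^ i) = 1 - ?w0"
      proof -
        have "1 = (\<Sum>i\<le>n. coeff w i * s ^ i)"
          using poly_sum_atMost[of w n s] le w by (simp add: n_def)
        also have "{..n} = insert 0 {1..n}" by auto
        finally show ?thesis by (simp add: algebra_simps)
      qed
      finally have prt: "poly r t = t ^ n * (1 - ?w0)" .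
      have "poly u' t = 1"
        unfolding u'_def poly_add poly_smult poly_diff poly_monom prt u(2) by (simp add: algebra_simps)
      moreover have "degree u' < n"
      proof -
        have "degree (u - monom ?un n) < n"
        proof -
          have c0: "coeff (u - monom ?un n) i = 0" if "i > n - 1" for i
          proof (cases "i = n")
            case False
            then have "i > degree u" using that by (simp add: n_def)
            then show ?thesis using False by (simp add: coeff_eq_0)
          qed simp
          have "degree (u - monom ?un n) \<le> n - 1" by (intro degree_le allI impI c0)
          then show ?thesis using False by (simp add: n_def)
        qed
        moreover have "degree r \<le> n - 1"
          unfolding r_def
        proof (rule degree_sum_le)
          fix i assume "i \<in> {1..n}"
          then show "degree (monom (coeff w i) (n - i)) \<le> n - 1"
            using degree_monom_le[of "coeff w i" "n - i"] unfolding atLeastAtMost_iff by linarith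
        qed simp
        ultimately have "degree (smult (1 - ?w0) (u - monom ?un n)) \<le> n - 1" "degree (smult ?un r) \<le> n - 1"
          using degree_smult_le[of "1 - ?w0" "u - monom ?un n"] degree_smult_le[of ?un r] by linarith+
        then have "degree u' \<le> n - 1"
          unfolding u'_def by (intro degree_add_le) simp_all
        then show ?thesis using False by (simp add: n_def)
      qed
      ultimately show False using ih[of u'] pu' by (simp add: n_def)
    qed
    show False
    proof (cases "degree w \<le> degree u")
      case True
      show False
      proof (rule main[OF _ True less.prems(1,2,4,3,5)])
        fix u' assume "degree u' < degree u" "ppair G u' 0" "poly u' t = 1"
        then show False using less.hyps[of u' w t s] less.prems by simp
      qed
    next
      case False
      then have le: "degree u \<le> degree w" by simp
      have ts: "s * t = 1" using less.prems(1) by (simp add: mult.commute)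
      show False
      proof (rule main[OF _ le ts less.prems(3,5,2,4)])
        fix u' assume "degree u' < degree w" "ppair G u' 0" "poly u' s = 1"
        then show False using less.hyps[of u u' t s] less.prems by simp
      qed
    qed
  qed
  have "(\<exists>c. (t, c) \<in> G) \<or> (inverse t, 0) \<in> G" if t: "t \<noteq> 0" for t
  proof (cases "\<exists>c. (t, c) \<in> G")
    case False
    obtain u where u: "ppair G u 0" "poly u t = 1" using rel[OF False] by blast
    have "\<exists>c. (inverse t, c) \<in> G"
    proof (rule ccontr)
      assume "\<nexists>c. (inverse t, c) \<in> G"
      from rel[OF this] show False using no[of t "inverse t" u] u t by auto
    qed
    then obtain c where c: "(inverse t, c) \<in> G" by blast
    have "c = 0"
    proof (rule ccontr)
      assume c0: "c \<noteq> 0"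
      \<comment> \<open>A nonzero value \<open>c\<close> of the inverse would permit the value
        \<open>inverse c\<close> for \<open>t\<close>, because reversed relations are relations for
        the inverse.\<close>
      have "(t, inverse c) \<in> G"
      proof (rule adj)
        fix p q assume pq: "ppair G p q" "poly p t = 0"
        define n where "n = max (degree p) (degree q)"
        have "(\<Sum>i\<le>n. coeff p i * inverse t ^ (n - i), \<Sum>i\<le>n. coeff q i * c ^ (n - i)) \<in> G"
          using pq c by (intro pg_sum[OF h G(2)] pg pg_power[OF h G(2)]) (auto simp: ppair_def)
        moreover have "(\<Sum>i\<le>n. coeff p i * inverse t ^ (n - i)) = inverse t ^ n * poly p t"
          by (rule poly_reverse_sum) (auto simp: n_def t)
        moreover have "(\<Sum>i\<le>n. coeff q i * c ^ (n - i)) = c ^ n * poly q (inverse c)"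
          by (rule poly_reverse_sum) (auto simp: n_def c0)
        ultimately have "(0, c ^ n * poly q (inverse c)) \<in> G" using pq(2) by simp
        from pg_0D[OF h G(2) this] show "poly q (inverse c) = 0" using c0 by simp
      qed
      then show False using False by blast
    qed
    then show ?thesis using c by simp
  qed simp
  then show ?thesis using G by blast
qed

text \<open>Divide by a coordinate with the largest pole. All ratios become finite and the one at
  \<open>m\<close> becomes 1, so every point of projective space over the big field has a
  specialization at the place; this is properness.\<close>

lemma place_maximum:
  assumes h: "rhom h" and G: "pgraph h G"
    and val: "\<And>t. t \<noteq> 0 \<Longrightarrow> (\<exists>c. (t, c) \<in> G) \<or> (inverse t, 0) \<in> G"
    and w: "\<exists>i. w (i::'i::finite) \<noteq> 0"
  shows "\<exists>m. w m \<noteq> 0 \<and> (\<forall>i. \<exists>c. (w i / w m, c) \<in> G)"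
proof -
  have "\<exists>m\<in>A. w m \<noteq> 0 \<and> (\<forall>i\<in>A. \<exists>c. (w i / w m, c) \<in> G)" if "finite A" "\<exists>i\<in>A. w i \<noteq> 0" for A
    using that
  proof (induction A)
    case (insert k A)
    show ?case
    proof (cases "w k = 0")
      case True
      then obtain m where "m \<in> A" "w m \<noteq> 0" "\<forall>i\<in>A. \<exists>c. (w i / w m, c) \<in> G"
        using insert by auto
      then show ?thesis using True pg_0[OF h G] by (intro bexI[of _ m]) auto
    next
      case k: False
      have kk: "\<exists>c. (w k / w k, c) \<in> G" using k pg_1[OF h G] by auto
      show ?thesis
      proof (cases "\<exists>i\<in>A. w i \<noteq> 0")
        case False
        then show ?thesis using k kk pg_0[OF h G] by (intro bexI[of _ k]) auto
      next
        case True
        then obtain m where m: "m \<in> A" "w m \<noteq> 0" "\<forall>i\<in>A. \<exists>c. (w i / w m, c) \<in> G"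
          using insert by auto
        show ?thesis
        proof (cases "\<exists>c. (w k / w m, c) \<in> G")
          case True
          then show ?thesis using m by (intro bexI[of _ m]) auto
        next
          case False
          then have "(w m / w k, 0) \<in> G" using val[of "w k / w m"] k m by auto
          moreover have "w i / w k = w i / w m * (w m / w k)" for i using m by simp
          ultimately have "\<exists>c. (w i / w k, c) \<in> G" if "i \<in> A" for i
            using m(3) that pg_mult[OF h G] by metis
          then show ?thesis using k kk by (intro bexI[of _ k]) auto
        qed
      qed
    qed
  qed simp
  from this[of UNIV] w show ?thesis by auto
qed

section \<open>A Nullstellensatz for generic points\<close>

definition subalg :: "('k \<Rightarrow> 'f::comm_ring_1) \<Rightarrow> 'f set \<Rightarrow> bool" where
  "subalg h A \<longleftrightarrow> (\<forall>c. h c \<in> A) \<and> (\<forall>a\<in>A. \<forall>b\<in>A. a + b \<in> A \<and> a * b \<in> A)"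

definition pcoefs :: "'f set \<Rightarrow> 'f::zero poly \<Rightarrow> bool" where
  "pcoefs A p \<longleftrightarrow> (\<forall>i. coeff p i \<in> A)"

definition adjoin :: "'f set \<Rightarrow> 'f::comm_ring_1 \<Rightarrow> 'f set" where
  "adjoin A t = {poly p t | p. pcoefs A p}"

context
  fixes h :: "'k::field \<Rightarrow> 'f::comm_ring_1" and A
  assumes h: "rhom h" and A: "subalg h A"
begin

lemma sa_const: "h c \<in> A"
  and sa_add: "a \<in> A \<Longrightarrow> b \<in> A \<Longrightarrow> a + b \<in> A"
  and sa_mult: "a \<in> A \<Longrightarrow> b \<in> A \<Longrightarrow> a * b \<in> A"
  using A by (auto simp: subalg_def)

lemma sa_0: "0 \<in> A" and sa_1: "1 \<in> A"
  using sa_const[of 0] sa_const[of 1] by (simp_all add: rhom_0[OF h] rhom_1[OF h])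

lemma sa_uminus: "a \<in> A \<Longrightarrow> - a \<in> A"
  using sa_mult[OF sa_const[of "- 1"], of a] by (simp add: rhom_uminus[OF h] rhom_1[OF h])

lemma sa_diff: "a \<in> A \<Longrightarrow> b \<in> A \<Longrightarrow> a - b \<in> A"
  using sa_add[OF _ sa_uminus, of a b] by simp

lemma sa_sum: "(\<And>i. i \<in> S \<Longrightarrow> f i \<in> A) \<Longrightarrow> sum f S \<in> A"
  by (induction S rule: infinite_finite_induct) (auto simp: sa_0 intro: sa_add)

lemma sa_power: "a \<in> A \<Longrightarrow> a ^ n \<in> A"
  by (induction n) (auto simp: sa_1 intro: sa_mult)

lemma sa_of_nat: "of_nat n \<in> A"
  using sa_const[of "of_nat n"] by (simp add: rhom_of_nat[OF h])

lemma sa_ev: "(\<And>i. z i \<in> A) \<Longrightarrow> ev h f z \<in> A"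
  by (induction f rule: mp_ring_induct) (simp_all add: ev_simps h sa_const sa_add sa_mult)

lemma pcoefs_0: "pcoefs A 0"
  by (simp add: pcoefs_def sa_0)

lemma pcoefs_pCons: "a \<in> A \<Longrightarrow> pcoefs A p \<Longrightarrow> pcoefs A (pCons a p)"
  by (auto simp: pcoefs_def coeff_pCons split: nat.split)

lemma pcoefs_add: "pcoefs A p \<Longrightarrow> pcoefs A q \<Longrightarrow> pcoefs A (p + q)"
  by (simp add: pcoefs_def sa_add)

lemma pcoefs_diff: "pcoefs A p \<Longrightarrow> pcoefs A q \<Longrightarrow> pcoefs A (p - q)"
  by (simp add: pcoefs_def sa_diff)

lemma pcoefs_mult: "pcoefs A p \<Longrightarrow> pcoefs A q \<Longrightarrow> pcoefs A (p * q)"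
  by (auto simp: pcoefs_def coeff_mult intro!: sa_sum sa_mult)

lemma pcoefs_smult: "a \<in> A \<Longrightarrow> pcoefs A p \<Longrightarrow> pcoefs A (smult a p)"
  by (simp add: pcoefs_def sa_mult)

lemma pcoefs_monom: "a \<in> A \<Longrightarrow> pcoefs A (monom a n)"
  by (simp add: pcoefs_def sa_0)

lemma adjoin_subalg: "subalg h (adjoin A t)"
  unfolding subalg_def
proof (intro conjI ballI allI)
  fix c show "h c \<in> adjoin A t"
    using pcoefs_pCons[OF sa_const pcoefs_0, of c] by (force simp: adjoin_def)
next
  fix a b assume "a \<in> adjoin A t" "b \<in> adjoin A t"
  then obtain p q where pq: "a = poly p t" "pcoefs A p" "b = poly q t" "pcoefs A q"
    by (auto simp: adjoin_def)
  then have "a + b = poly (p + q) t" "a * b = poly (p * q) t" by simp_all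
  then show "a + b \<in> adjoin A t" "a * b \<in> adjoin A t"
    using pcoefs_add pcoefs_mult pq unfolding adjoin_def by blast+
qed

lemma adjoin_superset: "A \<subseteq> adjoin A t"
proof
  fix a assume "a \<in> A"
  then show "a \<in> adjoin A t"
    using pcoefs_pCons[OF _ pcoefs_0, of a] by (force simp: adjoin_def)
qed

lemma adjoin_member: "t \<in> adjoin A t"
proof -
  have "pcoefs A [:0, 1:]" by (intro pcoefs_pCons pcoefs_0 sa_0 sa_1)
  then show ?thesis by (force simp: adjoin_def)
qed

end

lemma pseudo_reduce:
  fixes f g :: "'f::idom poly"
  assumes "g \<noteq> 0" "degree g \<le> degree f"
  defines "f' \<equiv> smult (lead_coeff g) f - monom (lead_coeff f) (degree f - degree g) * g"
  shows "f' = 0 \<or> degree f' < degree f"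
proof -
  have co: "coeff f' i = 0" if "i \<ge> degree f" for i
  proof -
    have "coeff (monom (lead_coeff f) (degree f - degree g) * g) i
        = lead_coeff f * coeff g (i - (degree f - degree g))"
      using that by (simp add: coeff_monom_mult)
    moreover have "coeff f i * lead_coeff g = lead_coeff f * coeff g (i - (degree f - degree g))"
    proof (cases "i = degree f")
      case False
      then have "coeff f i = 0" "coeff g (i - (degree f - degree g)) = 0"
        using that assms(2) by (auto intro!: coeff_eq_0)
      then show ?thesis by simp
    qed (use assms(2) in simp)
    ultimately show ?thesis by (simp add: f'_def mult.commute)
  qed
  show ?thesis
  proof (cases "degree f = 0")
    case True
    have "f' = 0" by (rule poly_eqI) (simp add: co True)
    then show ?thesis ..
  next
    case False
    have "degree f' \<le> degree f - 1" by (rule degree_le) (use co in simp)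
    then show ?thesis using False by linarith
  qed
qed

text \<open>Coefficients cannot be divided inside \<open>A\<close>, so \<open>f\<close> is
  multiplied by a power of the leading coefficient of \<open>g\<close> instead.\<close>

lemma pseudo_division:
  fixes h :: "'k::field \<Rightarrow> 'f::idom"
  assumes h: "rhom h" and A: "subalg h A"
  shows "pcoefs A f \<Longrightarrow> pcoefs A g \<Longrightarrow> g \<noteq> 0 \<Longrightarrow>
    \<exists>q r k. pcoefs A q \<and> pcoefs A r \<and> smult (lead_coeff g ^ k) f = g * q + r \<and> (r = 0 \<or> degree r < degree g)"
proof (induction "degree f" arbitrary: f rule: less_induct)
  case less
  note pc = pcoefs_0[OF h A] pcoefs_add[OF h A] pcoefs_diff[OF h A] pcoefs_mult[OF h A]
    pcoefs_smult[OF h A] pcoefs_monom[OF h A] sa_power[OF h A] sa_mult[OF h A]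
  have lc: "lead_coeff f \<in> A" "lead_coeff g \<in> A"
    using less.prems by (auto simp: pcoefs_def)
  show ?case
  proof (cases "degree f < degree g")
    case True
    then show ?thesis
      using less.prems pc(1) by (intro exI[of _ 0] exI[of _ f]) simp
  next
    case False
    let ?m = "monom (lead_coeff f) (degree f - degree g)"
    define f' where "f' = smult (lead_coeff g) f - ?m * g"
    have f': "pcoefs A f'" unfolding f'_def using less.prems lc by (intro pc)
    have "f' = 0 \<or> degree f' < degree f"
      unfolding f'_def using pseudo_reduce[of g f] less.prems False by simp
    then obtain q r k where *: "pcoefs A q" "pcoefs A r"
      "smult (lead_coeff g ^ k) f' = g * q + r" "r = 0 \<or> degree r < degree g"
    proof
      assume "f' = 0"
      then show ?thesis using that[of 0 0 0] pc(1) by simp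
    next
      assume "degree f' < degree f"
      then show ?thesis using less.hyps[of f'] f' less.prems(2,3) that by blast
    qed
    have "smult (lead_coeff g ^ Suc k) f = smult (lead_coeff g ^ k) (f' + ?m * g)"
      by (simp add: f'_def mult.commute)
    also have "\<dots> = g * (q + smult (lead_coeff g ^ k) ?m) + r"
      using *(3) by (simp add: smult_add_right algebra_simps)
    finally show ?thesis
      using * lc by (intro exI[of _ "q + smult (lead_coeff g ^ k) ?m"] exI[of _ r] exI[of _ "Suc k"] conjI pc) auto
  qed
qed

text \<open>The invariant that survives the adjunction of an element in the proof of the Nullstellensatz.\<close>

definition detects :: "('k::field \<Rightarrow> 'f::field) \<Rightarrow> 'f set \<Rightarrow> bool" where
  "detects h A \<longleftrightarrow> (\<forall>v\<in>A. v \<noteq> 0 \<longrightarrow>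
    (\<exists>G. pgraph h G \<and> A \<subseteq> fst ` G \<and> (\<forall>b. (v, b) \<in> G \<longrightarrow> b \<noteq> 0)))"

text \<open>A transcendental \<open>x\<close> may receive any value. One is chosen that is no root
  of the residue polynomial of \<open>q\<close>, which is nonzero because its leading coefficient
  was kept nonzero.\<close>

lemma detects_adjoin_transcendental:
  fixes h :: "'k::{alg_closed_field, field_char_0} \<Rightarrow> 'f::field"
  assumes h: "rhom h" and A: "subalg h A" and det: "detects h A"
    and tr: "\<And>p. pcoefs A p \<Longrightarrow> poly p x = 0 \<Longrightarrow> p = 0"
  shows "detects h (adjoin A x)"
  unfolding detects_def
proof (intro ballI impI)
  fix v assume "v \<in> adjoin A x" "v \<noteq> 0"
  then obtain q where q: "v = poly q x" "pcoefs A q" "q \<noteq> 0"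
    unfolding adjoin_def using poly_0 by blast
  then have "lead_coeff q \<in> A" "lead_coeff q \<noteq> 0" by (auto simp: pcoefs_def)
  then obtain G where G: "pgraph h G" "A \<subseteq> fst ` G" "\<And>b. (lead_coeff q, b) \<in> G \<Longrightarrow> b \<noteq> 0"
    using det unfolding detects_def by blast
  \<comment> \<open>\<open>x\<close> is transcendental over \<open>A\<close> only; values of other
    elements in the domain of \<open>G\<close> could conflict with the value chosen for
    \<open>x\<close>, so they are dropped.\<close>
  define G1 where "G1 = G \<inter> A \<times> UNIV"
  have G1: "pgraph h G1"
    using G(1) A unfolding pgraph_def G1_def subalg_def by auto
  have dom: "\<exists>b. (a, b) \<in> G1" if "a \<in> A" for a
    using that G(2) by (force simp: G1_def)
  obtain q' where q': "ppair G1 q q'"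
    using ppair_exists[OF h G1, of q] dom q(2) by (auto simp: pcoefs_def)
  have "(lead_coeff q, coeff q' (degree q)) \<in> G" using q' by (auto simp: ppair_def G1_def)
  then have "q' \<noteq> 0" using G(3) by force
  then obtain c where c: "poly q' c \<noteq> 0"
    using poly_roots_finite[of q'] infinite_UNIV_char_0[where 'a = 'k]
    by (metis (mono_tags, lifting) UNIV_eq_I mem_Collect_eq)
  have ad: "pgraph h (padjoin G1 x c)"
  proof (rule padjoin_pgraph[OF h G1])
    fix p r assume pr: "ppair G1 p r" "poly p x = 0"
    have "pcoefs A p" using pr(1) by (auto simp: ppair_def pcoefs_def G1_def)
    then have p0: "p = 0" using tr pr(2) by blast
    have "r = 0"
      using pr(1) pg_0D[OF h G1] by (intro poly_eqI) (auto simp: p0 ppair_def)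
    then show "poly r c = 0" by simp
  qed
  have "adjoin A x \<subseteq> fst ` padjoin G1 x c"
  proof
    fix a assume "a \<in> adjoin A x"
    then obtain p where p: "a = poly p x" "pcoefs A p" by (auto simp: adjoin_def)
    obtain p' where "ppair G1 p p'"
      using ppair_exists[OF h G1, of p] dom p(2) by (auto simp: pcoefs_def)
    then show "a \<in> fst ` padjoin G1 x c" using p(1) by (force simp: padjoin_def)
  qed
  moreover have "b \<noteq> 0" if b: "(v, b) \<in> padjoin G1 x c" for b
  proof -
    have "(v, poly q' c) \<in> padjoin G1 x c" using q' q(1) by (auto simp: padjoin_def)
    then show ?thesis using pg_unique[OF h ad b] c by simp
  qed
  ultimately show "\<exists>G. pgraph h G \<and> adjoin A x \<subseteq> fst ` G \<and> (\<forall>b. (v, b) \<in> G \<longrightarrow> b \<noteq> 0)"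
    using ad by blast
qed

text \<open>Among the nonzero multiples of \<open>v\<close>, written as polynomials in
  \<open>x\<close>, take one of least degree. If it were not constant, pseudo-division of it by the
  minimal polynomial \<open>p0\<close>, or of \<open>p0\<close> by it, would produce a multiple of
  smaller degree or a proper factor of \<open>p0\<close> vanishing at \<open>x\<close>.\<close>

lemma algebraic_multiple:
  fixes h :: "'k::field \<Rightarrow> 'f::field"
  assumes h: "rhom h" and A: "subalg h A"
    and p: "pcoefs A p" "p \<noteq> 0" "poly p x = 0"
    and v: "v \<in> adjoin A x" "v \<noteq> 0"
  shows "\<exists>s\<in>adjoin A x. v * s \<in> A \<and> v * s \<noteq> 0"
proof -
  note Ax = adjoin_subalg[OF h A, of x]
  note pc = pcoefs_diff[OF h A] pcoefs_mult[OF h A] pcoefs_smult[OF h A]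
  define p0 where "p0 = arg_min degree (\<lambda>p. pcoefs A p \<and> p \<noteq> 0 \<and> poly p x = 0)"
  have p0: "pcoefs A p0" "p0 \<noteq> 0" "poly p0 x = 0"
    unfolding p0_def using arg_min_natI[of "\<lambda>p. pcoefs A p \<and> p \<noteq> 0 \<and> poly p x = 0" p degree] p by auto
  have p0_min: "degree p0 \<le> degree q" if "pcoefs A q" "q \<noteq> 0" "poly q x = 0" for q
    unfolding p0_def by (rule arg_min_nat_le) (use that in auto)
  define Q where "Q g \<longleftrightarrow> pcoefs A g \<and> poly g x \<noteq> 0 \<and> (\<exists>s\<in>adjoin A x. poly g x = v * s)" for g
  obtain g1 where "pcoefs A g1" "v = poly g1 x" using v by (auto simp: adjoin_def)
  then have "Q g1" using v sa_1[OF h Ax] by (auto simp: Q_def intro!: bexI[of _ 1])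
  define g where "g = arg_min degree Q"
  have g: "Q g" unfolding g_def using \<open>Q g1\<close> by (rule arg_min_natI)
  have g_min: "degree g \<le> degree q" if "Q q" for q
    unfolding g_def using that by (rule arg_min_nat_le)
  have gA: "pcoefs A g" "poly g x \<noteq> 0" "g \<noteq> 0" using g by (auto simp: Q_def)
  obtain s where s: "s \<in> adjoin A x" "poly g x = v * s" using g by (auto simp: Q_def)
  have "degree g = 0"
  proof (rule ccontr)
    assume dg: "degree g \<noteq> 0"
    have lt: "degree g < degree p0"
    proof (rule ccontr)
      assume "\<not> ?thesis"
      obtain q r k where qr: "pcoefs A q" "pcoefs A r"
          "smult (lead_coeff p0 ^ k) g = p0 * q + r" "r = 0 \<or> degree r < degree p0"
        using pseudo_division[OF h A gA(1) p0(1,2)] by blast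
      let ?c = "lead_coeff p0 ^ k"
      have cA: "?c \<in> A" using p0(1) by (intro sa_power[OF h A]) (simp add: pcoefs_def)
      have rx: "poly r x = ?c * poly g x"
        using arg_cong[OF qr(3), of "\<lambda>p. poly p x"] p0(3) by simp
      have "Q r"
        unfolding Q_def
      proof (intro conjI bexI)
        show "poly r x \<noteq> 0" using rx gA(2) p0(2) by simp
        show "poly r x = v * (?c * s)" using rx s(2) by simp
        show "?c * s \<in> adjoin A x"
          using cA adjoin_superset[OF h A, of x] s(1) by (intro sa_mult[OF h Ax]) auto
      qed fact
      then have "degree g \<le> degree r" "r \<noteq> 0" using g_min by (auto simp: Q_def)
      then show False using qr(4) \<open>\<not> degree g < degree p0\<close> by simp
    qed
    obtain q r k where qr: "pcoefs A q" "pcoefs A r"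
        "smult (lead_coeff g ^ k) p0 = g * q + r" "r = 0 \<or> degree r < degree g"
      using pseudo_division[OF h A p0(1) gA(1,3)] by blast
    have rx: "poly r x = - (poly g x * poly q x)"
      using arg_cong[OF qr(3), of "\<lambda>p. poly p x"] p0(3) by (simp add: eq_neg_iff_add_eq_0 add.commute)
    show False
    proof (cases "poly r x = 0")
      case False
      have "Q r"
        unfolding Q_def
      proof (intro conjI bexI)
        show "poly r x = v * (- (s * poly q x))" using rx s(2) by simp
        show "- (s * poly q x) \<in> adjoin A x"
          using s(1) qr(1) by (intro sa_uminus[OF h Ax] sa_mult[OF h Ax]) (auto simp: adjoin_def)
      qed fact+
      then show False using g_min[of r] qr(4) by (auto simp: Q_def)
    next
      case True
      then have "r = 0" using p0_min[of r] qr(2,4) lt by force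
      then have eq: "smult (lead_coeff g ^ k) p0 = g * q" using qr(3) by simp
      have "q \<noteq> 0" using eq p0(2) gA(3) by auto
      moreover have "poly q x = 0" using rx True gA(2) by simp
      ultimately have "degree p0 \<le> degree q" using p0_min qr(1) by blast
      moreover have "degree p0 = degree g + degree q"
        using arg_cong[OF eq, of degree] gA(3) \<open>q \<noteq> 0\<close> by (simp add: degree_mult_eq)
      ultimately show False using dg by simp
    qed
  qed
  then obtain u where "g = [:u:]" by (auto elim: degree_eq_zeroE)
  then have "poly g x = u" "u \<in> A" using gA(1) by (auto simp: pcoefs_def dest: spec[of _ 0])
  then show ?thesis using s gA(2) by (intro bexI[of _ s]) auto
qed

text \<open>The element \<open>v * s * lead_coeff p\<close> of \<open>A\<close> is kept nonzero. Its
  last factor makes \<open>x\<close> integral, hence finite, at the place; the product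
  \<open>v * s\<close> prevents \<open>v\<close> from vanishing there.\<close>

lemma detects_adjoin_algebraic:
  fixes h :: "'k::{alg_closed_field, field_char_0} \<Rightarrow> 'f::field"
  assumes h: "rhom h" and A: "subalg h A" and det: "detects h A"
    and p: "pcoefs A p" "p \<noteq> 0" "poly p x = 0"
  shows "detects h (adjoin A x)"
  unfolding detects_def
proof (intro ballI impI)
  fix v assume v: "v \<in> adjoin A x" "v \<noteq> 0"
  obtain s where s: "s \<in> adjoin A x" "v * s \<in> A" "v * s \<noteq> 0"
    using algebraic_multiple[OF h A p v] by blast
  let ?a = "lead_coeff p"
  have a: "?a \<in> A" "?a \<noteq> 0" using p by (auto simp: pcoefs_def)
  have "v * s * ?a \<in> A" "v * s * ?a \<noteq> 0" using s a sa_mult[OF h A] by auto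
  then obtain G0 where G0: "pgraph h G0" "A \<subseteq> fst ` G0" "\<And>b. (v * s * ?a, b) \<in> G0 \<Longrightarrow> b \<noteq> 0"
    using det unfolding detects_def by blast
  obtain G where G: "G0 \<subseteq> G" "pgraph h G" and val: "\<And>t. t \<noteq> 0 \<Longrightarrow> (\<exists>c. (t, c) \<in> G) \<or> (inverse t, 0) \<in> G"
    using place_exists[OF h G0(1)] by blast
  have dom: "\<exists>b. (a, b) \<in> G" if "a \<in> A" for a using that G0(2) G(1) by force
  have nz: "b \<noteq> 0" if "(v * s * ?a, b) \<in> G" for b
  proof -
    obtain b' where b': "(v * s * ?a, b') \<in> G0"
      using G0(2) \<open>v * s * ?a \<in> A\<close> by force
    then show ?thesis using G0(3)[OF b'] pg_unique[OF h G(2) that] G(1) by blast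
  qed
  obtain va where va: "(v * s, va) \<in> G" using dom s(2) by blast
  obtain ba where ba: "(?a, ba) \<in> G" using dom a(1) by blast
  have nz2: "va * ba \<noteq> 0" by (rule nz) (rule pg_mult[OF h G(2) va ba])
  have "\<exists>c. (x, c) \<in> G"
  proof (cases "x = 0")
    case True
    then show ?thesis using pg_0[OF h G(2)] by blast
  next
    case x: False
    show ?thesis
    proof (rule ccontr)
      assume "\<not> ?thesis"
      then have inv: "(inverse x, 0) \<in> G" using val[OF x] by blast
      obtain p' where p': "ppair G p p'"
        using ppair_exists[OF h G(2), of p] dom p(1) by (auto simp: pcoefs_def)
      let ?n = "degree p"
      have "(\<Sum>i\<le>?n. coeff p i * inverse x ^ (?n - i), \<Sum>i\<le>?n. coeff p' i * 0 ^ (?n - i)) \<in> G"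
        using p' inv by (intro pg_sum[OF h G(2)] pg_mult[OF h G(2)] pg_power[OF h G(2)]) (auto simp: ppair_def)
      moreover have "(\<Sum>i\<le>?n. coeff p i * inverse x ^ (?n - i)) = 0"
        using poly_reverse_sum[of p ?n x "inverse x"] x p(3) by simp
      moreover have "(\<Sum>i\<le>?n. coeff p' i * 0 ^ (?n - i)) = (\<Sum>i\<le>?n. if i = ?n then coeff p' i else 0)"
        by (intro sum.cong) auto
      ultimately have "coeff p' ?n = 0" using pg_0D[OF h G(2)] by (simp add: sum.delta)
      moreover have "(?a, coeff p' ?n) \<in> G" using p' by (simp add: ppair_def)
      ultimately show False using pg_unique[OF h G(2) ba] nz2 by auto
    qed
  qed
  then obtain c where c: "(x, c) \<in> G" ..
  have sub: "adjoin A x \<subseteq> fst ` G"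
  proof
    fix a assume "a \<in> adjoin A x"
    then obtain q where q: "a = poly q x" "pcoefs A q" by (auto simp: adjoin_def)
    obtain q' where q': "ppair G q q'"
      using ppair_exists[OF h G(2), of q] dom q(2) by (auto simp: pcoefs_def)
    have "(\<Sum>i\<le>degree q. coeff q i * x ^ i, \<Sum>i\<le>degree q. coeff q' i * c ^ i) \<in> G"
      using q' c by (intro pg_sum[OF h G(2)] pg_mult[OF h G(2)] pg_power[OF h G(2)]) (auto simp: ppair_def)
    then show "a \<in> fst ` G" unfolding q(1) poly_altdef by force
  qed
  moreover have "b \<noteq> 0" if b: "(v, b) \<in> G" for b
  proof
    assume "b = 0"
    obtain bs where "(s, bs) \<in> G" using sub s(1) by force
    then have "(v * s, b * bs) \<in> G" by (intro pg_mult[OF h G(2) b])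
    then have "va = 0" using pg_unique[OF h G(2) va] \<open>b = 0\<close> by simp
    then show False using nz2 by simp
  qed
  ultimately show "\<exists>G. pgraph h G \<and> adjoin A x \<subseteq> fst ` G \<and> (\<forall>b. (v, b) \<in> G \<longrightarrow> b \<noteq> 0)"
    using G(2) by blast
qed

text \<open>The coordinates are adjoined to the constants one at a time. A partial homomorphism on
  the resulting algebra that does not kill \<open>ev h g z\<close> sends \<open>z\<close> to the
  point wanted.\<close>

theorem nullstellensatz:
  fixes h :: "'k::{alg_closed_field, field_char_0} \<Rightarrow> 'f::field" and z :: "'i::finite \<Rightarrow> 'f"
  assumes h: "rhom h" and g: "ev h g z \<noteq> 0"
  shows "\<exists>b. mp_eval g b \<noteq> 0 \<and> (\<forall>f. ev h f z = 0 \<longrightarrow> mp_eval f b = 0)"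
proof -
  have "\<exists>A. subalg h A \<and> detects h A \<and> z ` S \<subseteq> A" if "finite S" for S
    using that
  proof (induction S)
    case empty
    have "subalg h (range h)"
      unfolding subalg_def
    proof (intro conjI ballI allI)
      fix a b assume "a \<in> range h" "b \<in> range h"
      then show "a + b \<in> range h" "a * b \<in> range h"
        by (auto simp: rhom_add[OF h, symmetric] rhom_mult[OF h, symmetric])
    qed simp
    moreover have "detects h (range h)"
      unfolding detects_def
    proof (intro ballI impI)
      fix v assume "v \<in> range h" "v \<noteq> 0"
      let ?G = "range (\<lambda>c. (h c, c))"
      have inj: "h a = h b \<longleftrightarrow> a = b" for a b
        using rhom_eq_0_iff[OF h, of "a - b"] by (simp add: rhom_diff[OF h])
      have "pgraph h ?G"
        unfolding pgraph_def using rhom_0[OF h] inj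
        by (auto simp: image_iff rhom_add[OF h] rhom_mult[OF h] rhom_eq_0_iff[OF h])
      moreover have "range h \<subseteq> fst ` ?G" by force
      moreover have "\<forall>b. (v, b) \<in> ?G \<longrightarrow> b \<noteq> 0"
        using \<open>v \<noteq> 0\<close> by (auto simp: rhom_0[OF h])
      ultimately show "\<exists>G. pgraph h G \<and> range h \<subseteq> fst ` G \<and> (\<forall>b. (v, b) \<in> G \<longrightarrow> b \<noteq> 0)" by blast
    qed
    ultimately show ?case by (intro exI[of _ "range h"]) simp
  next
    case (insert i S)
    then obtain A where A: "subalg h A" "detects h A" "z ` S \<subseteq> A" by blast
    have "detects h (adjoin A (z i))"
    proof (cases "\<exists>p. pcoefs A p \<and> p \<noteq> 0 \<and> poly p (z i) = 0")
      case True
      then show ?thesis using detects_adjoin_algebraic[OF h A(1,2)] by blast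
    next
      case False
      then show ?thesis using detects_adjoin_transcendental[OF h A(1,2)] by blast
    qed
    then show ?case
      using A adjoin_subalg[OF h A(1)] adjoin_superset[OF h A(1), of "z i"] adjoin_member[OF h A(1)]
      by (intro exI[of _ "adjoin A (z i)"]) auto
  qed
  from this[of UNIV] obtain A where A: "subalg h A" "detects h A" "range z \<subseteq> A" by auto
  have "ev h g z \<in> A" using A(3) by (intro sa_ev[OF h A(1)]) auto
  then obtain G where G: "pgraph h G" "A \<subseteq> fst ` G" "\<And>b. (ev h g z, b) \<in> G \<Longrightarrow> b \<noteq> 0"
    using A(2) g unfolding detects_def by blast
  have "\<forall>i. \<exists>b. (z i, b) \<in> G" using A(3) G(2) by force
  then obtain b where b: "\<And>i. (z i, b i) \<in> G" by metis
  have evG: "(ev h f z, mp_eval f b) \<in> G" for f by (rule pg_ev[OF h G(1) b])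
  show ?thesis
  proof (intro exI[of _ b] conjI allI impI)
    show "mp_eval g b \<noteq> 0" by (rule G(3)[OF evG])
    fix f assume "ev h f z = 0"
    then show "mp_eval f b = 0" using evG[of f] pg_0D[OF h G(1)] by simp
  qed
qed

section \<open>Extension of derivations\<close>

text \<open>A partial derivation is given by its graph, a subring of the dual numbers over \<open>'f\<close>.\<close>

definition dgraph :: "('k::field \<Rightarrow> 'f::field) \<Rightarrow> ('f \<times> 'f) set \<Rightarrow> bool" where
  "dgraph h G \<longleftrightarrow> (\<forall>c. (h c, 0) \<in> G) \<and>
    (\<forall>a b a' b'. (a, b) \<in> G \<longrightarrow> (a', b') \<in> G \<longrightarrow>
      (a + a', b + b') \<in> G \<and> (a * a', a * b' + a' * b) \<in> G) \<and>
    (\<forall>b. (0, b) \<in> G \<longrightarrow> b = 0)"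

text \<open>The value that the Leibniz rule forces on \<open>poly p t\<close> if \<open>t\<close> is
  sent to \<open>u\<close> and the coefficients of \<open>p\<close> to those of
  \<open>r\<close>.\<close>

definition dval :: "'f::field \<Rightarrow> 'f \<Rightarrow> 'f poly \<Rightarrow> 'f poly \<Rightarrow> 'f" where
  "dval t u p r = poly r t + poly (pderiv p) t * u"

definition dadjoin :: "('f::field \<times> 'f) set \<Rightarrow> 'f \<Rightarrow> 'f \<Rightarrow> ('f \<times> 'f) set" where
  "dadjoin G t u = {(poly p t, dval t u p r) | p r. ppair G p r}"

lemma dval_add: "dval t u (p + p') (r + r') = dval t u p r + dval t u p' r'"
  by (simp add: dval_def pderiv_add algebra_simps)

lemma dval_diff: "dval t u (p - p') (r - r') = dval t u p r - dval t u p' r'"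
  by (simp add: dval_def pderiv_diff algebra_simps)

lemma dval_mult: "dval t u (p * p') (p * r' + p' * r) = poly p t * dval t u p' r' + poly p' t * dval t u p r"
  by (simp add: dval_def pderiv_mult algebra_simps)

context
  fixes h :: "'k::field \<Rightarrow> 'f::field" and G
  assumes h: "rhom h" and G: "dgraph h G"
begin

lemma dg_const: "(h c, 0) \<in> G"
  and dg_add: "(a, b) \<in> G \<Longrightarrow> (a', b') \<in> G \<Longrightarrow> (a + a', b + b') \<in> G"
  and dg_mult: "(a, b) \<in> G \<Longrightarrow> (a', b') \<in> G \<Longrightarrow> (a * a', a * b' + a' * b) \<in> G"
  and dg_0D: "(0, b) \<in> G \<Longrightarrow> b = 0"
  using G by (auto simp: dgraph_def)

lemma dg_0: "(0, 0) \<in> G" and dg_1: "(1, 0) \<in> G"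
  using dg_const[of 0] dg_const[of 1] by (simp_all add: rhom_0[OF h] rhom_1[OF h])

lemma dg_uminus: "(a, b) \<in> G \<Longrightarrow> (- a, - b) \<in> G"
  using dg_mult[OF dg_const[of "- 1"], of a b] by (simp add: rhom_uminus[OF h] rhom_1[OF h])

lemma dg_diff: "(a, b) \<in> G \<Longrightarrow> (a', b') \<in> G \<Longrightarrow> (a - a', b - b') \<in> G"
  using dg_add[OF _ dg_uminus, of a b a' b'] by simp

lemma dg_unique: "(a, b) \<in> G \<Longrightarrow> (a, b') \<in> G \<Longrightarrow> b = b'"
  using dg_diff[of a b a b'] dg_0D[of "b - b'"] by simp

lemma dg_sum: "(\<And>i. i \<in> S \<Longrightarrow> (f i, g i) \<in> G) \<Longrightarrow> (sum f S, sum g S) \<in> G"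
  by (induction S rule: infinite_finite_induct) (auto simp: dg_0 intro: dg_add)

lemma dg_subalg: "subalg h (fst ` G)"
  unfolding subalg_def
proof (intro conjI allI ballI)
  show "h c \<in> fst ` G" for c using dg_const[of c] by (metis fst_conv image_eqI)
  fix a b assume "a \<in> fst ` G" "b \<in> fst ` G"
  then obtain a' b' where "(a, a') \<in> G" "(b, b') \<in> G" by auto
  then show "a + b \<in> fst ` G" "a * b \<in> fst ` G"
    using dg_add[of a a' b b'] dg_mult[of a a' b b'] by (metis fst_conv image_eqI)+
qed

lemma dpair_0: "ppair G 0 0"
  by (simp add: ppair_def dg_0)

lemma dpair_pCons: "(a, b) \<in> G \<Longrightarrow> ppair G p q \<Longrightarrow> ppair G (pCons a p) (pCons b q)"
  by (auto simp: ppair_def coeff_pCons split: nat.split)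

lemma dpair_add: "ppair G p q \<Longrightarrow> ppair G p' q' \<Longrightarrow> ppair G (p + p') (q + q')"
  by (simp add: ppair_def dg_add)

lemma dpair_diff: "ppair G p q \<Longrightarrow> ppair G p' q' \<Longrightarrow> ppair G (p - p') (q - q')"
  by (simp add: ppair_def dg_diff)

lemma dpair_monom: "(a, b) \<in> G \<Longrightarrow> ppair G (monom a n) (monom b n)"
  by (simp add: ppair_def dg_0)

lemma dpair_mult:
  assumes "ppair G p r" "ppair G p' r'"
  shows "ppair G (p * p') (p * r' + p' * r)"
  unfolding ppair_def
proof
  fix n
  have "(\<Sum>i\<le>n. coeff p i * coeff p' (n - i),
      \<Sum>i\<le>n. coeff p i * coeff r' (n - i) + coeff p' (n - i) * coeff r i) \<in> G"
    using assms by (intro dg_sum dg_mult) (auto simp: ppair_def)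
  then show "(coeff (p * p') n, coeff (p * r' + p' * r) n) \<in> G"
    by (simp add: coeff_mult sum.distrib mult.commute[of p' r] mult.commute[of "coeff p' _"])
qed

lemma dpair_exists:
  assumes "\<And>i. \<exists>b. (coeff p i, b) \<in> G"
  shows "\<exists>q. ppair G p q"
proof -
  obtain b where b: "\<And>i. (coeff p i, b i) \<in> G" using assms by metis
  have "ppair G (\<Sum>i\<in>A. monom (coeff p i) i) (\<Sum>i\<in>A. monom (b i) i)" for A
    by (induction A rule: infinite_finite_induct) (auto intro: dpair_0 dpair_add dpair_monom b)
  from this[of "{..degree p}"] show ?thesis by (auto simp: poly_as_sum_of_monoms)
qed

lemma dadjoin_dgraph:
  assumes "\<And>p r. ppair G p r \<Longrightarrow> poly p t = 0 \<Longrightarrow> dval t u p r = 0"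
  shows "dgraph h (dadjoin G t u)"
  unfolding dgraph_def
proof (intro conjI allI impI)
  fix d
  have "ppair G [:h d:] 0" using dpair_pCons[OF dg_const dpair_0, of d] by simp
  moreover have "(h d, 0) = (poly [:h d:] t, dval t u [:h d:] 0)" by (simp add: dval_def pderiv_pCons)
  ultimately show "(h d, 0) \<in> dadjoin G t u"
    unfolding dadjoin_def by blast
next
  fix a b a' b' assume "(a, b) \<in> dadjoin G t u" "(a', b') \<in> dadjoin G t u"
  then obtain p r p' r' where *: "a = poly p t" "b = dval t u p r" "ppair G p r"
      "a' = poly p' t" "b' = dval t u p' r'" "ppair G p' r'"
    by (auto simp: dadjoin_def)
  have "(a + a', b + b') = (poly (p + p') t, dval t u (p + p') (r + r'))"
    by (simp add: * dval_add)
  then show "(a + a', b + b') \<in> dadjoin G t u"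
    unfolding dadjoin_def using dpair_add[OF *(3,6)] by blast
  have "(a * a', a * b' + a' * b) = (poly (p * p') t, dval t u (p * p') (p * r' + p' * r))"
    by (simp add: * dval_mult)
  then show "(a * a', a * b' + a' * b) \<in> dadjoin G t u"
    unfolding dadjoin_def using dpair_mult[OF *(3,6)] by blast
next
  fix b assume "(0, b) \<in> dadjoin G t u"
  then obtain p r where "poly p t = 0" "b = dval t u p r" "ppair G p r" by (auto simp: dadjoin_def)
  then show "b = 0" using assms by simp
qed

lemma dadjoin_superset: "G \<subseteq> dadjoin G t u"
proof
  fix x assume "x \<in> G"
  then have "ppair G [:fst x:] [:snd x:]" by (intro dpair_pCons dpair_0) simp
  moreover have "x = (poly [:fst x:] t, dval t u [:fst x:] [:snd x:])"
    by (simp add: dval_def pderiv_pCons)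
  ultimately show "x \<in> dadjoin G t u" unfolding dadjoin_def by blast
qed

lemma dadjoin_member: "(t, u) \<in> dadjoin G t u"
proof -
  have "ppair G [:0, 1:] 0" using dpair_pCons[OF dg_0 dpair_pCons[OF dg_1 dpair_0]] by simp
  moreover have "(t, u) = (poly [:0, 1:] t, dval t u [:0, 1:] 0)"
    by (simp add: dval_def pderiv_pCons)
  ultimately show ?thesis unfolding dadjoin_def by blast
qed

lemma dadjoin_transcendental:
  assumes "\<And>p. pcoefs (fst ` G) p \<Longrightarrow> poly p t = 0 \<Longrightarrow> p = 0"
  shows "dgraph h (dadjoin G t u)"
proof (rule dadjoin_dgraph)
  fix p r assume pr: "ppair G p r" "poly p t = 0"
  then have "pcoefs (fst ` G) p" unfolding ppair_def pcoefs_def by (metis fst_conv image_eqI)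
  then have p: "p = 0" using assms pr(2) by blast
  have "r = 0" using pr(1) dg_0D by (intro poly_eqI) (auto simp: p ppair_def)
  then show "dval t u p r = 0" by (simp add: p dval_def)
qed

end

text \<open>The minimal polynomial \<open>p0\<close> dictates \<open>u\<close>; the equation for
  \<open>u\<close> is solvable because the derivative of \<open>p0\<close> does not vanish at
  \<open>t\<close>, by minimality and characteristic zero. All other relations reduce to
  \<open>p0\<close> by pseudo-division.\<close>

lemma dadjoin_algebraic:
  fixes h :: "'k::field \<Rightarrow> 'f::field_char_0"
  assumes h: "rhom h" and G: "dgraph h G" and p: "pcoefs (fst ` G) p" "p \<noteq> 0" "poly p t = 0"
  shows "\<exists>u. dgraph h (dadjoin G t u)"
proof -
  note A = dg_subalg[OF h G]
  define P where "P p \<longleftrightarrow> pcoefs (fst ` G) p \<and> p \<noteq> 0 \<and> poly p t = 0" for p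
  define p0 where "p0 = arg_min degree P"
  have p0: "P p0" unfolding p0_def by (rule arg_min_natI[of P p]) (use p in \<open>simp add: P_def\<close>)
  have min: "degree p0 \<le> degree q" if "P q" for q
    unfolding p0_def using that by (rule arg_min_nat_le)
  obtain r0 where r0: "ppair G p0 r0"
    using dpair_exists[OF h G, of p0] p0 by (force simp: P_def pcoefs_def)
  have d0: "degree p0 \<noteq> 0"
  proof
    assume "degree p0 = 0"
    then obtain a where "p0 = [:a:]" by (auto elim: degree_eq_zeroE)
    then show False using p0 by (auto simp: P_def)
  qed
  have "pcoefs (fst ` G) (pderiv p0)"
    unfolding pcoefs_def
  proof
    fix i
    have "coeff p0 (Suc i) \<in> fst ` G" using p0 by (auto simp: P_def pcoefs_def)
    then show "coeff (pderiv p0) i \<in> fst ` G"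
      unfolding coeff_pderiv using sa_mult[OF h A sa_of_nat[OF h A]] by blast
  qed
  moreover have "pderiv p0 \<noteq> 0" using d0 by (simp add: pderiv_eq_0_iff)
  moreover have "degree (pderiv p0) < degree p0" using d0 by (simp add: degree_pderiv)
  ultimately have nz: "poly (pderiv p0) t \<noteq> 0" using min[of "pderiv p0"] by (auto simp: P_def)
  define u where "u = - poly r0 t / poly (pderiv p0) t"
  have u0: "dval t u p0 r0 = 0" using nz by (simp add: dval_def u_def)
  have "dval t u p r = 0" if "ppair G p r" "poly p t = 0" for p r
    using that
  proof (induction "degree p" arbitrary: p r rule: less_induct)
    case less
    have pc: "pcoefs (fst ` G) p" using less.prems unfolding ppair_def pcoefs_def by (metis fst_conv image_eqI)
    show ?case
    proof (cases "degree p < degree p0")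
      case True
      then have p: "p = 0" using min[of p] less.prems pc by (auto simp: P_def)
      have "r = 0" using less.prems dg_0D[OF h G] by (intro poly_eqI) (auto simp: p ppair_def)
      then show ?thesis by (simp add: p dval_def)
    next
      case False
      let ?c = "lead_coeff p0" and ?k = "degree p - degree p0"
      have c: "(?c, coeff r0 (degree p0)) \<in> G" and a: "(lead_coeff p, coeff r (degree p)) \<in> G"
        using r0 less.prems by (auto simp: ppair_def)
      let ?m = "monom (lead_coeff p) ?k" and ?m' = "monom (coeff r (degree p)) ?k"
      define p' where "p' = [:?c:] * p - ?m * p0"
      define r' where "r' = ([:?c:] * r + p * [:coeff r0 (degree p0):]) - (?m * r0 + p0 * ?m')"
      have pp: "ppair G p' r'"
        unfolding p'_def r'_def using c a r0 less.prems
        by (intro dpair_diff[OF h G] dpair_mult[OF h G] dpair_pCons[OF h G] dpair_0[OF h G] dpair_monom[OF h G])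
      have "p' = smult ?c p - ?m * p0" by (simp add: p'_def)
      then have deg: "p' = 0 \<or> degree p' < degree p"
        using pseudo_reduce[of p0 p] False p0 by (simp add: P_def)
      \<comment> \<open>Of the four Leibniz terms three vanish: \<open>p\<close> and
        \<open>p0\<close> vanish at \<open>t\<close>, and \<open>u\<close> was chosen to make
        \<open>dval t u p0 r0\<close> zero.\<close>
      have "dval t u p' r' = ?c * dval t u p r"
        unfolding p'_def r'_def dval_diff dval_mult using less.prems(2) p0 u0 by (simp add: P_def)
      moreover have "dval t u p' r' = 0"
      proof (cases "p' = 0")
        case True
        have "r' = 0" using pp dg_0D[OF h G] by (intro poly_eqI) (auto simp: True ppair_def)
        then show ?thesis by (simp add: True dval_def)
      next
        case F: False
        have "poly p' t = 0" using less.prems(2) p0 by (simp add: p'_def P_def)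
        then show ?thesis using less.hyps[of p' r'] F deg pp by blast
      qed
      ultimately show ?thesis using p0 by (simp add: P_def)
    qed
  qed
  then show ?thesis using dadjoin_dgraph[OF h G] by blast
qed

text \<open>A maximal partial derivation is total, since any element could be adjoined: freely if it
  is transcendental over the domain, by its minimal polynomial otherwise.\<close>

theorem derivation_exists:
  fixes h :: "'k::field \<Rightarrow> 'f::field_char_0"
  assumes h: "rhom h" and G0: "dgraph h G0"
  shows "\<exists>D. derivation D \<and> (\<forall>c. D (h c) = 0) \<and> (\<forall>a b. (a, b) \<in> G0 \<longrightarrow> D a = b)"
proof -
  define fam where "fam = {G. G0 \<subseteq> G \<and> dgraph h G}"
  have "\<exists>M\<in>fam. \<forall>X\<in>fam. M \<subseteq> X \<longrightarrow> X = M"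
  proof (rule subset_Zorn_nonempty)
    show "fam \<noteq> {}" using G0 by (auto simp: fam_def)
  next
    fix \<C> assume ne: "\<C> \<noteq> {}" and ch: "subset.chain fam \<C>"
    then have sub: "\<And>C. C \<in> \<C> \<Longrightarrow> G0 \<subseteq> C \<and> dgraph h C"
      by (auto simp: subset_chain_def fam_def)
    note two = chain_two[OF ch]
    have "dgraph h (\<Union>\<C>)"
      unfolding dgraph_def
    proof (intro conjI allI impI)
      show "(h c, 0) \<in> \<Union>\<C>" for c using ne sub dg_const[OF h] by blast
      fix a b a' b' assume "(a, b) \<in> \<Union>\<C>" "(a', b') \<in> \<Union>\<C>"
      then obtain C where C: "C \<in> \<C>" "(a, b) \<in> C" "(a', b') \<in> C" using two by blast
      then have "dgraph h C" using sub by blast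
      then show "(a + a', b + b') \<in> \<Union>\<C>" "(a * a', a * b' + a' * b) \<in> \<Union>\<C>"
        using C dg_add[OF h] dg_mult[OF h] by blast+
    next
      show "b = 0" if "(0, b) \<in> \<Union>\<C>" for b using that sub dg_0D[OF h] by blast
    qed
    then show "\<Union>\<C> \<in> fam" using ne sub by (auto simp: fam_def)
  qed
  then obtain G where G: "G0 \<subseteq> G" "dgraph h G"
    and max: "\<And>X. G0 \<subseteq> X \<Longrightarrow> dgraph h X \<Longrightarrow> G \<subseteq> X \<Longrightarrow> X = G"
    by (auto simp: fam_def)
  have dom: "\<exists>b. (t, b) \<in> G" for t
  proof -
    have "\<exists>u. dgraph h (dadjoin G t u)"
    proof (cases "\<exists>p. pcoefs (fst ` G) p \<and> p \<noteq> 0 \<and> poly p t = 0")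
      case True
      then show ?thesis using dadjoin_algebraic[OF h G(2)] by blast
    next
      case False
      then show ?thesis using dadjoin_transcendental[OF h G(2)] by blast
    qed
    then obtain u where "dgraph h (dadjoin G t u)" ..
    then have "dadjoin G t u = G"
      using dadjoin_superset[OF h G(2), of t u] G(1) by (intro max) auto
    then show ?thesis using dadjoin_member[OF h G(2), of t u] by auto
  qed
  then obtain D where D: "\<And>t. (t, D t) \<in> G" by metis
  have eq: "D a = b" if "(a, b) \<in> G" for a b using dg_unique[OF h G(2) D that] .
  have "derivation D"
    unfolding derivation_def using dg_add[OF h G(2) D D] dg_mult[OF h G(2) D D] eq by simp
  then show ?thesis using eq dg_const[OF h G(2)] G(1) by blast
qed

no_notation fps_nth (infixl \<open>$\<close> 75)

section \<open>Linear algebra\<close>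

definition dot :: "'f::comm_ring_1 ^ 'n::finite \<Rightarrow> 'f ^ 'n \<Rightarrow> 'f" where
  "dot u v = (\<Sum>i\<in>UNIV. u $ i * v $ i)"

definition ann :: "('f::field ^ 'n::finite) set \<Rightarrow> ('f ^ 'n) set" where
  "ann R = {v. \<forall>r\<in>R. dot r v = 0}"

lemma dot_add_right: "dot u (v + w) = dot u v + dot u w"
  and dot_add_left: "dot (v + w) u = dot v u + dot w u"
  and dot_scale_right: "dot u (c *s v) = c * dot u v"
  and dot_scale_left: "dot (c *s u) v = c * dot u v"
  and dot_0_right [simp]: "dot u 0 = 0"
  and dot_0_left [simp]: "dot 0 u = 0"
  and dot_commute: "dot u v = dot v u"
  by (simp_all add: dot_def sum.distrib distrib_left distrib_right sum_distrib_left mult_ac)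

lemma dot_sum_left: "dot (\<Sum>i\<in>A. f i) v = (\<Sum>i\<in>A. dot (f i) v)"
  by (induction A rule: infinite_finite_induct) (simp_all add: dot_add_left)

lemma dot_axis: "dot (axis k 1) v = v $ k"
proof -
  have "dot (axis k 1) v = (\<Sum>i\<in>UNIV. if i = k then v $ i else 0)"
    unfolding dot_def by (intro sum.cong) (auto simp: axis_def)
  then show ?thesis by (simp add: sum.delta)
qed

lemma matrix_dot: "(M *v v) $ i = dot (M $ i) v"
  by (simp add: matrix_vector_mult_def dot_def)

lemma subspace_ann: "vec.subspace (ann R)"
  by (auto simp: vec.subspace_def ann_def dot_add_right dot_scale_right)

lemma ann_span: "ann (vec.span R) = ann R"
proof -
  have "dot r v = 0" if "r \<in> vec.span R" "v \<in> ann R" for r v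
    using that(1)
  proof (induction rule: vec.span_induct_alt)
    case base
    show ?case by simp
  next
    case (step c x y)
    then show ?case using that(2) by (simp add: dot_add_left dot_scale_left ann_def)
  qed
  then show ?thesis using vec.span_superset[of R] by (auto simp: ann_def)
qed

lemma card_add_card_Compl: "card B + card (- B) = CARD('n)" for B :: "'n::finite set"
  using card_Un_disjoint[of B "- B"] by (simp add: Un_commute)

lemma nonsingular_solve:
  fixes M :: "'f::field ^ 'n ^ 'n"
  assumes "det M \<noteq> 0"
  shows "\<exists>v. M *v v = (y :: 'f ^ 'n)"
proof -
  obtain N where "M ** N = mat 1" using assms invertible_det_nz[of M] by (auto simp: invertible_def)
  then have "M *v (N *v y) = y" by (simp add: matrix_vector_mul_assoc matrix_vector_mul_lid)
  then show ?thesis ..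
qed

lemma nonsingular_inj:
  fixes M :: "'f::field ^ 'n ^ 'n"
  assumes "det M \<noteq> 0" "M *v v = M *v w"
  shows "v = w"
proof -
  obtain N where "N ** M = mat 1" using assms(1) invertible_det_nz[of M] by (auto simp: invertible_def)
  then have "N *v (M *v u) = u" for u by (simp add: matrix_vector_mul_assoc matrix_vector_mul_lid)
  then show ?thesis using assms(2) by metis
qed

lemma ann_rows_dim:
  fixes M :: "'f::field ^ 'n ^ 'n"
  assumes M: "det M \<noteq> 0"
  shows "vec.dim (ann ((\<lambda>i. M $ i) ` B)) + card B = CARD('n)"
proof -
  let ?T = "ann ((\<lambda>i. M $ i) ` B)"
  have "(*v) M ` ?T = {x. \<forall>i. i \<notin> - B \<longrightarrow> x $ i = 0}"
  proof (intro equalityI subsetI)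
    fix y :: "'f ^ 'n" assume y: "y \<in> {x. \<forall>i. i \<notin> - B \<longrightarrow> x $ i = 0}"
    obtain v where v: "M *v v = y" using nonsingular_solve[OF M] by blast
    then have "v \<in> ?T" using y by (auto simp: ann_def matrix_dot[symmetric])
    then show "y \<in> (*v) M ` ?T" using v by blast
  qed (auto simp: ann_def matrix_dot)
  moreover have "vec.dim ((*v) M ` ?T) = vec.dim ?T"
    by (rule vec.dim_image_eq) (auto intro!: inj_onI nonsingular_inj[OF M])
  ultimately have "vec.dim ?T = card (- B)" using dim_substandard_cart[where 'a = 'f and d = "- B"] by simp
  then show ?thesis using card_add_card_Compl[of B] by simp
qed

text \<open>A basis of the span of \<open>R\<close> is completed by vectors from \<open>E\<close>.
  Packing both into one invertible matrix lets a single determinant certify the rank of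
  \<open>R\<close>.\<close>

lemma row_completion:
  fixes R E :: "('f::field ^ 'n::finite) set"
  assumes E: "vec.span E = UNIV"
  shows "\<exists>M :: 'f ^ 'n ^ 'n. \<exists>B. det M \<noteq> 0 \<and> (\<forall>i\<in>B. M $ i \<in> R) \<and> (\<forall>i. i \<notin> B \<longrightarrow> M $ i \<in> E)
    \<and> ann ((\<lambda>i. M $ i) ` B) = ann R"
proof -
  obtain Bs where Bs: "Bs \<subseteq> R" "vec.independent Bs" "R \<subseteq> vec.span Bs"
    by (rule vec.maximal_independent_subset)
  obtain C where C: "Bs \<subseteq> C" "C \<subseteq> Bs \<union> E" "vec.independent C" "Bs \<union> E \<subseteq> vec.span C"
    using vec.maximal_independent_subset_extend[of Bs "Bs \<union> E"] Bs by blast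
  have spanC: "vec.span C = UNIV"
    using C(4) E vec.span_mono[of E "vec.span C"] by (auto simp: vec.span_span)
  have finC: "finite C" using C(3) vec.finiteI_independent by blast
  have "card C = CARD('n)"
    using vec.dim_eq_card_independent[OF C(3)] vec.dim_span[of C] spanC vec_dim_card by metis
  then obtain f :: "'n \<Rightarrow> _" where f: "bij_betw f UNIV C"
    using finite_same_card_bij[of "UNIV :: 'n set" C] finC by auto
  define M where "M = (\<chi> i. f i)"
  have "rows M = C"
  proof -
    have "row i M = f i" for i by (simp add: row_def M_def vec_eq_iff)
    then have "rows M = range f" by (auto simp: rows_def)
    then show ?thesis using f by (simp add: bij_betw_def)
  qed
  then have M: "det M \<noteq> 0"
    using matrix_left_invertible_span_rows_gen[of M] spanC
    by (simp add: invertible_det_nz[symmetric] invertible_left_inverse)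
  define B where "B = f -` Bs"
  have im: "(\<lambda>i. M $ i) ` B = Bs"
    using f C(1) by (auto simp: M_def B_def bij_betw_def)
  have "vec.span Bs = vec.span R"
    using Bs(1,3) vec.span_mono[of Bs R] vec.span_mono[of R "vec.span Bs"] by (auto simp: vec.span_span)
  then have "ann Bs = ann R" using ann_span by metis
  moreover have "M $ i \<in> E" if "i \<notin> B" for i
  proof -
    have "f i \<in> C" using f by (auto simp: bij_betw_def)
    then show ?thesis using that C(2) by (auto simp: M_def B_def)
  qed
  ultimately show ?thesis using M im Bs(1) by (intro exI[of _ M] exI[of _ B]) auto
qed

text \<open>Expand \<open>u\<close> in the rows. The vector dual to a row outside \<open>B\<close>
  lies in the annihilator of the rows in \<open>B\<close>, and pairing with it isolates the
  coefficient at that row.\<close>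

lemma double_ann:
  fixes M :: "'f::field ^ 'n ^ 'n"
  assumes M: "det M \<noteq> 0" and u: "\<And>v. v \<in> ann ((\<lambda>i. M $ i) ` B) \<Longrightarrow> dot u v = 0"
  shows "\<exists>l. u = (\<Sum>i\<in>B. l i *s M $ i)"
proof -
  obtain y where "transpose M *v y = u"
    using nonsingular_solve[of "transpose M"] M by (auto simp: det_transpose)
  then have u_eq: "u = (\<Sum>i\<in>UNIV. y $ i *s M $ i)"
    by (auto simp: vec_eq_iff matrix_vector_mult_def transpose_def mult.commute)
  have "y $ j = 0" if "j \<notin> B" for j
  proof -
    obtain v where v: "M *v v = axis j 1" using nonsingular_solve[OF M] by blast
    then have Mv: "dot (M $ i) v = (if i = j then 1 else 0)" for i
      by (simp add: matrix_dot[symmetric] axis_def)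
    then have "v \<in> ann ((\<lambda>i. M $ i) ` B)" using that by (auto simp: ann_def)
    then have "0 = dot u v" using u by simp
    also have "\<dots> = (\<Sum>i\<in>UNIV. if i = j then y $ i else 0)"
      unfolding u_eq dot_sum_left dot_scale_left Mv by (intro sum.cong) auto
    finally show ?thesis by (simp add: sum.delta)
  qed
  then have "u = (\<Sum>i\<in>B. y $ i *s M $ i)"
    unfolding u_eq by (intro sum.mono_neutral_right) auto
  then show ?thesis by blast
qed

lemma span_axis: "vec.span (range (\<lambda>k. axis k (1::'f::field)) :: ('f ^ 'n) set) = UNIV"
proof -
  have "range (\<lambda>k. axis k (1::'f)) = (cart_basis :: ('f ^ 'n) set)"
    by (auto simp: cart_basis_def)
  then show ?thesis using vec.span_Basis by simp
qed

text \<open>Complete \<open>R\<close> by unit vectors; the positions of these unit vectors are the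
  free coordinates of the solution space.\<close>

lemma ann_coordinates:
  fixes R :: "('f::field ^ 'n::finite) set"
  shows "\<exists>C. card C = vec.dim (ann R) \<and> (\<forall>w. \<exists>v\<in>ann R. \<forall>j\<in>C. v $ j = w j)"
proof -
  obtain M :: "'f ^ 'n ^ 'n" and B where M: "det M \<noteq> 0"
      "\<And>i. i \<notin> B \<Longrightarrow> M $ i \<in> range (\<lambda>k. axis k 1)" "ann ((\<lambda>i. M $ i) ` B) = ann R"
    using row_completion[OF span_axis, of R] by blast
  then have "\<forall>i. \<exists>k. i \<notin> B \<longrightarrow> M $ i = axis k 1" by blast
  then obtain k where k: "\<And>i. i \<notin> B \<Longrightarrow> M $ i = axis (k i) 1" by metis
  have inj: "inj_on k (- B)"
  proof (rule inj_onI)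
    fix i j assume ij: "i \<in> - B" "j \<in> - B" "k i = k j"
    show "i = j"
    proof (rule ccontr)
      assume "i \<noteq> j"
      moreover have "row i M = row j M"
        using ij k[of i] k[of j] by (simp add: row_def)
      ultimately show False using det_identical_rows[of i j M] M(1) by simp
    qed
  qed
  show ?thesis
  proof (intro exI[of _ "k ` (- B)"] conjI allI)
    have "card (k ` (- B)) = card (- B)" by (rule card_image[OF inj])
    then show "card (k ` (- B)) = vec.dim (ann R)"
      using ann_rows_dim[OF M(1), of B] card_add_card_Compl[of B] M(3) by simp
    fix w
    obtain v where v: "M *v v = (\<chi> i. if i \<in> B then 0 else w (k i))"
      using nonsingular_solve[OF M(1)] by blast
    then have Mv: "dot (M $ i) v = (if i \<in> B then 0 else w (k i))" for i
      by (simp add: matrix_dot[symmetric])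
    have "v \<in> ann R" unfolding M(3)[symmetric] by (auto simp: ann_def Mv)
    moreover have "v $ j = w j" if j: "j \<in> k ` (- B)" for j
    proof -
      obtain i where "i \<notin> B" "j = k i" using j by blast
      then show ?thesis using Mv[of i] k[of i] by (simp add: dot_axis)
    qed
    ultimately show "\<exists>v\<in>ann R. \<forall>j\<in>k ` (- B). v $ j = w j" by blast
  qed
qed

lemma card_le_dim_projection:
  fixes T :: "('f::field ^ 'n) set"
  assumes "\<And>w. \<exists>v\<in>T. \<forall>j\<in>C. v $ j = w j"
  shows "card C \<le> vec.dim T"
proof -
  define P :: "'f ^ 'n ^ 'n" where "P = (\<chi> j. if j \<in> C then axis j 1 else 0)"
  have P: "(P *v v) $ j = (if j \<in> C then v $ j else 0)" for v j
    by (simp add: matrix_dot P_def dot_axis)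
  have "{x. \<forall>i. i \<notin> C \<longrightarrow> x $ i = 0} \<subseteq> (*v) P ` T"
  proof
    fix x :: "'f ^ 'n" assume x: "x \<in> {x. \<forall>i. i \<notin> C \<longrightarrow> x $ i = 0}"
    obtain v where "v \<in> T" "\<forall>j\<in>C. v $ j = x $ j" using assms[of "\<lambda>j. x $ j"] by blast
    then show "x \<in> (*v) P ` T" using x by (intro image_eqI[of _ _ v]) (auto simp: P vec_eq_iff)
  qed
  then have "card C \<le> vec.dim ((*v) P ` T)"
    using vec.dim_subset[of "{x. \<forall>i. i \<notin> C \<longrightarrow> x $ i = 0}" "(*v) P ` T"]
      dim_substandard_cart[where 'a = 'f and d = C] by simp
  also have "\<dots> \<le> vec.dim T" by (rule vec.dim_image_le) simp
  finally show ?thesis .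
qed

text \<open>A kernel vector with nonzero entry \<open>k\<close> would allow the coordinate
  \<open>k\<close> to be prescribed in addition to those in \<open>C\<close>, which exceeds the
  dimension.\<close>

lemma projection_injective:
  fixes T :: "('f::field ^ 'n) set"
  assumes T: "vec.subspace T" and sur: "\<And>w. \<exists>v\<in>T. \<forall>j\<in>C. v $ j = w j"
    and card: "card C = vec.dim T" and v: "v \<in> T" "\<forall>j\<in>C. v $ j = 0"
  shows "v = 0"
proof (rule ccontr)
  assume "v \<noteq> 0"
  then obtain k where k: "v $ k \<noteq> 0" by (auto simp: vec_eq_iff)
  then have kC: "k \<notin> C" using v by blast
  have "card (insert k C) \<le> vec.dim T"
  proof (rule card_le_dim_projection)
    fix w
    obtain x where x: "x \<in> T" "\<forall>j\<in>C. x $ j = w j" using sur by blast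
    let ?y = "x + ((w k - x $ k) / v $ k) *s v"
    have "?y \<in> T" using x v T by (intro vec.subspace_add vec.subspace_scale)
    moreover have "\<forall>j\<in>insert k C. ?y $ j = w j" using x v k by auto
    ultimately show "\<exists>v\<in>T. \<forall>j\<in>insert k C. v $ j = w j" by blast
  qed
  then show False using card kC by simp
qed

section \<open>Tangent vectors and specialization\<close>

definition grad :: "('k::comm_ring_1 \<Rightarrow> 'r::comm_ring_1) \<Rightarrow> ('k, 'i::finite) mpoly \<Rightarrow> ('i \<Rightarrow> 'r) \<Rightarrow> 'r ^ 'i" where
  "grad h f z = (\<chi> i. ev h (mp_pderiv i f) z)"

definition tang :: "('k::field \<Rightarrow> 'f::field) \<Rightarrow> ('k, 'i::finite) mpoly set \<Rightarrow> ('i \<Rightarrow> 'f) \<Rightarrow> ('f ^ 'i) set" where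
  "tang h I z = ann ((\<lambda>f. grad h f z) ` I)"

definition relations :: "('k::comm_ring_1 \<Rightarrow> 'r::comm_ring_1) \<Rightarrow> ('i::finite \<Rightarrow> 'r) \<Rightarrow> ('k, 'i) mpoly set" where
  "relations h z = {f. ev h f z = 0}"

lemma grad_nth [simp]: "grad h f z $ i = ev h (mp_pderiv i f) z"
  by (simp add: grad_def)

lemma subspace_tang: "vec.subspace (tang h I z)"
  by (simp add: tang_def subspace_ann)

lemma grad_add: "rhom h \<Longrightarrow> grad h (f + g) z = grad h f z + grad h g z"
  by (simp add: vec_eq_iff mp_pderiv_add ev_add)

lemma grad_mult: "rhom h \<Longrightarrow> grad h (f * g) z = ev h f z *s grad h g z + ev h g z *s grad h f z"
  by (simp add: vec_eq_iff mp_pderiv_mult ev_add ev_mult)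

lemma der_ev_grad:
  assumes "derivation D" "rhom h" "\<And>c. D (h c) = 0"
  shows "D (ev h f z) = dot (grad h f z) (\<chi> i. D (z i))"
  using der_ev[OF assms] by (simp add: dot_def)

lemma derivation_tang:
  assumes "derivation D" "rhom h" "\<And>c. D (h c) = 0"
  shows "(\<chi> i. D (z i)) \<in> tang h (relations h z) z"
proof -
  have "dot (grad h f z) (\<chi> i. D (z i)) = 0" if "ev h f z = 0" for f
    using der_ev_grad[OF assms, of f z] that der_0[OF assms(1)] by simp
  then show ?thesis by (auto simp: tang_def ann_def relations_def)
qed

text \<open>The derivative in direction \<open>v\<close> is well defined on the values
  \<open>ev h f z\<close> because \<open>v\<close> kills the gradients of all relations; it then
  extends to the field. With \<open>derivation_tang\<close> this identifies tangent vectors at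
  \<open>z\<close> with the vectors of the values \<open>D (z i)\<close>.\<close>

lemma tang_derivation:
  fixes h :: "'k::field \<Rightarrow> 'f::field_char_0"
  assumes h: "rhom h" and v: "v \<in> tang h (relations h z) z"
  shows "\<exists>D. derivation D \<and> (\<forall>c. D (h c) = 0) \<and> (\<forall>i. D (z i) = v $ i)"
proof -
  let ?G = "range (\<lambda>f. (ev h f z, dot (grad h f z) v))"
  have "dgraph h ?G"
    unfolding dgraph_def
  proof (intro conjI allI impI)
    fix c
    have "(h c, 0) = (ev h (mp_const c) z, dot (grad h (mp_const c) z) v)"
      by (simp add: ev_const[OF h] dot_def)
    then show "(h c, 0) \<in> ?G" by blast
  next
    fix a b a' b' assume "(a, b) \<in> ?G" "(a', b') \<in> ?G"
    then obtain f g where *: "a = ev h f z" "b = dot (grad h f z) v" "a' = ev h g z" "b' = dot (grad h g z) v"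
      by auto
    have "(a + a', b + b') = (ev h (f + g) z, dot (grad h (f + g) z) v)"
      by (simp add: * ev_add[OF h] grad_add[OF h] dot_add_left)
    then show "(a + a', b + b') \<in> ?G" by blast
    have "(a * a', a * b' + a' * b) = (ev h (f * g) z, dot (grad h (f * g) z) v)"
      by (simp add: * ev_mult[OF h] grad_mult[OF h] dot_add_left dot_scale_left)
    then show "(a * a', a * b' + a' * b) \<in> ?G" by blast
  next
    fix b assume "(0, b) \<in> ?G"
    then obtain f where "ev h f z = 0" "b = dot (grad h f z) v" by auto
    then show "b = 0" using v by (auto simp: tang_def ann_def relations_def)
  qed
  from derivation_exists[OF h this] obtain D where D: "derivation D" "\<And>c. D (h c) = 0"
    "\<And>f. D (ev h f z) = dot (grad h f z) v" by blast
  have "D (z i) = v $ i" for i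
  proof -
    have "grad h (mp_var i) z = axis i 1"
      by (auto simp: vec_eq_iff mp_pderiv_var axis_def ev_1[OF h])
    then show ?thesis using D(3)[of "mp_var i"] by (simp add: ev_var[OF h] dot_axis)
  qed
  then show ?thesis using D by blast
qed

section \<open>Algebraic independence of coordinates\<close>

definition vars_in :: "'i set \<Rightarrow> ('k::comm_ring_1, 'i::finite) mpoly \<Rightarrow> bool" where
  "vars_in B f \<longleftrightarrow> (\<forall>m\<in>Poly_Mapping.keys f. \<forall>i. i \<notin> B \<longrightarrow> Poly_Mapping.lookup m i = 0)"

lemma vars_in_const: "vars_in B (mp_const c)"
  by (simp add: vars_in_def mp_const_def)

lemma vars_in_add: "vars_in B f \<Longrightarrow> vars_in B g \<Longrightarrow> vars_in B (f + g)"
  using keys_add[of f g] unfolding vars_in_def by blast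

lemma vars_in_mult: "vars_in B f \<Longrightarrow> vars_in B g \<Longrightarrow> vars_in B (f * g)"
  unfolding vars_in_def
proof (intro ballI allI impI)
  fix m i assume *: "\<forall>m\<in>Poly_Mapping.keys f. \<forall>i. i \<notin> B \<longrightarrow> Poly_Mapping.lookup m i = 0"
    "\<forall>m\<in>Poly_Mapping.keys g. \<forall>i. i \<notin> B \<longrightarrow> Poly_Mapping.lookup m i = 0"
    "m \<in> Poly_Mapping.keys (f * g)" "i \<notin> B"
  then obtain a b where "m = a + b" "a \<in> Poly_Mapping.keys f" "b \<in> Poly_Mapping.keys g"
    using keys_mult[of f g] by blast
  then show "Poly_Mapping.lookup m i = 0" using * by (simp add: lookup_add)
qed

lemma vars_in_var: "i \<in> B \<Longrightarrow> vars_in B (mp_var i)"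
  by (auto simp: vars_in_def mp_var_def lookup_single when_def)

lemma vars_in_pderiv: "vars_in B f \<Longrightarrow> vars_in B (mp_pderiv i f)"
  unfolding vars_in_def
proof (intro ballI allI impI)
  fix m j assume *: "\<forall>m\<in>Poly_Mapping.keys f. \<forall>i. i \<notin> B \<longrightarrow> Poly_Mapping.lookup m i = 0"
    "m \<in> Poly_Mapping.keys (mp_pderiv i f)" "j \<notin> B"
  then have "m + Poly_Mapping.single i 1 \<in> Poly_Mapping.keys f"
    by (auto simp: in_keys_iff lookup_pderiv)
  then have "Poly_Mapping.lookup (m + Poly_Mapping.single i 1) j = 0" using * by blast
  then show "Poly_Mapping.lookup m j = 0" by (simp add: lookup_add)
qed

lemma vars_in_pderiv_0:
  fixes f :: "('k::comm_ring_1, 'i::finite) mpoly"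
  assumes "vars_in B f" "i \<notin> B"
  shows "mp_pderiv i f = 0"
proof (rule poly_mapping_eqI)
  fix m :: "'i \<Rightarrow>\<^sub>0 nat"
  have "Poly_Mapping.lookup (m + Poly_Mapping.single i 1) i \<noteq> 0" by (simp add: lookup_add)
  then have "m + Poly_Mapping.single i 1 \<notin> Poly_Mapping.keys f"
    using assms(1)[unfolded vars_in_def, rule_format, OF _ assms(2)] by metis
  then show "Poly_Mapping.lookup (mp_pderiv i f) m = Poly_Mapping.lookup 0 m"
    by (simp add: lookup_pderiv in_keys_iff)
qed

lemma mp_const_if_pderiv_0:
  fixes f :: "('k::field_char_0, 'i::finite) mpoly"
  assumes "\<And>i. mp_pderiv i f = 0"
  shows "f = mp_const (Poly_Mapping.lookup f 0)"
proof (rule poly_mapping_eqI)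
  fix m
  show "Poly_Mapping.lookup f m = Poly_Mapping.lookup (mp_const (Poly_Mapping.lookup f 0)) m"
  proof (cases "m = 0")
    case False
    then obtain i where i: "Poly_Mapping.lookup m i \<noteq> 0"
      by (metis poly_mapping_eqI lookup_zero)
    define m' where "m' = m - Poly_Mapping.single i 1"
    have m: "m' + Poly_Mapping.single i 1 = m"
      using i by (intro poly_mapping_eqI) (auto simp: m'_def lookup_add lookup_minus lookup_single when_def)
    have "of_nat (Suc (Poly_Mapping.lookup m' i)) * Poly_Mapping.lookup f m = 0"
      using lookup_pderiv[of i f m'] unfolding m assms by (simp only: lookup_zero)
    then have "Poly_Mapping.lookup f m = 0"
      by (metis mult_eq_0_iff of_nat_eq_0_iff nat.distinct(1))
    then show ?thesis using False by (simp add: mp_const_def lookup_single)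
  qed (simp add: mp_const_def)
qed

text \<open>The tangent space can move each coordinate in \<open>B\<close> alone, so every partial
  derivative of a relation in these variables is again a relation, of lower degree. By induction all
  of them vanish, and in characteristic zero the relation is a constant.\<close>

lemma coordinates_independent:
  fixes h :: "'k::field_char_0 \<Rightarrow> 'f::field" and z :: "'i::finite \<Rightarrow> 'f"
  assumes h: "rhom h" and sur: "\<And>w. \<exists>v\<in>tang h (relations h z) z. \<forall>j\<in>B. v $ j = w j"
    and f: "vars_in B f" "ev h f z = 0"
  shows "f = 0"
proof -
  let ?tdeg = "\<lambda>m. \<Sum>i\<in>UNIV. Poly_Mapping.lookup m i"
  have "\<forall>m\<in>Poly_Mapping.keys f. ?tdeg m < N \<Longrightarrow> vars_in B f \<Longrightarrow> ev h f z = 0 \<Longrightarrow> f = 0" for N f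
  proof (induction N arbitrary: f)
    case 0
    then have "Poly_Mapping.keys f = {}" by auto
    then show ?case by simp
  next
    case (Suc N)
    have "mp_pderiv i f = 0" for i
    proof (cases "i \<in> B")
      case True
      obtain v where v: "v \<in> tang h (relations h z) z" "\<forall>j\<in>B. v $ j = (if j = i then 1 else 0)"
        using sur[of "\<lambda>j. if j = i then 1 else 0"] by blast
      have "0 = dot (grad h f z) v"
        using v(1) Suc.prems(3) by (auto simp: tang_def ann_def relations_def)
      also have "\<dots> = (\<Sum>j\<in>UNIV. if j = i then ev h (mp_pderiv i f) z else 0)"
        unfolding dot_def
      proof (intro sum.cong refl)
        fix j
        show "grad h f z $ j * v $ j = (if j = i then ev h (mp_pderiv i f) z else 0)"
          using v(2) True vars_in_pderiv_0[OF Suc.prems(2), of j] by (cases "j \<in> B") auto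
      qed
      finally have e: "ev h (mp_pderiv i f) z = 0" by (simp add: sum.delta)
      show ?thesis
      proof (rule Suc.IH)
        show "\<forall>m\<in>Poly_Mapping.keys (mp_pderiv i f). ?tdeg m < N"
        proof
          fix m assume "m \<in> Poly_Mapping.keys (mp_pderiv i f)"
          then have "m + Poly_Mapping.single i 1 \<in> Poly_Mapping.keys f"
            by (auto simp: in_keys_iff lookup_pderiv)
          then have "?tdeg (m + Poly_Mapping.single i 1) < Suc N" using Suc.prems(1) by blast
          moreover have "?tdeg (Poly_Mapping.single i (1::nat)) = 1"
            by (simp add: lookup_single when_def sum.delta)
          ultimately show "?tdeg m < N" by (simp add: lookup_add sum.distrib)
        qed
      qed (use e Suc.prems in \<open>auto intro: vars_in_pderiv\<close>)
    qed (use Suc.prems in \<open>simp add: vars_in_pderiv_0\<close>)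
    then have "f = mp_const (Poly_Mapping.lookup f 0)" by (rule mp_const_if_pderiv_0)
    moreover from this have "h (Poly_Mapping.lookup f 0) = 0"
      using Suc.prems(3) ev_const[OF h] by metis
    ultimately show ?case using rhom_eq_0_iff[OF h] by (metis rhom_0[OF rhom_mp_const])
  qed
  moreover have "\<forall>m\<in>Poly_Mapping.keys f. ?tdeg m < Suc (Max (?tdeg ` Poly_Mapping.keys f))"
    by (auto simp: less_Suc_eq_le)
  ultimately show ?thesis using f by blast
qed

text \<open>The converse of \<open>coordinates_independent\<close>: without relations, values of a
  derivation may be prescribed on the coordinates in \<open>B\<close>. Together they make the
  dimension of the tangent space behave like a transcendence degree.\<close>

lemma independent_coordinates:
  fixes h :: "'k::field \<Rightarrow> 'f::field_char_0"
  assumes h: "rhom h" and ind: "\<And>f. vars_in B f \<Longrightarrow> ev h f z = 0 \<Longrightarrow> f = 0"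
  shows "\<exists>D. derivation D \<and> (\<forall>c. D (h c) = 0) \<and> (\<forall>j\<in>B. D (z j) = w j)"
proof -
  let ?v = "\<chi> j. if j \<in> B then w j else 0"
  let ?G = "{(ev h f z, dot (grad h f z) ?v) | f. vars_in B f}"
  have "dgraph h ?G"
    unfolding dgraph_def
  proof (intro conjI allI impI)
    fix c
    have "(h c, 0) = (ev h (mp_const c) z, dot (grad h (mp_const c) z) ?v)"
      by (simp add: ev_const[OF h] dot_def)
    then show "(h c, 0) \<in> ?G" using vars_in_const by blast
  next
    fix a b a' b' assume "(a, b) \<in> ?G" "(a', b') \<in> ?G"
    then obtain f g where *: "a = ev h f z" "b = dot (grad h f z) ?v" "a' = ev h g z" "b' = dot (grad h g z) ?v"
      and v: "vars_in B f" "vars_in B g"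
      by auto
    have "(a + a', b + b') = (ev h (f + g) z, dot (grad h (f + g) z) ?v)"
      by (simp add: * ev_add[OF h] grad_add[OF h] dot_add_left)
    then show "(a + a', b + b') \<in> ?G" using vars_in_add[OF v] by blast
    have "(a * a', a * b' + a' * b) = (ev h (f * g) z, dot (grad h (f * g) z) ?v)"
      by (simp add: * ev_mult[OF h] grad_mult[OF h] dot_add_left dot_scale_left)
    then show "(a * a', a * b' + a' * b) \<in> ?G" using vars_in_mult[OF v] by blast
  next
    fix b assume "(0, b) \<in> ?G"
    then obtain f where f: "ev h f z = 0" "b = dot (grad h f z) ?v" "vars_in B f" by auto
    then have "f = 0" using ind by blast
    then show "b = 0" using f(2) by (simp add: dot_def)
  qed
  from derivation_exists[OF h this] obtain D where D: "derivation D" "\<And>c. D (h c) = 0"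
    "\<And>f. vars_in B f \<Longrightarrow> D (ev h f z) = dot (grad h f z) ?v" by blast
  have "D (z i) = w i" if "i \<in> B" for i
  proof -
    have "grad h (mp_var i) z = axis i 1"
      by (auto simp: vec_eq_iff mp_pderiv_var axis_def ev_1[OF h])
    then show ?thesis using D(3)[OF vars_in_var[OF that]] that by (simp add: ev_var[OF h] dot_axis)
  qed
  then show ?thesis using D by blast
qed

text \<open>If the dimension does not drop under specialization, then the independent coordinates of
  \<open>y\<close> generate an algebra over which every \<open>f(z)\<close> is algebraic; the constant term of its equation
  survives the specialization.\<close>

theorem specialization_dim:
  fixes h :: "'k::field_char_0 \<Rightarrow> 'f::field_char_0" and y z :: "'i::finite \<Rightarrow> 'f"
  assumes h: "rhom h" and sub: "relations h z \<subseteq> relations h y"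
  defines "d \<equiv> \<lambda>z. vec.dim (tang h (relations h z) z)"
  shows "d y \<le> d z" and "d y = d z \<Longrightarrow> relations h y \<subseteq> relations h z"
proof -
  obtain C where C: "card C = d y" "\<And>w. \<exists>v\<in>tang h (relations h y) y. \<forall>j\<in>C. v $ j = w j"
    unfolding d_def tang_def using ann_coordinates by blast
  have ind_y: "f = 0" if "vars_in C f" "ev h f y = 0" for f
    by (rule coordinates_independent[OF h C(2)]) (use that in auto)
  have ind_z: "f = 0" if "vars_in C f" "ev h f z = 0" for f
    using ind_y that sub by (auto simp: relations_def)
  have sur: "\<exists>v\<in>tang h (relations h z) z. \<forall>j\<in>C. v $ j = w j" for w
  proof -
    obtain D where "derivation D" "\<And>c. D (h c) = 0" "\<forall>j\<in>C. D (z j) = w j"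
      using independent_coordinates[where B = C and h = h and z = z, OF h ind_z] by blast
    then show ?thesis
      by (intro bexI[OF _ derivation_tang[of D, OF _ h]]) auto
  qed
  show "d y \<le> d z" unfolding C(1)[symmetric] unfolding d_def by (rule card_le_dim_projection[OF sur])
  assume eq: "d y = d z"
  show "relations h y \<subseteq> relations h z"
  proof (rule subsetI, rule ccontr)
    fix f assume f: "f \<in> relations h y" "f \<notin> relations h z"
    define t where "t = ev h f z"
    have t: "t \<noteq> 0" using f(2) by (simp add: t_def relations_def)
    define G where "G = {(ev h g z, 0::'f) | g. vars_in C g}"
    have G: "dgraph h G"
      unfolding dgraph_def
    proof (intro conjI allI impI)
      fix c
      show "(h c, 0) \<in> G" unfolding G_def using vars_in_const[of C c] ev_const[OF h, of c z] by force
    next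
      fix a b a' b' assume "(a, b) \<in> G" "(a', b') \<in> G"
      then obtain g g' where g: "a = ev h g z" "b = 0" "vars_in C g" "a' = ev h g' z" "b' = 0" "vars_in C g'"
        by (auto simp: G_def)
      then have "a + a' = ev h (g + g') z" "a * a' = ev h (g * g') z" by (simp_all add: ev_add[OF h] ev_mult[OF h])
      then show "(a + a', b + b') \<in> G" "(a * a', a * b' + a' * b) \<in> G"
        unfolding G_def using g vars_in_add[OF g(3,6)] vars_in_mult[OF g(3,6)] by auto
    qed (auto simp: G_def)
    \<comment> \<open>If \<open>t\<close> were transcendental over the polynomials in the
      coordinates of \<open>C\<close>, some derivation would kill these but not \<open>t\<close>.
      But a tangent vector at \<open>z\<close> is determined by its entries in \<open>C\<close>, so
      that derivation kills all \<open>z j\<close> and hence \<open>t\<close>.\<close>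
    have "\<exists>p. pcoefs (fst ` G) p \<and> p \<noteq> 0 \<and> poly p t = 0"
    proof (rule ccontr)
      assume "\<not> ?thesis"
      then have "dgraph h (dadjoin G t 1)" by (intro dadjoin_transcendental[OF h G]) blast
      from derivation_exists[OF h this] obtain D where D: "derivation D" "\<And>c. D (h c) = 0"
        "\<And>a b. (a, b) \<in> dadjoin G t 1 \<Longrightarrow> D a = b" by blast
      have "D (z j) = 0" if "j \<in> C" for j
      proof -
        have "(z j, 0) \<in> G"
          unfolding G_def using vars_in_var[OF that] ev_var[OF h, of j z] by force
        then show ?thesis using D(3) dadjoin_superset[OF h G] by blast
      qed
      then have "(\<chi> i. D (z i)) = 0"
        using eq C(1) unfolding d_def
        by (intro projection_injective[OF subspace_tang sur _ derivation_tang[OF D(1) h D(2)]]) auto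
      then have "D t = 0" unfolding t_def der_ev_grad[OF D(1) h D(2)] by simp
      then show False using D(3)[OF dadjoin_member[OF h G]] by simp
    qed
    then obtain p1 where p1: "pcoefs (fst ` G) p1 \<and> p1 \<noteq> 0 \<and> poly p1 t = 0" by blast
    define p where "p = arg_min degree (\<lambda>p. pcoefs (fst ` G) p \<and> p \<noteq> 0 \<and> poly p t = 0)"
    have p: "pcoefs (fst ` G) p" "p \<noteq> 0" "poly p t = 0"
      unfolding p_def using arg_min_natI[of "\<lambda>p. pcoefs (fst ` G) p \<and> p \<noteq> 0 \<and> poly p t = 0" p1 degree] p1 by auto
    have p_min: "degree p \<le> degree q" if "pcoefs (fst ` G) q" "q \<noteq> 0" "poly q t = 0" for q
      unfolding p_def by (rule arg_min_nat_le) (use that in auto)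
    \<comment> \<open>Otherwise the relation could be divided by \<open>t\<close>, against
      minimality.\<close>
    have c0: "coeff p 0 \<noteq> 0"
    proof
      assume 0: "coeff p 0 = 0"
      obtain q a where pq: "p = pCons a q" by (cases p)
      have "pcoefs (fst ` G) q" "q \<noteq> 0" "poly q t = 0" "a = 0"
        using p 0 t unfolding pq pcoefs_def by (auto simp: coeff_pCons split: nat.splits dest: spec[of _ "Suc _"])
      then show False using p_min[of q] pq by simp
    qed
    have "\<forall>i. \<exists>g. vars_in C g \<and> coeff p i = ev h g z"
      using p(1) by (force simp: pcoefs_def G_def)
    then obtain g where g: "\<And>i. vars_in C (g i)" "\<And>i. coeff p i = ev h (g i) z" by metis
    have ev_sum': "ev h (\<Sum>i\<le>degree p. g i * f ^ i) x = (\<Sum>i\<le>degree p. ev h (g i) x * ev h f x ^ i)" for x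
      by (simp add: ev_sum[OF h] ev_mult[OF h] ev_power[OF h])
    have "ev h (\<Sum>i\<le>degree p. g i * f ^ i) z = 0"
      unfolding ev_sum' using p(3) by (simp add: poly_altdef g(2) t_def)
    then have "ev h (\<Sum>i\<le>degree p. g i * f ^ i) y = 0" using sub by (auto simp: relations_def)
    moreover have "ev h f y = 0" using f(1) by (simp add: relations_def)
    ultimately have "(\<Sum>i\<le>degree p. if i = 0 then ev h (g 0) y else 0) = 0"
      unfolding ev_sum' by (simp add: power_0_left if_distrib cong: if_cong sum.cong)
    then have "ev h (g 0) y = 0" by (simp add: sum.delta)
    then have "g 0 = 0" using ind_y g(1) by blast
    then show False using c0 g(2)[of 0] by simp
  qed
qed

section \<open>Homogeneous components and closures\<close>

definition hcomp :: "'i set \<Rightarrow> nat \<Rightarrow> ('k::comm_ring_1, 'i::finite) mpoly \<Rightarrow> ('k, 'i) mpoly" where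
  "hcomp A d f = (\<Sum>m\<in>{m\<in>Poly_Mapping.keys f. (\<Sum>i\<in>A. Poly_Mapping.lookup m i) = d}.
    Poly_Mapping.single m (Poly_Mapping.lookup f m))"

lemma lookup_hcomp:
  "Poly_Mapping.lookup (hcomp A d f) m =
    (if (\<Sum>i\<in>A. Poly_Mapping.lookup m i) = d then Poly_Mapping.lookup f m else 0)"
  by (auto simp: hcomp_def lookup_sum lookup_single when_def sum.delta in_keys_iff)

lemma hcomp_homogeneous: "homogeneous_in A d (hcomp A d f)"
  by (auto simp: homogeneous_in_def in_keys_iff lookup_hcomp split: if_splits)

lemma hcomp_homogeneous': "homogeneous_in B e f \<Longrightarrow> homogeneous_in B e (hcomp A d f)"
  by (auto simp: homogeneous_in_def in_keys_iff lookup_hcomp split: if_splits)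

lemma sum_hcomp: "\<exists>D. f = (\<Sum>d\<le>D. hcomp A d f)"
proof -
  let ?deg = "\<lambda>m. \<Sum>i\<in>A. Poly_Mapping.lookup m i"
  let ?D = "Max (?deg ` Poly_Mapping.keys f)"
  have "f = (\<Sum>d\<le>?D. hcomp A d f)"
  proof (rule poly_mapping_eqI)
    fix m
    have "?deg m \<le> ?D" if "m \<in> Poly_Mapping.keys f" using that by auto
    then have "Poly_Mapping.lookup f m = 0 \<or> ?deg m \<le> ?D" unfolding in_keys_iff by blast
    then show "Poly_Mapping.lookup f m = Poly_Mapping.lookup (\<Sum>d\<le>?D. hcomp A d f) m"
      by (simp add: lookup_sum lookup_hcomp sum.delta del: Max_ge_iff) blast
  qed
  then show ?thesis by blast
qed

text \<open>Scaling only the variables in \<open>A\<close> covers the projective case and each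
  factor of the biprojective one.\<close>

definition scale :: "'i set \<Rightarrow> 'r \<Rightarrow> ('i \<Rightarrow> 'r) \<Rightarrow> 'i \<Rightarrow> 'r::comm_ring_1" where
  "scale A c z = (\<lambda>i. if i \<in> A then c * z i else z i)"

lemma ev_scale:
  assumes h: "rhom h" and f: "homogeneous_in A d f"
  shows "ev h f (scale A c z) = c ^ d * ev h f z"
proof -
  have "mon_eval (scale A c z) m = c ^ d * mon_eval z m" if "m \<in> Poly_Mapping.keys f" for m
  proof -
    have "mon_eval (scale A c z) m
        = (\<Prod>i\<in>UNIV. (if i \<in> A then c ^ Poly_Mapping.lookup m i else 1) * z i ^ Poly_Mapping.lookup m i)"
      unfolding mon_eval_def scale_def by (intro prod.cong) (auto simp: power_mult_distrib)
    also have "\<dots> = (\<Prod>i\<in>A. c ^ Poly_Mapping.lookup m i) * mon_eval z m"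
      by (simp add: prod.distrib mon_eval_def prod.If_cases)
    also have "(\<Prod>i\<in>A. c ^ Poly_Mapping.lookup m i) = c ^ d"
      using f that by (simp add: homogeneous_in_def power_sum[symmetric])
    finally show ?thesis .
  qed
  then show ?thesis by (simp add: ev_def sum_distrib_left mult_ac)
qed

text \<open>As a function of \<open>c\<close> the value at the scaled point is a polynomial whose
  coefficients are the values of the homogeneous components; \<open>c\<close> is chosen off the
  roots of those that are not identically zero.\<close>

lemma scaling_avoids:
  fixes z :: "'i::finite \<Rightarrow> 'k::field_char_0"
  assumes G: "finite G"
  shows "\<exists>c. c \<noteq> 0 \<and> (\<forall>g\<in>G. mp_eval g (scale A c z) = 0 \<longrightarrow> (\<forall>d. mp_eval (hcomp A d g) z = 0))"
proof -
  have "\<exists>p. \<forall>c. poly p c = mp_eval g (scale A c z) \<and> (p = 0 \<longrightarrow> (\<forall>d. mp_eval (hcomp A d g) z = 0))" for g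
  proof -
    obtain D where D: "g = (\<Sum>d\<le>D. hcomp A d g)" using sum_hcomp by blast
    define p where "p = (\<Sum>d\<le>D. monom (mp_eval (hcomp A d g) z) d)"
    have "poly p c = mp_eval g (scale A c z)" for c
    proof -
      have "mp_eval g (scale A c z) = (\<Sum>d\<le>D. mp_eval (hcomp A d g) (scale A c z))"
        by (subst D) (simp add: mp_eval_sum)
      also have "\<dots> = poly p c"
        unfolding p_def poly_sum
        by (intro sum.cong refl)
          (simp add: mp_eval_ev ev_scale[OF rhom_id hcomp_homogeneous] poly_monom mult.commute)
      finally show ?thesis ..
    qed
    moreover have "mp_eval (hcomp A d g) z = 0" if "p = 0" for d
    proof (cases "d \<le> D")
      case True
      have "coeff p d = mp_eval (hcomp A d g) z"
        using True by (simp add: p_def coeff_sum sum.delta)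
      then show ?thesis using that by simp
    next
      case False
      have "hcomp A d g = 0"
      proof (rule poly_mapping_eqI)
        fix m
        show "Poly_Mapping.lookup (hcomp A d g) m = Poly_Mapping.lookup 0 m"
          using arg_cong[OF D, of "\<lambda>f. Poly_Mapping.lookup f m"] False
          by (auto simp: lookup_hcomp lookup_sum sum.delta split: if_splits)
      qed
      then show ?thesis by simp
    qed
    ultimately show ?thesis by blast
  qed
  then obtain p where p: "\<And>g c. poly (p g) c = mp_eval g (scale A c z)"
    "\<And>g d. p g = 0 \<Longrightarrow> mp_eval (hcomp A d g) z = 0" by metis
  have "finite (insert 0 (\<Union>g\<in>{g\<in>G. p g \<noteq> 0}. {c. poly (p g) c = 0}))"
    using G by (auto intro: poly_roots_finite)
  from ex_new_if_finite[OF infinite_UNIV_char_0 this]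
  obtain c where c: "c \<notin> insert 0 (\<Union>g\<in>{g\<in>G. p g \<noteq> 0}. {c. poly (p g) c = 0})" ..
  show ?thesis
  proof (intro exI[of _ c] conjI ballI impI allI)
    show "c \<noteq> 0" using c by blast
    fix g d assume g: "g \<in> G" "mp_eval g (scale A c z) = 0"
    then have "p g = 0" using c by (auto simp: p)
    then show "mp_eval (hcomp A d g) z = 0" by (rule p(2))
  qed
qed

lemma hcomp_vanishes:
  fixes z :: "'i::finite \<Rightarrow> 'k::field_char_0"
  assumes "\<And>c. c \<noteq> 0 \<Longrightarrow> mp_eval g (scale A c z) = 0"
  shows "mp_eval (hcomp A d g) z = 0"
  using scaling_avoids[of "{g}" A z] assms by blast

section \<open>Projective points, cones and vanishing ideals\<close>

definition pt :: "'k::field ^ 'n::finite \<Rightarrow> ('k, 'n) proj_space" where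
  "pt v = Abs_proj_space (vec.span {v})"

lemma in_hcoords_iff: "v \<in> hcoords x \<longleftrightarrow> v \<noteq> 0 \<and> pt v = x"
proof -
  have Rep_pt: "Rep_proj_space (pt v) = vec.span {v}" if "v \<noteq> 0"
    unfolding pt_def by (rule Abs_proj_space_inverse) (use that in auto)
  show ?thesis
  proof
    assume v: "v \<in> hcoords x"
    then have v0: "v \<noteq> 0" by (simp add: hcoords_def)
    obtain w where w: "Rep_proj_space x = vec.span {w}" "w \<noteq> 0" using Rep_proj_space[of x] by auto
    then have "v \<in> vec.span {w}" using v by (simp add: hcoords_def)
    then obtain c where c: "v = c *s w" by (auto simp: vec.span_singleton)
    with v0 have "c \<noteq> 0" by auto
    have "vec.span {v} = vec.span {w}"
    proof (intro equalityI subsetI)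
      fix u assume "u \<in> vec.span {v}"
      then show "u \<in> vec.span {w}" by (auto simp: vec.span_singleton c)
    next
      fix u assume "u \<in> vec.span {w}"
      then obtain d where "u = d *s w" by (auto simp: vec.span_singleton)
      then have "u = (d / c) *s v" using \<open>c \<noteq> 0\<close> by (simp add: c)
      then show "u \<in> vec.span {v}" by (auto simp: vec.span_singleton)
    qed
    then show "v \<noteq> 0 \<and> pt v = x" using v0 w Rep_pt[OF v0] Rep_proj_space_inject by metis
  next
    assume "v \<noteq> 0 \<and> pt v = x"
    then show "v \<in> hcoords x" using Rep_pt vec.span_base[of v "{v}"] by (auto simp: hcoords_def)
  qed
qed

lemma hcoords_pt: "v \<noteq> 0 \<Longrightarrow> v \<in> hcoords (pt v)"
  by (simp add: in_hcoords_iff)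

lemma hcoords_scale: "v \<in> hcoords x \<Longrightarrow> c \<noteq> 0 \<Longrightarrow> c *s v \<in> hcoords x"
proof -
  assume v: "v \<in> hcoords x" and c: "c \<noteq> 0"
  have "c *s v \<in> Rep_proj_space x"
  proof -
    obtain w where w: "Rep_proj_space x = vec.span {w}" using Rep_proj_space[of x] by auto
    then show ?thesis using v vec.span_scale[of v "{w}" c] by (simp add: hcoords_def)
  qed
  then show ?thesis using v c by (simp add: hcoords_def)
qed

text \<open>The affine cone without its vertex.\<close>

definition cone :: "('k::field, 'n::finite) proj_space set \<Rightarrow> ('n \<Rightarrow> 'k) set" where
  "cone X = {($) v | v x. x \<in> X \<and> v \<in> hcoords x}"

definition bicone :: "(('k::field, 'n::finite) proj_space \<times> ('k, 'm::finite) proj_space) set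
    \<Rightarrow> ('n + 'm \<Rightarrow> 'k) set" where
  "bicone W = {case_sum (($) v) (($) w) | v w x y. (x, y) \<in> W \<and> v \<in> hcoords x \<and> w \<in> hcoords y}"

definition ideal :: "('k::field, 'n::finite) proj_space set \<Rightarrow> ('k, 'n) mpoly set" where
  "ideal X = {f. \<forall>p\<in>X. vanishes f p}"

definition biideal :: "(('k::field, 'n::finite) proj_space \<times> ('k, 'm::finite) proj_space) set
    \<Rightarrow> ('k, 'n + 'm) mpoly set" where
  "biideal W = {f. \<forall>q\<in>W. bivanishes f q}"

lemma ideal_iff: "f \<in> ideal X \<longleftrightarrow> (\<forall>a\<in>cone X. mp_eval f a = 0)"
  by (auto simp: ideal_def cone_def vanishes_def)

lemma biideal_iff: "f \<in> biideal W \<longleftrightarrow> (\<forall>a\<in>bicone W. mp_eval f a = 0)"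
  unfolding biideal_def bicone_def bivanishes_def by fastforce

lemma scale_vec: "scale UNIV c (($) v) = ($) (c *s v)"
  by (auto simp: scale_def)

lemma vanishes_hcomp:
  fixes f :: "('k::field_char_0, 'n::finite) mpoly"
  shows "vanishes f p \<longleftrightarrow> (\<forall>d. vanishes (hcomp UNIV d f) p)"
proof
  assume f: "vanishes f p"
  show "\<forall>d. vanishes (hcomp UNIV d f) p"
    unfolding vanishes_def
  proof (intro allI ballI)
    fix d a assume a: "a \<in> hcoords p"
    show "mp_eval (hcomp UNIV d f) (($) a) = 0"
      by (rule hcomp_vanishes) (use f hcoords_scale[OF a] in \<open>simp add: scale_vec vanishes_def\<close>)
  qed
next
  assume *: "\<forall>d. vanishes (hcomp UNIV d f) p"
  obtain D where D: "f = (\<Sum>d\<le>D. hcomp UNIV d f)" using sum_hcomp by blast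
  show "vanishes f p"
    unfolding vanishes_def by (subst D) (use * in \<open>simp add: mp_eval_sum vanishes_def\<close>)
qed

lemma scale_Inl: "scale (range Inl) c (case_sum (($) v) (($) w)) = case_sum (($) (c *s v)) (($) w)"
  and scale_Inr: "scale (range Inr) c (case_sum (($) v) (($) w)) = case_sum (($) v) (($) (c *s w))"
  by (auto simp: scale_def fun_eq_iff split: sum.splits)

lemma bivanishes_hcomp:
  fixes f :: "('k::field_char_0, 'n::finite + 'm::finite) mpoly"
  shows "bivanishes f q \<longleftrightarrow> (\<forall>d e. bivanishes (hcomp (range Inl) d (hcomp (range Inr) e f)) q)"
proof
  assume f: "bivanishes f q"
  have 1: "mp_eval (hcomp (range Inr) e f) (case_sum (($) a) (($) b)) = 0"
    if a: "a \<in> hcoords (fst q)" and b: "b \<in> hcoords (snd q)" for e a b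
    by (rule hcomp_vanishes) (use f a hcoords_scale[OF b] in \<open>simp add: scale_Inr bivanishes_def\<close>)
  show "\<forall>d e. bivanishes (hcomp (range Inl) d (hcomp (range Inr) e f)) q"
    unfolding bivanishes_def
  proof (intro allI ballI)
    fix d e a b assume a: "a \<in> hcoords (fst q)" and b: "b \<in> hcoords (snd q)"
    show "mp_eval (hcomp (range Inl) d (hcomp (range Inr) e f)) (case_sum (($) a) (($) b)) = 0"
      by (rule hcomp_vanishes) (use 1 b hcoords_scale[OF a] in \<open>simp add: scale_Inl\<close>)
  qed
next
  assume *: "\<forall>d e. bivanishes (hcomp (range Inl) d (hcomp (range Inr) e f)) q"
  have inner: "bivanishes (hcomp (range Inr) e f) q" for e
  proof -
    obtain D where D: "hcomp (range Inr) e f = (\<Sum>d\<le>D. hcomp (range Inl) d (hcomp (range Inr) e f))"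
      using sum_hcomp by blast
    show ?thesis
      unfolding bivanishes_def by (subst D) (use * in \<open>simp add: mp_eval_sum bivanishes_def\<close>)
  qed
  obtain E where E: "f = (\<Sum>e\<le>E. hcomp (range Inr) e f)" using sum_hcomp by blast
  have "bivanishes (\<Sum>e\<le>E. hcomp (range Inr) e f) q"
    using inner by (simp add: mp_eval_sum bivanishes_def)
  then show "bivanishes f q" by (subst E)
qed

text \<open>Both Zariski topologies may be computed with arbitrary instead of (bi)homogeneous equations.\<close>

lemma zero_locus_topology:
  fixes van :: "'f \<Rightarrow> 'p \<Rightarrow> bool"
  assumes top: "\<And>S. closedin T S \<longleftrightarrow> (\<exists>F. (\<forall>f\<in>F. P f) \<and> S = {p. \<forall>f\<in>F. van f p})"
    and univ: "topspace T = UNIV"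
    and dec: "\<And>f. \<exists>F. (\<forall>g\<in>F. P g) \<and> (\<forall>p. van f p \<longleftrightarrow> (\<forall>g\<in>F. van g p))"
  shows "closedin T {p. \<forall>f\<in>F. van f p}"
    and "closedin T S \<Longrightarrow> (\<And>f. (\<And>q. q \<in> S \<Longrightarrow> van f q) \<Longrightarrow> van f p) \<Longrightarrow> p \<in> S"
    and "p \<in> T closure_of S \<longleftrightarrow> (\<forall>f. (\<forall>q\<in>S. van f q) \<longrightarrow> van f p)"
proof -
  from dec have "\<exists>F'. \<forall>f. (\<forall>g\<in>F' f. P g) \<and> (\<forall>p. van f p \<longleftrightarrow> (\<forall>g\<in>F' f. van g p))"
    by (intro choice) blast
  then obtain F' where F': "\<And>f g. g \<in> F' f \<Longrightarrow> P g" "\<And>f p. van f p \<longleftrightarrow> (\<forall>g\<in>F' f. van g p)"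
    by blast
  show cl: "closedin T {p. \<forall>f\<in>F. van f p}" for F
  proof -
    have "(\<forall>f\<in>F. van f p) \<longleftrightarrow> (\<forall>f\<in>F. \<forall>g\<in>F' f. van g p)" for p
      by (intro ball_cong refl F'(2))
    then have "{p. \<forall>f\<in>F. van f p} = {p. \<forall>g\<in>\<Union>(F' ` F). van g p}" by blast
    moreover have "\<forall>g\<in>\<Union>(F' ` F). P g" using F'(1) by blast
    ultimately show ?thesis unfolding top by (intro exI conjI)
  qed
  show mem: "p \<in> S" if S: "closedin T S" and all: "\<And>f. (\<And>q. q \<in> S \<Longrightarrow> van f q) \<Longrightarrow> van f p" for S p
  proof -
    obtain G where G: "S = {p. \<forall>f\<in>G. van f p}" using S[unfolded top] by auto
    have "van f p" if f: "f \<in> G" for f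
    proof (rule all)
      show "van f q" if "q \<in> S" for q using that f G by simp
    qed
    then show ?thesis using G by simp
  qed
  show "p \<in> T closure_of S \<longleftrightarrow> (\<forall>f. (\<forall>q\<in>S. van f q) \<longrightarrow> van f p)"
  proof
    assume p: "p \<in> T closure_of S"
    show "\<forall>f. (\<forall>q\<in>S. van f q) \<longrightarrow> van f p"
    proof (intro allI impI)
      fix f assume "\<forall>q\<in>S. van f q"
      then have "T closure_of S \<subseteq> {p. \<forall>f\<in>{f}. van f p}"
        by (intro closure_of_minimal cl) auto
      then show "van f p" using p by auto
    qed
  next
    assume *: "\<forall>f. (\<forall>q\<in>S. van f q) \<longrightarrow> van f p"
    have "S \<subseteq> T closure_of S" using univ by (intro closure_of_subset) simp
    then show "p \<in> T closure_of S" by (intro mem closedin_closure_of) (use * in blast)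
  qed
qed

lemma zariski_dec:
  fixes f :: "('k::field_char_0, 'n::finite) mpoly"
  shows "\<exists>F. (\<forall>g\<in>F. homogeneous g) \<and> (\<forall>p. vanishes f p \<longleftrightarrow> (\<forall>g\<in>F. vanishes g p))"
  by (rule exI[of _ "range (\<lambda>d. hcomp UNIV d f)"])
    (use hcomp_homogeneous vanishes_hcomp[of f] in \<open>auto simp: homogeneous_def\<close>)

lemma bizariski_dec:
  fixes f :: "('k::field_char_0, 'n::finite + 'm::finite) mpoly"
  shows "\<exists>F. (\<forall>g\<in>F. bihomogeneous g) \<and> (\<forall>p. bivanishes f p \<longleftrightarrow> (\<forall>g\<in>F. bivanishes g p))"
proof (rule exI[of _ "range (\<lambda>(d, e). hcomp (range Inl) d (hcomp (range Inr) e f))"], intro conjI ballI allI)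
  fix g assume "g \<in> range (\<lambda>(d, e). hcomp (range Inl) d (hcomp (range Inr) e f))"
  then show "bihomogeneous g"
    using hcomp_homogeneous hcomp_homogeneous'[OF hcomp_homogeneous] by (fastforce simp: bihomogeneous_def)
qed (subst bivanishes_hcomp, auto)

lemmas zariski_locus = zero_locus_topology[where T = zariski and van = vanishes and P = homogeneous,
    OF closedin_zariski topspace_zariski zariski_dec]

lemmas bizariski_locus = zero_locus_topology[where T = bizariski and van = bivanishes and P = bihomogeneous,
    OF closedin_bizariski topspace_bizariski bizariski_dec]

lemma zariski_closure_iff:
  fixes S :: "('k::field_char_0, 'n::finite) proj_space set"
  shows "p \<in> zariski closure_of S \<longleftrightarrow> (\<forall>f\<in>ideal S. vanishes f p)"
  using zariski_locus(3)[of p S] by (auto simp: ideal_def)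

lemma bizariski_closure_iff:
  fixes S :: "(('k::field_char_0, 'n::finite) proj_space \<times> ('k, 'm::finite) proj_space) set"
  shows "q \<in> bizariski closure_of S \<longleftrightarrow> (\<forall>f\<in>biideal S. bivanishes f q)"
  using bizariski_locus(3)[of q S] by (auto simp: biideal_def)

lemma closed_memI:
  fixes S :: "('k::field_char_0, 'n::finite) proj_space set"
  assumes "closedin zariski S" "\<And>f. f \<in> ideal S \<Longrightarrow> vanishes f p"
  shows "p \<in> S"
  using zariski_locus(2)[OF assms(1), of p] assms(2) by (auto simp: ideal_def)

lemma biclosed_memI:
  fixes S :: "(('k::field_char_0, 'n::finite) proj_space \<times> ('k, 'm::finite) proj_space) set"
  assumes "closedin bizariski S" "\<And>f. f \<in> biideal S \<Longrightarrow> bivanishes f q"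
  shows "q \<in> S"
  using bizariski_locus(2)[OF assms(1), of q] assms(2) by (auto simp: biideal_def)

lemma ideal_antimono: "X \<subseteq> Y \<Longrightarrow> ideal Y \<subseteq> ideal X"
  by (auto simp: ideal_def)

lemma ideal_hcomp:
  fixes f :: "('k::field_char_0, 'n::finite) mpoly"
  shows "f \<in> ideal X \<Longrightarrow> hcomp UNIV d f \<in> ideal X"
  unfolding ideal_def using vanishes_hcomp by blast

lemma ideal_hcompI:
  fixes f :: "('k::field_char_0, 'n::finite) mpoly"
  shows "(\<And>d. hcomp UNIV d f \<in> ideal X) \<Longrightarrow> f \<in> ideal X"
  unfolding ideal_def using vanishes_hcomp by blast

lemma irreducible_avoid:
  assumes X: "irreducible_in T X" and "finite \<C>" "\<And>C. C \<in> \<C> \<Longrightarrow> closedin T C \<and> \<not> X \<subseteq> C"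
  shows "\<exists>x\<in>X. \<forall>C\<in>\<C>. x \<notin> C"
proof -
  have "\<not> X \<subseteq> \<Union>\<C>"
    using assms(2,3)
  proof (induction \<C>)
    case empty
    then show ?case using X by (auto simp: irreducible_in_def)
  next
    case (insert C \<C>)
    have "closedin T (\<Union>\<C>)" using insert by (intro closedin_Union) auto
    moreover have "closedin T C" "\<not> X \<subseteq> C" using insert.prems by auto
    moreover have "\<not> X \<subseteq> \<Union>\<C>" using insert by simp
    ultimately have "\<not> X \<subseteq> C \<union> \<Union>\<C>" using X unfolding irreducible_in_def by blast
    then show ?case by simp
  qed
  then show ?thesis by blast
qed

text \<open>The inclusions of conormal varieties in the final argument are reduced to open parts by
  this.\<close>

lemma irreducible_dense:
  assumes X: "irreducible_in T X" and C: "closedin T C" "\<not> X \<subseteq> C" and D: "closedin T D" "X - C \<subseteq> D"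
  shows "X \<subseteq> D"
  using X C D unfolding irreducible_in_def by blast

section \<open>Generic points and the dimension of a variety\<close>

lemma inst_range: "(\<And>j. (\<lambda>i. s i j) \<in> S) \<Longrightarrow> inst S (\<lambda>i. st (s i))"
  unfolding inst_def by (intro exI[of _ s]) simp

text \<open>Irreducibility gives a point of \<open>X\<close> at which some homogeneous component of
  each relevant polynomial is nonzero; a suitable rescaling of its coordinates makes the polynomials
  themselves nonzero.\<close>

lemma cone_avoid:
  fixes X :: "('k::field_char_0, 'n::finite) proj_space set"
  assumes X: "irreducible_in zariski X" and G: "finite G"
  shows "\<exists>a\<in>cone X. \<forall>g\<in>G. g \<in> ideal X \<or> mp_eval g a \<noteq> 0"
proof -
  define H where "H = {g\<in>G. g \<notin> ideal X}"
  have "\<forall>g. \<exists>d. g \<in> H \<longrightarrow> hcomp UNIV d g \<notin> ideal X"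
    using ideal_hcompI unfolding H_def by blast
  then obtain d where d: "\<And>g. g \<in> H \<Longrightarrow> hcomp UNIV (d g) g \<notin> ideal X" by metis
  define \<C> where "\<C> = (\<lambda>g. {p. \<forall>f\<in>{hcomp UNIV (d g) g}. vanishes f p}) ` H"
  have "\<exists>x\<in>X. \<forall>C\<in>\<C>. x \<notin> C"
  proof (rule irreducible_avoid[OF X])
    show "finite \<C>" using G by (simp add: \<C>_def H_def)
    fix C assume "C \<in> \<C>"
    then obtain g where g: "g \<in> H" "C = {p. \<forall>f\<in>{hcomp UNIV (d g) g}. vanishes f p}" by (auto simp: \<C>_def)
    then show "closedin zariski C \<and> \<not> X \<subseteq> C"
      using d[OF g(1)] zariski_locus(1)[of "{hcomp UNIV (d g) g}"] by (auto simp: ideal_def)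
  qed
  then obtain x where x: "x \<in> X" "\<And>g. g \<in> H \<Longrightarrow> \<not> vanishes (hcomp UNIV (d g) g) x"
    by (auto simp: \<C>_def)
  obtain v where v: "v \<in> hcoords x" using hcoords_nonempty by blast
  have nz: "mp_eval (hcomp UNIV (d g) g) (($) v) \<noteq> 0" if "g \<in> H" for g
    using x(2)[OF that] v vanishes_iff[of "hcomp UNIV (d g) g" v x] hcomp_homogeneous[of UNIV "d g" g]
    by (auto simp: homogeneous_def)
  obtain c where c: "c \<noteq> 0" "\<And>g. g \<in> G \<Longrightarrow> mp_eval g (scale UNIV c (($) v)) = 0 \<Longrightarrow>
      (\<forall>d. mp_eval (hcomp UNIV d g) (($) v) = 0)"
    using scaling_avoids[OF G, of UNIV "($) v"] by blast
  show ?thesis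
  proof (intro bexI[of _ "($) (c *s v)"] ballI)
    show "($) (c *s v) \<in> cone X" using hcoords_scale[OF v c(1)] x(1) by (auto simp: cone_def)
    fix g assume g: "g \<in> G"
    show "g \<in> ideal X \<or> mp_eval g (($) (c *s v)) \<noteq> 0"
      using c(2)[OF g] nz[of g] g by (auto simp: H_def scale_vec)
  qed
qed

text \<open>By \<open>cone_avoid\<close> the conditions "\<open>g\<close> is in the ideal or does
  not vanish at the point" are finitely satisfiable; saturation realizes all of them
  together.\<close>

lemma generic_point_exists:
  fixes X :: "('k::field_char_0, 'n::finite) proj_space set"
  assumes X: "irreducible_in zariski X"
  shows "\<exists>z. inst (cone X) z \<and> relations om z = ideal X"
proof -
  have "\<exists>s. (\<forall>j. (\<lambda>i. s i j) \<in> cone X) \<and>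
      (\<forall>g. eventually (\<lambda>j. g \<in> ideal X \<or> mp_eval g (\<lambda>i. s i j) \<noteq> 0) (oF :: 'k oidx filter))"
    by (rule saturation[where Q = "\<lambda>g a. g \<in> ideal X \<or> mp_eval g a \<noteq> 0"]) (rule cone_avoid[OF X])
  then obtain s where s: "\<And>j. (\<lambda>i. s i j) \<in> cone X"
    "\<And>g. eventually (\<lambda>j. g \<in> ideal X \<or> mp_eval g (\<lambda>i. s i j) \<noteq> 0) (oF :: 'k oidx filter)" by blast
  define z where "z = (\<lambda>i. st (s i))"
  have inst: "inst (cone X) z" unfolding z_def by (rule inst_range) (rule s)
  have "ev om g z = 0 \<longleftrightarrow> g \<in> ideal X" for g
  proof
    assume "g \<in> ideal X"
    then show "ev om g z = 0" by (intro inst_ev_0[OF inst]) (simp add: ideal_iff)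
  next
    assume "ev om g z = 0"
    then have "eventually (\<lambda>j. mp_eval g (\<lambda>i. s i j) = 0) (oF :: 'k oidx filter)"
      by (simp add: z_def st_ev st_eq_0)
    with s(2)[of g] have "eventually (\<lambda>j :: 'k oidx. g \<in> ideal X) oF"
      by (rule eventually_elim2) auto
    then show "g \<in> ideal X" by simp
  qed
  then show ?thesis using inst by (auto simp: relations_def)
qed

lemma ideal_prime:
  fixes X :: "('k::field_char_0, 'n::finite) proj_space set"
  assumes X: "irreducible_in zariski X" and "f * g \<in> ideal X"
  shows "f \<in> ideal X \<or> g \<in> ideal X"
proof -
  obtain z where z: "relations om z = ideal X" using generic_point_exists[OF X] by blast
  show ?thesis
    using assms(2) unfolding z[symmetric] by (simp add: relations_def ev_mult rhom_om)
qed

text \<open>The dimension of the affine cone, thus one more than the projective dimension. The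
  choice of the generic point is immaterial by \<open>pdim_eq\<close>.\<close>

definition pdim :: "('k::field_char_0, 'n::finite) proj_space set \<Rightarrow> nat" where
  "pdim X = (let z = (SOME z. relations om z = ideal X) in vec.dim (tang om (ideal X) z))"

lemma pdim_eq:
  assumes "relations om z = ideal X"
  shows "pdim X = vec.dim (tang om (ideal X) z)"
proof -
  define y where "y = (SOME z. relations om z = ideal X)"
  have y: "relations om y = ideal X" unfolding y_def by (rule someI[where x = z]) fact
  have "vec.dim (tang om (ideal X) y) = vec.dim (tang om (ideal X) z)"
    using specialization_dim(1)[OF rhom_om, of y z] specialization_dim(1)[OF rhom_om, of z y]
    by (simp add: y assms)
  then show ?thesis unfolding pdim_def Let_def y_def[symmetric] by simp
qed

text \<open>A generic point of \<open>X\<close> is a specialization of one of \<open>Y\<close>, so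
  \<open>specialization_dim\<close> applies; equal dimensions would make the ideals equal.\<close>

lemma pdim_mono:
  fixes X Y :: "('k::field_char_0, 'n::finite) proj_space set"
  assumes X: "irreducible_in zariski X" and Y: "irreducible_in zariski Y" and sub: "X \<subseteq> Y"
  shows "pdim X \<le> pdim Y" and "closedin zariski X \<Longrightarrow> X \<noteq> Y \<Longrightarrow> pdim X < pdim Y"
proof -
  obtain x y where xy: "relations om x = ideal X" "relations om y = ideal Y"
    using generic_point_exists[OF X] generic_point_exists[OF Y] by blast
  have sub': "relations om y \<subseteq> relations om x"
    using ideal_antimono[OF sub] by (simp add: xy)
  show le: "pdim X \<le> pdim Y"
    using specialization_dim(1)[OF rhom_om sub'] by (simp add: pdim_eq[OF xy(1)] pdim_eq[OF xy(2)] xy)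
  show "pdim X < pdim Y" if "closedin zariski X" "X \<noteq> Y"
  proof (rule ccontr)
    assume "\<not> ?thesis"
    with le have "pdim X = pdim Y" by simp
    then have "ideal X \<subseteq> ideal Y"
      using specialization_dim(2)[OF rhom_om sub'] by (simp add: pdim_eq[OF xy(1)] pdim_eq[OF xy(2)] xy)
    then have "p \<in> X" if "p \<in> Y" for p
      using that by (intro closed_memI[OF \<open>closedin zariski X\<close>]) (auto simp: ideal_def)
    then show False using sub \<open>X \<noteq> Y\<close> by blast
  qed
qed

lemma mp_pderiv_homogeneous:
  assumes "homogeneous_in UNIV d f"
  shows "homogeneous_in UNIV (d - 1) (mp_pderiv i f)"
  unfolding homogeneous_in_def
proof
  fix m assume "m \<in> Poly_Mapping.keys (mp_pderiv i f)"
  then have "m + Poly_Mapping.single i 1 \<in> Poly_Mapping.keys f"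
    by (auto simp: in_keys_iff lookup_pderiv)
  then have "(\<Sum>j\<in>UNIV. Poly_Mapping.lookup (m + Poly_Mapping.single i 1) j) = d"
    using assms by (simp add: homogeneous_in_def)
  moreover have "(\<Sum>j\<in>UNIV. Poly_Mapping.lookup (Poly_Mapping.single i (1::nat)) j) = 1"
    by (simp add: lookup_single when_def sum.delta)
  ultimately show "(\<Sum>j\<in>UNIV. Poly_Mapping.lookup m j) = d - 1"
    by (simp add: lookup_add sum.distrib)
qed

lemma sum_single: "(\<Sum>i\<in>A. Poly_Mapping.single m (c i)) = Poly_Mapping.single m (\<Sum>i\<in>A. c i)"
  by (induction A rule: infinite_finite_induct) (simp_all add: single_add)

lemma euler:
  assumes "homogeneous_in UNIV d f"
  shows "(\<Sum>i\<in>UNIV. mp_var i * mp_pderiv i f) = of_nat d * f"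
proof -
  have mono: "(\<Sum>i\<in>UNIV. mp_var i * mp_pderiv i (Poly_Mapping.single m c)) =
      Poly_Mapping.single m (of_nat (\<Sum>i\<in>UNIV. Poly_Mapping.lookup m i) * c)" for m :: "'a \<Rightarrow>\<^sub>0 nat" and c :: 'b
  proof -
    have "mp_var i * mp_pderiv i (Poly_Mapping.single m c) = Poly_Mapping.single m (of_nat (Poly_Mapping.lookup m i) * c)" for i
    proof (cases "Poly_Mapping.lookup m i = 0")
      case True
      then show ?thesis by (simp add: mp_pderiv_single)
    next
      case False
      then have "Poly_Mapping.single i 1 + (m - Poly_Mapping.single i 1) = m"
        by (intro poly_mapping_eqI) (auto simp: lookup_add lookup_minus lookup_single when_def)
      then show ?thesis by (simp add: mp_pderiv_single mp_var_def mult_single)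
    qed
    then show ?thesis by (simp add: sum_single sum_distrib_right)
  qed
  have "(\<Sum>i\<in>UNIV. mp_var i * mp_pderiv i f) =
      (\<Sum>m\<in>Poly_Mapping.keys f. \<Sum>i\<in>UNIV. mp_var i * mp_pderiv i (Poly_Mapping.single m (Poly_Mapping.lookup f m)))"
    by (subst mpoly_eq_sum_single[of f], subst sum.swap) (simp add: mp_pderiv_sum sum_distrib_left)
  also have "\<dots> = (\<Sum>m\<in>Poly_Mapping.keys f. of_nat d * Poly_Mapping.single m (Poly_Mapping.lookup f m))"
  proof (intro sum.cong refl)
    fix m assume "m \<in> Poly_Mapping.keys f"
    then have "(\<Sum>i\<in>UNIV. Poly_Mapping.lookup m i) = d" using assms by (simp add: homogeneous_in_def)
    moreover have "of_nat d * Poly_Mapping.single m (Poly_Mapping.lookup f m)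
        = Poly_Mapping.single m (of_nat d * Poly_Mapping.lookup f m)"
      using mult_single[of 0 "of_nat d" m "Poly_Mapping.lookup f m"] by (simp add: single_of_nat)
    ultimately show "(\<Sum>i\<in>UNIV. mp_var i * mp_pderiv i (Poly_Mapping.single m (Poly_Mapping.lookup f m)))
        = of_nat d * Poly_Mapping.single m (Poly_Mapping.lookup f m)"
      by (simp add: mono)
  qed
  also have "\<dots> = of_nat d * f"
    by (subst (2) mpoly_eq_sum_single[of f]) (simp add: sum_distrib_left)
  finally show ?thesis .
qed

text \<open>Euler's identity in each degree: the line through the point is tangent to the
  cone.\<close>

lemma euler_tang:
  fixes I :: "('k::field, 'n::finite) mpoly set"
  assumes h: "rhom h" and I: "I \<subseteq> relations h z" "\<And>f d. f \<in> I \<Longrightarrow> hcomp UNIV d f \<in> I"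
  shows "(\<chi> i. z i) \<in> tang h I z"
  unfolding tang_def ann_def
proof clarify
  fix f assume f: "f \<in> I"
  have hom: "dot (grad h g z) (\<chi> i. z i) = 0" if "homogeneous_in UNIV d g" "g \<in> I" for d g
  proof -
    have "dot (grad h g z) (\<chi> i. z i) = ev h (\<Sum>i\<in>UNIV. mp_var i * mp_pderiv i g) z"
      by (simp add: dot_def ev_sum[OF h] ev_mult[OF h] ev_var[OF h] mult.commute)
    also have "\<dots> = ev h (of_nat d) z * ev h g z" by (simp add: euler[OF that(1)] ev_mult[OF h])
    also have "ev h g z = 0" using that(2) I(1) by (auto simp: relations_def)
    finally show ?thesis by simp
  qed
  obtain D where D: "f = (\<Sum>d\<le>D. hcomp UNIV d f)" using sum_hcomp by blast
  have "grad h (\<Sum>d\<in>A. hcomp UNIV d f) z = (\<Sum>d\<in>A. grad h (hcomp UNIV d f) z)" for A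
    by (simp add: vec_eq_iff mp_pderiv_sum ev_sum[OF h])
  then have "dot (grad h f z) (\<chi> i. z i) = (\<Sum>d\<le>D. dot (grad h (hcomp UNIV d f) z) (\<chi> i. z i))"
    using D dot_sum_left by metis
  then show "dot (grad h f z) (\<chi> i. z i) = 0"
    using hom[OF hcomp_homogeneous I(2)[OF f]] by simp
qed

text \<open>\<open>tangent_lin\<close> tests homogeneous equations at all representatives.
  Homogeneous components reduce arbitrary equations to these, and homogeneity of the partial
  derivatives reduces all representatives to one.\<close>

lemma tangent_lin_eq:
  fixes X :: "('k::field_char_0, 'n::finite) proj_space set"
  assumes x: "x \<in> X" and a: "a \<in> hcoords x"
  shows "tangent_lin X x = tang (\<lambda>x. x) (ideal X) (($) a)"
proof (intro equalityI subsetI)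
  fix v assume v: "v \<in> tangent_lin X x"
  show "v \<in> tang (\<lambda>x. x) (ideal X) (($) a)"
    unfolding tang_def ann_def
  proof clarify
    fix f assume f: "f \<in> ideal X"
    obtain D where D: "f = (\<Sum>d\<le>D. hcomp UNIV d f)" using sum_hcomp by blast
    have "dot (grad (\<lambda>x. x) (hcomp UNIV d f) (($) a)) v = 0" for d
      using v a ideal_hcomp[OF f, of d] hcomp_homogeneous[of UNIV d f]
      unfolding tangent_lin_def by (auto simp: dot_def ideal_def homogeneous_def mp_eval_ev)
    moreover have "grad (\<lambda>x. x) (\<Sum>d\<in>A. hcomp UNIV d f) (($) a) = (\<Sum>d\<in>A. grad (\<lambda>x. x) (hcomp UNIV d f) (($) a))" for A
      by (simp add: vec_eq_iff mp_pderiv_sum ev_sum)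
    ultimately have "dot (grad (\<lambda>x. x) (\<Sum>d\<le>D. hcomp UNIV d f) (($) a)) v = 0"
      by (simp add: dot_sum_left)
    then show "dot (grad (\<lambda>x. x) f (($) a)) v = 0" using D by simp
  qed
next
  fix v assume v: "v \<in> tang (\<lambda>x. x) (ideal X) (($) a)"
  show "v \<in> tangent_lin X x"
    unfolding tangent_lin_def
  proof (intro CollectI allI impI ballI; elim conjE)
    fix f b assume f: "homogeneous f" "\<forall>p\<in>X. vanishes f p" and b: "b \<in> hcoords x"
    obtain c where c: "b = c *s a" using hcoords_multiple[OF a b] by blast
    obtain d where d: "homogeneous_in UNIV d f" using f(1) by (auto simp: homogeneous_def)
    have "mp_eval (mp_pderiv i f) (($) b) = c ^ (d - 1) * mp_eval (mp_pderiv i f) (($) a)" for i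
      unfolding c scale_vec[symmetric] mp_eval_ev by (rule ev_scale[OF rhom_id mp_pderiv_homogeneous[OF d]])
    then have "(\<Sum>i\<in>UNIV. mp_eval (mp_pderiv i f) (($) b) * v $ i)
        = c ^ (d - 1) * dot (grad (\<lambda>x. x) f (($) a)) v"
      by (simp add: dot_def sum_distrib_left mp_eval_ev mult.assoc)
    also have "dot (grad (\<lambda>x. x) f (($) a)) v = 0"
      using v f(2) by (auto simp: tang_def ann_def ideal_def)
    finally show "(\<Sum>i\<in>UNIV. mp_eval (mp_pderiv i f) (($) b) * v $ i) = 0" by simp
  qed
qed

lemma coords_in_tangent_lin:
  fixes X :: "('k::field_char_0, 'n::finite) proj_space set"
  assumes x: "x \<in> X" and a: "a \<in> hcoords x"
  shows "a \<in> tangent_lin X x"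
proof -
  have "(\<chi> i. a $ i) \<in> tang (\<lambda>x. x) (ideal X) (($) a)"
  proof (rule euler_tang[OF rhom_id])
    show "ideal X \<subseteq> relations (\<lambda>x. x) (($) a)"
      using x a by (auto simp: relations_def ideal_def vanishes_def mp_eval_ev)
  qed (rule ideal_hcomp)
  then show ?thesis by (simp add: tangent_lin_eq[OF x a])
qed

lemma relations_nonzero:
  fixes X :: "('k::field_char_0, 'n::finite) proj_space set"
  assumes z: "relations om z = ideal X" and X: "X \<noteq> {}"
  shows "\<exists>i. z i \<noteq> 0"
proof (rule ccontr)
  assume "\<not> ?thesis"
  then have z0: "mp_var i \<in> ideal X" for i
    unfolding z[symmetric] by (auto simp: relations_def ev_var rhom_om)
  obtain x a where "x \<in> X" and a: "a \<in> hcoords x" using X hcoords_nonempty by blast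
  then have "mp_eval (mp_var i) (($) a) = 0" for i using z0[of i] by (auto simp: ideal_def vanishes_def)
  then have "a = 0" by (simp add: vec_eq_iff mp_eval_ev ev_var)
  then show False using a by (simp add: in_hcoords_iff)
qed

lemma pdim_pos:
  fixes X :: "('k::field_char_0, 'n::finite) proj_space set"
  assumes X: "irreducible_in zariski X"
  shows "pdim X > 0"
proof -
  obtain z where z: "relations om z = ideal X" using generic_point_exists[OF X] by blast
  have v: "(\<chi> i. z i) \<in> tang om (ideal X) z"
    by (rule euler_tang[OF rhom_om]) (auto simp: z ideal_hcomp)
  have nz: "(\<chi> i. z i) \<noteq> 0"
    using relations_nonzero[OF z] X by (auto simp: vec_eq_iff irreducible_in_def)
  have "card {\<chi> i. z i} \<le> vec.dim (tang om (ideal X) z)"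
    by (rule vec.independent_card_le_dim) (use v nz in auto)
  then show ?thesis by (simp add: pdim_eq[OF z])
qed

text \<open>With full dimension every coordinate could be moved independently, so there would be no
  relations and the ideal would be zero.\<close>

lemma pdim_less:
  fixes X :: "('k::field_char_0, 'n::finite) proj_space set"
  assumes X: "irreducible_variety X" "X \<noteq> UNIV"
  shows "pdim X < CARD('n)"
proof (rule ccontr)
  assume *: "\<not> ?thesis"
  obtain z where z: "relations om z = ideal X"
    using generic_point_exists X by (auto simp: irreducible_variety_def)
  have "vec.dim (tang om (ideal X) z) = vec.dim (UNIV :: ('k omega ^ 'n) set)"
    using * vec.dim_subset_UNIV[of "tang om (ideal X) z"] vec_dim_card
    by (simp add: pdim_eq[OF z] vec.dimension_def card_cart_basis)
  then have all: "tang om (relations om z) z = UNIV"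
    unfolding z
    using vec.subspace_dim_equal[OF subspace_tang vec.subspace_UNIV subset_UNIV, of om "ideal X" z] by simp
  have "f = 0" if "f \<in> ideal X" for f
  proof (rule coordinates_independent[OF rhom_om, where B = UNIV and z = z])
    show "\<exists>v\<in>tang om (relations om z) z. \<forall>j\<in>UNIV. v $ j = w j" for w
      unfolding all by (intro bexI[of _ "\<chi> j. w j"]) auto
  qed (use that z in \<open>auto simp: vars_in_def relations_def\<close>)
  then have "vanishes f p" if "f \<in> ideal X" for f p
    using mp_eval_zero that unfolding vanishes_def by metis
  moreover have "closedin zariski X"
    using X(1) by (simp add: irreducible_variety_def projective_variety_def)
  ultimately have "X = UNIV" using closed_memI[of X] by blast
  then show False using X(2) by simp
qed

section \<open>Frames of gradients\<close>

text \<open>Gradients of equations in the rows of \<open>B\<close>, constant vectors elsewhere. The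
  constants come from the ground field, so the determinant is a polynomial over it, and where it is
  nonzero the gradients are independent.\<close>

definition frame :: "('k::field \<Rightarrow> 'f::field) \<Rightarrow> 'n set \<Rightarrow> ('n \<Rightarrow> ('k, 'n::finite) mpoly) \<Rightarrow> ('n \<Rightarrow> 'k ^ 'n)
    \<Rightarrow> ('n \<Rightarrow> 'f) \<Rightarrow> 'f ^ 'n ^ 'n" where
  "frame h B f e z = (\<chi> i. if i \<in> B then grad h (f i) z else (\<chi> j. h (e i $ j)))"

definition frame_poly :: "'n set \<Rightarrow> ('n \<Rightarrow> ('k::field, 'n::finite) mpoly) \<Rightarrow> ('n \<Rightarrow> 'k ^ 'n)
    \<Rightarrow> ('k, 'n) mpoly ^ 'n ^ 'n" where
  "frame_poly B f e = (\<chi> i j. if i \<in> B then mp_pderiv j (f i) else mp_const (e i $ j))"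

lemma rhom_det: "rhom g \<Longrightarrow> g (det A) = det (\<chi> i j. g (A $ i $ j))"
  by (simp add: det_def rhom_sum rhom_mult rhom_of_int rhom_prod)

lemma ev_frame_det: "rhom h \<Longrightarrow> ev h (det (frame_poly B f e)) z = det (frame h B f e z)"
proof -
  assume h: "rhom h"
  have "(\<chi> i j. ev h (frame_poly B f e $ i $ j) z) = frame h B f e z"
    by (simp add: vec_eq_iff frame_poly_def frame_def ev_const[OF h])
  then show ?thesis using rhom_det[OF rhom_ev[OF h], of "frame_poly B f e" z] by simp
qed

lemma frame_exists:
  fixes I :: "('k::field, 'n::finite) mpoly set" and h :: "'k \<Rightarrow> 'f::field"
  assumes h: "rhom h"
  shows "\<exists>B f e. (\<forall>i\<in>B. f i \<in> I) \<and> det (frame h B f e z) \<noteq> 0 \<and> card B + vec.dim (tang h I z) = CARD('n)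
    \<and> ann ((\<lambda>i. grad h (f i) z) ` B) = tang h I z"
proof -
  obtain M :: "'f ^ 'n ^ 'n" and B where M: "det M \<noteq> 0" "\<forall>i\<in>B. M $ i \<in> (\<lambda>f. grad h f z) ` I"
      "\<forall>i. i \<notin> B \<longrightarrow> M $ i \<in> range (\<lambda>k. axis k 1)" "ann ((\<lambda>i. M $ i) ` B) = tang h I z"
    using row_completion[OF span_axis, of "(\<lambda>f. grad h f z) ` I"] unfolding tang_def by blast
  have "\<forall>i. \<exists>f. i \<in> B \<longrightarrow> f \<in> I \<and> M $ i = grad h f z" using M(2) by blast
  then obtain f where f: "\<And>i. i \<in> B \<Longrightarrow> f i \<in> I" "\<And>i. i \<in> B \<Longrightarrow> M $ i = grad h (f i) z" by metis
  have "\<forall>i. \<exists>k. i \<notin> B \<longrightarrow> M $ i = axis k 1" using M(3) by blast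
  then obtain k where k: "\<And>i. i \<notin> B \<Longrightarrow> M $ i = axis (k i) 1" by metis
  have "frame h B f (\<lambda>i. axis (k i) 1) z = M"
    by (auto simp: vec_eq_iff frame_def f(2) k axis_def rhom_0[OF h] rhom_1[OF h])
  moreover have "card B + vec.dim (tang h I z) = CARD('n)"
    using ann_rows_dim[OF M(1), of B] M(4) by simp
  moreover have "(\<lambda>i. grad h (f i) z) ` B = (\<lambda>i. M $ i) ` B" using f(2) by (intro image_cong) auto
  ultimately show ?thesis using M f(1) by metis
qed

lemma frame_tang:
  fixes I :: "('k::field, 'n::finite) mpoly set"
  assumes f: "\<And>i. i \<in> B \<Longrightarrow> f i \<in> I" and det: "det (frame h B f e z) \<noteq> 0"
  shows "vec.dim (tang h I z) + card B \<le> CARD('n)"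
    and "vec.dim (tang h I z) + card B \<ge> CARD('n) \<Longrightarrow> tang h I z = ann ((\<lambda>i. frame h B f e z $ i) ` B)"
proof -
  have rows: "frame h B f e z $ i = grad h (f i) z" if "i \<in> B" for i using that by (simp add: frame_def)
  have sub: "tang h I z \<subseteq> ann ((\<lambda>i. frame h B f e z $ i) ` B)"
    unfolding tang_def ann_def using f rows by auto
  show "vec.dim (tang h I z) + card B \<le> CARD('n)"
    using vec.dim_subset[OF sub] ann_rows_dim[OF det, of B] by simp
  show "tang h I z = ann ((\<lambda>i. frame h B f e z $ i) ` B)" if "vec.dim (tang h I z) + card B \<ge> CARD('n)"
    using that ann_rows_dim[OF det, of B] by (intro vec.subspace_dim_equal subspace_tang subspace_ann sub) simp
qed

text \<open>The rank of the gradients has its generic value here. Unlike \<open>smooth_locus\<close>, this does not mention the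
  Krull dimension; the two agree for irreducible varieties.\<close>

definition regular_locus :: "('k::field_char_0, 'n::finite) proj_space set \<Rightarrow> ('k, 'n) proj_space set" where
  "regular_locus X = {x\<in>X. vec.dim (tangent_lin X x) = pdim X}"

context
  fixes X :: "('k::field_char_0, 'n::finite) proj_space set"
  assumes X: "irreducible_in zariski X"
begin

lemma generic_frame_exists:
  "\<exists>B f e. (\<forall>i\<in>B. f i \<in> ideal X) \<and> card B + pdim X = CARD('n) \<and> det (frame_poly B f e) \<notin> ideal X"
proof -
  obtain z where z: "relations om z = ideal X" using generic_point_exists[OF X] by blast
  obtain B f e where *: "\<forall>i\<in>B. f i \<in> ideal X" "det (frame om B f e z) \<noteq> 0"
      "card B + vec.dim (tang om (ideal X) z) = CARD('n)"
    using frame_exists[OF rhom_om, where I = "ideal X" and z = z] by blast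
  moreover have "det (frame_poly B f e) \<notin> ideal X"
    using *(2) ev_frame_det[OF rhom_om, of B f e z] by (simp add: z[symmetric] relations_def)
  ultimately show ?thesis by (metis pdim_eq[OF z])
qed

text \<open>Semicontinuity of rank: the determinant of a frame that is nonsingular at
  \<open>x\<close> is not in the ideal, so the frame is nonsingular at the generic point
  too.\<close>

lemma pdim_le_tangent_lin:
  assumes "x \<in> X"
  shows "pdim X \<le> vec.dim (tangent_lin X x)"
proof -
  obtain z where z: "relations om z = ideal X" using generic_point_exists[OF X] by blast
  obtain a where a: "a \<in> hcoords x" using hcoords_nonempty by blast
  obtain B f e where *: "\<forall>i\<in>B. f i \<in> ideal X" "det (frame (\<lambda>x. x) B f e (($) a)) \<noteq> 0"
      "card B + vec.dim (tang (\<lambda>x. x) (ideal X) (($) a)) = CARD('n)"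
    using frame_exists[OF rhom_id, where I = "ideal X" and z = "($) a"] by blast
  have "det (frame_poly B f e) \<notin> ideal X"
  proof
    assume "det (frame_poly B f e) \<in> ideal X"
    then have "mp_eval (det (frame_poly B f e)) (($) a) = 0"
      using assms a by (auto simp: ideal_def vanishes_def)
    then show False using *(2) ev_frame_det[OF rhom_id, of B f e "($) a"] by (simp add: mp_eval_ev)
  qed
  then have "det (frame om B f e z) \<noteq> 0"
    using ev_frame_det[OF rhom_om, of B f e z] by (simp add: z[symmetric] relations_def)
  then have "pdim X + card B \<le> CARD('n)"
    using frame_tang(1)[of B f "ideal X" om e z] *(1) by (simp add: pdim_eq[OF z])
  then show ?thesis using *(3) tangent_lin_eq[OF assms a] by simp
qed

text \<open>The frame bounds the tangent space from above by \<open>pdim X\<close>, semicontinuity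
  bounds it from below; hence the gradients in the frame cut out exactly the tangent space.\<close>

lemma regular_if_frame:
  assumes x: "x \<in> X" "a \<in> hcoords x" and f: "\<And>i. i \<in> B \<Longrightarrow> f i \<in> ideal X"
    and B: "card B + pdim X = CARD('n)" and det: "mp_eval (det (frame_poly B f e)) (($) a) \<noteq> 0"
  shows "x \<in> regular_locus X"
    and "tangent_lin X x = ann ((\<lambda>i. frame (\<lambda>x. x) B f e (($) a) $ i) ` B)"
    and "det (frame (\<lambda>x. x) B f e (($) a)) \<noteq> 0"
proof -
  show d: "det (frame (\<lambda>x. x) B f e (($) a)) \<noteq> 0"
    using det ev_frame_det[OF rhom_id, of B f e "($) a"] by (simp add: mp_eval_ev)
  have le: "vec.dim (tangent_lin X x) + card B \<le> CARD('n)"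
    unfolding tangent_lin_eq[OF x] by (rule frame_tang(1)[OF f d])
  then show "x \<in> regular_locus X"
    using pdim_le_tangent_lin[OF x(1)] B x(1) by (simp add: regular_locus_def)
  show "tangent_lin X x = ann ((\<lambda>i. frame (\<lambda>x. x) B f e (($) a) $ i) ` B)"
    unfolding tangent_lin_eq[OF x]
    by (rule frame_tang(2)[OF f d]) (use pdim_le_tangent_lin[OF x(1)] B tangent_lin_eq[OF x] in simp_all)
qed

lemma frame_at_regular:
  assumes x: "x \<in> regular_locus X" "a \<in> hcoords x"
  shows "\<exists>B f e. (\<forall>i\<in>B. f i \<in> ideal X) \<and> card B + pdim X = CARD('n) \<and>
    mp_eval (det (frame_poly B f e)) (($) a) \<noteq> 0"
proof -
  have xX: "x \<in> X" using x by (simp add: regular_locus_def)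
  obtain B f e where *: "\<forall>i\<in>B. f i \<in> ideal X" "det (frame (\<lambda>x. x) B f e (($) a)) \<noteq> 0"
      "card B + vec.dim (tang (\<lambda>x. x) (ideal X) (($) a)) = CARD('n)"
    using frame_exists[OF rhom_id, where I = "ideal X" and z = "($) a"] by blast
  then show ?thesis
    using x(1) tangent_lin_eq[OF xX x(2)] ev_frame_det[OF rhom_id, of B f e "($) a"]
    by (intro exI[of _ B] exI[of _ f] exI[of _ e]) (auto simp: regular_locus_def mp_eval_ev)
qed

lemma regular_locus_open: "\<exists>C. closedin zariski C \<and> regular_locus X = X - C"
proof -
  define E where "E = {det (frame_poly B f e) | B f e. (\<forall>i\<in>B. f i \<in> ideal X) \<and> card B + pdim X = CARD('n)}"
  have "regular_locus X = X - {p. \<forall>g\<in>E. vanishes g p}"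
  proof (intro equalityI subsetI)
    fix x assume x: "x \<in> regular_locus X"
    obtain a where a: "a \<in> hcoords x" using hcoords_nonempty by blast
    obtain B f e where "\<forall>i\<in>B. f i \<in> ideal X" "card B + pdim X = CARD('n)"
      "mp_eval (det (frame_poly B f e)) (($) a) \<noteq> 0" using frame_at_regular[OF x a] by blast
    then have "det (frame_poly B f e) \<in> E" "\<not> vanishes (det (frame_poly B f e)) x"
      using a by (auto simp: E_def vanishes_def)
    then show "x \<in> X - {p. \<forall>g\<in>E. vanishes g p}" using x by (auto simp: regular_locus_def)
  next
    fix x assume x: "x \<in> X - {p. \<forall>g\<in>E. vanishes g p}"
    then obtain g where "g \<in> E" "\<not> vanishes g x" by blast
    then obtain B f e a where "\<forall>i\<in>B. f i \<in> ideal X" "card B + pdim X = CARD('n)" "a \<in> hcoords x"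
      "mp_eval (det (frame_poly B f e)) (($) a) \<noteq> 0"
      unfolding E_def vanishes_def by blast
    then show "x \<in> regular_locus X" using regular_if_frame(1)[of x a B f e] x by blast
  qed
  then show ?thesis using zariski_locus(1)[of E] by blast
qed

lemma regular_locus_nonempty: "regular_locus X \<noteq> {}"
proof -
  obtain B f e where *: "\<forall>i\<in>B. f i \<in> ideal X" "card B + pdim X = CARD('n)" "det (frame_poly B f e) \<notin> ideal X"
    using generic_frame_exists by blast
  then obtain x a where "x \<in> X" "a \<in> hcoords x" "mp_eval (det (frame_poly B f e)) (($) a) \<noteq> 0"
    unfolding ideal_def vanishes_def by blast
  then show ?thesis using regular_if_frame(1)[of x a B f e] * by blast
qed

end

section \<open>Products of a cone with an affine space\<close>

text \<open>On the line joining a point good for all polynomials of \<open>G\<close> to one good for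
  \<open>g'\<close>, each of the polynomials has only finitely many zeros.\<close>

lemma affine_avoid:
  fixes G :: "('k::field_char_0, 'i::finite) mpoly set"
  assumes G: "finite G" "\<And>g. g \<in> G \<Longrightarrow> \<exists>s. mp_eval g s \<noteq> 0"
  shows "\<exists>s. \<forall>g\<in>G. mp_eval g s \<noteq> 0"
  using assms
proof (induction G)
  case (insert g' G)
  then obtain s where s: "\<And>g. g \<in> G \<Longrightarrow> mp_eval g s \<noteq> 0" by auto
  obtain s' where s': "mp_eval g' s' \<noteq> 0" using insert.prems by auto
  define p where "p g = ev (\<lambda>c. [:c:]) g (\<lambda>i. [:s i, s' i - s i:])" for g :: "('k, 'i) mpoly"
  have c: "rhom (\<lambda>c::'k. [:c:])" by (simp add: rhom_def one_pCons)
  have p: "poly (p g) t = mp_eval g (\<lambda>i. s i + t * (s' i - s i))" for g t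
    unfolding p_def mp_eval_ev
    by (subst rhom_ev_comp[OF _ c]) (simp_all add: rhom_def)
  have "p g \<noteq> 0" if "g \<in> insert g' G" for g
    using that p[of g 0] p[of g' 1] s[of g] s' by auto
  then have "finite (\<Union>g\<in>insert g' G. {t. poly (p g) t = 0})"
    using insert.hyps by (intro finite_UN_I poly_roots_finite) auto
  from ex_new_if_finite[OF infinite_UNIV_char_0 this]
  obtain t where "t \<notin> (\<Union>g\<in>insert g' G. {t. poly (p g) t = 0})" ..
  then show ?case by (intro exI[of _ "\<lambda>i. s i + t * (s' i - s i)"]) (simp add: p)
qed simp

text \<open>The affine factor carries free parameters: the coefficients of vector fields for the
  formal curves, and those of combinations of gradients for the conormal varieties.\<close>

definition cyl :: "('k::field, 'n::finite) proj_space set \<Rightarrow> ('n + 'n \<Rightarrow> 'k) set" where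
  "cyl X = {case_sum b c | b c. b \<in> cone X}"

definition cyl_ideal :: "('k::field, 'n::finite) proj_space set \<Rightarrow> ('k, 'n + 'n) mpoly set" where
  "cyl_ideal X = {g. \<forall>s\<in>cyl X. mp_eval g s = 0}"

definition fixr :: "('n \<Rightarrow> 'k) \<Rightarrow> ('k::field, 'n::finite + 'n) mpoly \<Rightarrow> ('k, 'n) mpoly" where
  "fixr c = mp_subst (case_sum mp_var (\<lambda>l. mp_const (c l)))"

definition fixl :: "('n \<Rightarrow> 'k) \<Rightarrow> ('k::field, 'n::finite + 'n) mpoly \<Rightarrow> ('k, 'n) mpoly" where
  "fixl b = mp_subst (case_sum (\<lambda>i. mp_const (b i)) mp_var)"

lemma mp_eval_fixr: "mp_eval (fixr c g) b = mp_eval g (case_sum b c)"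
  unfolding fixr_def mp_eval_ev ev_subst[OF rhom_id]
  by (rule arg_cong[where f = "ev (\<lambda>x. x) g"]) (auto simp: fun_eq_iff ev_simps split: sum.splits)

lemma mp_eval_fixl: "mp_eval (fixl b g) c = mp_eval g (case_sum b c)"
  unfolding fixl_def mp_eval_ev ev_subst[OF rhom_id]
  by (rule arg_cong[where f = "ev (\<lambda>x. x) g"]) (auto simp: fun_eq_iff ev_simps split: sum.splits)

lemma cyl_ideal_iff: "g \<in> cyl_ideal X \<longleftrightarrow> (\<forall>c. fixr c g \<in> ideal X)"
  by (auto simp: cyl_ideal_def cyl_def ideal_iff mp_eval_fixr)

lemma cyl_generic_exists:
  fixes X :: "('k::field_char_0, 'n::finite) proj_space set"
  assumes X: "irreducible_in zariski X"
  shows "\<exists>z. inst (cyl X) z \<and> relations om z = cyl_ideal X"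
proof -
  have avoid: "\<exists>s\<in>cyl X. \<forall>g\<in>G. g \<in> cyl_ideal X \<or> mp_eval g s \<noteq> 0" if G: "finite G" for G
  proof -
    define H where "H = {g\<in>G. g \<notin> cyl_ideal X}"
    have "\<forall>g. \<exists>c. g \<in> H \<longrightarrow> fixr c g \<notin> ideal X" by (auto simp: H_def cyl_ideal_iff)
    then obtain c where c: "\<And>g. g \<in> H \<Longrightarrow> fixr (c g) g \<notin> ideal X" by metis
    have "finite ((\<lambda>g. fixr (c g) g) ` H)" using G by (simp add: H_def)
    from cone_avoid[OF X this] obtain b where b: "b \<in> cone X"
      "\<And>g. g \<in> H \<Longrightarrow> mp_eval g (case_sum b (c g)) \<noteq> 0"
      using c by (auto simp: mp_eval_fixr)
    have "\<exists>l. \<forall>g\<in>fixl b ` H. mp_eval g l \<noteq> 0"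
    proof (rule affine_avoid)
      fix g' assume "g' \<in> fixl b ` H"
      then obtain g where "g \<in> H" "g' = fixl b g" by blast
      then show "\<exists>s. mp_eval g' s \<noteq> 0" using b(2) by (auto simp: mp_eval_fixl)
    qed (use G in \<open>simp add: H_def\<close>)
    then obtain l where "\<And>g. g \<in> H \<Longrightarrow> mp_eval g (case_sum b l) \<noteq> 0" by (auto simp: mp_eval_fixl)
    then show ?thesis using b(1) by (intro bexI[of _ "case_sum b l"]) (auto simp: cyl_def H_def)
  qed
  have "\<exists>s. (\<forall>j. (\<lambda>i. s i j) \<in> cyl X) \<and>
      (\<forall>g. eventually (\<lambda>j. g \<in> cyl_ideal X \<or> mp_eval g (\<lambda>i. s i j) \<noteq> 0) (oF :: 'k oidx filter))"
    by (rule saturation[where Q = "\<lambda>g a. g \<in> cyl_ideal X \<or> mp_eval g a \<noteq> 0"]) (rule avoid)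
  then obtain s where s: "\<And>j. (\<lambda>i. s i j) \<in> cyl X"
    "\<And>g. eventually (\<lambda>j. g \<in> cyl_ideal X \<or> mp_eval g (\<lambda>i. s i j) \<noteq> 0) (oF :: 'k oidx filter)" by blast
  define z where "z = (\<lambda>i. st (s i))"
  have inst: "inst (cyl X) z" unfolding z_def by (rule inst_range) (rule s)
  have "ev om g z = 0 \<longleftrightarrow> g \<in> cyl_ideal X" for g
  proof
    assume "g \<in> cyl_ideal X"
    then show "ev om g z = 0" by (intro inst_ev_0[OF inst]) (simp add: cyl_ideal_def)
  next
    assume "ev om g z = 0"
    then have "eventually (\<lambda>j. mp_eval g (\<lambda>i. s i j) = 0) (oF :: 'k oidx filter)"
      by (simp add: z_def st_ev st_eq_0)
    with s(2)[of g] have "eventually (\<lambda>j :: 'k oidx. g \<in> cyl_ideal X) oF"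
      by (rule eventually_elim2) auto
    then show "g \<in> cyl_ideal X" by simp
  qed
  then show ?thesis using inst by (auto simp: relations_def)
qed

section \<open>The locus of a point over an extension field\<close>

text \<open>The closure of the point over the ground field. Only homogeneous relations are used,
  because the relations of one coordinate vector need not form a homogeneous ideal.\<close>

definition locus :: "('k::field \<Rightarrow> 'f::field) \<Rightarrow> ('n::finite \<Rightarrow> 'f) \<Rightarrow> ('k, 'n) proj_space set" where
  "locus h z = {p. \<forall>f. homogeneous f \<and> ev h f z = 0 \<longrightarrow> vanishes f p}"

context
  fixes h :: "'k::{alg_closed_field, field_char_0} \<Rightarrow> 'f::field" and z :: "'n::finite \<Rightarrow> 'f"
  assumes h: "rhom h" and z: "\<exists>i. z i \<noteq> 0"
begin

lemma closed_locus: "closedin zariski (locus h z)"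
proof -
  have "locus h z = {p. \<forall>f\<in>{f. homogeneous f \<and> ev h f z = 0}. vanishes f p}" by (auto simp: locus_def)
  then show ?thesis by (simp only: zariski_locus(1))
qed

lemma vanishes_on_locus:
  assumes g: "homogeneous g"
  shows "(\<forall>p\<in>locus h z. vanishes g p) \<longleftrightarrow> ev h g z = 0"
proof
  assume van: "\<forall>p\<in>locus h z. vanishes g p"
  show "ev h g z = 0"
  proof (rule ccontr)
    assume nz: "ev h g z \<noteq> 0"
    obtain i where "z i \<noteq> 0" using z by blast
    \<comment> \<open>The extra factor keeps the specialized point away from the origin.\<close>
    then have "ev h (g * mp_var i) z \<noteq> 0" using nz by (simp add: ev_mult[OF h] ev_var[OF h])
    from nullstellensatz[OF h this] obtain b where b: "mp_eval (g * mp_var i) b \<noteq> 0"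
      "\<And>f. ev h f z = 0 \<Longrightarrow> mp_eval f b = 0" by blast
    define v where "v = (\<chi> i. b i)"
    have bv: "b = ($) v" by (simp add: v_def fun_eq_iff)
    have "b i \<noteq> 0" "mp_eval g b \<noteq> 0" using b(1) by (auto simp: mp_eval_ev ev_mult ev_var)
    then have v: "v \<in> hcoords (pt v)" by (intro hcoords_pt) (auto simp: v_def vec_eq_iff)
    have "pt v \<in> locus h z"
      unfolding locus_def using b(2) vanishes_iff[OF _ v] by (auto simp: bv)
    then have "mp_eval g (($) v) = 0" using van v by (auto simp: vanishes_def)
    then show False using \<open>mp_eval g b \<noteq> 0\<close> by (simp add: bv)
  qed
qed (use g in \<open>auto simp: locus_def\<close>)

lemma irreducible_locus: "irreducible_in zariski (locus h z)"
  unfolding irreducible_in_def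
proof (intro conjI allI impI; (elim conjE)?)
  show "locus h z \<noteq> {}"
    using vanishes_on_locus[OF homogeneous_one] by (auto simp: ev_1[OF h])
  fix C D assume C: "closedin zariski C" and D: "closedin zariski D" and sub: "locus h z \<subseteq> C \<union> D"
  show "locus h z \<subseteq> C \<or> locus h z \<subseteq> D"
  proof (rule ccontr)
    assume no: "\<not> ?thesis"
    obtain F where F: "\<And>f. f \<in> F \<Longrightarrow> homogeneous f" "C = {p. \<forall>f\<in>F. vanishes f p}"
      using C[unfolded closedin_zariski] by auto
    obtain G where G: "\<And>f. f \<in> G \<Longrightarrow> homogeneous f" "D = {p. \<forall>f\<in>G. vanishes f p}"
      using D[unfolded closedin_zariski] by auto
    have ex: "\<exists>f\<in>F. ev h f z \<noteq> 0" if "\<not> locus h z \<subseteq> {p. \<forall>f\<in>F. vanishes f p}" "\<And>f. f \<in> F \<Longrightarrow> homogeneous f" for F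
      using that vanishes_on_locus by blast
    obtain f where f: "f \<in> F" "ev h f z \<noteq> 0" using ex[of F] no F by blast
    obtain g where g: "g \<in> G" "ev h g z \<noteq> 0" using ex[of G] no G by blast
    have "vanishes (f * g) p" if "p \<in> locus h z" for p
    proof -
      have "vanishes f p \<or> vanishes g p" using that sub f(1) g(1) F(2) G(2) by blast
      then show ?thesis using vanishes_mult[OF F(1)[OF f(1)] G(1)[OF g(1)]] by simp
    qed
    then have "ev h (f * g) z = 0"
      using vanishes_on_locus[OF homogeneous_mult[OF F(1)[OF f(1)] G(1)[OF g(1)]]] by blast
    then show False using f g by (simp add: ev_mult[OF h])
  qed
qed simp

end

section \<open>Taylor homomorphisms\<close>

lemma leibniz:
  assumes D: "derivation (D :: 'r::comm_ring_1 \<Rightarrow> 'r)"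
  shows "(D ^^ m) (f * g) = (\<Sum>k\<le>m. of_nat (m choose k) * (D ^^ k) f * (D ^^ (m - k)) g)"
proof (induction m)
  case (Suc m)
  have Dn: "D (of_nat n * x) = of_nat n * D x" for n x
    by (induction n) (simp_all add: der_0[OF D] der_add[OF D] distrib_right)
  let ?a = "\<lambda>k. (D ^^ k) f" and ?b = "\<lambda>k. (D ^^ k) g"
  have "(D ^^ Suc m) (f * g) = (\<Sum>k\<le>m. D (of_nat (m choose k) * (?a k * ?b (m - k))))"
    using Suc.IH by (simp add: der_sum[OF D] mult.assoc)
  also have "\<dots> = (\<Sum>k\<le>m. of_nat (m choose k) * (?a k * ?b (Suc m - k)) + of_nat (m choose k) * (?a (Suc k) * ?b (m - k)))"
    by (intro sum.cong refl) (simp only: Dn, simp add: der_mult[OF D] Suc_diff_le algebra_simps)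
  also have "\<dots> = (\<Sum>k\<le>m. of_nat (m choose k) * (?a k * ?b (Suc m - k)))
      + (\<Sum>k\<le>m. of_nat (m choose k) * (?a (Suc k) * ?b (m - k)))"
    by (rule sum.distrib)
  also have "(\<Sum>k\<le>m. of_nat (m choose k) * (?a k * ?b (Suc m - k)))
      = ?a 0 * ?b (Suc m) + (\<Sum>k\<le>m. of_nat (m choose Suc k) * (?a (Suc k) * ?b (m - k)))"
    (is "?L = _")
  proof -
    have "?L = (\<Sum>k\<le>Suc m. of_nat (m choose k) * (?a k * ?b (Suc m - k)))"
      by (simp add: binomial_eq_0)
    also have "\<dots> = ?a 0 * ?b (Suc m) + (\<Sum>k\<le>m. of_nat (m choose Suc k) * (?a (Suc k) * ?b (m - k)))"
      by (subst sum.atMost_Suc_shift) simp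
    finally show ?thesis .
  qed
  finally have "(D ^^ Suc m) (f * g) = ?a 0 * ?b (Suc m)
      + (\<Sum>k\<le>m. of_nat (Suc m choose Suc k) * (?a (Suc k) * ?b (m - k)))"
    by (simp add: sum.distrib algebra_simps)
  then show ?case by (subst sum.atMost_Suc_shift) (simp add: mult.assoc)
qed simp

text \<open>The formal flow of \<open>D\<close>, that is the exponential of \<open>D\<close> times
  the series variable, followed by \<open>e\<close>. The Leibniz rule for higher powers makes it
  multiplicative.\<close>

definition taylor :: "('r \<Rightarrow> 'r) \<Rightarrow> ('r \<Rightarrow> 'f) \<Rightarrow> 'r \<Rightarrow> 'f::field_char_0 fps" where
  "taylor D e g = Abs_fps (\<lambda>m. e ((D ^^ m) g) / fact m)"

context
  fixes D :: "'r::comm_ring_1 \<Rightarrow> 'r" and e :: "'r \<Rightarrow> 'f::field_char_0"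
  assumes D: "derivation D" and e: "rhom e"
begin

lemma funpow_der_add: "(D ^^ m) (f + g) = (D ^^ m) f + (D ^^ m) g"
  by (induction m) (simp_all add: der_add[OF D])

lemma rhom_taylor: "rhom (taylor D e)"
  unfolding rhom_def
proof (intro conjI allI)
  have "(D ^^ m) 1 = (if m = 0 then 1 else 0)" for m
    by (induction m) (simp_all add: der_0[OF D] der_1[OF D])
  then show "taylor D e 1 = 1"
    by (intro fps_ext) (simp add: taylor_def rhom_1[OF e] rhom_0[OF e])
  show "taylor D e (f + g) = taylor D e f + taylor D e g" for f g
    by (intro fps_ext) (simp add: taylor_def funpow_der_add rhom_add[OF e] add_divide_distrib)
  show "taylor D e (f * g) = taylor D e f * taylor D e g" for f g
  proof (intro fps_ext)
    fix m
    have "of_nat (m choose k) * e ((D ^^ k) f) * e ((D ^^ (m - k)) g) / fact m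
        = e ((D ^^ k) f) / fact k * (e ((D ^^ (m - k)) g) / fact (m - k))" if "k \<le> m" for k
    proof -
      have "of_nat (m choose k) / fact m = (1 :: 'f) / (fact k * fact (m - k))"
        using that by (simp add: binomial_fact)
      then show ?thesis by (simp add: field_simps)
    qed
    then have "(\<Sum>k\<le>m. of_nat (m choose k) * e ((D ^^ k) f) * e ((D ^^ (m - k)) g) / fact m)
        = (\<Sum>k\<le>m. e ((D ^^ k) f) / fact k * (e ((D ^^ (m - k)) g) / fact (m - k)))"
      by (intro sum.cong refl) auto
    then show "fps_nth (taylor D e (f * g)) m = fps_nth (taylor D e f * taylor D e g) m"
      by (simp add: taylor_def leibniz[OF D] rhom_sum[OF e] rhom_mult[OF e] rhom_of_nat[OF e]
          fps_mult_nth sum_divide_distrib atLeast0AtMost)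
  qed
qed

lemma taylor_deriv: "fps_deriv (taylor D e g) = taylor D e (D g)"
proof (rule fps_ext)
  fix m
  have "(D ^^ Suc m) g = (D ^^ m) (D g)" by (simp add: funpow_swap1)
  then show "fps_nth (fps_deriv (taylor D e g)) m = fps_nth (taylor D e (D g)) m"
    using fact_nonzero[of m, where 'a = 'f] of_nat_neq_0[of m, where 'a = 'f]
    by (simp add: taylor_def divide_simps del: of_nat_Suc)
qed

lemma taylor_const: "D g = 0 \<Longrightarrow> taylor D e g = fps_const (e g)"
proof -
  assume g: "D g = 0"
  have "(D ^^ m) g = (if m = 0 then g else 0)" for m
    by (induction m) (simp_all add: g der_0[OF D])
  then show ?thesis by (intro fps_ext) (simp add: taylor_def rhom_0[OF e])
qed

end

section \<open>Formal curves at a regular point\<close>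

text \<open>Numerators of Cramer's rule: divided by the determinant of the frame they form the
  vector dual to row \<open>l\<close>. Clearing the denominator makes them polynomials.\<close>

definition cofield :: "'n set \<Rightarrow> ('n \<Rightarrow> ('k::field, 'n::finite) mpoly) \<Rightarrow> ('n \<Rightarrow> 'k ^ 'n) \<Rightarrow> 'n \<Rightarrow> 'n
    \<Rightarrow> ('k, 'n) mpoly" where
  "cofield B f e l i = det (\<chi> r s. if s = i then (if r = l then 1 else 0) else frame_poly B f e $ r $ s)"

definition cofield_vec :: "('k::field \<Rightarrow> 'f::field) \<Rightarrow> 'n set \<Rightarrow> ('n \<Rightarrow> ('k, 'n::finite) mpoly) \<Rightarrow> ('n \<Rightarrow> 'k ^ 'n)
    \<Rightarrow> ('n \<Rightarrow> 'f) \<Rightarrow> 'n \<Rightarrow> 'f ^ 'n" where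
  "cofield_vec h B f e z l = (\<chi> i. ev h (cofield B f e l i) z)"

context
  fixes h :: "'k::field \<Rightarrow> 'f::field" and B and f :: "'n::finite \<Rightarrow> ('k, 'n) mpoly" and e z
  assumes h: "rhom h" and det: "det (frame h B f e z) \<noteq> 0"
begin

lemma cofield_cramer:
  "dot (frame h B f e z $ r) (cofield_vec h B f e z l) = (if r = l then det (frame h B f e z) else 0)"
proof -
  let ?M = "frame h B f e z"
  have fp: "ev h (frame_poly B f e $ r $ s) z = ?M $ r $ s" for r s
    by (simp add: frame_poly_def frame_def ev_const[OF h])
  have v: "ev h (cofield B f e l i) z = det (\<chi> r s. if s = i then axis l 1 $ r else ?M $ r $ s)" for i
    unfolding cofield_def rhom_det[OF rhom_ev[OF h]]
    by (rule arg_cong[where f = det]) (auto simp: vec_eq_iff axis_def ev_1[OF h] fp)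
  obtain x where x: "?M *v x = axis l 1" using nonsingular_solve[OF det] by blast
  have "x = (\<chi> i. det (\<chi> r s. if s = i then axis l 1 $ r else ?M $ r $ s) / det ?M)"
    using cramer[of ?M x "axis l 1"] x det by simp
  then have "cofield_vec h B f e z l = det ?M *s x"
    using det by (simp add: vec_eq_iff v cofield_vec_def)
  moreover have "dot (?M $ r) x = (if r = l then 1 else 0)"
    using x by (simp add: matrix_dot[symmetric] axis_def)
  ultimately show ?thesis by (simp add: dot_scale_right)
qed

text \<open>The Cramer vectors belonging to rows outside \<open>B\<close> span the annihilator of
  the rows in \<open>B\<close>.\<close>

lemma kills_ann_iff:
  "(\<forall>v\<in>ann ((\<lambda>i. frame h B f e z $ i) ` B). dot u v = 0) \<longleftrightarrow>
    (\<forall>l. l \<notin> B \<longrightarrow> dot u (cofield_vec h B f e z l) = 0)"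
proof (intro iffI allI impI ballI)
  fix l assume "\<forall>v\<in>ann ((\<lambda>i. frame h B f e z $ i) ` B). dot u v = 0" "l \<notin> B"
  moreover have "cofield_vec h B f e z l \<in> ann ((\<lambda>i. frame h B f e z $ i) ` B)" if "l \<notin> B"
    using that by (auto simp: ann_def cofield_cramer)
  ultimately show "dot u (cofield_vec h B f e z l) = 0" by blast
next
  let ?M = "frame h B f e z"
  fix v assume u: "\<forall>l. l \<notin> B \<longrightarrow> dot u (cofield_vec h B f e z l) = 0"
    and v: "v \<in> ann ((\<lambda>i. ?M $ i) ` B)"
  let ?w = "\<Sum>l\<in>- B. (dot (?M $ l) v / det ?M) *s cofield_vec h B f e z l"
  have "?M *v v = ?M *v ?w"
  proof (simp only: vec_eq_iff matrix_dot, intro allI)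
    fix r
    have "dot (?M $ r) ?w = (\<Sum>l\<in>- B. if l = r then dot (?M $ l) v else 0)"
      unfolding dot_commute[of "?M $ r"] dot_sum_left dot_scale_left
      by (intro sum.cong refl) (simp add: dot_commute[of _ "?M $ r"] cofield_cramer det)
    also have "\<dots> = dot (?M $ r) v" using v by (auto simp: sum.delta ann_def)
    finally show "dot (?M $ r) v = dot (?M $ r) ?w" ..
  qed
  then have "v = ?w" by (rule nonsingular_inj[OF det])
  then have "dot u v = dot u ?w" by simp
  also have "\<dots> = 0"
    unfolding dot_commute[of u] dot_sum_left dot_scale_left
    using u by (intro sum.neutral) (simp add: dot_commute[of _ u])
  finally show "dot u v = 0" .
qed

end

text \<open>At a regular point with coordinates \<open>a\<close> a frame of gradients yields polynomial vector fields
  \<open>vfield l\<close> by Cramer's rule. They are tangent to the variety, and the constant rows of the frame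
  are dual to them up to the factor \<open>det (frame_poly B f e)\<close>. The formal flow of a linear
  combination of them starting in \<open>a\<close>, with generic coefficients supported in \<open>A\<close>, is a point of
  the variety over a field of Laurent series; its locus is the member of the chain belonging
  to \<open>A\<close>.\<close>

locale regular_frame =
  fixes X :: "('k::{alg_closed_field, field_char_0}, 'n::finite) proj_space set"
    and B :: "'n set" and f :: "'n \<Rightarrow> ('k, 'n) mpoly" and e :: "'n \<Rightarrow> 'k ^ 'n"
    and a :: "'k ^ 'n" and i0 :: 'n and c :: "'n \<Rightarrow> 'k omega"
  assumes irr: "irreducible_in zariski X" and closed: "closedin zariski X"
    and f: "\<And>i. i \<in> B \<Longrightarrow> f i \<in> ideal X" and card_B: "card B + pdim X = CARD('n)"
    and a: "a \<noteq> 0" "pt a \<in> X" and nonsing: "mp_eval (det (frame_poly B f e)) (($) a) \<noteq> 0"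
    and i0: "i0 \<notin> B" "dot (e i0) a \<noteq> 0"
    and c: "\<And>g. ev om g c = 0 \<Longrightarrow> mp_eval g s = 0"
begin

abbreviation disc :: "('k, 'n) mpoly" where "disc \<equiv> det (frame_poly B f e)"

abbreviation vfield :: "'n \<Rightarrow> 'n \<Rightarrow> ('k, 'n) mpoly" where "vfield \<equiv> cofield B f e"

text \<open>A vector field with undetermined coefficients: the variables \<open>Inr l\<close> are
  the coefficients, and \<open>D\<close> treats them as constants.\<close>

definition D :: "('k, 'n + 'n) mpoly \<Rightarrow> ('k, 'n + 'n) mpoly" where
  "D g = (\<Sum>i\<in>UNIV. (\<Sum>l\<in>- B. mp_var (Inr l) * mp_subst (\<lambda>i. mp_var (Inl i)) (vfield l i)) * mp_pderiv (Inl i) g)"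

abbreviation up :: "('k, 'n) mpoly \<Rightarrow> ('k, 'n + 'n) mpoly" where
  "up \<equiv> mp_subst (\<lambda>i. mp_var (Inl i))"

lemma derivation_D: "derivation D"
proof -
  define w where "w i = (\<Sum>l\<in>- B. mp_var (Inr l) * up (vfield l i))" for i
  have "D g = (\<Sum>i\<in>UNIV. w i * mp_pderiv (Inl i) g)" for g
    by (simp add: D_def w_def)
  then show ?thesis
    by (simp add: derivation_def mp_pderiv_add mp_pderiv_mult distrib_left sum.distrib sum_distrib_left mult_ac)
qed

lemma mp_eval_up: "mp_eval (up g) (case_sum b s) = mp_eval g b"
  by (simp add: mp_eval_ev ev_subst ev_var)

lemma vfield_cramer:
  assumes det: "mp_eval disc b \<noteq> 0"
  shows "dot (frame (\<lambda>x. x) B f e b $ r) (\<chi> i. mp_eval (vfield l i) b) = (if r = l then mp_eval disc b else 0)"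
  using cofield_cramer[OF rhom_id, of B f e b r l] det
  by (simp add: mp_eval_ev ev_frame_det cofield_vec_def)

lemma disc_nonzero: "disc \<notin> ideal X"
  using nonsing a hcoords_pt[OF a(1)] by (auto simp: ideal_def vanishes_def)

text \<open>The points where \<open>disc\<close> is nonzero are dense, because the ideal of
  \<open>X\<close> is prime and does not contain \<open>disc\<close>.\<close>

lemma cyl_idealI:
  assumes "\<And>b s. b \<in> cone X \<Longrightarrow> mp_eval disc b \<noteq> 0 \<Longrightarrow> mp_eval g (case_sum b s) = 0"
  shows "g \<in> cyl_ideal X"
  unfolding cyl_ideal_iff
proof
  fix s
  have "disc * fixr s g \<in> ideal X"
    using assms by (auto simp: ideal_iff mp_eval_mult mp_eval_fixr)
  then show "fixr s g \<in> ideal X" using ideal_prime[OF irr] disc_nonzero by blast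
qed

lemma mp_eval_D: "mp_eval (D g) (case_sum b s) =
    (\<Sum>i\<in>UNIV. (\<Sum>l\<in>- B. s l * mp_eval (vfield l i) b) * mp_eval (mp_pderiv (Inl i) g) (case_sum b s))"
  unfolding D_def mp_eval_sum mp_eval_mult mp_eval_up by (simp add: mp_eval_ev ev_var)

text \<open>Where \<open>disc\<close> is nonzero, the vector field is orthogonal to the gradients of
  the frame and hence tangent to \<open>X\<close>, so it kills the equations of \<open>X\<close>
  there.\<close>

lemma D_cyl_ideal:
  assumes g: "g \<in> cyl_ideal X"
  shows "D g \<in> cyl_ideal X"
proof (rule cyl_idealI)
  fix b s assume b: "b \<in> cone X" and det: "mp_eval disc b \<noteq> 0"
  obtain v x where v: "b = ($) v" "x \<in> X" "v \<in> hcoords x" using b by (auto simp: cone_def)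
  have der: "derivation (mp_pderiv i :: ('k, 'n) mpoly \<Rightarrow> _)" for i
    by (simp add: derivation_def mp_pderiv_add mp_pderiv_mult)
  have "mp_pderiv i (fixr s g) = fixr s (mp_pderiv (Inl i) g)" for i
  proof -
    let ?\<sigma> = "case_sum mp_var (\<lambda>l. mp_const (s l)) :: 'n + 'n \<Rightarrow> ('k, 'n) mpoly"
    have "mp_pderiv i (fixr s g) = (\<Sum>j\<in>UNIV. ev mp_const (mp_pderiv j g) ?\<sigma> * mp_pderiv i (?\<sigma> j))"
      unfolding fixr_def mp_subst_def by (rule der_ev[OF der rhom_mp_const]) simp
    also have "\<dots> = (\<Sum>j\<in>UNIV. if j = Inl i then ev mp_const (mp_pderiv j g) ?\<sigma> else 0)"
      by (intro sum.cong refl) (auto simp: mp_pderiv_var split: sum.splits)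
    finally show ?thesis by (simp add: sum.delta fixr_def mp_subst_def)
  qed
  then have pd: "mp_eval (mp_pderiv (Inl i) g) (case_sum b s) = grad (\<lambda>x. x) (fixr s g) b $ i" for i
    by (simp add: mp_eval_fixr[symmetric] mp_eval_ev[symmetric])
  let ?w = "\<Sum>l\<in>- B. s l *s (\<chi> i. mp_eval (vfield l i) b)"
  have "dot (frame (\<lambda>x. x) B f e b $ r) ?w = 0" if "r \<in> B" for r
  proof -
    have "dot (frame (\<lambda>x. x) B f e b $ r) ?w =
        (\<Sum>l\<in>- B. s l * dot (frame (\<lambda>x. x) B f e b $ r) (\<chi> i. mp_eval (vfield l i) b))"
      by (simp add: dot_commute[of "frame (\<lambda>x. x) B f e b $ r"] dot_sum_left dot_scale_left)
    also have "\<dots> = 0"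
      unfolding vfield_cramer[OF det] using that by (intro sum.neutral) auto
    finally show ?thesis .
  qed
  moreover have "tangent_lin X x = ann ((\<lambda>i. frame (\<lambda>x. x) B f e b $ i) ` B)"
    unfolding v(1) by (rule regular_if_frame(2)[OF irr v(2,3) f card_B]) (use det v(1) in auto)
  ultimately have "?w \<in> tangent_lin X x" unfolding ann_def by blast
  then have "?w \<in> tang (\<lambda>x. x) (ideal X) b" by (simp add: tangent_lin_eq[OF v(2,3)] v(1))
  moreover have "fixr s g \<in> ideal X" using g by (simp add: cyl_ideal_iff)
  ultimately have "dot (grad (\<lambda>x. x) (fixr s g) b) ?w = 0" by (auto simp: tang_def ann_def)
  then show "mp_eval (D g) (case_sum b s) = 0"
    unfolding mp_eval_D pd by (simp add: dot_def mult.commute)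
qed

text \<open>Along the flow the linear form \<open>e r\<close> moves with speed "coefficient number
  \<open>r\<close> times \<open>disc\<close>"; this tells the curves for different \<open>A\<close>
  apart.\<close>

lemma D_row:
  assumes r: "r \<notin> B"
  shows "D (up (\<Sum>j\<in>UNIV. mp_const (e r $ j) * mp_var j)) - mp_var (Inr r) * up disc \<in> cyl_ideal X"
proof (rule cyl_idealI)
  fix b s assume b: "b \<in> cone X" and det: "mp_eval disc b \<noteq> 0"
  have up_lin: "up (\<Sum>j\<in>UNIV. mp_const (e r $ j) * mp_var j) = (\<Sum>j\<in>UNIV. mp_const (e r $ j) * mp_var (Inl j))"
    unfolding mp_subst_def by (simp add: ev_simps[OF rhom_mp_const])
  have "mp_pderiv (Inl i) (\<Sum>j\<in>UNIV. mp_const (e r $ j) * mp_var (Inl j) :: ('k, 'n + 'n) mpoly) = mp_const (e r $ i)" for i :: 'n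
  proof -
    have "mp_pderiv (Inl i) (\<Sum>j\<in>UNIV. mp_const (e r $ j) * mp_var (Inl j) :: ('k, 'n + 'n) mpoly)
        = (\<Sum>j\<in>UNIV. if j = i then mp_const (e r $ j) else (0 :: ('k, 'n + 'n) mpoly))"
      unfolding mp_pderiv_sum by (intro sum.cong refl) (auto simp: mp_pderiv_mult mp_pderiv_var)
    then show ?thesis by (simp add: sum.delta)
  qed
  then have "mp_eval (D (up (\<Sum>j\<in>UNIV. mp_const (e r $ j) * mp_var j))) (case_sum b s)
      = (\<Sum>i\<in>UNIV. (\<Sum>l\<in>- B. s l * mp_eval (vfield l i) b) * e r $ i)"
    unfolding mp_eval_D up_lin by (simp add: mp_eval_ev ev_const)
  also have "\<dots> = (\<Sum>l\<in>- B. s l * dot (e r) (\<chi> i. mp_eval (vfield l i) b))"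
    unfolding dot_def sum_distrib_right sum_distrib_left by (subst sum.swap) (simp add: mult_ac)
  also have "\<dots> = (\<Sum>l\<in>- B. if l = r then s l * mp_eval disc b else 0)"
  proof (intro sum.cong refl)
    fix l assume "l \<in> - B"
    have "frame (\<lambda>x. x) B f e b $ r = e r" using r by (simp add: frame_def vec_eq_iff)
    then show "s l * dot (e r) (\<chi> i. mp_eval (vfield l i) b) = (if l = r then s l * mp_eval disc b else 0)"
      using vfield_cramer[OF det, of r l] by auto
  qed
  also have "\<dots> = s r * mp_eval disc b" using r by (simp add: sum.delta)
  finally show "mp_eval (D (up (\<Sum>j\<in>UNIV. mp_const (e r $ j) * mp_var j)) - mp_var (Inr r) * up disc) (case_sum b s) = 0"
    using mp_eval_up[of disc b s]
    by (simp add: mp_eval_ev ev_diff ev_mult ev_var)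
qed

definition cmask :: "'n set \<Rightarrow> 'n \<Rightarrow> 'k omega" where
  "cmask A = (\<lambda>l. if l \<in> A then c l else 0)"

definition base :: "'n set \<Rightarrow> ('k, 'n + 'n) mpoly \<Rightarrow> 'k omega" where
  "base A g = ev om g (case_sum (\<lambda>i. om (a $ i)) (cmask A))"

definition curve :: "'n set \<Rightarrow> ('k, 'n + 'n) mpoly \<Rightarrow> 'k omega fps" where
  "curve A = taylor D (base A)"

lemma rhom_base: "rhom (base A)"
  unfolding base_def by (rule rhom_ev[OF rhom_om])

lemma rhom_curve: "rhom (curve A)"
  unfolding curve_def by (rule rhom_taylor[OF derivation_D rhom_base])

lemma om_0: "om 0 = 0" by (rule rhom_0[OF rhom_om])

lemma base_cyl_ideal: "g \<in> cyl_ideal X \<Longrightarrow> base A g = 0"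
proof -
  assume g: "g \<in> cyl_ideal X"
  have "\<forall>l. \<exists>s. cmask A l = st s" using st_surj by blast
  then obtain s where s: "\<And>l. cmask A l = st (s l)" by metis
  have eq: "case_sum (\<lambda>i. om (a $ i)) (cmask A) = (\<lambda>i. st (case_sum (\<lambda>i j. a $ i) s i))"
    by (auto simp: fun_eq_iff om_def s split: sum.splits)
  have "inst (cyl X) (case_sum (\<lambda>i. om (a $ i)) (cmask A))"
    unfolding eq
  proof (rule inst_range)
    fix j
    have "(\<lambda>i. case_sum (\<lambda>i j. a $ i) s i j) = case_sum (($) a) (\<lambda>l. s l j)"
      by (auto simp: fun_eq_iff split: sum.splits)
    moreover have "($) a \<in> cone X" using a hcoords_pt[OF a(1)] by (auto simp: cone_def)
    ultimately show "(\<lambda>i. case_sum (\<lambda>i j. a $ i) s i j) \<in> cyl X" by (auto simp: cyl_def)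
  qed
  then show ?thesis
    unfolding base_def by (rule inst_ev_0) (use g in \<open>auto simp: cyl_ideal_def\<close>)
qed

lemma curve_cyl_ideal: "g \<in> cyl_ideal X \<Longrightarrow> curve A g = 0"
proof -
  assume g: "g \<in> cyl_ideal X"
  have "(D ^^ m) g \<in> cyl_ideal X" for m by (induction m) (simp_all add: g D_cyl_ideal)
  then show ?thesis
    by (intro fps_ext) (simp add: curve_def taylor_def base_cyl_ideal)
qed

text \<open>A relation satisfied by the generic coefficients supported in \<open>A'\<close> is an
  identity in them, so it persists when those outside \<open>A\<close> are set to zero.\<close>

lemma base_mono:
  assumes "A \<subseteq> A'" and g: "base A' g = 0"
  shows "base A g = 0"
proof -
  define q where "q A = mp_subst (case_sum (\<lambda>i. mp_const (a $ i)) (\<lambda>l. if l \<in> A then mp_var l else 0)) g" for A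
  have ev_q: "ev h (q A) s = ev h g (case_sum (\<lambda>i. h (a $ i)) (\<lambda>l. if l \<in> A then s l else 0))"
    if "rhom h" for h :: "'k \<Rightarrow> 'r::comm_ring_1" and A s
    unfolding q_def ev_subst[OF that]
    by (rule arg_cong[where f = "ev h g"]) (auto simp: fun_eq_iff ev_simps[OF that] split: sum.splits)
  have "ev om (q A') c = 0" using g by (simp add: ev_q[OF rhom_om] base_def cmask_def)
  then have q': "mp_eval (q A') s = 0" for s using c by blast
  have "mp_eval (q A) s = 0" for s
  proof -
    have "mp_eval (q A) s = mp_eval (q A') (\<lambda>l. if l \<in> A then s l else 0)"
      unfolding mp_eval_ev ev_q[OF rhom_id]
      by (rule arg_cong[where f = "ev (\<lambda>x. x) g"]) (use assms(1) in \<open>auto simp: fun_eq_iff split: sum.splits\<close>)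
    then show ?thesis using q' by simp
  qed
  moreover have "inst UNIV c"
  proof -
    have "\<forall>l. \<exists>s. c l = st s" using st_surj by blast
    then obtain s where s: "\<And>l. c l = st (s l)" by metis
    have "c = (\<lambda>l. st (s l))" using s by blast
    then show ?thesis by (simp add: inst_range)
  qed
  ultimately have "ev om (q A) c = 0" by (intro inst_ev_0) auto
  then show ?thesis by (simp add: ev_q[OF rhom_om] base_def cmask_def)
qed

definition emb :: "'k \<Rightarrow> 'k omega fls" where
  "emb k = fps_to_fls (fps_const (om k))"

definition point :: "'n set \<Rightarrow> 'n \<Rightarrow> 'k omega fls" where
  "point A i = fps_to_fls (curve A (mp_var (Inl i)))"

lemma rhom_fps_to_fls: "rhom (fps_to_fls :: 'a::field fps \<Rightarrow> 'a fls)"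
  by (simp add: rhom_def fls_times_fps_to_fls)

lemma D_const: "D (mp_const k) = 0"
  by (simp add: D_def)

lemma rhom_emb: "rhom emb"
  unfolding emb_def
  by (intro rhom_comp[OF rhom_fps_to_fls] rhom_comp[OF _ rhom_om])
    (simp add: rhom_def fps_const_add fps_const_mult)

lemma ev_point: "ev emb g (point A) = fps_to_fls (curve A (up g))"
proof -
  have "curve A (mp_const k) = fps_const (om k)" for k
    unfolding curve_def using taylor_const[OF derivation_D rhom_base D_const]
    by (simp add: base_def ev_const[OF rhom_om])
  then have "fps_to_fls (curve A (up g)) = ev (\<lambda>k. fps_to_fls (fps_const (om k))) g (\<lambda>i. fps_to_fls (curve A (mp_var (Inl i))))"
    unfolding mp_subst_def
    by (subst rhom_ev_comp[OF rhom_comp[OF rhom_fps_to_fls rhom_curve] rhom_mp_const]) simp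
  then show ?thesis by (simp add: emb_def[abs_def] point_def[abs_def])
qed

lemma ev_point_0: "ev emb g (point A) = 0 \<longleftrightarrow> curve A (up g) = 0"
  unfolding ev_point by simp

lemma curve_nth_0: "fps_nth (curve A (up g)) 0 = om (mp_eval g (($) a))"
proof -
  have "base A (up g) = ev om g (\<lambda>i. om (a $ i))"
    by (simp add: base_def ev_subst[OF rhom_om] ev_var[OF rhom_om])
  also have "\<dots> = om (mp_eval g (($) a))"
    unfolding mp_eval_ev using rhom_ev_comp[OF rhom_om rhom_id, of g "($) a"] by simp
  finally show ?thesis by (simp add: curve_def taylor_def)
qed

lemma point_nonzero: "\<exists>i. point A i \<noteq> 0"
proof -
  obtain i where i: "a $ i \<noteq> 0" using a(1) by (auto simp: vec_eq_iff)
  have "up (mp_var i) = mp_var (Inl i)" unfolding mp_subst_def by (simp add: ev_var[OF rhom_mp_const])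
  then have "fps_nth (curve A (mp_var (Inl i))) 0 = om (a $ i)"
    using curve_nth_0[of A "mp_var i"] by (simp add: mp_eval_ev ev_var)
  then have "curve A (mp_var (Inl i)) \<noteq> 0" using i rhom_eq_0_iff[OF rhom_om, of "a $ i"] by force
  then show ?thesis by (auto simp: point_def intro!: exI[of _ i])
qed

lemmas locus_point = closed_locus[OF rhom_emb point_nonzero] irreducible_locus[OF rhom_emb point_nonzero]
  vanishes_on_locus[OF rhom_emb point_nonzero]

lemma mem_locus: "pt a \<in> locus emb (point A)"
  unfolding locus_def
proof (intro CollectI allI impI; elim conjE)
  fix g assume g: "homogeneous g" "ev emb g (point A) = 0"
  then have "om (mp_eval g (($) a)) = 0" using curve_nth_0[of A g] by (simp add: ev_point_0)
  then show "vanishes g (pt a)"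
    using vanishes_iff[OF g(1) hcoords_pt[OF a(1)]] rhom_eq_0_iff[OF rhom_om] by blast
qed

lemma locus_subset: "locus emb (point A) \<subseteq> X"
proof
  fix p assume p: "p \<in> locus emb (point A)"
  obtain F where F: "\<And>g. g \<in> F \<Longrightarrow> homogeneous g" "X = {p. \<forall>g\<in>F. vanishes g p}"
    using closed[unfolded closedin_zariski] by auto
  have "vanishes g p" if g: "g \<in> F" for g
  proof -
    have "g \<in> ideal X" using g F(2) by (auto simp: ideal_def)
    then have "up g \<in> cyl_ideal X" by (auto simp: cyl_ideal_def cyl_def mp_eval_up ideal_iff)
    then have "ev emb g (point A) = 0" by (simp add: ev_point_0 curve_cyl_ideal)
    then show ?thesis using p F(1)[OF g] by (auto simp: locus_def)
  qed
  then show "p \<in> X" using F(2) by simp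
qed

lemma locus_mono:
  assumes "A \<subseteq> A'"
  shows "locus emb (point A) \<subseteq> locus emb (point A')"
proof -
  have "curve A g = 0" if "curve A' g = 0" for g
  proof (rule fps_ext)
    fix m
    have "fps_nth (curve A' g) m = 0" using that by simp
    then have "base A' ((D ^^ m) g) = 0" by (simp add: curve_def taylor_def)
    then show "fps_nth (curve A g) m = fps_nth 0 m"
      using base_mono[OF assms] by (simp add: curve_def taylor_def)
  qed
  then show ?thesis by (auto simp: locus_def ev_point_0)
qed

text \<open>The form \<open>g\<close> is \<open>e l\<close> minus the multiple of
  \<open>e i0\<close> that makes it vanish at \<open>a\<close>. As \<open>i0\<close> is never in
  \<open>A\<close>, the form \<open>e i0\<close> is constant along the curves. Without
  \<open>l\<close> in the support \<open>g\<close> stays zero along the curve; with \<open>l\<close>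
  its initial speed is \<open>c l\<close> times the value of \<open>disc\<close> at
  \<open>a\<close>, which is nonzero.\<close>

lemma locus_strict:
  assumes l: "l \<notin> B" "l \<noteq> i0" "l \<notin> A" "i0 \<notin> A"
  shows "locus emb (point A) \<noteq> locus emb (point (insert l A))"
proof -
  define lin where "lin r = (\<Sum>j\<in>UNIV. mp_const (e r $ j) * mp_var j)" for r
  define k where "k = dot (e l) a / dot (e i0) a"
  define g where "g = lin l - mp_const k * lin i0"
  have g_eq: "g = (\<Sum>j\<in>UNIV. Poly_Mapping.single (Poly_Mapping.single j 1) (e l $ j - k * e i0 $ j))"
    by (simp add: g_def lin_def mp_const_def mp_var_def mult_single sum_distrib_left sum_subtractf[symmetric] single_diff)
  have "homogeneous_in UNIV 1 g"
    unfolding homogeneous_in_def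
  proof
    fix m assume "m \<in> Poly_Mapping.keys g"
    then have "(\<Sum>j\<in>UNIV. Poly_Mapping.lookup (Poly_Mapping.single (Poly_Mapping.single j 1) (e l $ j - k * e i0 $ j)) m) \<noteq> 0"
      by (simp only: g_eq in_keys_iff lookup_sum) simp
    then obtain j where "Poly_Mapping.lookup (Poly_Mapping.single (Poly_Mapping.single j 1) (e l $ j - k * e i0 $ j)) m \<noteq> 0"
      by (rule sum.not_neutral_contains_not_neutral)
    then have "\<exists>j. m = Poly_Mapping.single j 1" by (auto simp: lookup_single when_def split: if_splits)
    then show "(\<Sum>i\<in>UNIV. Poly_Mapping.lookup m i) = 1" by (auto simp: lookup_single when_def sum.delta)
  qed
  then have hom: "homogeneous g" by (auto simp: homogeneous_def)
  have ev_lin: "mp_eval (lin r) (($) a) = dot (e r) a" for r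
    by (simp add: lin_def mp_eval_ev ev_simps dot_def)
  have g0: "fps_nth (curve A (up g)) 0 = 0" for A
  proof -
    have "mp_eval g (($) a) = 0"
      using i0(2) ev_lin[of l] ev_lin[of i0] by (simp add: g_def mp_eval_ev ev_simps k_def)
    then show ?thesis by (simp add: curve_nth_0 om_0)
  qed
  have deriv_lin: "fps_deriv (curve A (up (lin r))) = fps_const (cmask A r) * curve A (up disc)"
    if r: "r \<notin> B" for r A
  proof -
    have "curve A (D (up (lin r)) - mp_var (Inr r) * up disc) = 0"
      unfolding lin_def by (rule curve_cyl_ideal[OF D_row[OF r]])
    then have "curve A (D (up (lin r))) = curve A (mp_var (Inr r)) * curve A (up disc)"
      by (simp add: rhom_diff[OF rhom_curve] rhom_mult[OF rhom_curve])
    moreover have "D (mp_var (Inr r)) = 0" by (simp add: D_def mp_pderiv_var)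
    then have "curve A (mp_var (Inr r)) = fps_const (cmask A r)"
      unfolding curve_def by (subst taylor_const[OF derivation_D rhom_base]) (simp_all add: base_def ev_var[OF rhom_om])
    ultimately show ?thesis unfolding curve_def by (simp add: taylor_deriv[OF derivation_D rhom_base])
  qed
  have up_g: "up g = up (lin l) - mp_const k * up (lin i0)"
    unfolding g_def mp_subst_def by (simp add: ev_simps[OF rhom_mp_const])
  have deriv_g: "fps_deriv (curve A (up g)) = fps_const (cmask A l) * curve A (up disc)" if "i0 \<notin> A" for A
  proof -
    have "curve A (mp_const k) = fps_const (om k)"
      unfolding curve_def using taylor_const[OF derivation_D rhom_base D_const]
      by (simp add: base_def ev_const[OF rhom_om])
    then have "curve A (up g) = curve A (up (lin l)) - fps_const (om k) * curve A (up (lin i0))"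
      unfolding up_g by (simp add: rhom_diff[OF rhom_curve] rhom_mult[OF rhom_curve])
    then show ?thesis using that l(1) i0(1) by (simp add: deriv_lin cmask_def)
  qed
  have "fps_deriv (curve A (up g)) = 0" using deriv_g[OF l(4)] l(3) by (simp add: cmask_def)
  then have "curve A (up g) = 0" using g0[of A] by (simp add: fps_deriv_eq_0_iff)
  then have 1: "\<forall>p\<in>locus emb (point A). vanishes g p" by (simp add: locus_point(3)[OF hom] ev_point_0)
  have cl: "c l \<noteq> 0"
  proof
    assume "c l = 0"
    then have "mp_eval (mp_var l) (\<lambda>i. 1) = (0::'k)" by (intro c) (simp add: ev_var[OF rhom_om])
    then show False by (simp add: mp_eval_ev ev_var)
  qed
  let ?A = "insert l A"
  have "fps_nth (fps_deriv (curve ?A (up g))) 0 = c l * om (mp_eval disc (($) a))"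
    using deriv_g[of ?A] l by (simp add: cmask_def curve_nth_0)
  then have "curve ?A (up g) \<noteq> 0" using cl nonsing rhom_eq_0_iff[OF rhom_om] by force
  then have "\<not> (\<forall>p\<in>locus emb (point ?A). vanishes g p)" by (simp add: locus_point(3)[OF hom] ev_point_0)
  then show ?thesis using 1 by metis
qed

lemma chain: "\<exists>V. irred_chain zariski X (pdim X - 1) V \<and> pt a \<in> V 0"
proof -
  \<comment> \<open>Of the \<open>pdim X\<close> indices outside \<open>B\<close> one is spent on
    \<open>i0\<close>, the form used for normalization. This is the \<open>- 1\<close> between the
    cone and projective space.\<close>
  let ?C = "- B - {i0}"
  have card_C: "card ?C = pdim X - 1"
    using card_B card_add_card_Compl[of B] i0(1) by simp
  obtain q where q: "bij_betw q {..<card ?C} ?C"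
    using ex_bij_betw_nat_finite[of ?C] by (auto simp: lessThan_atLeast0)
  define A where "A i = q ` {..<i}" for i
  define V where "V i = locus emb (point (A i))" for i
  have "irred_chain zariski X (pdim X - 1) V"
    unfolding irred_chain_def
  proof (intro conjI allI impI)
    fix i
    show "closedin (subtopology zariski X) (V i)"
      using closed_locus[OF rhom_emb point_nonzero] locus_subset unfolding V_def
      by (simp add: closedin_closed_subtopology[OF closed])
    show "irreducible_in zariski (V i)" unfolding V_def by (rule locus_point(2))
    assume i: "i < pdim X - 1"
    then have iC: "q i \<in> ?C" using q by (auto simp: card_C bij_betw_def)
    have Suc: "A (Suc i) = insert (q i) (A i)" by (auto simp: A_def lessThan_Suc)
    have sub: "A i \<subseteq> ?C" using q i by (auto simp: A_def card_C bij_betw_def)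
    have "q i \<notin> A i"
    proof
      assume "q i \<in> A i"
      then obtain j where "j < i" "q i = q j" by (auto simp: A_def)
      then show False using q i inj_onD[of q "{..<card ?C}" i j] by (auto simp: card_C bij_betw_def)
    qed
    then show "V i \<subset> V (Suc i)"
      using locus_mono[of "A i" "A (Suc i)"] locus_strict[of "q i" "A i"] iC sub
      unfolding V_def Suc by blast
  qed
  then show ?thesis using mem_locus unfolding V_def by blast
qed

end

lemma regular_chain:
  fixes X :: "('k::{alg_closed_field, field_char_0}, 'n::finite) proj_space set"
  assumes X: "irreducible_variety X" and x: "x \<in> regular_locus X"
  shows "\<exists>V. irred_chain zariski X (pdim X - 1) V \<and> x \<in> V 0"
proof -
  have irr: "irreducible_in zariski X" and cl: "closedin zariski X"
    using X by (auto simp: irreducible_variety_def projective_variety_def)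
  obtain a where a: "a \<in> hcoords x" using hcoords_nonempty by blast
  obtain B f e where f: "\<forall>i\<in>B. f i \<in> ideal X" "card B + pdim X = CARD('n)"
    "mp_eval (det (frame_poly B f e)) (($) a) \<noteq> 0"
    using frame_at_regular[OF irr x a] by blast
  have xX: "x \<in> X" using x by (simp add: regular_locus_def)
  let ?M = "frame (\<lambda>x. x) B f e (($) a)"
  have rf: "tangent_lin X x = ann ((\<lambda>i. ?M $ i) ` B)" "det ?M \<noteq> 0"
    using regular_if_frame(2,3)[OF irr xX a _ f(2,3)] f(1) by auto
  have a0: "a \<noteq> 0" using a by (simp add: in_hcoords_iff)
  \<comment> \<open>By Euler \<open>a\<close> is tangent, so all rows in \<open>B\<close> kill it;
    as \<open>a\<close> is nonzero, the remaining rows of the nonsingular frame cannot all kill it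
    as well.\<close>
  have "\<exists>i. i \<notin> B \<and> dot (?M $ i) a \<noteq> 0"
  proof (rule ccontr)
    assume "\<not> ?thesis"
    moreover have "dot (?M $ i) a = 0" if "i \<in> B" for i
      using coords_in_tangent_lin[OF xX a] that by (auto simp: rf(1) ann_def)
    ultimately have "?M *v a = ?M *v 0" by (auto simp: vec_eq_iff matrix_dot)
    then show False using nonsingular_inj[OF rf(2)] a0 by blast
  qed
  then obtain i0 where i0: "i0 \<notin> B" "dot (?M $ i0) a \<noteq> 0" by blast
  have e: "?M $ i0 = e i0" using i0(1) by (simp add: frame_def vec_eq_iff)
  \<comment> \<open>The affine part of a generic point of the cylinder satisfies no polynomial
    relation and provides the generic coefficients of the flow.\<close>
  obtain z where z: "relations om z = cyl_ideal X" using cyl_generic_exists[OF irr] by blast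
  have c: "mp_eval g s = 0" if "ev om g (\<lambda>l. z (Inr l)) = 0" for g s
  proof -
    have "mp_subst (\<lambda>l. mp_var (Inr l)) g \<in> relations om z"
      using that by (simp add: relations_def ev_subst[OF rhom_om] ev_var[OF rhom_om])
    moreover have "case_sum (($) a) s \<in> cyl X" using xX a by (auto simp: cyl_def cone_def)
    ultimately have "mp_eval (mp_subst (\<lambda>l. mp_var (Inr l)) g) (case_sum (($) a) s) = 0"
      by (auto simp: z cyl_ideal_def)
    then show ?thesis by (simp add: mp_eval_ev ev_subst ev_var)
  qed
  have pta: "pt a = x" using a by (simp add: in_hcoords_iff)
  interpret regular_frame X B f e a i0 "\<lambda>l. z (Inr l)"
  proof
    show "pt a \<in> X" using a xX by (simp add: in_hcoords_iff)
  qed (use irr cl f a0 i0 e c in auto)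
  show ?thesis using chain pta by simp
qed

section \<open>Krull dimension and the smooth locus\<close>

text \<open>Each strict inclusion raises \<open>pdim\<close>, which starts at 1 or more.\<close>

lemma chain_length:
  fixes S :: "('k::field_char_0, 'n::finite) proj_space set"
  assumes S: "closedin zariski S" and V: "irred_chain zariski S n V"
  shows "i \<le> n \<Longrightarrow> Suc i \<le> pdim (V i)"
proof (induction i)
  case 0
  then show ?case using V pdim_pos[of "V 0"] by (auto simp: irred_chain_def)
next
  case (Suc i)
  have "closedin zariski (V i)" "irreducible_in zariski (V i)" "irreducible_in zariski (V (Suc i))" "V i \<subset> V (Suc i)"
    using V Suc.prems by (auto simp: irred_chain_def closedin_closed_subtopology[OF S])
  then have "pdim (V i) < pdim (V (Suc i))" using pdim_mono(2)[of "V i" "V (Suc i)"] by blast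
  then show ?case using Suc by simp
qed

text \<open>No chain is longer than \<open>pdim X - 1\<close>, while tangent spaces have dimension
  at least \<open>pdim X\<close>; so smoothness forces the generic rank. Conversely a regular point
  starts a chain of the maximal length, built from formal curves.\<close>

lemma smooth_locus_eq:
  fixes X :: "('k::{alg_closed_field, field_char_0}, 'n::finite) proj_space set"
  assumes X: "irreducible_variety X"
  shows "smooth_locus X = regular_locus X"
proof -
  have irr: "irreducible_in zariski X" and cl: "closedin zariski X"
    using X by (auto simp: irreducible_variety_def projective_variety_def)
  have pos: "pdim X > 0" using pdim_pos[OF irr] .
  have upper: "local_dim zariski X x \<le> enat (pdim X - 1)" for x
    unfolding local_dim_def
  proof (rule Sup_least)
    fix d assume "d \<in> {enat n |n. \<exists>V. irred_chain zariski X n V \<and> x \<in> V 0}"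
    then obtain n V where n: "d = enat n" "irred_chain zariski X n V" by blast
    have "Suc n \<le> pdim (V n)" using chain_length[OF cl n(2)] by simp
    moreover have "pdim (V n) \<le> pdim X"
      using n(2) by (intro pdim_mono(1)[OF _ irr])
        (auto simp: irred_chain_def closedin_closed_subtopology[OF cl])
    ultimately show "d \<le> enat (pdim X - 1)" using n(1) by simp
  qed
  show ?thesis
  proof (intro equalityI subsetI)
    fix x assume "x \<in> smooth_locus X"
    then have x: "x \<in> X" and d: "enat (vec.dim (tangent_lin X x)) = local_dim zariski X x + 1"
      by (auto simp: smooth_locus_def)
    have "enat (vec.dim (tangent_lin X x)) \<le> enat (pdim X - 1) + 1"
      unfolding d using upper by (rule add_right_mono)
    then have "vec.dim (tangent_lin X x) \<le> pdim X" using pos by (simp add: one_enat_def)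
    then show "x \<in> regular_locus X"
      using pdim_le_tangent_lin[OF irr x] x by (simp add: regular_locus_def)
  next
    fix x assume x: "x \<in> regular_locus X"
    obtain V where V: "irred_chain zariski X (pdim X - 1) V" "x \<in> V 0" using regular_chain[OF X x] by blast
    have "enat (pdim X - 1) \<le> local_dim zariski X x"
      unfolding local_dim_def using V by (intro Sup_upper) blast
    then have "local_dim zariski X x = enat (pdim X - 1)" using upper[of x] by simp
    then show "x \<in> smooth_locus X"
      using x pos by (simp add: smooth_locus_def regular_locus_def one_enat_def)
  qed
qed

section \<open>Elimination\<close>

lemma inst_cone_nonzero:
  fixes s :: "'i::finite \<Rightarrow> 'k::field oidx \<Rightarrow> 'k"
  assumes "\<And>j. \<exists>i. s i j \<noteq> 0"
  shows "\<exists>i. st (s i) \<noteq> 0"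
proof (rule ccontr)
  assume "\<not> ?thesis"
  then have "\<forall>i. eventually (\<lambda>j. s i j = 0) oF" by (simp add: st_eq_0)
  then have "eventually (\<lambda>j. \<forall>i. s i j = 0) (oF :: 'k oidx filter)" by (simp add: eventually_all_finite)
  then have "eventually (\<lambda>j. False) (oF :: 'k oidx filter)"
    by (rule eventually_mono) (use assms in blast)
  then show False by simp
qed

lemma hcoords_nonzero_nth: "a \<in> hcoords x \<Longrightarrow> \<exists>i. a $ i \<noteq> 0"
  by (auto simp: in_hcoords_iff vec_eq_iff)

text \<open>Elimination by places. A point of the closure is a specialization of the second half of
  a point of \<open>Q\<close> over the big field. A place extending this specialization, normalized
  by \<open>place_maximum\<close> on the first half, gives a preimage over the ground field.\<close>

theorem closed_snd_image:
  fixes Q :: "(('k::{alg_closed_field, field_char_0}, 'n::finite) proj_space \<times> ('k, 'm::finite) proj_space) set"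
  assumes Q: "closedin bizariski Q"
  shows "closedin zariski (snd ` Q)"
proof -
  have "y \<in> snd ` Q" if y: "y \<in> zariski closure_of (snd ` Q)" for y
  proof -
    obtain b where b: "b \<in> hcoords y" using hcoords_nonempty by blast
    \<comment> \<open>Saturating these conditions yields a point \<open>z\<close> such that every
      relation of its second half holds at \<open>b\<close>.\<close>
    define W where "W g s \<longleftrightarrow> mp_eval g (($) b) \<noteq> 0 \<longrightarrow> mp_eval g (\<lambda>i. s (Inr i)) \<noteq> 0"
      for g :: "('k, 'm) mpoly" and s :: "'n + 'm \<Rightarrow> 'k"
    have avoid: "\<exists>s\<in>bicone Q. \<forall>g\<in>G. W g s" if G: "finite G" for G
    proof -
      define g where "g = (\<Prod>g\<in>{g\<in>G. mp_eval g (($) b) \<noteq> 0}. g)"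
      have ev_g: "mp_eval g s = (\<Prod>g\<in>{g\<in>G. mp_eval g (($) b) \<noteq> 0}. mp_eval g s)" for s
        unfolding g_def mp_eval_ev ev_prod[OF rhom_id] ..
      have "mp_eval g (($) b) \<noteq> 0" unfolding ev_g using G by simp
      then have "\<not> vanishes g y" using b by (auto simp: vanishes_def)
      then have "g \<notin> ideal (snd ` Q)" using y unfolding zariski_closure_iff by blast
      then have "\<exists>q\<in>Q. \<exists>b'\<in>hcoords (snd q). mp_eval g (($) b') \<noteq> 0"
        by (simp add: ideal_def vanishes_def)
      then obtain q b' where q: "q \<in> Q" "b' \<in> hcoords (snd q)" "mp_eval g (($) b') \<noteq> 0"
        by blast
      obtain a' where a': "a' \<in> hcoords (fst q)" using hcoords_nonempty by blast
      show ?thesis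
      proof (intro bexI[of _ "case_sum (($) a') (($) b')"] ballI)
        show "case_sum (($) a') (($) b') \<in> bicone Q"
          using q a' unfolding bicone_def
          by (intro CollectI exI[of _ a'] exI[of _ b'] exI[of _ "fst q"] exI[of _ "snd q"]) simp
        fix g' assume "g' \<in> G"
        then show "W g' (case_sum (($) a') (($) b'))" using q(3) G unfolding ev_g W_def by auto
      qed
    qed
    have "\<exists>s. (\<forall>j. (\<lambda>i. s i j) \<in> bicone Q) \<and> (\<forall>g. eventually (\<lambda>j. W g (\<lambda>i. s i j)) (oF :: 'k oidx filter))"
      by (rule saturation) (rule avoid)
    then obtain s where s: "\<And>j. (\<lambda>i. s i j) \<in> bicone Q"
      "\<And>g. eventually (\<lambda>j. W g (\<lambda>i. s i j)) (oF :: 'k oidx filter)" by blast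
    define z where "z i = st (s i)" for i
    have inst: "inst (bicone Q) z" unfolding z_def[abs_def] by (rule inst_range) (rule s)
    define G0 where "G0 = range (\<lambda>g. (ev om g (\<lambda>i. z (Inr i)), mp_eval g (($) b)))"
    have G0: "pgraph om G0"
      unfolding pgraph_def
    proof (intro conjI allI impI)
      fix c
      have "(om c, c) = (ev om (mp_const c) (\<lambda>i. z (Inr i)), mp_eval (mp_const c) (($) b))"
        by (simp add: mp_eval_ev ev_const rhom_om)
      then show "(om c, c) \<in> G0" unfolding G0_def by blast
    next
      fix p p' q q' assume "(p, p') \<in> G0" "(q, q') \<in> G0"
      then obtain f g where *: "p = ev om f (\<lambda>i. z (Inr i))" "p' = mp_eval f (($) b)"
        "q = ev om g (\<lambda>i. z (Inr i))" "q' = mp_eval g (($) b)" by (auto simp: G0_def)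
      have "(p + q, p' + q') = (ev om (f + g) (\<lambda>i. z (Inr i)), mp_eval (f + g) (($) b))"
        "(p * q, p' * q') = (ev om (f * g) (\<lambda>i. z (Inr i)), mp_eval (f * g) (($) b))"
        by (simp_all add: * mp_eval_ev ev_add ev_mult rhom_om)
      then show "(p + q, p' + q') \<in> G0" "(p * q, p' * q') \<in> G0" unfolding G0_def by blast+
    next
      fix v assume "(0, v) \<in> G0"
      then obtain g where g: "ev om g (\<lambda>i. z (Inr i)) = 0" "v = mp_eval g (($) b)" by (auto simp: G0_def)
      then have "eventually (\<lambda>j. mp_eval g (\<lambda>i. s (Inr i) j) = 0) (oF :: 'k oidx filter)"
        by (simp add: z_def st_ev st_eq_0)
      with s(2)[of g] have "eventually (\<lambda>j :: 'k oidx. v = 0) oF"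
        by (rule eventually_elim2) (auto simp: W_def g(2))
      then show "v = 0" by simp
    qed
    from place_exists[OF rhom_om G0] obtain G where G: "G0 \<subseteq> G" "pgraph om G"
      "\<And>t. t \<noteq> 0 \<Longrightarrow> (\<exists>c. (t, c) \<in> G) \<or> (inverse t, 0) \<in> G" by blast
    have "\<exists>i. s (Inl i) j \<noteq> 0" for j
    proof -
      obtain v w x y where "(\<lambda>i. s i j) = case_sum (($) v) (($) w)" "v \<in> hcoords x"
        using s(1)[of j] by (auto simp: bicone_def)
      then show ?thesis using hcoords_nonzero_nth[of v x] fun_cong[of "\<lambda>i. s i j" _ "Inl _"] by fastforce
    qed
    then have "\<exists>i. z (Inl i) \<noteq> 0" unfolding z_def by (rule inst_cone_nonzero)
    from place_maximum[OF rhom_om G(2,3) this] obtain m where m: "z (Inl m) \<noteq> 0"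
      "\<And>i. \<exists>c. (z (Inl i) / z (Inl m), c) \<in> G" by blast
    then obtain c where c: "\<And>i. (z (Inl i) / z (Inl m), c i) \<in> G" by metis
    have "c m = 1" using c[of m] m(1) pg_unique[OF rhom_om G(2) _ pg_1[OF rhom_om G(2)]] by simp
    define a where "a = (\<chi> i. c i)"
    have a: "a \<in> hcoords (pt a)"
      using \<open>c m = 1\<close> by (intro hcoords_pt) (auto simp: a_def vec_eq_iff intro!: exI[of _ m])
    have "(pt a, y) \<in> Q"
    proof -
      obtain F where F: "\<And>f. f \<in> F \<Longrightarrow> bihomogeneous f" "Q = {q. \<forall>f\<in>F. bivanishes f q}"
        using Q[unfolded closedin_bizariski] by auto
      have "bivanishes f (pt a, y)" if f: "f \<in> F" for f
      proof -
        obtain d where d: "homogeneous_in (range Inl) d f" using F(1)[OF f] by (auto simp: bihomogeneous_def)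
        have "f \<in> biideal Q" using f F(2) by (auto simp: biideal_def)
        then have "ev om f z = 0" by (intro inst_ev_0[OF inst]) (simp add: biideal_iff)
        then have 0: "ev om f (scale (range Inl) (inverse (z (Inl m))) z) = 0"
          by (simp add: ev_scale[OF rhom_om d])
        have "(ev om f (scale (range Inl) (inverse (z (Inl m))) z), mp_eval f (case_sum (($) a) (($) b))) \<in> G"
        proof (rule pg_ev[OF rhom_om G(2)])
          fix i
          show "(scale (range Inl) (inverse (z (Inl m))) z i, case_sum (($) a) (($) b) i) \<in> G"
          proof (cases i)
            case (Inl i)
            then show ?thesis using c[of i] by (simp add: scale_def a_def field_simps)
          next
            case (Inr i)
            have "(ev om (mp_var i) (\<lambda>i. z (Inr i)), mp_eval (mp_var i) (($) b)) \<in> G"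
              using G(1) unfolding G0_def by blast
            moreover have "(Inr i :: 'n + 'm) \<notin> range Inl" by auto
            ultimately show ?thesis using Inr by (simp add: scale_def ev_var rhom_om mp_eval_ev)
          qed
        qed
        then have "mp_eval f (case_sum (($) a) (($) b)) = 0" using 0 pg_0D[OF rhom_om G(2)] by simp
        then show ?thesis using bivanishes_iff[OF F(1)[OF f], of a "(pt a, y)" b] a b by simp
      qed
      then show ?thesis using F(2) by blast
    qed
    then show ?thesis by force
  qed
  then show ?thesis using closure_of_subset_eq[of "snd ` Q" zariski] by auto
qed

section \<open>Exchange of factors and products of closed sets\<close>

definition mp_swap :: "('k::comm_ring_1, 'n::finite + 'm::finite) mpoly \<Rightarrow> ('k, 'm + 'n) mpoly" where
  "mp_swap = mp_subst (case_sum (\<lambda>i. mp_var (Inr i)) (\<lambda>i. mp_var (Inl i)))"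

lemma ev_swap: "rhom h \<Longrightarrow> ev h (mp_swap f) (case_sum a b) = ev h f (case_sum b a)"
  unfolding mp_swap_def by (subst ev_subst)
    (auto intro!: arg_cong[where f = "ev h f"] simp: fun_eq_iff ev_var split: sum.splits)

lemma bivanishes_swap: "bivanishes (mp_swap f) q \<longleftrightarrow> bivanishes f (prod.swap q)"
  by (auto simp: bivanishes_def mp_eval_ev ev_swap)

lemma closed_swap:
  fixes Q :: "(('k::field_char_0, 'n::finite) proj_space \<times> ('k, 'm::finite) proj_space) set"
  assumes "closedin bizariski Q"
  shows "closedin bizariski (prod.swap ` Q)"
proof -
  have "prod.swap ` Q = {q. \<forall>f\<in>mp_swap ` biideal Q. bivanishes f q}"
  proof (intro equalityI subsetI)
    fix q assume q: "q \<in> {q. \<forall>f\<in>mp_swap ` biideal Q. bivanishes f q}"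
    then have "prod.swap q \<in> Q"
      by (intro biclosed_memI[OF assms]) (auto simp: bivanishes_swap)
    then have "prod.swap (prod.swap q) \<in> prod.swap ` Q" by (rule imageI)
    then show "q \<in> prod.swap ` Q" by simp
  qed (auto simp: bivanishes_swap biideal_def)
  then show ?thesis by (simp only: bizariski_locus(1))
qed

lemma closed_fst_image:
  fixes Q :: "(('k::{alg_closed_field, field_char_0}, 'n::finite) proj_space \<times> ('k, 'm::finite) proj_space) set"
  assumes Q: "closedin bizariski Q"
  shows "closedin zariski (fst ` Q)"
proof -
  have "fst ` Q = snd ` (prod.swap ` Q)" by (simp add: image_image)
  then show ?thesis using closed_snd_image[OF closed_swap[OF Q]] by simp
qed

lemma closed_vimage:
  fixes S :: "('k::field_char_0, 'n::finite) proj_space set" and S' :: "('k, 'm::finite) proj_space set"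
  assumes "closedin zariski S" "closedin zariski S'"
  shows "closedin bizariski (S \<times> S')"
proof -
  have fst: "bivanishes (mp_subst (\<lambda>i. mp_var (Inl i)) f) q \<longleftrightarrow> vanishes f (fst q)"
    for f :: "('k, 'n) mpoly" and q :: "('k, 'n) proj_space \<times> ('k, 'm) proj_space"
    using hcoords_nonempty[of "snd q"] by (auto simp: bivanishes_def vanishes_def mp_eval_ev ev_subst ev_var)
  have snd: "bivanishes (mp_subst (\<lambda>i. mp_var (Inr i)) f) q \<longleftrightarrow> vanishes f (snd q)"
    for f :: "('k, 'm) mpoly" and q :: "('k, 'n) proj_space \<times> ('k, 'm) proj_space"
    using hcoords_nonempty[of "fst q"] by (auto simp: bivanishes_def vanishes_def mp_eval_ev ev_subst ev_var)
  have "S \<times> S' = {q. \<forall>f\<in>mp_subst (\<lambda>i. mp_var (Inl i)) ` ideal S \<union> mp_subst (\<lambda>i. mp_var (Inr i)) ` ideal S'. bivanishes f q}"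
  proof (intro equalityI subsetI)
    fix q assume "q \<in> S \<times> S'"
    then show "q \<in> {q. \<forall>f\<in>mp_subst (\<lambda>i. mp_var (Inl i)) ` ideal S \<union> mp_subst (\<lambda>i. mp_var (Inr i)) ` ideal S'. bivanishes f q}"
      by (auto simp: fst snd ideal_def)
  next
    fix q assume q: "q \<in> {q. \<forall>f\<in>mp_subst (\<lambda>i. mp_var (Inl i)) ` ideal S \<union> mp_subst (\<lambda>i. mp_var (Inr i)) ` ideal S'. bivanishes f q}"
    have "fst q \<in> S" by (rule closed_memI[OF assms(1)]) (use q in \<open>simp add: fst[symmetric]\<close>)
    moreover have "snd q \<in> S'" by (rule closed_memI[OF assms(2)]) (use q in \<open>simp add: snd[symmetric]\<close>)
    ultimately show "q \<in> S \<times> S'" by (cases q) simp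
  qed
  then show ?thesis by (simp only: bizariski_locus(1))
qed

section \<open>Krull dimension via linear sections\<close>

text \<open>For nonempty closed \<open>F\<close> this expresses dimension at least \<open>k\<close>
  without mentioning chains (\<open>krull_dim_ge_iff\<close>), in a form to which elimination
  applies.\<close>

definition meets :: "('k::field, 'n::finite) proj_space set \<Rightarrow> nat \<Rightarrow> bool" where
  "meets F k \<longleftrightarrow> (\<forall>u :: nat \<Rightarrow> 'k ^ 'n. \<exists>x\<in>F. \<forall>a\<in>hcoords x. \<forall>j<k. dot (u j) a = 0)"

lemma meets_mono: "meets F k \<Longrightarrow> F \<subseteq> F' \<Longrightarrow> k' \<le> k \<Longrightarrow> meets F' k'"
  unfolding meets_def by (meson less_le_trans subsetD)

lemma meets_0: "meets F 0 \<longleftrightarrow> F \<noteq> {}"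
  by (auto simp: meets_def)

lemma meets_less:
  fixes F :: "('k::field, 'n::finite) proj_space set"
  assumes "meets F k"
  shows "k < CARD('n)"
proof (rule ccontr)
  assume "\<not> ?thesis"
  obtain g :: "nat \<Rightarrow> 'n" where g: "bij_betw g {..<CARD('n)} UNIV"
    using ex_bij_betw_nat_finite[of "UNIV :: 'n set"] by (auto simp: lessThan_atLeast0)
  obtain x where x: "\<And>a j. a \<in> hcoords x \<Longrightarrow> j < k \<Longrightarrow> dot (axis (g j) (1::'k)) a = 0"
    using assms[unfolded meets_def, rule_format, of "\<lambda>j. axis (g j) 1"] by blast
  obtain a where a: "a \<in> hcoords x" using hcoords_nonempty by blast
  have "a $ i = 0" for i
  proof -
    obtain j where "j < CARD('n)" "g j = i" using g by (auto simp: bij_betw_def) (metis lessThan_iff rangeI image_iff UNIV_I)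
    then show ?thesis using x[OF a, of j] \<open>\<not> k < CARD('n)\<close> by (simp add: dot_axis)
  qed
  then show False using hcoords_nonzero_nth[OF a] by blast
qed

lemma common_kernel:
  fixes T :: "('f::field ^ 'n) set" and u :: "nat \<Rightarrow> 'f ^ 'n"
  assumes T: "vec.subspace T" and k: "k < vec.dim T"
  shows "\<exists>v\<in>T. v \<noteq> 0 \<and> (\<forall>j<k. dot (u j) v = 0)"
proof (rule ccontr)
  assume no: "\<not> ?thesis"
  have "k \<le> CARD('n)" using k vec.dim_subset_UNIV[of T] by (simp add: vec.dimension_def card_cart_basis)
  then obtain g :: "nat \<Rightarrow> 'n" where g: "inj_on g {..<k}"
    by (metis card_le_inj card_lessThan finite finite_lessThan)
  define N :: "'f ^ 'n ^ 'n" where "N = (\<chi> i. if i \<in> g ` {..<k} then u (inv_into {..<k} g i) else 0)"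
  have N: "(N *v v) $ i = (if i \<in> g ` {..<k} then dot (u (inv_into {..<k} g i)) v else 0)" for v i
    by (simp add: matrix_dot N_def)
  have Ng: "(N *v v) $ g j = dot (u j) v" if "j < k" for v j
    using that g by (simp add: N)
  have "inj_on ((*v) N) (vec.span T)"
  proof (rule inj_onI)
    fix v w assume vw: "v \<in> vec.span T" "w \<in> vec.span T" "N *v v = N *v w"
    then have "v - w \<in> T" using T by (simp add: vec.span_eq_iff[THEN iffD2] vec.subspace_diff)
    moreover have "dot (u j) (v - w) = 0" if "j < k" for j
      using Ng[OF that, of "v - w"] vw(3) by (simp add: matrix_vector_mult_diff_distrib)
    ultimately have "v - w = 0" using no by blast
    then show "v = w" by simp
  qed
  then have "vec.dim T = vec.dim ((*v) N ` T)" by (intro vec.dim_image_eq[symmetric]) simp_all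
  also have "\<dots> \<le> vec.dim {x::'f^'n. \<forall>i. i \<notin> g ` {..<k} \<longrightarrow> x $ i = 0}"
    by (rule vec.dim_subset) (auto simp: N)
  also have "\<dots> = k" unfolding dim_substandard_cart using card_image[OF g] by simp
  finally show False using k by simp
qed

text \<open>Differentiating the relation leaves its formal derivative at \<open>t\<close> times
  \<open>D t\<close>, which gives a relation of lower degree.\<close>

lemma transcendental_if_derivation:
  fixes D :: "'f::field_char_0 \<Rightarrow> 'f"
  assumes D: "derivation D" and t: "D t \<noteq> 0"
  shows "(\<And>i. D (coeff p i) = 0) \<Longrightarrow> poly p t = 0 \<Longrightarrow> p = 0"
proof (induction "degree p" arbitrary: p rule: less_induct)
  case less
  have D_pow: "D (t ^ n) = of_nat n * t ^ (n - 1) * D t" for n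
  proof (induction n)
    case (Suc n)
    then show ?case by (cases n) (simp_all add: der_mult[OF D] algebra_simps)
  qed (simp add: der_1[OF D])
  have D_of_nat: "D (of_nat n) = 0" for n
    by (induction n) (simp_all add: der_0[OF D] der_1[OF D] der_add[OF D])
  show ?case
  proof (cases "degree p = 0")
    case True
    then obtain a where "p = [:a:]" by (auto elim: degree_eq_zeroE)
    then show ?thesis using less.prems(2) by simp
  next
    case False
    have "0 = D (poly p t)" using less.prems(2) der_0[OF D] by simp
    also have "\<dots> = (\<Sum>i\<le>degree p. coeff p i * (of_nat i * t ^ (i - 1) * D t))"
      by (simp add: poly_altdef der_sum[OF D] der_mult[OF D] less.prems(1) D_pow)
    also have "\<dots> = poly (pderiv p) t * D t"
    proof -
      have "poly (pderiv p) t = (\<Sum>i\<le>degree p - 1. coeff (pderiv p) i * t ^ i)"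
        by (simp add: poly_altdef degree_pderiv)
      also have "\<dots> = (\<Sum>i\<le>degree p. coeff p i * (of_nat i * t ^ (i - 1)))"
        using False by (subst (2) Suc_diff_1[symmetric], simp, subst sum.atMost_Suc_shift)
          (simp add: coeff_pderiv mult_ac)
      finally show ?thesis by (simp add: sum_distrib_left mult_ac)
    qed
    finally have "poly (pderiv p) t = 0" using t by simp
    moreover have "D (coeff (pderiv p) i) = 0" for i
      by (simp add: coeff_pderiv der_mult[OF D] less.prems(1) D_of_nat del: of_nat_Suc)
    moreover have "degree (pderiv p) < degree p" using False by (simp add: degree_pderiv)
    ultimately have "pderiv p = 0" using less.hyps by blast
    then show ?thesis using False by (simp add: pderiv_eq_0_iff)
  qed
qed

lemma ideal_at_0:
  fixes X :: "('k::field_char_0, 'n::finite) proj_space set"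
  assumes "X \<noteq> {}" "f \<in> ideal X"
  shows "mp_eval f (\<lambda>i. 0) = 0"
proof -
  obtain x a where xa: "x \<in> X" "a \<in> hcoords x" using assms(1) hcoords_nonempty by blast
  obtain D where D: "f = (\<Sum>d\<le>D. hcomp UNIV d f)" using sum_hcomp by blast
  have "mp_eval (hcomp UNIV d f) (scale UNIV 0 (($) a)) = 0" for d
    using ideal_hcomp[OF assms(2), of d] xa
    by (auto simp: mp_eval_ev ev_scale[OF rhom_id hcomp_homogeneous] ideal_def vanishes_def)
  then have "mp_eval (\<Sum>d\<le>D. hcomp UNIV d f) (scale UNIV 0 (($) a)) = 0" by (simp add: mp_eval_sum)
  then show ?thesis using D by (simp add: scale_def)
qed

text \<open>A derivation that kills the given linear forms but not all coordinates exhibits a coordinate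
  that is transcendental over the linear forms; a place at which this coordinate is infinite and
  the linear forms are finite has its centre on the linear section.\<close>

lemma irreducible_meets:
  fixes X :: "('k::{alg_closed_field, field_char_0}, 'n::finite) proj_space set"
  assumes X: "irreducible_variety X" and k: "k < pdim X"
  shows "meets X k"
  unfolding meets_def
proof
  fix u :: "nat \<Rightarrow> 'k ^ 'n"
  have irr: "irreducible_in zariski X" and cl: "closedin zariski X"
    using X by (auto simp: irreducible_variety_def projective_variety_def)
  have ne: "X \<noteq> {}" using irr by (simp add: irreducible_in_def)
  obtain z where z: "relations om z = ideal X" using generic_point_exists[OF irr] by blast
  have dimT: "k < vec.dim (tang om (relations om z) z)" using k by (simp add: pdim_eq[OF z] z)
  obtain v where v: "v \<in> tang om (relations om z) z" "v \<noteq> 0"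
    "\<And>j. j < k \<Longrightarrow> dot (\<chi> i. om (u j $ i)) v = 0"
    using common_kernel[OF subspace_tang dimT, of "\<lambda>j. \<chi> i. om (u j $ i)"] by blast
  obtain D where D: "derivation D" "\<And>c. D (om c) = 0" "\<And>i. D (z i) = v $ i"
    using tang_derivation[OF rhom_om v(1)] by blast
  obtain m where m: "v $ m \<noteq> 0" using v(2) by (auto simp: vec_eq_iff)
  define w where "w j = (\<Sum>i\<in>UNIV. om (u j $ i) * z i)" for j
  have Dw: "D (w j) = 0" if "j < k" for j
    using v(3)[OF that] by (simp add: w_def der_sum[OF D(1)] der_mult[OF D(1)] D(2,3) dot_def)
  have zm: "z m \<noteq> 0" using m D(3)[of m] der_0[OF D(1)] by metis
  define s where "s = inverse (z m)"
  have Ds: "D s \<noteq> 0"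
  proof
    assume "D s = 0"
    then have "D (z m * s) = s * v $ m" by (simp add: der_mult[OF D(1)] D(3))
    moreover have "z m * s = 1" using zm by (simp add: s_def)
    ultimately show False using der_1[OF D(1)] m zm by (simp add: s_def)
  qed
  \<comment> \<open>Polynomials have variables in a finite type, so the \<open>k\<close> forms are
    numbered by elements of \<open>'n\<close>; the other variables are sent to 0.\<close>
  have "k \<le> CARD('n)"
    using dimT vec.dim_subset_UNIV[of "tang om (relations om z) z"] by (simp add: vec.dimension_def card_cart_basis)
  then obtain g :: "nat \<Rightarrow> 'n" where g: "inj_on g {..<k}"
    by (metis card_le_inj card_lessThan finite finite_lessThan)
  define \<sigma> :: "'n \<Rightarrow> ('k, 'n) mpoly" where "\<sigma> i = (if i \<in> g ` {..<k}
      then \<Sum>l\<in>UNIV. mp_const (u (inv_into {..<k} g i) $ l) * mp_var l else 0)" for i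
  define y where "y i = ev om (\<sigma> i) z" for i
  have y: "y (g j) = w j" if "j < k" for j
    using that g by (simp add: y_def \<sigma>_def w_def ev_simps[OF rhom_om])
  have Dy: "D (y i) = 0" for i
  proof (cases "i \<in> g ` {..<k}")
    case True
    then show ?thesis using y Dw by auto
  qed (simp add: y_def \<sigma>_def der_0[OF D(1)])
  have Dev: "D (ev om q y) = 0" for q
    unfolding der_ev[OF D(1) rhom_om D(2)] by (simp add: Dy)
  \<comment> \<open>All the forms may be sent to 0 simultaneously because the vertex lies in the
    closure of the cone (\<open>ideal_at_0\<close>).\<close>
  define G0 where "G0 = range (\<lambda>q. (ev om q y, mp_eval q (\<lambda>i. 0)))"
  have G0: "pgraph om G0"
    unfolding pgraph_def
  proof (intro conjI allI impI)
    fix c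
    have "(om c, c) = (ev om (mp_const c) y, mp_eval (mp_const c) (\<lambda>i. 0))"
      by (simp add: mp_eval_ev ev_const rhom_om)
    then show "(om c, c) \<in> G0" unfolding G0_def by blast
  next
    fix p p' q q' assume "(p, p') \<in> G0" "(q, q') \<in> G0"
    then obtain f h where *: "p = ev om f y" "p' = mp_eval f (\<lambda>i. 0)" "q = ev om h y" "q' = mp_eval h (\<lambda>i. 0)"
      by (auto simp: G0_def)
    have "(p + q, p' + q') = (ev om (f + h) y, mp_eval (f + h) (\<lambda>i. 0))"
      "(p * q, p' * q') = (ev om (f * h) y, mp_eval (f * h) (\<lambda>i. 0))"
      by (simp_all add: * mp_eval_ev ev_add ev_mult rhom_om)
    then show "(p + q, p' + q') \<in> G0" "(p * q, p' * q') \<in> G0" unfolding G0_def by blast+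
  next
    fix b assume "(0, b) \<in> G0"
    then obtain q where q: "ev om q y = 0" "b = mp_eval q (\<lambda>i. 0)" by (auto simp: G0_def)
    have "(\<lambda>j. ev om (\<sigma> j) z) = y" by (simp add: y_def fun_eq_iff)
    then have "mp_subst \<sigma> q \<in> ideal X"
      unfolding z[symmetric] using q(1) by (simp add: relations_def ev_subst[OF rhom_om])
    then have "mp_eval (mp_subst \<sigma> q) (\<lambda>i. 0) = 0" by (rule ideal_at_0[OF ne])
    moreover have "ev (\<lambda>x. x) (\<sigma> i) (\<lambda>i. 0) = 0" for i by (simp add: \<sigma>_def ev_simps)
    ultimately show "b = 0" using q(2) by (simp add: mp_eval_ev ev_subst)
  qed
  have "pgraph om (padjoin G0 s 0)"
  proof (rule padjoin_pgraph[OF rhom_om G0])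
    fix p q assume pq: "ppair G0 p q" "poly p s = 0"
    have "D (coeff p i) = 0" for i
    proof -
      have "(coeff p i, coeff q i) \<in> G0" using pq(1) by (simp add: ppair_def)
      then obtain r where "coeff p i = ev om r y" unfolding G0_def by blast
      then show ?thesis using Dev by simp
    qed
    then have "p = 0" using transcendental_if_derivation[OF D(1) Ds] pq(2) by blast
    then have "q = 0" using pq(1) pg_0D[OF rhom_om G0] by (intro poly_eqI) (auto simp: ppair_def)
    then show "poly q 0 = 0" by simp
  qed
  from place_exists[OF rhom_om this] obtain G where G: "padjoin G0 s 0 \<subseteq> G" "pgraph om G"
    "\<And>t. t \<noteq> 0 \<Longrightarrow> (\<exists>c. (t, c) \<in> G) \<or> (inverse t, 0) \<in> G" by blast
  have G0_G: "G0 \<subseteq> G" using padjoin_superset[OF rhom_om G0] G(1) by blast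
  have s0: "(s, 0) \<in> G" using padjoin_member[OF rhom_om G0, of s 0] G(1) by blast
  have "\<exists>i. z i \<noteq> 0" using zm by blast
  from place_maximum[OF rhom_om G(2,3) this] obtain m' where m': "z m' \<noteq> 0"
    "\<And>i. \<exists>c. (z i / z m', c) \<in> G" by blast
  then obtain b where b: "\<And>i. (z i / z m', b i) \<in> G" by metis
  have "b m' = 1" using b[of m'] m'(1) pg_unique[OF rhom_om G(2) _ pg_1[OF rhom_om G(2)]] by simp
  \<comment> \<open>If \<open>z m'\<close> had a finite value then so would \<open>z m\<close>,
    whose inverse \<open>s\<close> has value 0.\<close>
  have inv0: "(inverse (z m'), 0) \<in> G"
  proof (rule ccontr)
    assume "\<not> ?thesis"
    then obtain c where "(z m', c) \<in> G" using G(3)[OF m'(1)] by blast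
    from pg_mult[OF rhom_om G(2) pg_mult[OF rhom_om G(2) b[of m] this] s0]
    have "(1, 0) \<in> G" using m'(1) zm by (simp add: s_def)
    then show False using pg_unique[OF rhom_om G(2) pg_1[OF rhom_om G(2)]] by fastforce
  qed
  define a where "a = (\<chi> i. b i)"
  have a: "a \<in> hcoords (pt a)"
    using \<open>b m' = 1\<close> by (intro hcoords_pt) (auto simp: a_def vec_eq_iff intro!: exI[of _ m'])
  have "pt a \<in> X"
  proof -
    obtain F where F: "\<And>f. f \<in> F \<Longrightarrow> homogeneous f" "X = {p. \<forall>f\<in>F. vanishes f p}"
      using cl[unfolded closedin_zariski] by auto
    have "vanishes f (pt a)" if f: "f \<in> F" for f
    proof -
      obtain d where d: "homogeneous_in UNIV d f" using F(1)[OF f] by (auto simp: homogeneous_def)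
      have "f \<in> ideal X" using f F(2) by (auto simp: ideal_def)
      then have "ev om f z = 0" by (simp add: z[symmetric] relations_def)
      then have 0: "ev om f (scale UNIV (inverse (z m')) z) = 0" by (simp add: ev_scale[OF rhom_om d])
      have "(ev om f (scale UNIV (inverse (z m')) z), mp_eval f (($) a)) \<in> G"
        by (rule pg_ev[OF rhom_om G(2)]) (use b in \<open>simp add: scale_def a_def divide_inverse mult.commute\<close>)
      then have "mp_eval f (($) a) = 0" using 0 pg_0D[OF rhom_om G(2)] by simp
      then show ?thesis using vanishes_iff[OF F(1)[OF f] a] by simp
    qed
    then show ?thesis using F(2) by blast
  qed
  moreover have "dot (u j) a' = 0" if j: "j < k" and a': "a' \<in> hcoords (pt a)" for j a'
  proof -
    have "(w j, 0) \<in> G"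
    proof -
      have "(ev om (mp_var (g j)) y, mp_eval (mp_var (g j)) (\<lambda>i. 0)) \<in> G" using G0_G unfolding G0_def by blast
      then show ?thesis using y[OF j] by (simp add: ev_var[OF rhom_om] mp_eval_ev ev_var)
    qed
    from pg_mult[OF rhom_om G(2) this inv0] have 1: "(w j * inverse (z m'), 0) \<in> G" by simp
    have "(\<Sum>i\<in>UNIV. om (u j $ i) * (z i / z m'), \<Sum>i\<in>UNIV. u j $ i * b i) \<in> G"
      by (intro pg_sum[OF rhom_om G(2)] pg_mult[OF rhom_om G(2)] pg_const[OF rhom_om G(2)] b)
    moreover have "(\<Sum>i\<in>UNIV. om (u j $ i) * (z i / z m')) = w j * inverse (z m')"
      by (simp add: w_def sum_distrib_right divide_inverse mult.assoc)
    ultimately have "dot (u j) a = 0"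
      using pg_unique[OF rhom_om G(2) _ 1] by (simp add: dot_def a_def)
    moreover obtain c where "a' = c *s a" using hcoords_multiple[OF a a'] by blast
    ultimately show ?thesis by (simp add: dot_scale_right)
  qed
  ultimately show "\<exists>x\<in>X. \<forall>a\<in>hcoords x. \<forall>j<k. dot (u j) a = 0" by blast
qed

text \<open>Restriction to the line through \<open>s\<close> in direction \<open>i\<close> reduces
  the claim to one variable, where a polynomial with only zero values is zero.\<close>

lemma pderiv_zero_function:
  fixes f :: "('k::field_char_0, 'i::finite) mpoly"
  assumes f: "\<And>s. mp_eval f s = 0"
  shows "mp_eval (mp_pderiv i f) s = 0"
proof -
  define z where "z j = (if j = i then [:0, 1:] else [:s j:])" for j
  have c: "rhom (\<lambda>c::'k. [:c:])" by (simp add: rhom_def one_pCons)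
  have ev: "poly (ev (\<lambda>c. [:c:]) g z) t = mp_eval g (\<lambda>j. if j = i then t else s j)" for g t
    unfolding mp_eval_ev
    by (subst rhom_ev_comp[OF _ c]) (auto simp: rhom_def z_def intro!: arg_cong[where f = "ev (\<lambda>x. x) g"])
  have "\<forall>t. poly (ev (\<lambda>c. [:c:]) f z) t = 0" using ev[of f] f by simp
  then have "ev (\<lambda>c. [:c:]) f z = 0" by (simp only: poly_all_0_iff_0)
  then have "pderiv (ev (\<lambda>c. [:c:]) f z) = 0" by simp
  moreover have "derivation (pderiv :: 'k poly \<Rightarrow> _)"
    by (simp add: derivation_def pderiv_add pderiv_mult)
  ultimately have "0 = (\<Sum>j\<in>UNIV. ev (\<lambda>c. [:c:]) (mp_pderiv j f) z * pderiv (z j))"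
    using der_ev[of pderiv "\<lambda>c. [:c:]" f z, OF _ c] by (simp add: pderiv_pCons)
  also have "\<dots> = (\<Sum>j\<in>UNIV. if j = i then ev (\<lambda>c. [:c:]) (mp_pderiv j f) z else 0)"
    by (intro sum.cong refl) (auto simp: z_def pderiv_pCons)
  finally have "ev (\<lambda>c. [:c:]) (mp_pderiv i f) z = 0" by (simp add: sum.delta)
  then have "mp_eval (mp_pderiv i f) (\<lambda>j. if j = i then s i else s j) = 0" using ev[of "mp_pderiv i f" "s i"] by simp
  moreover have "(\<lambda>j. if j = i then s i else s j) = s" by auto
  ultimately show ?thesis by simp
qed

lemma affine_generic_independent:
  fixes c :: "'i::finite \<Rightarrow> 'k::field_char_0 omega"
  assumes "\<And>g s. ev om g c = 0 \<Longrightarrow> mp_eval g s = 0"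
  shows "\<exists>D. derivation D \<and> (\<forall>k. D (om k) = 0) \<and> (\<forall>i. D (c i) = w i)"
proof -
  have inst: "inst UNIV c"
  proof -
    have "\<forall>l. \<exists>s. c l = st s" using st_surj by blast
    then obtain s where s: "\<And>l. c l = st (s l)" by metis
    have "c = (\<lambda>l. st (s l))" using s by blast
    then show ?thesis by (simp add: inst_range)
  qed
  have "v \<in> tang om (relations om c) c" for v
    unfolding tang_def ann_def
  proof clarify
    fix f assume "f \<in> relations om c"
    then have "ev om (mp_pderiv i f) c = 0" for i
      by (intro inst_ev_0[OF inst] pderiv_zero_function) (auto simp: relations_def assms)
    then show "dot (grad om f c) v = 0" by (simp add: dot_def)
  qed
  then have "(\<chi> i. w i) \<in> tang om (relations om c) c" .
  from tang_derivation[OF rhom_om this] show ?thesis by auto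
qed

text \<open>The kernel of \<open>u j\<close> contains \<open>p\<close> and all other
  \<open>v i\<close> but not \<open>v j\<close>, so the vectors are independent.\<close>

lemma dual_vectors_dim:
  fixes T :: "('f::field ^ 'n) set"
  assumes J: "finite J" and p: "p \<in> T" "p \<noteq> 0" and v: "\<And>j. j \<in> J \<Longrightarrow> v j \<in> T"
    and up: "\<And>j. j \<in> J \<Longrightarrow> dot (u j) p = 0"
    and uv: "\<And>i j. i \<in> J \<Longrightarrow> j \<in> J \<Longrightarrow> dot (u i) (v j) = 0 \<longleftrightarrow> i \<noteq> j"
  shows "card J + 1 \<le> vec.dim T"
proof -
  have "vec.independent (insert p (v ` J)) \<and> card (insert p (v ` J)) = card J + 1"
    using J up uv
  proof (induction J)
    case empty
    then show ?case using p(2) by simp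
  next
    case (insert j J)
    have "insert p (v ` J) \<subseteq> {x. dot (u j) x = 0}" using insert.prems insert.hyps by auto
    then have "vec.span (insert p (v ` J)) \<subseteq> {x. dot (u j) x = 0}"
      by (rule vec.span_minimal) (auto simp: vec.subspace_def dot_add_right dot_scale_right)
    then have n: "v j \<notin> vec.span (insert p (v ` J))" using insert.prems(2)[of j j] by auto
    then have "v j \<notin> insert p (v ` J)" using vec.span_superset[of "insert p (v ` J)"] by blast
    moreover have "vec.independent (insert p (v ` J)) \<and> card (insert p (v ` J)) = card J + 1"
      using insert by auto
    moreover have "insert p (v ` insert j J) = insert (v j) (insert p (v ` J))" by auto
    moreover have "finite (insert p (v ` J))" using insert.hyps by simp
    ultimately show ?case
      using insert.hyps vec.independent_insertI[OF n] by (metis Suc_eq_plus1 card_insert_disjoint)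
  qed
  moreover have "insert p (v ` J) \<subseteq> T" using p v by auto
  ultimately show ?thesis using vec.independent_card_le_dim[of "insert p (v ` J)" T] by simp
qed

text \<open>A point of the section of \<open>F\<close> by \<open>k\<close> linear forms with independent generic coefficients has
  a locus of dimension at least \<open>k\<close>: the coefficients can be varied freely, and differentiating the
  equations shows that the point has to move along.\<close>

lemma meets_irreducible:
  fixes F :: "('k::{alg_closed_field, field_char_0}, 'n::finite) proj_space set"
  assumes F: "closedin zariski F" and k: "meets F k"
  shows "\<exists>V. irreducible_variety V \<and> V \<subseteq> F \<and> k < pdim V"
proof -
  have "k \<le> CARD('n)" using meets_less[OF k] by simp
  then obtain g :: "nat \<Rightarrow> 'n" where g: "inj_on g {..<k}"
    by (metis card_le_inj card_lessThan finite finite_lessThan)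
  define S where "S = {case_sum C (($) v) | C v x. x \<in> F \<and> v \<in> hcoords x \<and> (\<forall>j<k. (\<Sum>i\<in>UNIV. C (g j, i) * v $ i) = 0)}"
  define gl :: "('k, ('n \<times> 'n) + 'n) mpoly \<Rightarrow> ('k, 'n \<times> 'n) mpoly"
    where "gl = mp_subst (case_sum mp_var (\<lambda>i. 0))"
  define gr :: "('k, ('n \<times> 'n) + 'n) mpoly \<Rightarrow> ('k, 'n) mpoly"
    where "gr = mp_subst (case_sum (\<lambda>i. 0) mp_var)"
  \<comment> \<open>The first condition makes the coefficients \<open>c\<close> of the forms
    generic, the second makes the relations of the point \<open>p\<close> closed under homogeneous
    components.\<close>
  define Q where "Q f s \<longleftrightarrow> ((\<exists>C. mp_eval (gl f) C \<noteq> 0) \<longrightarrow> mp_eval (gl f) (\<lambda>i. s (Inl i)) \<noteq> 0) \<and>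
      (mp_eval (gr f) (\<lambda>i. s (Inr i)) = 0 \<longrightarrow> (\<forall>d. mp_eval (hcomp UNIV d (gr f)) (\<lambda>i. s (Inr i)) = 0))"
    for f and s :: "('n \<times> 'n) + 'n \<Rightarrow> 'k"
  have avoid: "\<exists>s\<in>S. \<forall>f\<in>G. Q f s" if G: "finite G" for G
  proof -
    have "finite (gl ` {f\<in>G. \<exists>C. mp_eval (gl f) C \<noteq> 0})" using G by simp
    from affine_avoid[OF this] obtain C where "\<forall>q\<in>gl ` {f\<in>G. \<exists>C. mp_eval (gl f) C \<noteq> 0}. mp_eval q C \<noteq> 0"
      by (auto simp only: image_iff mem_Collect_eq)
    then have C: "mp_eval (gl f) C \<noteq> 0" if "f \<in> G" "\<exists>C. mp_eval (gl f) C \<noteq> 0" for f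
      using that by blast
    obtain x where x: "x \<in> F" "\<And>a j. a \<in> hcoords x \<Longrightarrow> j < k \<Longrightarrow> dot (\<chi> i. C (g j, i)) a = 0"
      using k[unfolded meets_def, rule_format, of "\<lambda>j. \<chi> i. C (g j, i)"] by blast
    obtain v where v: "v \<in> hcoords x" using hcoords_nonempty by blast
    have "finite (gr ` G)" using G by simp
    from scaling_avoids[OF this, of UNIV "($) v"] obtain c where c: "c \<noteq> 0"
      "\<And>f d. f \<in> G \<Longrightarrow> mp_eval (gr f) (scale UNIV c (($) v)) = 0 \<Longrightarrow> mp_eval (hcomp UNIV d (gr f)) (($) v) = 0"
      by auto
    have cv: "c *s v \<in> hcoords x" by (rule hcoords_scale[OF v c(1)])
    show ?thesis
    proof (intro bexI[of _ "case_sum C (($) (c *s v))"] ballI)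
      show "case_sum C (($) (c *s v)) \<in> S"
        unfolding S_def using x(1) x(2)[OF cv] cv by (fastforce simp: dot_def)
      fix f assume f: "f \<in> G"
      have hc: "mp_eval (hcomp UNIV d (gr f)) (($) (c *s v)) = c ^ d * mp_eval (hcomp UNIV d (gr f)) (($) v)" for d
        unfolding scale_vec[symmetric] mp_eval_ev by (rule ev_scale[OF rhom_id hcomp_homogeneous])
      have "Q f (case_sum C x)" if "x = ($) (c *s v)" for x
        unfolding Q_def sum.case
        using C[OF f] c(2)[OF f] by (auto simp only: that hc scale_vec mult_zero_right)
      then show "Q f (case_sum C (($) (c *s v)))" by blast
    qed
  qed
  have "\<exists>s. (\<forall>j. (\<lambda>i. s i j) \<in> S) \<and> (\<forall>f. eventually (\<lambda>j. Q f (\<lambda>i. s i j)) (oF :: 'k oidx filter))"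
    by (rule saturation) (rule avoid)
  then obtain s where s: "\<And>j. (\<lambda>i. s i j) \<in> S"
    "\<And>f. eventually (\<lambda>j. Q f (\<lambda>i. s i j)) (oF :: 'k oidx filter)" by blast
  define c where "c i = st (s (Inl i))" for i
  define p where "p i = st (s (Inr i))" for i
  have s_S: "\<exists>x v. x \<in> F \<and> v \<in> hcoords x \<and> (\<forall>i. s (Inr i) j = v $ i) \<and>
      (\<forall>l<k. (\<Sum>i\<in>UNIV. s (Inl (g l, i)) j * v $ i) = 0)" for j
  proof -
    obtain C v x where *: "(\<lambda>i. s i j) = case_sum C (($) v)" "x \<in> F" "v \<in> hcoords x"
      "\<forall>l<k. (\<Sum>i\<in>UNIV. C (g l, i) * v $ i) = 0" using s(1)[of j] by (auto simp: S_def)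
    have "s (Inl i) j = C i" "s (Inr i') j = v $ i'" for i i'
      using fun_cong[OF *(1), of "Inl i"] fun_cong[OF *(1), of "Inr i'"] by simp_all
    then show ?thesis using * by auto
  qed
  have c_gen: "mp_eval f C = 0" if f: "ev om f c = 0" for f C
  proof (rule ccontr)
    assume nz: "mp_eval f C \<noteq> 0"
    define f' :: "('k, ('n \<times> 'n) + 'n) mpoly" where "f' = mp_subst (\<lambda>i. mp_var (Inl i)) f"
    have gl: "mp_eval (gl f') C = mp_eval f C" for C
      by (simp add: gl_def f'_def mp_eval_ev ev_subst ev_var)
    have "eventually (\<lambda>j. mp_eval f (\<lambda>i. s (Inl i) j) = 0) (oF :: 'k oidx filter)"
      using f unfolding c_def[abs_def] st_ev st_eq_0 .
    with s(2)[of f'] have "eventually (\<lambda>j. False) (oF :: 'k oidx filter)"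
      by (rule eventually_elim2) (use nz in \<open>auto simp: Q_def gl\<close>)
    then show False by simp
  qed
  have p_hom: "ev om (hcomp UNIV d f) p = 0" if f: "ev om f p = 0" for f d
  proof -
    define f' :: "('k, ('n \<times> 'n) + 'n) mpoly" where "f' = mp_subst (\<lambda>i. mp_var (Inr i)) f"
    have "gr f' = f"
    proof -
      have "mp_subst (\<lambda>i. mp_var i) q = q" for q :: "('k, 'n) mpoly"
        by (induction q rule: mp_ring_induct) (simp_all add: mp_subst_def ev_simps[OF rhom_mp_const])
      moreover have "gr f' = mp_subst (\<lambda>i. mp_var i) f"
        unfolding gr_def f'_def mp_subst_def
        by (subst rhom_ev_comp[OF rhom_ev[OF rhom_mp_const] rhom_mp_const]) (simp add: ev_simps[OF rhom_mp_const])
      ultimately show ?thesis by simp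
    qed
    have "eventually (\<lambda>j. mp_eval f (\<lambda>i. s (Inr i) j) = 0) (oF :: 'k oidx filter)"
      using f unfolding p_def[abs_def] st_ev st_eq_0 .
    with s(2)[of f'] have "eventually (\<lambda>j. mp_eval (hcomp UNIV d f) (\<lambda>i. s (Inr i) j) = 0) (oF :: 'k oidx filter)"
      by (rule eventually_elim2) (auto simp: Q_def \<open>gr f' = f\<close>)
    then show ?thesis unfolding p_def[abs_def] st_ev st_eq_0 .
  qed
  have p_nz: "\<exists>i. p i \<noteq> 0"
    unfolding p_def
  proof (rule inst_cone_nonzero)
    fix j
    obtain x v where "v \<in> hcoords x" "\<forall>i. s (Inr i) j = v $ i" using s_S[of j] by blast
    then show "\<exists>i. s (Inr i) j \<noteq> 0" using hcoords_nonzero_nth[of v x] by simp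
  qed
  have p_inst: "inst (cone F) p"
    unfolding p_def[abs_def]
  proof (rule inst_range)
    fix j
    obtain x v where xv: "x \<in> F" "v \<in> hcoords x" "\<forall>i. s (Inr i) j = v $ i" using s_S[of j] by blast
    then have "(\<lambda>i. s (Inr i) j) = ($) v" by auto
    then show "(\<lambda>i. s (Inr i) j) \<in> cone F" using xv by (auto simp: cone_def)
  qed
  have cp: "(\<Sum>i\<in>UNIV. c (g l, i) * p i) = 0" if l: "l < k" for l
  proof -
    define q :: "('k, ('n \<times> 'n) + 'n) mpoly" where "q = (\<Sum>i\<in>UNIV. mp_var (Inl (g l, i)) * mp_var (Inr i))"
    have "inst S (\<lambda>i. st (s i))" by (rule inst_range) (rule s)
    then have "ev om q (\<lambda>i. st (s i)) = 0"
    proof (rule inst_ev_0)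
      fix t assume "t \<in> S"
      then show "mp_eval q t = 0" using l by (auto simp: S_def q_def mp_eval_ev ev_simps)
    qed
    then show ?thesis by (simp add: q_def c_def p_def ev_simps[OF rhom_om])
  qed
  define V where "V = locus om p"
  note loc = closed_locus[OF rhom_om p_nz] irreducible_locus[OF rhom_om p_nz] vanishes_on_locus[OF rhom_om p_nz]
  have V: "irreducible_variety V"
    using loc(1,2) by (simp add: V_def irreducible_variety_def projective_variety_def)
  have rel: "relations om p = ideal V"
  proof (intro equalityI subsetI)
    fix f assume "f \<in> relations om p"
    then have "ev om (hcomp UNIV d f) p = 0" for d by (intro p_hom) (simp add: relations_def)
    then have "hcomp UNIV d f \<in> ideal V" for d
      using loc(3)[of "hcomp UNIV d f"] hcomp_homogeneous[of UNIV d f] unfolding V_def ideal_def homogeneous_def by blast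
    then show "f \<in> ideal V" by (rule ideal_hcompI)
  next
    fix f assume f: "f \<in> ideal V"
    obtain D where D: "f = (\<Sum>d\<le>D. hcomp UNIV d f)" using sum_hcomp by blast
    have "ev om (hcomp UNIV d f) p = 0" for d
      using ideal_hcomp[OF f, of d] loc(3)[of "hcomp UNIV d f"] hcomp_homogeneous[of UNIV d f]
      unfolding V_def ideal_def homogeneous_def by blast
    then have "ev om (\<Sum>d\<le>D. hcomp UNIV d f) p = 0" by (simp add: ev_sum[OF rhom_om])
    then show "f \<in> relations om p" using D by (simp add: relations_def)
  qed
  have "V \<subseteq> F"
  proof
    fix x assume x: "x \<in> V"
    have "f \<in> ideal V" if "f \<in> ideal F" for f
      unfolding rel[symmetric] relations_def using that
      by (auto intro!: inst_ev_0[OF p_inst] simp: ideal_iff)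
    then show "x \<in> F" using x by (intro closed_memI[OF F]) (auto simp: ideal_def)
  qed
  moreover have "k < pdim V"
  proof -
    obtain m where m: "p m \<noteq> 0" using p_nz by blast
    \<comment> \<open>\<open>D l\<close> moves only the coefficient of \<open>p m\<close> in form
      number \<open>l\<close>. Differentiating the equations of the section shows that this form
      takes the value -1 on the induced motion of \<open>p\<close>, and the other forms the value
      0.\<close>
    have "\<exists>D. derivation D \<and> (\<forall>k. D (om k) = 0) \<and> (\<forall>i. D (c i) = (if i = (g l, m) then inverse (p m) else 0))" for l
      by (rule affine_generic_independent) (rule c_gen)
    then obtain D where D: "\<And>l. derivation (D l)" "\<And>l k. D l (om k) = 0"
      "\<And>l i. D l (c i) = (if i = (g l, m) then inverse (p m) else 0)" by metis
    have "card {..<k} + 1 \<le> vec.dim (tang om (relations om p) p)"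
    proof (rule dual_vectors_dim)
      show "(\<chi> i. p i) \<in> tang om (relations om p) p"
        by (rule euler_tang[OF rhom_om]) (auto simp: relations_def p_hom)
      show "(\<chi> i. p i) \<noteq> 0" using m by (auto simp: vec_eq_iff)
      show "(\<chi> i. D l (p i)) \<in> tang om (relations om p) p" for l
        by (rule derivation_tang[OF D(1) rhom_om D(2)])
      show "dot (\<chi> i. c (g l, i)) (\<chi> i. p i) = 0" if "l \<in> {..<k}" for l
        using cp[of l] that by (simp add: dot_def)
      show "dot (\<chi> i. c (g l', i)) (\<chi> i. D l (p i)) = 0 \<longleftrightarrow> l' \<noteq> l" if l: "l' \<in> {..<k}" "l \<in> {..<k}" for l l'
      proof -
        have "0 = D l (\<Sum>i\<in>UNIV. c (g l', i) * p i)" using cp[of l'] l der_0[OF D(1)] by simp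
        also have "\<dots> = (\<Sum>i\<in>UNIV. c (g l', i) * D l (p i)) + (\<Sum>i\<in>UNIV. p i * D l (c (g l', i)))"
          by (simp add: der_sum[OF D(1)] der_mult[OF D(1)] sum.distrib)
        also have "(\<Sum>i\<in>UNIV. p i * D l (c (g l', i))) = (\<Sum>i\<in>UNIV. if i = m then (if l' = l then 1 else 0) else 0)"
          using g l m by (intro sum.cong refl) (auto simp: D(3) dest: inj_onD)
        also have "\<dots> = (if l' = l then 1 else 0)" by (simp add: sum.delta)
        finally have "dot (\<chi> i. c (g l', i)) (\<chi> i. D l (p i)) = - (if l' = l then 1 else 0)"
          by (simp add: dot_def eq_neg_iff_add_eq_0)
        then show ?thesis by simp
      qed
    qed simp
    then show ?thesis by (simp add: pdim_eq[OF rel] rel)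
  qed
  ultimately show ?thesis using V by blast
qed

text \<open>Both directions pass through an irreducible subset: the top of a long chain meets linear
  spaces because its \<open>pdim\<close> is large, and a set meeting all of them contains a variety
  with large \<open>pdim\<close>, which has a long chain starting at any regular point.\<close>

theorem krull_dim_ge_iff:
  fixes F :: "('k::{alg_closed_field, field_char_0}, 'n::finite) proj_space set"
  assumes F: "closedin zariski F" and ne: "F \<noteq> {}"
  shows "enat k \<le> krull_dim zariski F \<longleftrightarrow> meets F k"
proof
  assume k: "meets F k"
  obtain V where V: "irreducible_variety V" "V \<subseteq> F" "k < pdim V" using meets_irreducible[OF F k] by blast
  have irr: "irreducible_in zariski V" and cl: "closedin zariski V"
    using V(1) by (auto simp: irreducible_variety_def projective_variety_def)
  obtain x where "x \<in> regular_locus V" using regular_locus_nonempty[OF irr] by blast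
  then obtain W where W: "irred_chain zariski V (pdim V - 1) W" using regular_chain[OF V(1)] by blast
  have "irred_chain zariski F (pdim V - 1) W"
    using W V(2) unfolding irred_chain_def closedin_closed_subtopology[OF cl] closedin_closed_subtopology[OF F]
    by blast
  then have "enat (pdim V - 1) \<le> krull_dim zariski F"
    unfolding krull_dim_def by (intro Sup_upper) blast
  moreover have "enat k \<le> enat (pdim V - 1)" using V(3) by simp
  ultimately show "enat k \<le> krull_dim zariski F" by (rule order_trans[rotated])
next
  assume k: "enat k \<le> krull_dim zariski F"
  show "meets F k"
  proof (rule ccontr)
    assume no: "\<not> meets F k"
    then have "k \<noteq> 0" using ne by (metis meets_0)
    have "krull_dim zariski F \<le> enat (k - 1)"
      unfolding krull_dim_def
    proof (rule Sup_least)
      fix d assume "d \<in> {enat n |n. \<exists>V. irred_chain zariski F n V}"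
      then obtain n V where n: "d = enat n" "irred_chain zariski F n V" by blast
      have Vn: "closedin zariski (V n)" "V n \<subseteq> F" "irreducible_in zariski (V n)"
        using n(2) by (auto simp: irred_chain_def closedin_closed_subtopology[OF F])
      have "n < pdim (V n)" using chain_length[OF F n(2), of n] by simp
      then have "meets (V n) n"
        using Vn by (intro irreducible_meets) (auto simp: irreducible_variety_def projective_variety_def)
      then have "\<not> k \<le> n" using no meets_mono[of "V n" n F k] Vn(2) by blast
      then show "d \<le> enat (k - 1)" using n(1) by simp
    qed
    then have "enat k \<le> enat (k - 1)" using k by (rule order_trans[rotated])
    then show False using \<open>k \<noteq> 0\<close> by simp
  qed
qed

section \<open>Conormal varieties\<close>

lemma tangent_lin_scale: "v \<in> tangent_lin X x \<Longrightarrow> c *s v \<in> tangent_lin X x"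
proof -
  assume v: "v \<in> tangent_lin X x"
  have "(\<Sum>i\<in>UNIV. g i * (c *s v) $ i) = c * (\<Sum>i\<in>UNIV. g i * v $ i)" for g
    by (simp add: sum_distrib_left mult_ac)
  then show ?thesis using v unfolding tangent_lin_def by auto
qed

lemma tangent_hyperplane:
  assumes h: "h \<in> hcoords H"
  shows "tangent_space X x \<subseteq> hyperplane H \<longleftrightarrow> (\<forall>v\<in>tangent_lin X x. dot h v = 0)"
proof
  assume sub: "tangent_space X x \<subseteq> hyperplane H"
  show "\<forall>v\<in>tangent_lin X x. dot h v = 0"
  proof
    fix v assume v: "v \<in> tangent_lin X x"
    show "dot h v = 0"
    proof (cases "v = 0")
      case False
      have "hcoords (pt v) \<subseteq> tangent_lin X x"
      proof
        fix w assume "w \<in> hcoords (pt v)"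
        then obtain c where "w = c *s v" using hcoords_multiple[OF hcoords_pt[OF False]] by blast
        then show "w \<in> tangent_lin X x" using tangent_lin_scale[OF v] by simp
      qed
      then have "pt v \<in> hyperplane H" using sub by (auto simp: tangent_space_def)
      then show ?thesis using h hcoords_pt[OF False] by (auto simp: hyperplane_def dot_def)
    qed simp
  qed
next
  assume *: "\<forall>v\<in>tangent_lin X x. dot h v = 0"
  show "tangent_space X x \<subseteq> hyperplane H"
  proof
    fix y assume y: "y \<in> tangent_space X x"
    have "dot h' a = 0" if h': "h' \<in> hcoords H" and a: "a \<in> hcoords y" for h' a
    proof -
      obtain c where "h' = c *s h" using hcoords_multiple[OF h h'] by blast
      then show ?thesis using * y a by (auto simp: tangent_space_def dot_scale_left)
    qed
    then show "y \<in> hyperplane H" by (auto simp: hyperplane_def dot_def)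
  qed
qed

definition conormal_pairs ::
  "('k::field_char_0, 'n::finite) proj_space set \<Rightarrow> ('k, 'n) proj_space set \<Rightarrow>
    (('k, 'n) proj_space \<times> ('k, 'n) proj_space) set" where
  "conormal_pairs X Z = {(x, H). x \<in> regular_locus X \<and> x \<in> Z \<and> tangent_space X x \<subseteq> hyperplane H}"

lemma rel_conormal_eq:
  fixes X :: "('k::{alg_closed_field, field_char_0}, 'n::finite) proj_space set"
  assumes "irreducible_variety X"
  shows "rel_conormal X Z = bizariski closure_of conormal_pairs X Z"
  unfolding rel_conormal_def conormal_pairs_def smooth_locus_eq[OF assms] by simp

lemma conormal_rel_conormal:
  fixes X :: "('k::{alg_closed_field, field_char_0}, 'n::finite) proj_space set"
  assumes "irreducible_variety X"
  shows "conormal X = rel_conormal X X"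
proof -
  have "{(x, H). x \<in> smooth_locus X \<and> tangent_space X x \<subseteq> hyperplane H}
      = {(x, H). x \<in> smooth_locus X \<inter> X \<and> tangent_space X x \<subseteq> hyperplane H}"
    by (auto simp: smooth_locus_def)
  then show ?thesis by (simp add: conormal_def rel_conormal_def)
qed

lemma closed_rel_conormal: "closedin bizariski (rel_conormal X Z)"
  by (simp add: rel_conormal_def)

lemma rel_conormal_mono: "Z \<subseteq> Z' \<Longrightarrow> rel_conormal X Z \<subseteq> rel_conormal X Z'"
  unfolding rel_conormal_def by (intro closure_of_mono) auto

lemma in_bicone_iff:
  "case_sum (($) v) (($) w) \<in> bicone W \<longleftrightarrow> v \<noteq> 0 \<and> w \<noteq> 0 \<and> (pt v, pt w) \<in> W"
proof
  assume "case_sum (($) v) (($) w) \<in> bicone W"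
  then obtain v' w' x y where *: "case_sum (($) v) (($) w) = case_sum (($) v') (($) w')"
    "(x, y) \<in> W" "v' \<in> hcoords x" "w' \<in> hcoords y"
    by (auto simp: bicone_def)
  have "v $ i = v' $ i" "w $ j = w' $ j" for i j
    using fun_cong[OF *(1), of "Inl i"] fun_cong[OF *(1), of "Inr j"] by simp_all
  then have "v = v'" "w = w'" by (simp_all add: vec_eq_iff)
  then show "v \<noteq> 0 \<and> w \<noteq> 0 \<and> (pt v, pt w) \<in> W" using *(2-4) by (auto simp: in_hcoords_iff)
next
  assume "v \<noteq> 0 \<and> w \<noteq> 0 \<and> (pt v, pt w) \<in> W"
  then show "case_sum (($) v) (($) w) \<in> bicone W"
    unfolding bicone_def using hcoords_pt[of v] hcoords_pt[of w]
    by (intro CollectI exI[of _ v] exI[of _ w] exI[of _ "pt v"] exI[of _ "pt w"]) simp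
qed

text \<open>The locus where \<open>u\<close> kills the tangent space is cut out near a regular point by the
  polynomials obtained by pairing with the Cramer vectors of a frame.\<close>

definition kill_poly :: "'n set \<Rightarrow> ('n \<Rightarrow> ('k::field, 'n::finite) mpoly) \<Rightarrow> ('n \<Rightarrow> 'k ^ 'n) \<Rightarrow> 'n
    \<Rightarrow> ('k, 'n + 'n) mpoly" where
  "kill_poly B f e l = (\<Sum>i\<in>UNIV. mp_subst (\<lambda>i. mp_var (Inl i)) (cofield B f e l i) * mp_var (Inr i))"

lemma ev_kill_poly:
  assumes h: "rhom h"
  shows "ev h (kill_poly B f e l) (case_sum z u) = dot (\<chi> i. u i) (cofield_vec h B f e z l)"
  by (simp add: kill_poly_def ev_simps[OF h] ev_subst[OF h] dot_def cofield_vec_def mult.commute)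

lemma kills_tangent_iff:
  fixes X :: "('k::field_char_0, 'n::finite) proj_space set"
  assumes irr: "irreducible_in zariski X" and x: "x \<in> X" "a \<in> hcoords x"
    and f: "\<And>i. i \<in> B \<Longrightarrow> f i \<in> ideal X" and B: "card B + pdim X = CARD('n)"
    and det: "mp_eval (det (frame_poly B f e)) (($) a) \<noteq> 0"
  shows "(\<forall>v\<in>tangent_lin X x. dot u v = 0) \<longleftrightarrow>
    (\<forall>l. l \<notin> B \<longrightarrow> mp_eval (kill_poly B f e l) (case_sum (($) a) (($) u)) = 0)"
proof -
  have d: "det (frame (\<lambda>x. x) B f e (($) a)) \<noteq> 0"
    by (rule regular_if_frame(3)[OF irr x f B det])
  have t: "tangent_lin X x = ann ((\<lambda>i. frame (\<lambda>x. x) B f e (($) a) $ i) ` B)"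
    by (rule regular_if_frame(2)[OF irr x f B det])
  show ?thesis
    unfolding t kills_ann_iff[OF rhom_id d] mp_eval_ev ev_kill_poly[OF rhom_id] by simp
qed

text \<open>Over regular points the closure adds nothing. The conormal condition is given there by
  the polynomials \<open>kill_poly\<close>; multiplied by the determinant of the frame they vanish
  on all pairs, hence on the closure.\<close>

lemma rel_conormal_regular:
  fixes X Z :: "('k::{alg_closed_field, field_char_0}, 'n::finite) proj_space set"
  assumes X: "irreducible_variety X" and Z: "closedin zariski Z"
    and q: "(x, H) \<in> rel_conormal X Z" and x: "x \<in> regular_locus X"
  shows "(x, H) \<in> conormal_pairs X Z"
proof -
  have irr: "irreducible_in zariski X" using X by (simp add: irreducible_variety_def)
  have xX: "x \<in> X" using x by (simp add: regular_locus_def)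
  have qc: "(x, H) \<in> bizariski closure_of conormal_pairs X Z" using q by (simp add: rel_conormal_eq[OF X])
  have "closedin zariski (UNIV :: ('k, 'n) proj_space set)"
    using closedin_topspace[of "zariski :: ('k, 'n) proj_space topology"] by simp
  then have "bizariski closure_of conormal_pairs X Z \<subseteq> Z \<times> UNIV"
    using closed_vimage[OF Z] by (intro closure_of_minimal) (auto simp: conormal_pairs_def)
  then have xZ: "x \<in> Z" using qc by blast
  obtain a where a: "a \<in> hcoords x" using hcoords_nonempty by blast
  obtain h where h: "h \<in> hcoords H" using hcoords_nonempty by blast
  obtain B f e where f: "\<forall>i\<in>B. f i \<in> ideal X" "card B + pdim X = CARD('n)"
    "mp_eval (det (frame_poly B f e)) (($) a) \<noteq> 0" using frame_at_regular[OF irr x a] by blast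
  let ?d = "mp_subst (\<lambda>i. mp_var (Inl i)) (det (frame_poly B f e)) :: ('k, 'n + 'n) mpoly"
  have ev_d: "mp_eval ?d (case_sum (($) b) u) = mp_eval (det (frame_poly B f e)) (($) b)" for b u
    by (simp add: mp_eval_ev ev_subst ev_var)
  have "?d * kill_poly B f e l \<in> biideal (conormal_pairs X Z)" if l: "l \<notin> B" for l
    unfolding biideal_iff
  proof
    fix s assume "s \<in> bicone (conormal_pairs X Z)"
    then obtain b u y U where s: "s = case_sum (($) b) (($) u)" "(y, U) \<in> conormal_pairs X Z"
      "b \<in> hcoords y" "u \<in> hcoords U" by (auto simp: bicone_def)
    have y: "y \<in> X" and k: "\<forall>v\<in>tangent_lin X y. dot u v = 0"
      using s tangent_hyperplane[OF s(4), of X y] by (auto simp: conormal_pairs_def regular_locus_def)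
    show "mp_eval (?d * kill_poly B f e l) s = 0"
    proof (cases "mp_eval (det (frame_poly B f e)) (($) b) = 0")
      case True
      then show ?thesis by (simp add: mp_eval_mult s(1) ev_d)
    next
      case False
      have "mp_eval (kill_poly B f e l) (case_sum (($) b) (($) u)) = 0"
        using kills_tangent_iff[OF irr y s(3) _ f(2) False, of u] f(1) k l by blast
      then show ?thesis by (simp add: mp_eval_mult s(1))
    qed
  qed
  then have "bivanishes (?d * kill_poly B f e l) (x, H)" if "l \<notin> B" for l
    using qc that unfolding bizariski_closure_iff by blast
  then have "mp_eval (?d * kill_poly B f e l) (case_sum (($) a) (($) h)) = 0" if "l \<notin> B" for l
    using that a h by (auto simp: bivanishes_def)
  then have "mp_eval (kill_poly B f e l) (case_sum (($) a) (($) h)) = 0" if "l \<notin> B" for l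
    using that f(3) by (simp add: mp_eval_mult ev_d)
  then have "\<forall>v\<in>tangent_lin X x. dot h v = 0"
    using kills_tangent_iff[OF irr xX a _ f(2,3), of h] f(1) by blast
  then show ?thesis
    using x xZ tangent_hyperplane[OF h, of X x] by (simp add: conormal_pairs_def)
qed

lemma rel_conormal_subset:
  fixes X Z :: "('k::{alg_closed_field, field_char_0}, 'n::finite) proj_space set"
  assumes "closedin zariski Z"
  shows "rel_conormal X Z \<subseteq> Z \<times> UNIV"
proof -
  have "closedin zariski (UNIV :: ('k, 'n) proj_space set)"
    using closedin_topspace[of "zariski :: ('k, 'n) proj_space topology"] by simp
  then show ?thesis
    unfolding rel_conormal_def using closed_vimage[OF assms] by (intro closure_of_minimal) auto
qed

text \<open>The ideal of \<open>S\<close> consists of the relations of a point over a field, so it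
  is prime.\<close>

lemma irreducible_closure:
  fixes S :: "(('k::field_char_0, 'n::finite) proj_space \<times> ('k, 'm::finite) proj_space) set"
  assumes w: "relations om w = biideal S"
  shows "irreducible_in bizariski (bizariski closure_of S)"
  unfolding irreducible_in_def
proof (intro conjI allI impI; (elim conjE)?)
  have "1 \<notin> biideal S" unfolding w[symmetric] by (simp add: relations_def ev_1[OF rhom_om])
  then have "S \<noteq> {}" by (auto simp: biideal_def)
  then show "bizariski closure_of S \<noteq> {}"
    using closure_of_subset[of S bizariski] by auto
  fix C D :: "(('k, 'n) proj_space \<times> ('k, 'm) proj_space) set"
  assume C: "closedin bizariski C" and D: "closedin bizariski D" and sub: "bizariski closure_of S \<subseteq> C \<union> D"
  have sub': "S \<subseteq> C \<union> D" using sub closure_of_subset[of S bizariski] by simp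
  have ex: "\<exists>f\<in>biideal C. ev om f w \<noteq> 0" if C: "closedin bizariski C" "\<not> bizariski closure_of S \<subseteq> C" for C
  proof -
    have "\<not> S \<subseteq> C" using C closure_of_minimal by blast
    then obtain q where q: "q \<in> S" "q \<notin> C" by blast
    then obtain f where f: "f \<in> biideal C" "\<not> bivanishes f q" using biclosed_memI[OF C(1)] by blast
    then have "f \<notin> relations om w" unfolding w using q(1) by (auto simp: biideal_def)
    then show ?thesis using f(1) by (auto simp: relations_def)
  qed
  show "bizariski closure_of S \<subseteq> C \<or> bizariski closure_of S \<subseteq> D"
  proof (rule ccontr)
    assume "\<not> ?thesis"
    then obtain f g where f: "f \<in> biideal C" "ev om f w \<noteq> 0" and g: "g \<in> biideal D" "ev om g w \<noteq> 0"
      using ex[OF C] ex[OF D] by blast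
    have "f * g \<in> biideal S"
      unfolding biideal_iff
    proof
      fix s assume "s \<in> bicone S"
      then have "s \<in> bicone C \<or> s \<in> bicone D" using sub' unfolding bicone_def by blast
      then have "mp_eval f s = 0 \<or> mp_eval g s = 0" using f(1) g(1) unfolding biideal_iff by blast
      then show "mp_eval (f * g) s = 0" by (auto simp: mp_eval_mult)
    qed
    then have "ev om (f * g) w = 0" unfolding w[symmetric] by (simp add: relations_def)
    then show False using f(2) g(2) by (simp add: ev_mult[OF rhom_om])
  qed
qed simp

text \<open>The cylinder is a product: polynomials in its ideal have derivatives in the affine
  directions that vanish on it, so the affine part of a tangent vector can be corrected at
  will.\<close>

lemma cyl_tangent_split:
  fixes Z :: "('k::field_char_0, 'n::finite) proj_space set"
  assumes z: "relations om z = cyl_ideal Z" and v: "v \<in> tang om (relations om (\<lambda>i. z (Inl i))) (\<lambda>i. z (Inl i))"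
  shows "\<exists>D. derivation D \<and> (\<forall>k. D (om k) = 0) \<and> (\<forall>i. D (z (Inl i)) = v $ i) \<and> (\<forall>i. D (z (Inr i)) = \<mu> i)"
proof -
  obtain D where D: "derivation D" "\<And>k. D (om k) = 0" "\<And>i. D (z (Inl i)) = v $ i"
    using tang_derivation[OF rhom_om v] by blast
  have 1: "(\<chi> i. D (z i)) \<in> tang om (relations om z) z" by (rule derivation_tang[OF D(1) rhom_om D(2)])
  let ?w = "(\<chi> i. case_sum (\<lambda>i. 0) (\<lambda>i. \<mu> i - D (z (Inr i))) i) :: 'k omega ^ ('n + 'n)"
  have 2: "?w \<in> tang om (relations om z) z"
    unfolding tang_def ann_def
  proof clarify
    fix g assume g: "g \<in> relations om z"
    have "mp_pderiv (Inr i) g \<in> cyl_ideal Z" for i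
      unfolding cyl_ideal_def cyl_def
    proof clarify
      fix b l assume b: "b \<in> cone Z"
      have zero: "mp_eval (fixl b g) s = 0" for s
        using g b unfolding z by (auto simp: mp_eval_fixl cyl_ideal_def cyl_def)
      have der: "derivation (mp_pderiv i :: ('k, 'n) mpoly \<Rightarrow> _)"
        by (simp add: derivation_def mp_pderiv_add mp_pderiv_mult)
      let ?\<sigma> = "case_sum (\<lambda>i. mp_const (b i)) mp_var :: 'n + 'n \<Rightarrow> ('k, 'n) mpoly"
      have "mp_pderiv i (fixl b g) = (\<Sum>j\<in>UNIV. ev mp_const (mp_pderiv j g) ?\<sigma> * mp_pderiv i (?\<sigma> j))"
        unfolding fixl_def mp_subst_def by (rule der_ev[OF der rhom_mp_const]) simp
      also have "\<dots> = (\<Sum>j\<in>UNIV. if j = Inr i then ev mp_const (mp_pderiv j g) ?\<sigma> else 0)"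
        by (intro sum.cong refl) (auto simp: mp_pderiv_var split: sum.splits)
      finally have "mp_pderiv i (fixl b g) = fixl b (mp_pderiv (Inr i) g)"
        by (simp add: sum.delta fixl_def mp_subst_def)
      then show "mp_eval (mp_pderiv (Inr i) g) (case_sum b l) = 0"
        using pderiv_zero_function[OF zero, of i l] by (simp add: mp_eval_fixl)
    qed
    then have "ev om (mp_pderiv (Inr i) g) z = 0" for i
      unfolding z[symmetric] by (simp add: relations_def)
    then have "grad om g z $ i * ?w $ i = 0" for i by (cases i) simp_all
    then show "dot (grad om g z) ?w = 0" unfolding dot_def by (intro sum.neutral) blast
  qed
  have "(\<chi> i. D (z i)) + ?w \<in> tang om (relations om z) z"
    using 1 2 by (rule vec.subspace_add[OF subspace_tang])
  from tang_derivation[OF rhom_om this] obtain D' where D': "derivation D'" "\<And>k. D' (om k) = 0"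
    "\<And>i. D' (z i) = D (z i) + (case_sum (\<lambda>i. 0) (\<lambda>i. \<mu> i - D (z (Inr i))) i)" by auto
  then show ?thesis by (intro exI[of _ D']) (simp add: D(3))
qed

text \<open>A generic point of a relative conormal variety, parametrized by a generic point \<open>x\<close> of \<open>Z\<close> and
  generic coefficients \<open>c\<close> of a combination of the gradients of a frame.\<close>

lemma conormal_generic:
  fixes X Z :: "('k::{alg_closed_field, field_char_0}, 'n::finite) proj_space set"
  assumes X: "irreducible_variety X" and Z: "irreducible_variety Z" "Z \<subseteq> X"
    and x0: "x0 \<in> regular_locus X" "x0 \<in> Z" and dim: "pdim X < CARD('n)"
  shows "\<exists>B f e z y. (\<forall>i\<in>B. f i \<in> ideal X) \<and> card B + pdim X = CARD('n) \<and>
    det (frame om B f e (\<lambda>i. z (Inl i))) \<noteq> 0 \<and> relations om z = cyl_ideal Z \<and>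
    relations om (\<lambda>i. z (Inl i)) = ideal Z \<and>
    y = (\<lambda>k. \<Sum>i\<in>B. z (Inr i) * ev om (mp_pderiv k (f i)) (\<lambda>i. z (Inl i))) \<and>
    inst (bicone (conormal_pairs X Z)) (case_sum (\<lambda>i. z (Inl i)) y) \<and>
    relations om (case_sum (\<lambda>i. z (Inl i)) y) = biideal (conormal_pairs X Z)"
proof -
  have irrX: "irreducible_in zariski X" and irrZ: "irreducible_in zariski Z"
    using X Z by (auto simp: irreducible_variety_def)
  obtain a0 where a0: "a0 \<in> hcoords x0" using hcoords_nonempty by blast
  obtain B f e where f: "\<forall>i\<in>B. f i \<in> ideal X" "card B + pdim X = CARD('n)"
    "mp_eval (det (frame_poly B f e)) (($) a0) \<noteq> 0" using frame_at_regular[OF irrX x0(1) a0] by blast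
  let ?d = "det (frame_poly B f e)"
  have dZ: "?d \<notin> ideal Z" using f(3) a0 x0(2) by (auto simp: ideal_def vanishes_def)
  \<comment> \<open>Since \<open>pdim X\<close> is less than \<open>CARD('n)\<close> some gradient
    occurs; its generic coefficient is nonzero and keeps \<open>y\<close> from vanishing.\<close>
  obtain i1 where i1: "i1 \<in> B" using f(2) dim by (metis add_0 card.empty ex_in_conv less_irrefl)
  obtain z where z: "inst (cyl Z) z" "relations om z = cyl_ideal Z" using cyl_generic_exists[OF irrZ] by blast
  define x where "x i = z (Inl i)" for i
  define up :: "('k, 'n) mpoly \<Rightarrow> ('k, 'n + 'n) mpoly" where "up = mp_subst (\<lambda>i. mp_var (Inl i))"
  have ev_up: "ev h (up g) t = ev h g (\<lambda>i. t (Inl i))" if "rhom h" for h :: "'k \<Rightarrow> 'r::comm_ring_1" and g t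
    by (simp add: up_def ev_subst[OF that] ev_var[OF that])
  have relx: "relations om x = ideal Z"
  proof -
    have "g \<in> relations om x \<longleftrightarrow> up g \<in> relations om z" for g
      by (simp add: relations_def ev_up[OF rhom_om] x_def[abs_def])
    moreover have "up g \<in> cyl_ideal Z \<longleftrightarrow> g \<in> ideal Z" for g
    proof -
      have "mp_eval (up g) (case_sum b c) = mp_eval g b" for b c by (simp add: mp_eval_ev ev_up)
      then show ?thesis unfolding cyl_ideal_def cyl_def ideal_iff by fastforce
    qed
    ultimately show ?thesis by (auto simp: z(2))
  qed
  have detx: "det (frame om B f e x) \<noteq> 0"
    using dZ ev_frame_det[OF rhom_om, of B f e x] by (simp add: relx[symmetric] relations_def)
  have hp_gen: "ev h (\<Sum>i\<in>B'. mp_var (Inr i) * up (mp_pderiv k (f' i))) t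
      = (\<Sum>i\<in>B'. t (Inr i) * ev h (mp_pderiv k (f' i)) (\<lambda>i. t (Inl i)))"
    if "rhom h" for h :: "'k \<Rightarrow> 'r::comm_ring_1" and f' :: "'n \<Rightarrow> ('k, 'n) mpoly" and k t B'
    by (simp add: ev_simps[OF that] ev_up[OF that])
  define par where "par B' f' = case_sum (\<lambda>i. mp_var (Inl i)) (\<lambda>k. \<Sum>i\<in>B'. mp_var (Inr i) * up (mp_pderiv k (f' i)))"
    for B' and f' :: "'n \<Rightarrow> ('k, 'n) mpoly"
  define y where "y = (\<lambda>k. \<Sum>i\<in>B. z (Inr i) * ev om (mp_pderiv k (f i)) x)"
  have ev_par: "(\<lambda>i. ev om (par B f i) z) = case_sum x y"
    by (auto simp: fun_eq_iff par_def x_def[abs_def] y_def ev_var[OF rhom_om] hp_gen[OF rhom_om] split: sum.splits)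
  have eval_par: "(\<lambda>i. mp_eval (par B' f' i) (case_sum (($) b) l)) =
      case_sum (($) b) (($) (\<Sum>i\<in>B'. l i *s grad (\<lambda>x. x) (f' i) (($) b)))" for B' f' b l
    by (auto simp: fun_eq_iff par_def mp_eval_ev ev_var hp_gen sum_component split: sum.splits)
  have rows: "frame (\<lambda>x. x) B' f' e' t $ i = grad (\<lambda>x. x) (f' i) t" if "i \<in> B'" for B' f' e' t i
    using that by (simp add: frame_def)
  have kill: "dot (\<Sum>i\<in>B'. l i *s grad (\<lambda>x. x) (f' i) (($) b)) v = 0"
    if "\<forall>i\<in>B'. f' i \<in> ideal X" "t \<in> X" "b \<in> hcoords t" "v \<in> tangent_lin X t" for B' f' b l t v
  proof -
    have "dot (grad (\<lambda>x. x) (f' i) (($) b)) v = 0" if "i \<in> B'" for i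
      using that \<open>\<forall>i\<in>B'. f' i \<in> ideal X\<close> \<open>v \<in> tangent_lin X t\<close>
      unfolding tangent_lin_eq[OF \<open>t \<in> X\<close> \<open>b \<in> hcoords t\<close>] by (auto simp: tang_def ann_def)
    then show ?thesis unfolding dot_sum_left dot_scale_left by (intro sum.neutral) simp
  qed
  have inst: "inst (bicone (conormal_pairs X Z)) (case_sum x y)"
  proof -
    obtain s where s: "z = (\<lambda>i. st (s i))" "eventually (\<lambda>j. (\<lambda>i. s i j) \<in> cyl Z) oF"
      using z(1) by (auto simp: inst_def)
    have x_st: "x = (\<lambda>i. st (s (Inl i)))" by (simp add: x_def[abs_def] s(1))
    have "ev om ?d x \<noteq> 0" using detx ev_frame_det[OF rhom_om, of B f e x] by simp
    then have e1: "eventually (\<lambda>j. mp_eval ?d (\<lambda>i. s (Inl i) j) \<noteq> 0) oF"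
      unfolding x_st st_ev st_eq_0 oF_not .
    have "z (Inr i1) \<noteq> 0"
    proof
      assume "z (Inr i1) = 0"
      then have "mp_var (Inr i1) \<in> cyl_ideal Z" unfolding z(2)[symmetric] by (simp add: relations_def ev_var[OF rhom_om])
      moreover have "case_sum (($) a0) (\<lambda>i. 1) \<in> cyl Z" using a0 x0(2) by (auto simp: cyl_def cone_def)
      ultimately have "mp_eval (mp_var (Inr i1)) (case_sum (($) a0) (\<lambda>i. 1)) = 0" by (simp add: cyl_ideal_def)
      then show False by (simp add: mp_eval_ev ev_var)
    qed
    then have "\<not> eventually (\<lambda>j. s (Inr i1) j = 0) oF" by (simp add: s(1) st_eq_0)
    then have e2: "eventually (\<lambda>j. s (Inr i1) j \<noteq> 0) oF" by (simp add: oF_not)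
    have par_st: "case_sum x y = (\<lambda>i. st (\<lambda>j. mp_eval (par B f i) (\<lambda>i. s i j)))"
      unfolding ev_par[symmetric] s(1) st_ev ..
    have "eventually (\<lambda>j. (\<lambda>i. mp_eval (par B f i) (\<lambda>i. s i j)) \<in> bicone (conormal_pairs X Z)) oF"
      using s(2) e1 e2
    proof eventually_elim
      case (elim j)
      obtain b l t where bl: "(\<lambda>i. s i j) = case_sum (($) b) l" "t \<in> Z" "b \<in> hcoords t"
        using elim(1) by (auto simp: cyl_def cone_def)
      have sj: "s (Inl i) j = b $ i" "s (Inr i) j = l i" for i
        using fun_cong[OF bl(1), of "Inl i"] fun_cong[OF bl(1), of "Inr i"] by simp_all
      have db: "mp_eval ?d (($) b) \<noteq> 0" using elim(2) by (simp add: sj)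
      have tX: "t \<in> X" using bl(2) Z(2) by blast
      note reg = regular_if_frame[OF irrX tX bl(3) bspec[OF f(1)] f(2) db]
      let ?h = "\<Sum>i\<in>B. l i *s grad (\<lambda>x. x) (f i) (($) b)"
      have "?h \<noteq> 0"
      proof
        assume h0: "?h = 0"
        obtain v where v: "frame (\<lambda>x. x) B f e (($) b) *v v = axis i1 1"
          using nonsingular_solve[OF reg(3)] by blast
        have "dot (grad (\<lambda>x. x) (f i) (($) b)) v = (if i = i1 then 1 else 0)" if "i \<in> B" for i
          using arg_cong[OF v, of "\<lambda>w. w $ i"] rows[OF that, of f e "($) b"]
          by (auto simp: matrix_dot axis_def)
        then have "dot ?h v = (\<Sum>i\<in>B. if i = i1 then l i else 0)"
          unfolding dot_sum_left dot_scale_left by (intro sum.cong refl) auto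
        then show False using h0 i1 elim(3) by (simp add: sum.delta sj)
      qed
      moreover have "b \<noteq> 0" "pt b = t" using bl(3) by (auto simp: in_hcoords_iff)
      moreover have "tangent_space X t \<subseteq> hyperplane (pt ?h)"
        using kill[OF f(1) tX bl(3)] by (subst tangent_hyperplane[OF hcoords_pt[OF \<open>?h \<noteq> 0\<close>]]) blast
      ultimately show ?case
        unfolding bl(1) eval_par in_bicone_iff using reg(1) bl(2) by (simp add: conormal_pairs_def)
    qed
    then show ?thesis
      unfolding par_st inst_def by (intro exI[of _ "\<lambda>i j. mp_eval (par B f i) (\<lambda>i. s i j)"] conjI refl)
  qed
  have rel: "relations om (case_sum x y) = biideal (conormal_pairs X Z)"
  proof (intro equalityI subsetI)
    fix F assume "F \<in> biideal (conormal_pairs X Z)"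
    then have "ev om F (case_sum x y) = 0" by (intro inst_ev_0[OF inst]) (simp add: biideal_iff)
    then show "F \<in> relations om (case_sum x y)" by (simp add: relations_def)
  next
    fix F assume "F \<in> relations om (case_sum x y)"
    then have "mp_subst (par B f) F \<in> cyl_ideal Z"
      unfolding z(2)[symmetric] by (simp add: relations_def ev_subst[OF rhom_om] ev_par)
    then have F0: "mp_eval F (case_sum (($) b) (($) (\<Sum>i\<in>B. l i *s grad (\<lambda>x. x) (f i) (($) b)))) = 0"
      if "t \<in> Z" "b \<in> hcoords t" for b l t
      using that unfolding cyl_ideal_def cyl_def cone_def
      by (fastforce simp: mp_eval_ev ev_subst eval_par[unfolded mp_eval_ev])
    have F1: "mp_eval F (case_sum (($) b) (($) u)) = 0"
      if t: "t \<in> Z" "b \<in> hcoords t" and db: "mp_eval ?d (($) b) \<noteq> 0" and u: "\<forall>v\<in>tangent_lin X t. dot u v = 0" for b t u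
    proof -
      have tX: "t \<in> X" using t(1) Z(2) by blast
      note reg = regular_if_frame[OF irrX tX t(2) bspec[OF f(1)] f(2) db]
      obtain l where "u = (\<Sum>i\<in>B. l i *s frame (\<lambda>x. x) B f e (($) b) $ i)"
        using double_ann[OF reg(3), of B u] u reg(2) by blast
      also have "\<dots> = (\<Sum>i\<in>B. l i *s grad (\<lambda>x. x) (f i) (($) b))"
        by (intro sum.cong refl) (simp add: rows)
      finally show ?thesis using F0[OF t] by simp
    qed
    show "F \<in> biideal (conormal_pairs X Z)"
      unfolding biideal_iff
    proof
      fix s assume "s \<in> bicone (conormal_pairs X Z)"
      then obtain b u t U where s: "s = case_sum (($) b) (($) u)" "(t, U) \<in> conormal_pairs X Z"
        "b \<in> hcoords t" "u \<in> hcoords U" by (auto simp: bicone_def)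
      have t: "t \<in> regular_locus X" "t \<in> Z" and ku: "\<forall>v\<in>tangent_lin X t. dot u v = 0"
        using s tangent_hyperplane[OF s(4), of X t] by (auto simp: conormal_pairs_def)
      have tX: "t \<in> X" using t(2) Z(2) by blast
      \<comment> \<open>The chosen frame may degenerate at this regular point. Another frame
        represents \<open>u\<close> there, and with the coefficients \<open>l\<close> held fixed the
        resulting polynomial vanishes wherever the first frame is nonsingular, hence on all of
        \<open>Z\<close> by primality.\<close>
      obtain B' f' e' where f': "\<forall>i\<in>B'. f' i \<in> ideal X" "card B' + pdim X = CARD('n)"
        "mp_eval (det (frame_poly B' f' e')) (($) b) \<noteq> 0" using frame_at_regular[OF irrX t(1) s(3)] by blast
      note reg = regular_if_frame[OF irrX tX s(3) bspec[OF f'(1)] f'(2,3)]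
      obtain l where l: "u = (\<Sum>i\<in>B'. l i *s frame (\<lambda>x. x) B' f' e' (($) b) $ i)"
        using double_ann[OF reg(3), of B' u] ku reg(2) by blast
      have l': "u = (\<Sum>i\<in>B'. l i *s grad (\<lambda>x. x) (f' i) (($) b))"
        unfolding l by (intro sum.cong refl) (simp add: rows)
      let ?q = "fixr l (mp_subst (par B' f') F)"
      have ev_q: "mp_eval ?q (($) b') = mp_eval F (case_sum (($) b') (($) (\<Sum>i\<in>B'. l i *s grad (\<lambda>x. x) (f' i) (($) b'))))" for b'
        by (subst mp_eval_fixr) (simp only: mp_eval_ev ev_subst[OF rhom_id] eval_par[unfolded mp_eval_ev])
      have "?d * ?q \<in> ideal Z"
        unfolding ideal_def vanishes_def
      proof (intro CollectI ballI)
        fix t' b' assume t': "t' \<in> Z" "b' \<in> hcoords t'"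
        show "mp_eval (?d * ?q) (($) b') = 0"
        proof (cases "mp_eval ?d (($) b') = 0")
          case False
          have "mp_eval ?q (($) b') = 0"
            unfolding ev_q by (rule F1[OF t' False]) (use kill[OF f'(1) _ t'(2)] t'(1) Z(2) in blast)
          then show ?thesis by (simp add: mp_eval_mult)
        qed (simp add: mp_eval_mult)
      qed
      then have "?q \<in> ideal Z" using ideal_prime[OF irrZ] dZ by blast
      then have "mp_eval ?q (($) b) = 0" using t(2) s(3) by (auto simp: ideal_def vanishes_def)
      then show "mp_eval F s = 0" unfolding ev_q s(1) l' .
    qed
  qed
  show ?thesis
    using f(1,2) detx z(2) relx inst rel unfolding x_def[abs_def] y_def by blast
qed

section \<open>Biduality\<close>

text \<open>There are \<open>pdim X\<close> directions that move \<open>x\<close> and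
  \<open>card B\<close> that move the coefficients of the gradients with \<open>x\<close> fixed. The
  total \<open>CARD('n)\<close> includes one scaling in each factor, so the conormal variety itself
  has dimension \<open>CARD('n) - 2\<close>.\<close>

lemma conormal_dim:
  fixes X :: "('k::field_char_0, 'n::finite) proj_space set"
  assumes f: "\<And>i. i \<in> B \<Longrightarrow> f i \<in> ideal X" and B: "card B + pdim X = CARD('n)"
    and det: "det (frame om B f e (\<lambda>i. z (Inl i))) \<noteq> 0"
    and z: "relations om z = cyl_ideal X" and relx: "relations om (\<lambda>i. z (Inl i)) = ideal X"
    and y: "y = (\<lambda>k. \<Sum>i\<in>B. z (Inr i) * ev om (mp_pderiv k (f i)) (\<lambda>i. z (Inl i)))"
  defines "w \<equiv> case_sum (\<lambda>i. z (Inl i)) y"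
  shows "vec.dim (tang om (relations om w) w) = CARD('n)"
proof -
  define x where "x i = z (Inl i)" for i
  define c where "c i = z (Inr i)" for i
  have w: "w = case_sum x y" by (simp add: w_def x_def[abs_def])
  have y': "y k = (\<Sum>i\<in>B. c i * ev om (mp_pderiv k (f i)) x)" for k by (simp add: y c_def x_def[abs_def])
  define M where "M = frame om B f e x"
  have M: "det M \<noteq> 0" using det by (simp add: M_def x_def[abs_def])
  have "\<forall>i. \<exists>v. M *v v = axis i 1" using nonsingular_solve[OF M] by blast
  then obtain V where V: "\<And>i. M *v V i = axis i 1" by metis
  have MV: "dot (M $ j) (V i) = (if j = i then 1 else 0)" for i j
    using arg_cong[OF V[of i], of "\<lambda>w. w $ j"] by (simp add: matrix_dot axis_def)
  have rows: "M $ i = grad om (f i) x" if "i \<in> B" for i using that by (simp add: M_def frame_def)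
  have tx: "tang om (relations om x) x = ann ((\<lambda>i. M $ i) ` B)"
  proof -
    have rx: "relations om x = ideal X" using relx by (simp add: x_def[abs_def])
    show ?thesis
      unfolding rx M_def
      by (rule frame_tang(2)[OF f]) (use M B pdim_eq[OF rx] in \<open>simp_all add: M_def\<close>)
  qed
  \<comment> \<open>Linear coordinates on the tangent space: for \<open>i\<close> outside
    \<open>B\<close> row \<open>i\<close> measures the motion of \<open>x\<close>; for
    \<open>i\<close> in \<open>B\<close> the dual vector \<open>V i\<close> extracts
    \<open>D (c i)\<close> from \<open>D y\<close> once \<open>x\<close> is fixed.\<close>
  define U where "U i = ((if i \<in> B then (\<chi> s. case_sum (\<lambda>k. 0) (\<lambda>k. V i $ k) s)
      else (\<chi> s. case_sum (\<lambda>k. M $ i $ k) (\<lambda>k. 0) s)) :: 'k omega ^ ('n + 'n))" for i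
  have sum_plus: "(\<Sum>s\<in>UNIV. g s) = (\<Sum>k\<in>UNIV. g (Inl k)) + (\<Sum>k\<in>UNIV. g (Inr k))" for g :: "'n + 'n \<Rightarrow> 'k omega"
    unfolding UNIV_sum by (subst sum.union_disjoint) (auto simp: sum.reindex)
  have U: "dot (U i) v = (if i \<in> B then dot (V i) (\<chi> k. v $ Inr k) else dot (M $ i) (\<chi> k. v $ Inl k))" for i v
    by (simp add: dot_def sum_plus U_def)
  have Dy: "dot (V i) (\<chi> k. D (y k)) = D (c i)"
    if D: "derivation D" "\<And>k. D (om k) = 0" "\<And>i. D (x i) = 0" and i: "i \<in> B" for D i
  proof -
    have "D (ev om g x) = 0" for g unfolding der_ev[OF D(1) rhom_om D(2)] by (simp add: D(3))
    then have "(\<chi> k. D (y k)) = (\<Sum>j\<in>B. D (c j) *s M $ j)"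
      by (simp add: vec_eq_iff y' der_sum[OF D(1)] der_mult[OF D(1)] sum_component rows mult.commute)
    then have "dot (V i) (\<chi> k. D (y k)) = (\<Sum>j\<in>B. D (c j) * dot (M $ j) (V i))"
      by (simp only: dot_commute[of "V i"] dot_sum_left dot_scale_left)
    also have "\<dots> = (\<Sum>j\<in>B. if j = i then D (c j) else 0)"
      by (intro sum.cong refl) (simp add: MV)
    finally show ?thesis using i by (simp add: sum.delta)
  qed
  \<comment> \<open>A tangent vector killed by all \<open>U i\<close> has \<open>D x = 0\<close>,
    because the gradients in \<open>B\<close> kill \<open>D x\<close> anyway; then
    \<open>D c\<close> vanishes on \<open>B\<close>, and so does \<open>D y\<close>.\<close>
  have upper: "vec.dim (tang om (relations om w) w) \<le> CARD('n)"
  proof (rule ccontr)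
    assume "\<not> ?thesis"
    then have gt: "CARD('n) < vec.dim (tang om (relations om w) w)" by simp
    obtain q :: "nat \<Rightarrow> 'n" where q: "bij_betw q {..<CARD('n)} UNIV"
      using ex_bij_betw_nat_finite[of "UNIV :: 'n set"] by (auto simp: lessThan_atLeast0)
    obtain v where v: "v \<in> tang om (relations om w) w" "v \<noteq> 0" "\<And>j. j < CARD('n) \<Longrightarrow> dot (U (q j)) v = 0"
      using common_kernel[OF subspace_tang gt, of "\<lambda>j. U (q j)"] by blast
    have Uv: "dot (U i) v = 0" for i
    proof -
      have "i \<in> q ` {..<CARD('n)}" using q by (simp add: bij_betw_def)
      then show ?thesis using v(3) by auto
    qed
    obtain D where D: "derivation D" "\<And>k. D (om k) = 0" "\<And>i. D (w i) = v $ i"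
      using tang_derivation[OF rhom_om v(1)] by blast
    have vx: "v $ Inl k = D (x k)" and vy: "v $ Inr k = D (y k)" for k
      using D(3)[of "Inl k"] D(3)[of "Inr k"] by (simp_all add: w)
    have "dot (M $ i) (\<chi> k. D (x k)) = 0" for i
    proof (cases "i \<in> B")
      case True
      have "ev om (f i) x = 0" using f[OF True] relx by (auto simp: relations_def x_def[abs_def])
      then show ?thesis
        unfolding rows[OF True] der_ev_grad[OF D(1) rhom_om D(2), symmetric] by (simp add: der_0[OF D(1)])
    next
      case False
      then show ?thesis using Uv[of i] by (simp add: U vx)
    qed
    then have "M *v (\<chi> k. D (x k)) = M *v 0" by (simp add: vec_eq_iff matrix_dot)
    then have "(\<chi> k. D (x k)) = 0" by (rule nonsingular_inj[OF M])
    then have Dx: "D (x k) = 0" for k by (simp add: vec_eq_iff)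
    have Dc: "D (c i) = 0" if "i \<in> B" for i
      using Dy[OF D(1,2) Dx that] Uv[of i] that by (simp add: U vy)
    have "D (ev om g x) = 0" for g unfolding der_ev[OF D(1) rhom_om D(2)] by (simp add: Dx)
    then have "D (y k) = 0" for k by (simp add: y' der_sum[OF D(1)] der_mult[OF D(1)] Dc)
    then have "v $ s = 0" for s by (cases s) (simp_all add: vx vy Dx)
    then show False using v(2) by (simp add: vec_eq_iff)
  qed
  define N where "N = (\<chi> i. U i)"
  have "(*v) N ` tang om (relations om w) w = UNIV"
  proof (rule UNIV_eq_I[symmetric])
    fix t
    have "(\<Sum>i\<in>- B. t $ i *s V i) \<in> tang om (relations om x) x"
    proof -
      have "dot (M $ j) (\<Sum>i\<in>- B. t $ i *s V i) = 0" if "j \<in> B" for j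
        unfolding dot_commute[of "M $ j"] dot_sum_left dot_scale_left
        using that by (intro sum.neutral) (auto simp: dot_commute[of _ "M $ j"] MV)
      then show ?thesis unfolding tx by (auto simp: ann_def)
    qed
    from cyl_tangent_split[OF z this[unfolded x_def[abs_def]], of "\<lambda>i. 0"]
    obtain D where D: "derivation D" "\<And>k. D (om k) = 0" "\<And>k. D (x k) = (\<Sum>i\<in>- B. t $ i *s V i) $ k"
      by (auto simp: x_def)
    let ?v = "\<chi> s. D (w s)"
    have v: "?v \<in> tang om (relations om w) w" by (rule derivation_tang[OF D(1) rhom_om D(2)])
    \<comment> \<open>A second derivation with \<open>x\<close> fixed corrects the forms with index
      in \<open>B\<close> without disturbing the others.\<close>
    have 0: "0 \<in> tang om (relations om (\<lambda>i. z (Inl i))) (\<lambda>i. z (Inl i))" by (rule vec.subspace_0[OF subspace_tang])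
    from cyl_tangent_split[OF z 0, of "\<lambda>i. t $ i - dot (U i) ?v"]
    obtain D' where D': "derivation D'" "\<And>k. D' (om k) = 0" "\<And>k. D' (x k) = 0"
      "\<And>i. D' (c i) = t $ i - dot (U i) ?v" by (auto simp: x_def c_def)
    let ?v' = "\<chi> s. D' (w s)"
    have v': "?v' \<in> tang om (relations om w) w" by (rule derivation_tang[OF D'(1) rhom_om D'(2)])
    have "dot (U i) (?v + ?v') = t $ i" for i
    proof (cases "i \<in> B")
      case True
      have "dot (U i) ?v' = t $ i - dot (U i) ?v"
        unfolding U[of i ?v'] using Dy[OF D'(1,2,3) True] True by (simp add: w D'(4))
      then show ?thesis by (simp add: dot_add_right)
    next
      case False
      have "dot (U i) ?v' = 0" unfolding U[of i ?v'] using False by (simp add: w D'(3) dot_def)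
      moreover have "dot (U i) ?v = dot (M $ i) (\<Sum>l\<in>- B. t $ l *s V l)"
      proof -
        have "(\<chi> k. D (x k)) = (\<Sum>l\<in>- B. t $ l *s V l)" by (simp add: vec_eq_iff D(3))
        then show ?thesis unfolding U[of i ?v] using False by (simp add: w)
      qed
      moreover have "dot (M $ i) (\<Sum>l\<in>- B. t $ l *s V l) = (\<Sum>l\<in>- B. if l = i then t $ l else 0)"
        unfolding dot_commute[of "M $ i"] dot_sum_left dot_scale_left
        by (intro sum.cong refl) (auto simp: dot_commute[of _ "M $ i"] MV)
      ultimately show ?thesis using False by (simp add: dot_add_right sum.delta)
    qed
    then have "N *v (?v + ?v') = t" by (simp add: vec_eq_iff matrix_dot N_def)
    moreover have "?v + ?v' \<in> tang om (relations om w) w" using v v' by (rule vec.subspace_add[OF subspace_tang])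
    ultimately show "t \<in> (*v) N ` tang om (relations om w) w" by blast
  qed
  then have "vec.dim (UNIV :: ('k omega ^ 'n) set) \<le> vec.dim (tang om (relations om w) w)"
    using vec.dim_image_le[OF matrix_vector_mul_linear_gen, of N "tang om (relations om w) w"] by simp
  then show ?thesis using upper by (simp add: card_cart_basis)
qed

lemma swap_dim:
  fixes x :: "'n::finite \<Rightarrow> 'k::field_char_0 omega" and y :: "'n \<Rightarrow> 'k omega"
  shows "vec.dim (tang om (relations om (case_sum x y)) (case_sum x y))
    \<le> vec.dim (tang om (relations om (case_sum y x)) (case_sum y x))"
proof -
  let ?T = "\<lambda>w :: 'n + 'n \<Rightarrow> 'k omega. tang om (relations om w) w"
  define P :: "'k omega ^ ('n + 'n) ^ ('n + 'n)" where "P = (\<chi> s. axis (case_sum Inr Inl s) 1)"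
  have P: "(P *v v) $ s = v $ (case_sum Inr Inl s)" for v s by (simp add: matrix_dot P_def dot_axis)
  have inj: "inj_on ((*v) P) S" for S
  proof (rule inj_onI)
    fix v v' assume eq: "P *v v = P *v v'"
    have "v $ s = v' $ s" for s
      using arg_cong[OF eq, of "\<lambda>u. u $ (case_sum Inr Inl s)"] by (simp add: P split: sum.splits)
    then show "v = v'" by (simp add: vec_eq_iff)
  qed
  have "(*v) P ` ?T (case_sum x y) \<subseteq> ?T (case_sum y x)"
  proof clarify
    fix v assume "v \<in> ?T (case_sum x y)"
    then obtain D where D: "derivation D" "\<And>k. D (om k) = 0" "\<And>i. D (case_sum x y i) = v $ i"
      using tang_derivation[OF rhom_om] by blast
    have "P *v v = (\<chi> s. D (case_sum y x s))"
      by (auto simp: vec_eq_iff P D(3)[symmetric] split: sum.splits)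
    then show "P *v v \<in> ?T (case_sum y x)" using derivation_tang[OF D(1) rhom_om D(2)] by simp
  qed
  then have "vec.dim ((*v) P ` ?T (case_sum x y)) \<le> vec.dim (?T (case_sum y x))" by (rule vec.dim_subset)
  moreover have "vec.dim ((*v) P ` ?T (case_sum x y)) = vec.dim (?T (case_sum x y))"
    by (rule vec.dim_image_eq[OF matrix_vector_mul_linear_gen inj])
  ultimately show ?thesis by simp
qed

lemma conormal_pairs_dim:
  fixes X :: "('k::field_char_0, 'n::finite) proj_space set"
  assumes "(x, H) \<in> conormal_pairs X Z"
  shows "pdim X < CARD('n)"
proof (rule ccontr)
  assume no: "\<not> ?thesis"
  have x: "x \<in> X" "vec.dim (tangent_lin X x) = pdim X" "tangent_space X x \<subseteq> hyperplane H"
    using assms by (auto simp: conormal_pairs_def regular_locus_def)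
  obtain a where a: "a \<in> hcoords x" using hcoords_nonempty by blast
  obtain h where h: "h \<in> hcoords H" using hcoords_nonempty by blast
  have "vec.subspace (tangent_lin X x)" unfolding tangent_lin_eq[OF x(1) a] by (rule subspace_tang)
  then have "tangent_lin X x = UNIV"
    using vec.subspace_dim_equal[OF _ vec.subspace_UNIV subset_UNIV, of "tangent_lin X x"] no x(2)
    by (simp add: card_cart_basis)
  then have "dot (axis i 1) h = 0" for i
    using x(3) unfolding tangent_hyperplane[OF h] by (simp add: dot_commute[of _ h])
  then show False using hcoords_nonzero_nth[OF h] by (simp add: dot_axis)
qed

lemma irreducible_snd_image:
  fixes Q :: "(('k::field_char_0, 'n::finite) proj_space \<times> ('k, 'm::finite) proj_space) set"
  assumes Q: "irreducible_in bizariski Q"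
  shows "irreducible_in zariski (snd ` Q)"
  unfolding irreducible_in_def
proof (intro conjI allI impI; (elim conjE)?)
  show "snd ` Q \<noteq> {}" using Q by (simp add: irreducible_in_def)
  fix C D :: "('k, 'm) proj_space set"
  assume "closedin zariski C" "closedin zariski D" and sub: "snd ` Q \<subseteq> C \<union> D"
  moreover have "closedin zariski (UNIV :: ('k, 'n) proj_space set)"
    using closedin_topspace[of "zariski :: ('k, 'n) proj_space topology"] by simp
  ultimately have cl: "closedin bizariski (UNIV \<times> C :: (('k, 'n) proj_space \<times> _) set)"
      "closedin bizariski (UNIV \<times> D :: (('k, 'n) proj_space \<times> _) set)"
    using closed_vimage by blast+
  have "Q \<subseteq> UNIV \<times> C \<union> UNIV \<times> D" using sub by force
  then have "Q \<subseteq> UNIV \<times> C \<or> Q \<subseteq> UNIV \<times> D"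
    using Q cl unfolding irreducible_in_def by blast
  then show "snd ` Q \<subseteq> C \<or> snd ` Q \<subseteq> D" by auto
qed simp

lemma irreducible_rel_conormal:
  fixes X Z :: "('k::{alg_closed_field, field_char_0}, 'n::finite) proj_space set"
  assumes X: "irreducible_variety X" and Z: "irreducible_variety Z" "Z \<subseteq> X"
    and x0: "x0 \<in> regular_locus X" "x0 \<in> Z" and dim: "pdim X < CARD('n)"
  shows "irreducible_in bizariski (rel_conormal X Z)" and "irreducible_variety (rel_dual X Z)"
proof -
  show irr: "irreducible_in bizariski (rel_conormal X Z)"
    using conormal_generic[OF assms] irreducible_closure unfolding rel_conormal_eq[OF X] by blast
  show "irreducible_variety (rel_dual X Z)"
    unfolding rel_dual_def irreducible_variety_def projective_variety_def
    using irreducible_snd_image[OF irr] closed_snd_image[OF closed_rel_conormal] by blast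
qed

text \<open>At a generic point \<open>(x, y)\<close> of the conormal variety the tangent vectors of the dual variety at
  \<open>y\<close> are the \<open>D y\<close> for derivations \<open>D\<close> of the big field. Differentiating \<open>x \<cdot> y = 0\<close> and using
  that \<open>y\<close> kills \<open>D x\<close> shows that \<open>x\<close> kills \<open>D y\<close>. So the conormal variety is contained in the
  conormal variety of the dual, and both have the same dimension.\<close>

theorem biduality:
  fixes X :: "('k::{alg_closed_field, field_char_0}, 'n::finite) proj_space set"
  assumes X: "irreducible_variety X" and ne: "X \<noteq> UNIV"
  shows "irreducible_variety (dual_variety X)"
    and "rel_conormal X X = prod.swap ` rel_conormal (dual_variety X) (dual_variety X)"
proof -
  let ?Y = "dual_variety X"
  have irrX: "irreducible_in zariski X" using X by (simp add: irreducible_variety_def)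
  have dimX: "pdim X < CARD('n)" by (rule pdim_less[OF X ne])
  obtain x0 where x0: "x0 \<in> regular_locus X" using regular_locus_nonempty[OF irrX] by blast
  then have x0X: "x0 \<in> X" by (simp add: regular_locus_def)
  have Y_eq: "?Y = rel_dual X X" by (simp add: dual_variety_def rel_dual_def conormal_rel_conormal[OF X])
  show Y: "irreducible_variety ?Y"
    unfolding Y_eq by (rule irreducible_rel_conormal(2)[OF X X subset_refl x0 x0X dimX])
  have irrY: "irreducible_in zariski ?Y" using Y by (simp add: irreducible_variety_def)
  obtain B f e z y where G: "\<forall>i\<in>B. f i \<in> ideal X" "card B + pdim X = CARD('n)"
      "det (frame om B f e (\<lambda>i. z (Inl i))) \<noteq> 0" "relations om z = cyl_ideal X"
      "relations om (\<lambda>i. z (Inl i)) = ideal X"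
      "y = (\<lambda>k. \<Sum>i\<in>B. z (Inr i) * ev om (mp_pderiv k (f i)) (\<lambda>i. z (Inl i)))"
      "inst (bicone (conormal_pairs X X)) (case_sum (\<lambda>i. z (Inl i)) y)"
      "relations om (case_sum (\<lambda>i. z (Inl i)) y) = biideal (conormal_pairs X X)"
    using conormal_generic[OF X X subset_refl x0 x0X dimX] by blast
  define x where "x i = z (Inl i)" for i
  have inst: "inst (bicone (conormal_pairs X X)) (case_sum x y)"
    and relw: "relations om (case_sum x y) = biideal (conormal_pairs X X)"
    and relx: "relations om x = ideal X"
    using G(5,7,8) by (simp_all add: x_def[abs_def])
  have dim_w: "vec.dim (tang om (relations om (case_sum x y)) (case_sum x y)) = CARD('n)"
    using conormal_dim[OF bspec[OF G(1)] G(2-6)] by (simp add: x_def[abs_def])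
  have bi_closure: "biideal (conormal_pairs X X) = biideal (rel_conormal X X)"
  proof -
    have "conormal_pairs X X \<subseteq> rel_conormal X X"
      unfolding rel_conormal_eq[OF X] by (rule closure_of_subset) simp
    then show ?thesis
      unfolding rel_conormal_eq[OF X] biideal_def using bizariski_closure_iff[of _ "conormal_pairs X X"]
      by (auto simp: biideal_def)
  qed
  have rely: "relations om y = ideal ?Y"
  proof -
    have "g \<in> relations om y \<longleftrightarrow> mp_subst (\<lambda>i. mp_var (Inr i)) g \<in> relations om (case_sum x y)" for g
      by (simp add: relations_def ev_subst[OF rhom_om] ev_var[OF rhom_om])
    moreover have "mp_subst (\<lambda>i. mp_var (Inr i)) g \<in> biideal (rel_conormal X X) \<longleftrightarrow> g \<in> ideal ?Y" for g
    proof -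
      have "bivanishes (mp_subst (\<lambda>i. mp_var (Inr i)) g) q \<longleftrightarrow> vanishes g (snd q)"
        for q :: "('k, 'n) proj_space \<times> ('k, 'n) proj_space"
        using hcoords_nonempty[of "fst q"]
        by (auto simp: bivanishes_def vanishes_def mp_eval_ev ev_subst ev_var)
      then show ?thesis by (auto simp: biideal_def ideal_def Y_eq rel_dual_def)
    qed
    ultimately show ?thesis unfolding relw bi_closure by auto
  qed
  have xDy: "dot (\<chi> i. x i) v = 0" if v: "v \<in> tang om (ideal ?Y) y" for v
  proof -
    obtain D where D: "derivation D" "\<And>k. D (om k) = 0" "\<And>i. D (y i) = v $ i"
      using tang_derivation[OF rhom_om, of v y] v by (auto simp: rely)
    have y_comb: "(\<chi> k. y k) = (\<Sum>i\<in>B. z (Inr i) *s grad om (f i) x)"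
      by (simp add: vec_eq_iff G(6) sum_component x_def[abs_def])
    have "(\<chi> i. x i) \<in> tang om (ideal X) x"
      by (rule euler_tang[OF rhom_om]) (auto simp: relx ideal_hcomp)
    then have "dot (grad om (f i) x) (\<chi> i. x i) = 0" if "i \<in> B" for i
      using G(1) that by (auto simp: tang_def ann_def)
    then have "dot (\<chi> k. y k) (\<chi> i. x i) = 0"
      unfolding y_comb dot_sum_left dot_scale_left by (intro sum.neutral) simp
    then have "D (dot (\<chi> k. y k) (\<chi> i. x i)) = 0" by (simp add: der_0[OF D(1)])
    then have "dot (\<chi> k. y k) (\<chi> i. D (x i)) + dot (\<chi> i. x i) v = 0"
      by (simp add: dot_def der_sum[OF D(1)] der_mult[OF D(1)] D(3) sum.distrib)
    moreover have "dot (grad om (f i) x) (\<chi> i. D (x i)) = 0" if "i \<in> B" for i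
    proof -
      have "ev om (f i) x = 0" using G(1) that relx by (auto simp: relations_def)
      then show ?thesis
        unfolding der_ev_grad[OF D(1) rhom_om D(2), symmetric] by (simp add: der_0[OF D(1)])
    qed
    then have "dot (\<chi> k. y k) (\<chi> i. D (x i)) = 0"
      unfolding y_comb dot_sum_left dot_scale_left by (intro sum.neutral) simp
    ultimately show ?thesis by simp
  qed
  obtain B' g e' where F: "\<forall>i\<in>B'. g i \<in> ideal ?Y" "det (frame om B' g e' y) \<noteq> 0"
      "card B' + vec.dim (tang om (ideal ?Y) y) = CARD('n)"
    using frame_exists[OF rhom_om, where I = "ideal ?Y" and z = y] by blast
  have cardB': "card B' + pdim ?Y = CARD('n)" using F(3) by (simp add: pdim_eq[OF rely])
  have ty: "tang om (ideal ?Y) y = ann ((\<lambda>i. frame om B' g e' y $ i) ` B')"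
    by (rule frame_tang(2)) (use F in auto)
  have kill0: "ev om (mp_swap (kill_poly B' g e' l)) (case_sum x y) = 0" if "l \<notin> B'" for l
  proof -
    have "\<forall>v\<in>ann ((\<lambda>i. frame om B' g e' y $ i) ` B'). dot (\<chi> i. x i) v = 0"
      using xDy unfolding ty by blast
    then have "dot (\<chi> i. x i) (cofield_vec om B' g e' y l) = 0"
      using kills_ann_iff[OF rhom_om F(2), of "\<chi> i. x i"] that by blast
    then show ?thesis by (simp add: ev_swap[OF rhom_om] ev_kill_poly[OF rhom_om])
  qed
  \<comment> \<open>Tangency at the generic point consists of polynomial conditions, so it holds at
    almost all members of the representing family; these are honest conormal pairs of the dual
    variety.\<close>
  obtain s where s: "case_sum x y = (\<lambda>i. st (s i))"
    "eventually (\<lambda>j. (\<lambda>i. s i j) \<in> bicone (conormal_pairs X X)) oF"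
    using inst by (auto simp: inst_def)
  have y_st: "y = (\<lambda>i. st (s (Inr i)))"
  proof
    show "y i = st (s (Inr i))" for i using fun_cong[OF s(1), of "Inr i"] by simp
  qed
  have e1: "eventually (\<lambda>j. mp_eval (det (frame_poly B' g e')) (\<lambda>i. s (Inr i) j) \<noteq> 0) oF"
  proof -
    have "ev om (det (frame_poly B' g e')) y \<noteq> 0" using F(2) ev_frame_det[OF rhom_om, of B' g e' y] by simp
    then show ?thesis unfolding y_st st_ev st_eq_0 oF_not .
  qed
  have e2: "eventually (\<lambda>j. \<forall>l. l \<notin> B' \<longrightarrow> mp_eval (mp_swap (kill_poly B' g e' l)) (\<lambda>i. s i j) = 0) oF"
  proof -
    have "eventually (\<lambda>j. l \<notin> B' \<longrightarrow> mp_eval (mp_swap (kill_poly B' g e' l)) (\<lambda>i. s i j) = 0) oF" for l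
      using kill0[of l] unfolding s(1) st_ev st_eq_0 by (cases "l \<in> B'") auto
    then show ?thesis by (intro eventually_all_finite) blast
  qed
  have ev_pairs: "eventually (\<lambda>j. \<exists>v w. (\<lambda>i. s i j) = case_sum (($) v) (($) w) \<and> v \<noteq> 0 \<and> w \<noteq> 0 \<and>
      (pt w, pt v) \<in> conormal_pairs ?Y ?Y) oF"
    using s(2) e1 e2
  proof eventually_elim
    case (elim j)
    obtain v w t H where vw: "(\<lambda>i. s i j) = case_sum (($) v) (($) w)" "(t, H) \<in> conormal_pairs X X"
      "v \<in> hcoords t" "w \<in> hcoords H" using elim(1) by (auto simp: bicone_def)
    have sj: "(\<lambda>i. s (Inr i) j) = ($) w"
    proof
      show "s (Inr i) j = w $ i" for i using fun_cong[OF vw(1), of "Inr i"] by simp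
    qed
    have "conormal_pairs X X \<subseteq> rel_conormal X X"
      unfolding rel_conormal_eq[OF X] by (rule closure_of_subset) simp
    then have "(t, H) \<in> rel_conormal X X" using vw(2) by blast
    then have H: "H \<in> ?Y" unfolding Y_eq rel_dual_def by force
    have dw: "mp_eval (det (frame_poly B' g e')) (($) w) \<noteq> 0" using elim(2) by (simp add: sj)
    have "mp_eval (kill_poly B' g e' l) (case_sum (($) w) (($) v)) = 0" if "l \<notin> B'" for l
      using elim(3) that unfolding vw(1) by (simp add: mp_eval_ev ev_swap)
    then have "\<forall>u\<in>tangent_lin ?Y H. dot v u = 0"
      using kills_tangent_iff[OF irrY H vw(4) bspec[OF F(1)] cardB' dw] by blast
    then have "tangent_space ?Y H \<subseteq> hyperplane t" using tangent_hyperplane[OF vw(3)] by blast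
    moreover have "H \<in> regular_locus ?Y"
      by (rule regular_if_frame(1)[OF irrY H vw(4) bspec[OF F(1)] cardB' dw])
    ultimately have "(H, t) \<in> conormal_pairs ?Y ?Y" using H by (simp add: conormal_pairs_def)
    then show ?case using vw by (auto simp: in_hcoords_iff)
  qed
  have "\<exists>H t. (H, t) \<in> conormal_pairs ?Y ?Y"
  proof (rule ccontr)
    assume "\<not> ?thesis"
    then have "eventually (\<lambda>j. False) (oF :: 'k oidx filter)"
      using ev_pairs by (auto elim: eventually_mono)
    then show False by simp
  qed
  then obtain H0 t0 where H0: "(H0, t0) \<in> conormal_pairs ?Y ?Y" by blast
  have dimY: "pdim ?Y < CARD('n)" by (rule conormal_pairs_dim[OF H0])
  have H0r: "H0 \<in> regular_locus ?Y" "H0 \<in> ?Y" using H0 by (auto simp: conormal_pairs_def)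
  have sub: "biideal (conormal_pairs ?Y ?Y) \<subseteq> relations om (case_sum y x)"
  proof
    fix q assume q: "q \<in> biideal (conormal_pairs ?Y ?Y)"
    have "eventually (\<lambda>j. mp_eval (mp_swap q) (\<lambda>i. s i j) = 0) oF"
      using ev_pairs
    proof (rule eventually_mono, elim exE conjE)
      fix j v w assume *: "(\<lambda>i. s i j) = case_sum (($) v) (($) w)" "v \<noteq> 0" "w \<noteq> 0"
        "(pt w, pt v) \<in> conormal_pairs ?Y ?Y"
      then have "case_sum (($) w) (($) v) \<in> bicone (conormal_pairs ?Y ?Y)" by (simp add: in_bicone_iff)
      then show "mp_eval (mp_swap q) (\<lambda>i. s i j) = 0"
        using q unfolding *(1) biideal_iff by (simp add: mp_eval_ev ev_swap)
    qed
    then have "ev om (mp_swap q) (case_sum x y) = 0" by (simp add: s(1) st_ev st_eq_0)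
    then show "q \<in> relations om (case_sum y x)" by (simp add: relations_def ev_swap[OF rhom_om])
  qed
  obtain BY fY eY zY yY where GY: "\<forall>i\<in>BY. fY i \<in> ideal ?Y" "card BY + pdim ?Y = CARD('n)"
      "det (frame om BY fY eY (\<lambda>i. zY (Inl i))) \<noteq> 0" "relations om zY = cyl_ideal ?Y"
      "relations om (\<lambda>i. zY (Inl i)) = ideal ?Y"
      "yY = (\<lambda>k. \<Sum>i\<in>BY. zY (Inr i) * ev om (mp_pderiv k (fY i)) (\<lambda>i. zY (Inl i)))"
      "relations om (case_sum (\<lambda>i. zY (Inl i)) yY) = biideal (conormal_pairs ?Y ?Y)"
    using conormal_generic[OF Y Y subset_refl H0r dimY] by blast
  let ?wY = "case_sum (\<lambda>i. zY (Inl i)) yY"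
  have dim_wY: "vec.dim (tang om (relations om ?wY) ?wY) = CARD('n)"
    using conormal_dim[OF bspec[OF GY(1)] GY(2-6)] .
  have sub': "relations om ?wY \<subseteq> relations om (case_sum y x)" using sub GY(7) by simp
  \<comment> \<open>Both conormal varieties have bicones of dimension \<open>CARD('n)\<close>, so
    the specialization from the generic point of the second to \<open>(y, x)\<close> loses no
    dimension and the relations agree.\<close>
  have "vec.dim (tang om (relations om (case_sum y x)) (case_sum y x)) = vec.dim (tang om (relations om ?wY) ?wY)"
    using specialization_dim(1)[OF rhom_om sub'] swap_dim[of x y] dim_w dim_wY by simp
  then have sup: "relations om (case_sum y x) \<subseteq> biideal (conormal_pairs ?Y ?Y)"
    using specialization_dim(2)[OF rhom_om sub'] GY(7) by simp
  have mem: "(t, H) \<in> rel_conormal X X \<longleftrightarrow> (H, t) \<in> rel_conormal ?Y ?Y" for t H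
  proof -
    have "relations om (case_sum y x) = biideal (conormal_pairs ?Y ?Y)" using sub sup by blast
    then have eq: "q \<in> biideal (conormal_pairs ?Y ?Y) \<longleftrightarrow> mp_swap q \<in> biideal (conormal_pairs X X)" for q
      unfolding relw[symmetric] by (auto simp: relations_def ev_swap[OF rhom_om])
    have eq': "q \<in> biideal (conormal_pairs X X) \<longleftrightarrow> mp_swap q \<in> biideal (conormal_pairs ?Y ?Y)" for q
    proof -
      have "mp_swap (mp_swap q) \<in> biideal (conormal_pairs X X) \<longleftrightarrow> q \<in> biideal (conormal_pairs X X)"
        by (simp add: biideal_def bivanishes_swap)
      then show ?thesis using eq[of "mp_swap q"] by blast
    qed
    show ?thesis
      unfolding rel_conormal_eq[OF X] rel_conormal_eq[OF Y] bizariski_closure_iff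
    proof
      assume *: "\<forall>q\<in>biideal (conormal_pairs X X). bivanishes q (t, H)"
      show "\<forall>q\<in>biideal (conormal_pairs ?Y ?Y). bivanishes q (H, t)"
        using * eq bivanishes_swap[of _ "(t, H)"] by fastforce
    next
      assume *: "\<forall>q\<in>biideal (conormal_pairs ?Y ?Y). bivanishes q (H, t)"
      show "\<forall>q\<in>biideal (conormal_pairs X X). bivanishes q (t, H)"
        using * eq' bivanishes_swap[of _ "(H, t)"] by fastforce
    qed
  qed
  show "rel_conormal X X = prod.swap ` rel_conormal ?Y ?Y"
  proof (rule set_eqI)
    fix q :: "('k, 'n) proj_space \<times> ('k, 'n) proj_space"
    obtain t H where q: "q = (t, H)" by (cases q)
    show "q \<in> rel_conormal X X \<longleftrightarrow> q \<in> prod.swap ` rel_conormal ?Y ?Y"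
      unfolding q mem by (auto intro: image_eqI[where x = "(H, t)"])
  qed
qed

section \<open>Linear contact loci\<close>

text \<open>The equations are the 2 by 2 minors formed with a fixed coordinate vector of
  \<open>p\<close>.\<close>

lemma closed_point: "closedin zariski {p :: ('k::field_char_0, 'n::finite) proj_space}"
proof -
  obtain a where a: "a \<in> hcoords p" using hcoords_nonempty by blast
  define F where "F = range (\<lambda>(i, j). mp_const (a $ i) * mp_var j - mp_const (a $ j) * mp_var i :: ('k, 'n) mpoly)"
  have ev: "mp_eval (mp_const (a $ i) * mp_var j - mp_const (a $ j) * mp_var i) (($) v) = a $ i * v $ j - a $ j * v $ i"
    for i j v by (simp add: mp_eval_ev ev_simps)
  have "{p} = {x. \<forall>f\<in>F. vanishes f x}"
  proof (intro equalityI subsetI)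
    fix x assume "x \<in> {p}"
    then have "mp_eval f (($) v) = 0" if "f \<in> F" "v \<in> hcoords x" for f v
      using that hcoords_multiple[OF a, of v] by (auto simp: F_def ev)
    then show "x \<in> {x. \<forall>f\<in>F. vanishes f x}" by (simp add: vanishes_def)
  next
    fix x assume x: "x \<in> {x. \<forall>f\<in>F. vanishes f x}"
    obtain v where v: "v \<in> hcoords x" using hcoords_nonempty by blast
    have eq: "a $ i * v $ j = a $ j * v $ i" for i j
    proof -
      have "mp_const (a $ i) * mp_var j - mp_const (a $ j) * mp_var i \<in> F" by (auto simp: F_def)
      then have "a $ i * v $ j - a $ j * v $ i = 0"
        using x v ev[of i j v] unfolding vanishes_def by auto
      then show ?thesis by simp
    qed
    obtain i where i: "v $ i \<noteq> 0" using hcoords_nonzero_nth[OF v] by blast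
    have "a = (a $ i / v $ i) *s v"
      using i eq[of i] by (simp add: vec_eq_iff field_simps)
    moreover have "a $ i / v $ i \<noteq> 0" using calculation a by (metis in_hcoords_iff vec.scale_zero_left)
    ultimately have "a \<in> hcoords x" using hcoords_scale[OF v] by metis
    then show "x \<in> {p}" using a by (simp add: in_hcoords_iff)
  qed
  then show ?thesis by (simp only: zariski_locus(1))
qed

text \<open>The projectivized annihilator. For the tangent space of the dual variety at a smooth
  \<open>H\<close> it is the contact locus of \<open>H\<close>.\<close>

definition kernel_space :: "('k::field ^ 'n::finite) set \<Rightarrow> ('k, 'n) proj_space set" where
  "kernel_space T = {x. \<forall>a\<in>hcoords x. \<forall>v\<in>T. dot a v = 0}"

lemma closed_kernel_space:
  fixes T :: "('k::field_char_0 ^ 'n::finite) set"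
  shows "closedin zariski (kernel_space T)"
proof -
  have "kernel_space T = {x. \<forall>f\<in>(\<lambda>v. \<Sum>i\<in>UNIV. mp_var i * mp_const (v $ i)) ` T. vanishes f x}"
    by (auto simp: kernel_space_def vanishes_def mp_eval_ev ev_simps dot_def)
  then show ?thesis by (simp only: zariski_locus(1))
qed

context
  fixes M :: "'k::{alg_closed_field, field_char_0} ^ 'n ^ 'n" and B :: "'n::finite set"
  assumes M: "det M \<noteq> 0"
begin

abbreviation row_ann :: "('k ^ 'n) set" where "row_ann \<equiv> ann ((\<lambda>i. M $ i) ` B)"

lemma row_combination_kills: "v \<in> row_ann \<Longrightarrow> dot (\<Sum>i\<in>B. l i *s M $ i) v = 0"
  unfolding dot_sum_left dot_scale_left by (intro sum.neutral) (auto simp: ann_def)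

lemma row_dual: "\<exists>V. \<forall>i j. dot (V i) (M $ j) = (if i = j then 1 else 0)"
proof -
  have "\<forall>i. \<exists>v. M *v v = axis i 1" using nonsingular_solve[OF M] by blast
  then obtain V where V: "\<And>i. M *v V i = axis i 1" by metis
  have "dot (M $ j) (V i) = (if i = j then 1 else 0)" for i j
    using arg_cong[OF V[of i], of "\<lambda>w. w $ j"] by (auto simp: matrix_dot axis_def)
  then show ?thesis by (metis dot_commute)
qed

lemma row_combination_nonzero:
  assumes "i \<in> B" "l i \<noteq> 0"
  shows "(\<Sum>i\<in>B. l i *s M $ i) \<noteq> 0"
proof
  assume 0: "(\<Sum>i\<in>B. l i *s M $ i) = 0"
  obtain V where V: "\<And>i j. dot (V i) (M $ j) = (if i = j then 1 else 0)" using row_dual by blast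
  have "dot (\<Sum>j\<in>B. l j *s M $ j) (V i) = (\<Sum>j\<in>B. if j = i then l j else 0)"
    unfolding dot_sum_left dot_scale_left by (intro sum.cong refl) (auto simp: dot_commute[of _ "V i"] V)
  then show False using 0 assms by (simp add: sum.delta)
qed

lemma pt_row_combination:
  assumes "(\<Sum>i\<in>B. l i *s M $ i) \<noteq> 0"
  shows "pt (\<Sum>i\<in>B. l i *s M $ i) \<in> kernel_space row_ann"
  unfolding kernel_space_def
proof (intro CollectI ballI)
  fix a v assume a: "a \<in> hcoords (pt (\<Sum>i\<in>B. l i *s M $ i))" and v: "v \<in> row_ann"
  obtain c where "a = c *s (\<Sum>i\<in>B. l i *s M $ i)" using hcoords_multiple[OF hcoords_pt[OF assms] a] by blast
  then show "dot a v = 0" using row_combination_kills[OF v] by (simp add: dot_scale_left)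
qed

text \<open>Coefficients of row combinations are linear coordinates: fewer than
  \<open>card B\<close> conditions on them have a nonzero solution, whereas the dual basis gives
  \<open>card B\<close> conditions without one.\<close>

lemma meets_kernel_space: "meets (kernel_space row_ann) k \<longleftrightarrow> k < card B"
proof
  assume k: "meets (kernel_space row_ann) k"
  show "k < card B"
  proof (rule ccontr)
    assume no: "\<not> ?thesis"
    obtain q :: "nat \<Rightarrow> 'n" where q: "bij_betw q {..<card B} B"
      using ex_bij_betw_nat_finite[of B] by (auto simp: lessThan_atLeast0)
    obtain V where V: "\<And>i j. dot (V i) (M $ j) = (if i = j then 1 else 0)" using row_dual by blast
    obtain x where x: "x \<in> kernel_space row_ann" "\<And>a j. a \<in> hcoords x \<Longrightarrow> j < k \<Longrightarrow> dot (V (q j)) a = 0"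
      using k[unfolded meets_def, rule_format, of "\<lambda>j. V (q j)"] by blast
    obtain a where a: "a \<in> hcoords x" using hcoords_nonempty by blast
    obtain l where l: "a = (\<Sum>i\<in>B. l i *s M $ i)"
      using double_ann[OF M, of B a] x(1) a by (auto simp: kernel_space_def)
    have "l i = 0" if i: "i \<in> B" for i
    proof -
      obtain j where "j < card B" "i = q j" using q i by (auto simp: bij_betw_def)
      then have "dot (V i) a = 0" using x(2)[OF a, of j] no by simp
      moreover have "dot (V i) a = (\<Sum>j\<in>B. if j = i then l j else 0)"
        unfolding l dot_commute[of "V i"] dot_sum_left dot_scale_left
        by (intro sum.cong refl) (auto simp: dot_commute[of _ "V i"] V)
      ultimately show ?thesis using i by (simp add: sum.delta)
    qed
    then have "a = 0" unfolding l by (intro sum.neutral) simp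
    then show False using a by (simp add: in_hcoords_iff)
  qed
next
  assume k: "k < card B"
  show "meets (kernel_space row_ann) k"
    unfolding meets_def
  proof
    fix u :: "nat \<Rightarrow> 'k ^ 'n"
    let ?T = "{l :: 'k ^ 'n. \<forall>i. i \<notin> B \<longrightarrow> l $ i = 0}"
    have "vec.subspace ?T" by (auto simp: vec.subspace_def)
    moreover have "k < vec.dim ?T" using k by (simp add: dim_substandard_cart)
    ultimately obtain l where l: "l \<in> ?T" "l \<noteq> 0" "\<And>j. j < k \<Longrightarrow> dot (\<chi> i. dot (u j) (M $ i)) l = 0"
      using common_kernel[of ?T k "\<lambda>j. \<chi> i. dot (u j) (M $ i)"] by blast
    let ?a = "\<Sum>i\<in>B. l $ i *s M $ i"
    obtain i where "l $ i \<noteq> 0" using l(2) by (auto simp: vec_eq_iff)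
    then have nz: "?a \<noteq> 0" using l(1) by (intro row_combination_nonzero[of i]) auto
    have "dot (u j) a = 0" if a: "a \<in> hcoords (pt ?a)" and j: "j < k" for a j
    proof -
      have "dot (u j) ?a = (\<Sum>i\<in>B. dot (u j) (M $ i) * l $ i)"
        unfolding dot_commute[of "u j"] dot_sum_left dot_scale_left by (simp add: mult.commute)
      also have "\<dots> = (\<Sum>i\<in>UNIV. dot (u j) (M $ i) * l $ i)"
        using l(1) by (intro sum.mono_neutral_left) auto
      also have "\<dots> = 0" using l(3)[OF j] by (simp add: dot_def[of "\<chi> i. _ i"])
      finally have "dot (u j) ?a = 0" .
      moreover obtain c where "a = c *s ?a" using hcoords_multiple[OF hcoords_pt[OF nz] a] by blast
      ultimately show ?thesis by (simp add: dot_scale_right)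
    qed
    then show "\<exists>x\<in>kernel_space row_ann. \<forall>a\<in>hcoords x. \<forall>j<k. dot (u j) a = 0"
      using pt_row_combination[OF nz] by blast
  qed
qed

text \<open>The coefficients parametrize the space, so equations pull back to polynomials on affine
  space, where finitely many nonzero functions are nonzero simultaneously.\<close>

lemma irreducible_kernel_space:
  assumes B: "B \<noteq> {}"
  shows "irreducible_in zariski (kernel_space row_ann)"
  unfolding irreducible_in_def
proof (intro conjI allI impI; (elim conjE)?)
  have "meets (kernel_space row_ann) 0" unfolding meets_kernel_space using B by (simp add: card_gt_0_iff)
  then show "kernel_space row_ann \<noteq> {}" by (simp add: meets_0)
  fix C D assume C: "closedin zariski C" and D: "closedin zariski D" and sub: "kernel_space row_ann \<subseteq> C \<union> D"
  define \<sigma> :: "'n \<Rightarrow> ('k, 'n) mpoly" where "\<sigma> k = (\<Sum>i\<in>B. mp_var i * mp_const (M $ i $ k))" for k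
  have ev_\<sigma>: "mp_eval (mp_subst \<sigma> f) l = mp_eval f (($) (\<Sum>i\<in>B. l i *s M $ i))" for f l
  proof -
    have "(\<lambda>k. ev (\<lambda>x. x) (\<sigma> k) l) = ($) (\<Sum>i\<in>B. l i *s M $ i)"
      by (simp add: fun_eq_iff \<sigma>_def ev_simps sum_component)
    then show ?thesis by (simp add: mp_eval_ev ev_subst)
  qed
  have ex: "\<exists>f\<in>ideal C. \<exists>l. mp_eval (mp_subst \<sigma> f) l \<noteq> 0"
    if C: "closedin zariski C" "\<not> kernel_space row_ann \<subseteq> C" for C
  proof -
    obtain p where p: "p \<in> kernel_space row_ann" "p \<notin> C" using C(2) by blast
    then obtain f a where f: "f \<in> ideal C" "a \<in> hcoords p" "mp_eval f (($) a) \<noteq> 0"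
      using closed_memI[OF C(1), of p] unfolding vanishes_def by blast
    obtain l where "a = (\<Sum>i\<in>B. l i *s M $ i)"
      using double_ann[OF M, of B a] p(1) f(2) by (auto simp: kernel_space_def)
    then have "mp_eval (mp_subst \<sigma> f) l \<noteq> 0" using f(3) by (simp add: ev_\<sigma>)
    then show ?thesis using f(1) by blast
  qed
  show "kernel_space row_ann \<subseteq> C \<or> kernel_space row_ann \<subseteq> D"
  proof (rule ccontr)
    assume "\<not> ?thesis"
    then obtain f g where f: "f \<in> ideal C" "\<exists>l. mp_eval (mp_subst \<sigma> f) l \<noteq> 0"
      and g: "g \<in> ideal D" "\<exists>l. mp_eval (mp_subst \<sigma> g) l \<noteq> 0"
      using ex[OF C] ex[OF D] by blast
    obtain i1 where i1: "i1 \<in> B" using B by blast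
    have "\<exists>l. mp_eval (mp_var i1 :: ('k, 'n) mpoly) l \<noteq> 0"
      by (rule exI[of _ "\<lambda>i. 1"]) (simp add: mp_eval_ev ev_var)
    then have "\<exists>l. \<forall>q\<in>{mp_subst \<sigma> f, mp_subst \<sigma> g, mp_var i1}. mp_eval q l \<noteq> 0"
      using f(2) g(2) by (intro affine_avoid) auto
    then obtain l where l: "mp_eval (mp_subst \<sigma> f) l \<noteq> 0" "mp_eval (mp_subst \<sigma> g) l \<noteq> 0" "l i1 \<noteq> 0"
      by (auto simp: mp_eval_ev ev_var)
    let ?a = "\<Sum>i\<in>B. l i *s M $ i"
    have nz: "?a \<noteq> 0" using row_combination_nonzero[OF i1] l(3) by blast
    then have "pt ?a \<in> C \<union> D" using pt_row_combination[OF nz] sub by blast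
    then show False
      using l(1,2) f(1) g(1) hcoords_pt[OF nz] unfolding ev_\<sigma> ideal_def vanishes_def by blast
  qed
qed simp

lemma krull_dim_kernel_space:
  assumes B: "B \<noteq> {}"
  shows "krull_dim zariski (kernel_space row_ann) = enat (card B - 1)"
proof -
  have pos: "card B > 0" using B by (simp add: card_gt_0_iff)
  have ne: "kernel_space row_ann \<noteq> {}"
    using irreducible_kernel_space[OF B] by (simp add: irreducible_in_def)
  have iff: "enat k \<le> krull_dim zariski (kernel_space row_ann) \<longleftrightarrow> k < card B" for k
    by (simp add: krull_dim_ge_iff[OF closed_kernel_space ne] meets_kernel_space)
  have "\<not> enat (card B) \<le> krull_dim zariski (kernel_space row_ann)" "enat (card B - 1) \<le> krull_dim zariski (kernel_space row_ann)"
    using iff pos by simp_all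
  then show ?thesis using pos by (cases "krull_dim zariski (kernel_space row_ann)") auto
qed

text \<open>A closed subset of full dimension contains a variety whose \<open>pdim\<close> is at
  least \<open>card B\<close>. If it were proper, the \<open>pdim\<close> of the irreducible linear
  space would exceed \<open>card B\<close>, and the space would meet too many hyperplanes.\<close>

lemma kernel_space_maximal:
  assumes B: "B \<noteq> {}" and F: "closedin zariski F" "F \<subseteq> kernel_space row_ann" "F \<noteq> {}"
    and dim: "krull_dim zariski F = krull_dim zariski (kernel_space row_ann)"
  shows "F = kernel_space row_ann"
proof -
  have pos: "card B > 0" using B by (simp add: card_gt_0_iff)
  have irr: "irreducible_in zariski (kernel_space row_ann)" by (rule irreducible_kernel_space[OF B])
  have "meets F (card B - 1)"
    using krull_dim_ge_iff[OF F(1,3), of "card B - 1"] by (simp add: dim krull_dim_kernel_space[OF B])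
  from meets_irreducible[OF F(1) this] obtain V where V: "irreducible_variety V" "V \<subseteq> F" "card B - 1 < pdim V"
    by blast
  have "V = kernel_space row_ann"
  proof (rule ccontr)
    assume "V \<noteq> kernel_space row_ann"
    then have "pdim V < pdim (kernel_space row_ann)"
      using V F(2) irr by (intro pdim_mono(2)) (auto simp: irreducible_variety_def projective_variety_def)
    then have "card B < pdim (kernel_space row_ann)" using V(3) by simp
    then have "meets (kernel_space row_ann) (card B)"
      using irr closed_kernel_space
      by (intro irreducible_meets) (auto simp: irreducible_variety_def projective_variety_def)
    then show False by (simp add: meets_kernel_space)
  qed
  then show ?thesis using V(2) F(2) by blast
qed

end

section \<open>Generic dimensions\<close>

lemma generically_onI:
  fixes Y :: "('k::field_char_0, 'n::finite) proj_space set"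
  assumes Y: "irreducible_in zariski Y" and C: "closedin zariski C" "\<not> Y \<subseteq> C"
    and P: "\<And>y. y \<in> Y \<Longrightarrow> y \<notin> C \<Longrightarrow> P y"
  shows "generically_on zariski Y P"
  unfolding generically_on_def
proof (intro exI conjI ballI)
  have "openin zariski (UNIV - C)" using C(1) by (simp add: closedin_def)
  then show "openin (subtopology zariski Y) (Y - C)"
    unfolding openin_subtopology by (intro exI[of _ "UNIV - C"]) auto
  show "Y \<subseteq> zariski closure_of (Y - C)"
    by (rule irreducible_dense[OF Y C closedin_closure_of closure_of_subset]) simp
qed (use P in auto)

lemma generically_on_witness:
  fixes Y :: "('k::field_char_0, 'n::finite) proj_space set"
  assumes Y: "irreducible_in zariski Y" and PQ: "generically_on zariski Y P" "generically_on zariski Y Q"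
  shows "\<exists>y\<in>Y. P y \<and> Q y"
proof -
  obtain U where U: "openin (subtopology zariski Y) U" "Y \<subseteq> zariski closure_of U" "\<And>y. y \<in> U \<Longrightarrow> P y"
    using PQ(1) by (auto simp: generically_on_def)
  obtain V where V: "openin (subtopology zariski Y) V" "Y \<subseteq> zariski closure_of V" "\<And>y. y \<in> V \<Longrightarrow> Q y"
    using PQ(2) by (auto simp: generically_on_def)
  obtain S where S: "openin zariski S" "U = S \<inter> Y" using U(1) by (auto simp: openin_subtopology)
  obtain T where T: "openin zariski T" "V = T \<inter> Y" using V(1) by (auto simp: openin_subtopology)
  have ne: "Y \<noteq> {}" using Y by (simp add: irreducible_in_def)
  have cl: "closedin zariski (UNIV - S)" "closedin zariski (UNIV - T)"
    using openin_closedin_eq[of zariski S] openin_closedin_eq[of zariski T] S(1) T(1) by simp_all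
  have "U \<noteq> {}" "V \<noteq> {}" using U(2) V(2) ne by auto
  then have "\<not> Y \<subseteq> UNIV - S" "\<not> Y \<subseteq> UNIV - T" using S(2) T(2) by blast+
  then have "\<not> Y \<subseteq> (UNIV - S) \<union> (UNIV - T)"
    using Y cl unfolding irreducible_in_def by meson
  then obtain y where "y \<in> Y" "y \<in> S" "y \<in> T" by blast
  then show ?thesis using U(3) V(3) S(2) T(2) by blast
qed

text \<open>This evaluates the definite descriptions in \<open>defect\<close> and
  \<open>rel_defect\<close>.\<close>

lemma the_generic:
  fixes Y :: "('k::field_char_0, 'n::finite) proj_space set"
  assumes Y: "irreducible_in zariski Y" and g: "generically_on zariski Y (\<lambda>y. \<phi> y = d)"
  shows "(THE d. generically_on zariski Y (\<lambda>y. \<phi> y = d)) = d"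
proof (rule the_equality)
  show "generically_on zariski Y (\<lambda>y. \<phi> y = d)" by (rule g)
  fix d' assume "generically_on zariski Y (\<lambda>y. \<phi> y = d')"
  then show "d' = d" using generically_on_witness[OF Y g] by blast
qed

text \<open>A fibre has dimension at least \<open>k\<close> if and only if it meets all linear subspaces of codimension
  \<open>k\<close>; by elimination this is a closed condition, so the fibre dimension has a generic value.\<close>

lemma generic_fibre_dim:
  fixes A :: "(('k::{alg_closed_field, field_char_0}, 'n::finite) proj_space \<times> ('k, 'n) proj_space) set"
  assumes A: "closedin bizariski A" and irr: "irreducible_in zariski (snd ` A)"
  shows "\<exists>C d. closedin zariski C \<and> \<not> snd ` A \<subseteq> C \<and>
    (\<forall>H\<in>snd ` A - C. krull_dim zariski {x. (x, H) \<in> A} = d)"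
proof -
  have univ: "closedin zariski (UNIV :: ('k, 'n) proj_space set)"
    using closedin_topspace[of "zariski :: ('k, 'n) proj_space topology"] by simp
  have fibre: "closedin zariski {x. (x, H) \<in> A}" for H
  proof -
    have "closedin zariski (fst ` (A \<inter> (UNIV \<times> {H})))"
      by (intro closed_fst_image closedin_Int A closed_vimage univ closed_point)
    moreover have "fst ` (A \<inter> (UNIV \<times> {H})) = {x. (x, H) \<in> A}" by force
    ultimately show ?thesis by simp
  qed
  define Cl where "Cl k = {H. meets {x. (x, H) \<in> A} k}" for k
  have closed_Cl: "closedin zariski (Cl k)" for k
  proof -
    define lin where "lin u = kernel_space (u ` {..<k})" for u :: "nat \<Rightarrow> 'k ^ 'n"
    have "Cl k = (\<Inter>u. snd ` (A \<inter> (lin u \<times> UNIV)))"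
    proof (intro equalityI subsetI)
      fix H assume H: "H \<in> Cl k"
      show "H \<in> (\<Inter>u. snd ` (A \<inter> (lin u \<times> UNIV)))"
      proof
        fix u
        obtain x where "(x, H) \<in> A" "\<forall>a\<in>hcoords x. \<forall>j<k. dot (u j) a = 0"
          using H unfolding Cl_def meets_def by blast
        then have "(x, H) \<in> A \<inter> (lin u \<times> UNIV)" by (auto simp: lin_def kernel_space_def dot_commute)
        then show "H \<in> snd ` (A \<inter> (lin u \<times> UNIV))" by force
      qed
    next
      fix H assume H: "H \<in> (\<Inter>u. snd ` (A \<inter> (lin u \<times> UNIV)))"
      show "H \<in> Cl k"
        unfolding Cl_def meets_def
      proof (intro CollectI allI)
        fix u :: "nat \<Rightarrow> 'k ^ 'n"
        obtain x where "(x, H) \<in> A" "x \<in> lin u" using H by fastforce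
        then show "\<exists>x\<in>{x. (x, H) \<in> A}. \<forall>a\<in>hcoords x. \<forall>j<k. dot (u j) a = 0"
          by (auto simp: lin_def kernel_space_def dot_commute)
      qed
    qed
    moreover have "closedin zariski (\<Inter>u. snd ` (A \<inter> (lin u \<times> UNIV)))"
      unfolding lin_def
      by (intro closedin_INT closed_snd_image closedin_Int A closed_vimage univ closed_kernel_space) simp
    ultimately show ?thesis by simp
  qed
  have ne: "snd ` A \<noteq> {}" using irr by (simp add: irreducible_in_def)
  \<comment> \<open>The generic value is the least \<open>k\<close> for which some fibre has
    dimension at most \<open>k\<close>; one exists because no set meets all linear spaces cut out by
    \<open>CARD('n)\<close> forms or more.\<close>
  define P where "P k \<longleftrightarrow> (\<exists>H\<in>snd ` A. \<not> meets {x. (x, H) \<in> A} (Suc k))" for k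
  have "P (CARD('n))" using ne meets_less unfolding P_def by fastforce
  define k where "k = (LEAST k. P k)"
  have Pk: "P k" unfolding k_def using \<open>P (CARD('n))\<close> by (rule LeastI)
  have least: "\<not> P j" if "j < k" for j using that unfolding k_def by (rule not_less_Least)
  have lower: "meets {x. (x, H) \<in> A} k" if H: "H \<in> snd ` A" for H
  proof (cases k)
    case 0
    then show ?thesis using H by (force simp: meets_0)
  next
    case (Suc j)
    then show ?thesis using least[of j] H by (auto simp: P_def)
  qed
  show ?thesis
  proof (intro exI[of _ "Cl (Suc k)"] exI[of _ "enat k"] conjI ballI closed_Cl)
    show "\<not> snd ` A \<subseteq> Cl (Suc k)" using Pk by (auto simp: P_def Cl_def)
    fix H assume H: "H \<in> snd ` A - Cl (Suc k)"
    then have neH: "{x. (x, H) \<in> A} \<noteq> {}" by force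
    have "enat k \<le> krull_dim zariski {x. (x, H) \<in> A}" "\<not> enat (Suc k) \<le> krull_dim zariski {x. (x, H) \<in> A}"
      using lower[of H] H unfolding krull_dim_ge_iff[OF fibre neH] by (auto simp: Cl_def)
    then show "krull_dim zariski {x. (x, H) \<in> A} = enat k"
      by (cases "krull_dim zariski {x. (x, H) \<in> A}") auto
  qed
qed

section \<open>The relative reflexivity theorem\<close>

theorem theorem1p3:
  fixes X Z :: "('k::{alg_closed_field, field_char_0}, 'n::finite) proj_space set"
  assumes "irreducible_variety X"
    and "irreducible_variety Z"
    and "Z \<subseteq> X"
    and "X \<noteq> UNIV"
    and "dual_regular_rel X Z"
  shows "(rel_defect X Z = defect X \<longleftrightarrow> reflexive_rel X Z) \<and>
    (reflexive_rel X Z \<longleftrightarrow> reciprocal_rel X Z)"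
proof -
  note X = assms(1) and Z = assms(2) and ZX = assms(3)
  define Y where "Y = dual_variety X"
  define YZ where "YZ = rel_dual X Z"
  define A where "A = rel_conormal X Z"
  define B where "B = rel_conormal Y YZ"
  have Y: "irreducible_variety Y" unfolding Y_def by (rule biduality(1)[OF X assms(4)])
  have bidual: "(x, H) \<in> rel_conormal X X \<longleftrightarrow> (H, x) \<in> rel_conormal Y Y" for x H
    unfolding biduality(2)[OF X assms(4)] Y_def by force
  have irrX: "irreducible_in zariski X" and clX: "closedin zariski X"
    and irrZ: "irreducible_in zariski Z" and clZ: "closedin zariski Z"
    and irrY: "irreducible_in zariski Y" and clY: "closedin zariski Y"
    using X Z Y by (auto simp: irreducible_variety_def projective_variety_def)
  have univ: "closedin zariski (UNIV :: ('k, 'n) proj_space set)"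
    using closedin_topspace[of "zariski :: ('k, 'n) proj_space topology"] by simp
  obtain x0 H0 where xH0: "(x0, H0) \<in> A" "x0 \<in> regular_locus X" "H0 \<in> regular_locus Y"
    using assms(5) unfolding dual_regular_rel_def A_def Y_def[symmetric] smooth_locus_eq[OF X] smooth_locus_eq[OF Y] by blast
  have x0Z: "x0 \<in> Z"
    using rel_conormal_regular[OF X clZ xH0(1)[unfolded A_def] xH0(2)] by (simp add: conormal_pairs_def)
  have dimX: "pdim X < CARD('n)" by (rule pdim_less[OF X assms(4)])
  have A_W: "A \<subseteq> rel_conormal X X" unfolding A_def by (rule rel_conormal_mono[OF ZX])
  have clA: "closedin bizariski A" unfolding A_def by (rule closed_rel_conormal)
  have clB: "closedin bizariski B" unfolding B_def by (rule closed_rel_conormal)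
  have irrA: "irreducible_in bizariski A" and YZ: "irreducible_variety YZ"
    unfolding A_def YZ_def by (rule irreducible_rel_conormal[OF X Z ZX xH0(2) x0Z dimX])+
  have YZ_eq: "YZ = snd ` A" by (simp add: YZ_def rel_dual_def A_def)
  have Y_eq: "Y = snd ` rel_conormal X X"
    by (simp add: Y_def dual_variety_def conormal_rel_conormal[OF X])
  have YZ_Y: "YZ \<subseteq> Y" unfolding YZ_eq Y_eq using A_W by blast
  have irrYZ: "irreducible_in zariski YZ" and clYZ: "closedin zariski YZ"
    using YZ by (auto simp: irreducible_variety_def projective_variety_def)
  have H0YZ: "H0 \<in> YZ" unfolding YZ_eq using xH0(1) by force
  \<comment> \<open>A conormal pair exists only if \<open>pdim Y\<close> is below
    \<open>CARD('n)\<close>, which is required for the irreducibility of \<open>B\<close>.\<close>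
  have "(H0, x0) \<in> conormal_pairs Y Y"
    using xH0(1) A_W bidual by (intro rel_conormal_regular[OF Y clY _ xH0(3)]) blast
  then have dimY: "pdim Y < CARD('n)" by (rule conormal_pairs_dim)
  have irrB: "irreducible_in bizariski B"
    unfolding B_def by (rule irreducible_rel_conormal(1)[OF Y YZ YZ_Y xH0(3) H0YZ dimY])
  have B_W: "B \<subseteq> rel_conormal Y Y" unfolding B_def by (rule rel_conormal_mono[OF YZ_Y])
  obtain C1 where C1: "closedin zariski C1" "regular_locus X = X - C1" using regular_locus_open[OF irrX] by blast
  obtain C2 where C2: "closedin zariski C2" "regular_locus Y = Y - C2" using regular_locus_open[OF irrY] by blast
  have B_pairs: "(H, x) \<in> conormal_pairs Y Y" if "(x, H) \<in> rel_conormal X X" "H \<in> regular_locus Y" for x H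
    using that bidual by (intro rel_conormal_regular[OF Y clY _ that(2)]) blast
  have pairs_B: "(H, x) \<in> B" if "(H, x) \<in> conormal_pairs Y Y" "H \<in> YZ" for x H
  proof -
    have "(H, x) \<in> conormal_pairs Y YZ" using that by (auto simp: conormal_pairs_def)
    then show ?thesis
      using closure_of_subset[of "conormal_pairs Y YZ" bizariski] unfolding B_def rel_conormal_eq[OF Y] by auto
  qed
  have pairs_A: "(x, H) \<in> A" if "(x, H) \<in> conormal_pairs X X" "x \<in> Z" for x H
  proof -
    have "(x, H) \<in> conormal_pairs X Z" using that by (auto simp: conormal_pairs_def)
    then show ?thesis
      using closure_of_subset[of "conormal_pairs X Z" bizariski] unfolding A_def rel_conormal_eq[OF X] by auto
  qed
  have A_Z: "x \<in> Z" "H \<in> YZ" if "(x, H) \<in> A" for x H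
    using that rel_conormal_subset[OF clZ, of X] unfolding YZ_eq A_def by force+
  have B_YZ: "H \<in> YZ" if "(H, x) \<in> B" for x H
    using that rel_conormal_subset[OF clYZ, of Y] unfolding B_def by blast
  have clC: "closedin bizariski (C1 \<times> UNIV \<union> UNIV \<times> C2)" "closedin bizariski (C2 \<times> UNIV \<union> UNIV \<times> C1)"
    using C1(1) C2(1) univ by (intro closedin_Un closed_vimage; simp)+
  \<comment> \<open>Over regular points of \<open>Y\<close> biduality turns members of
    \<open>A\<close> into conormal pairs of \<open>Y\<close>, and their hyperplanes lie in
    \<open>YZ\<close>. The pair \<open>(x0, H0)\<close> shows that these members are dense in
    \<open>A\<close>.\<close>
  have A_sub_B: "A \<subseteq> prod.swap ` B"
  proof (rule irreducible_dense[OF irrA clC(1) _ closed_swap[OF clB]])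
    show "\<not> A \<subseteq> C1 \<times> UNIV \<union> UNIV \<times> C2" using xH0 C1(2) C2(2) by auto
    show "A - (C1 \<times> UNIV \<union> UNIV \<times> C2) \<subseteq> prod.swap ` B"
    proof (rule subrelI)
      fix x H assume "(x, H) \<in> A - (C1 \<times> UNIV \<union> UNIV \<times> C2)"
      then have xH: "(x, H) \<in> A" "(x, H) \<notin> C1 \<times> UNIV \<union> UNIV \<times> C2" by auto
      then have "H \<in> regular_locus Y" using A_Z(2)[OF xH(1)] YZ_Y C2(2) by blast
      then have "(H, x) \<in> B" using B_pairs A_W xH(1) A_Z(2)[OF xH(1)] pairs_B by blast
      then show "(x, H) \<in> prod.swap ` B" by (rule image_eqI[rotated]) simp
    qed
  qed
  then have AB: "(H, x) \<in> B" if "(x, H) \<in> A" for x H using that by auto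
  have refl_iff: "reflexive_rel X Z \<longleftrightarrow> (\<forall>H x. (H, x) \<in> B \<longrightarrow> (x, H) \<in> A)"
  proof -
    have "reflexive_rel X Z \<longleftrightarrow> A = prod.swap ` B"
      by (simp add: reflexive_rel_def A_def B_def Y_def YZ_def)
    also have "\<dots> \<longleftrightarrow> prod.swap ` B \<subseteq> A" using A_sub_B by blast
    finally show ?thesis by auto
  qed
  have recip_iff: "reciprocal_rel X Z \<longleftrightarrow> snd ` B = Z"
    by (simp add: reciprocal_rel_def rel_dual_def B_def Y_def YZ_def)
  \<comment> \<open>At every point of \<open>Z\<close> regular on \<open>X\<close> some hyperplane
    is tangent, because \<open>X\<close> is not the whole space; the closed image therefore contains
    a dense part of \<open>Z\<close>.\<close>
  have fst_A: "fst ` A = Z"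
  proof
    show "fst ` A \<subseteq> Z" using A_Z(1) by force
    show "Z \<subseteq> fst ` A"
    proof (rule irreducible_dense[OF irrZ C1(1) _ closed_fst_image[OF clA]])
      show "\<not> Z \<subseteq> C1" using x0Z xH0(2) C1(2) by blast
      show "Z - C1 \<subseteq> fst ` A"
      proof
        fix x assume x: "x \<in> Z - C1"
        then have xr: "x \<in> regular_locus X" using ZX C1(2) by blast
        obtain a where a: "a \<in> hcoords x" using hcoords_nonempty by blast
        have xX: "x \<in> X" using xr by (simp add: regular_locus_def)
        obtain Bf f e where f: "\<forall>i\<in>Bf. f i \<in> ideal X" "card Bf + pdim X = CARD('n)"
          "mp_eval (det (frame_poly Bf f e)) (($) a) \<noteq> 0" using frame_at_regular[OF irrX xr a] by blast
        have reg: "tangent_lin X x = ann ((\<lambda>i. frame (\<lambda>x. x) Bf f e (($) a) $ i) ` Bf)"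
            "det (frame (\<lambda>x. x) Bf f e (($) a)) \<noteq> 0"
          by (rule regular_if_frame[OF irrX xX a _ f(2,3)]; use f(1) in blast)+
        have "Bf \<noteq> {}" using f(2) dimX by auto
        then have "kernel_space (tangent_lin X x) \<noteq> {}"
          unfolding reg(1) using irreducible_kernel_space[OF reg(2)] by (simp add: irreducible_in_def)
        then obtain H where H: "H \<in> kernel_space (tangent_lin X x)" by blast
        obtain h where h: "h \<in> hcoords H" using hcoords_nonempty by blast
        have "(x, H) \<in> conormal_pairs X X"
          using H h xr xX tangent_hyperplane[OF h, of X x] by (auto simp: conormal_pairs_def kernel_space_def)
        then show "x \<in> fst ` A" using pairs_A x by force
      qed
    qed
  qed

  \<comment> \<open>Reflexivity and reciprocity\<close>
  have "reflexive_rel X Z \<Longrightarrow> reciprocal_rel X Z"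
  proof -
    assume "reflexive_rel X Z"
    then have "A = prod.swap ` B" using refl_iff A_sub_B by auto
    then have "fst ` A = snd ` B" by (simp add: image_image)
    then show ?thesis using fst_A unfolding recip_iff by simp
  qed
  moreover have "reciprocal_rel X Z \<Longrightarrow> reflexive_rel X Z"
  proof -
    assume "reciprocal_rel X Z"
    then have sndB: "snd ` B = Z" by (simp add: recip_iff)
    have "B \<subseteq> prod.swap ` A"
    proof (rule irreducible_dense[OF irrB clC(2) _ closed_swap[OF clA]])
      have "(H0, x0) \<in> B" by (rule AB[OF xH0(1)])
      then show "\<not> B \<subseteq> C2 \<times> UNIV \<union> UNIV \<times> C1" using xH0 C1(2) C2(2) by auto
      show "B - (C2 \<times> UNIV \<union> UNIV \<times> C1) \<subseteq> prod.swap ` A"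
      proof (rule subrelI)
        fix H x assume "(H, x) \<in> B - (C2 \<times> UNIV \<union> UNIV \<times> C1)"
        then have *: "(H, x) \<in> B" "(H, x) \<notin> C2 \<times> UNIV \<union> UNIV \<times> C1" by auto
        then have xZ: "x \<in> Z" using sndB by force
        then have "x \<in> regular_locus X" using ZX C1(2) *(2) by blast
        then have "(x, H) \<in> conormal_pairs X X"
          using *(1) B_W bidual by (intro rel_conormal_regular[OF X clX]) blast+
        then have "(x, H) \<in> A" using pairs_A xZ by blast
        then show "(H, x) \<in> prod.swap ` A" by (rule image_eqI[rotated]) simp
      qed
    qed
    then show ?thesis unfolding refl_iff by auto
  qed

  \<comment> \<open>Defects and reflexivity\<close>
  moreover have "rel_defect X Z = defect X \<longleftrightarrow> reflexive_rel X Z"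
  proof -
    \<comment> \<open>The number of independent gradients at a regular point of \<open>Y\<close>;
      the linear contact locus there has projective dimension \<open>r - 1\<close>.\<close>
    define r where "r = CARD('n) - pdim Y"
    have contact: "{x. (H, x) \<in> conormal_pairs Y Y} = kernel_space (tangent_lin Y H)"
      if H: "H \<in> regular_locus Y" for H
    proof (rule set_eqI)
      fix x :: "('k, 'n) proj_space"
      obtain a where a: "a \<in> hcoords x" using hcoords_nonempty by blast
      have "x \<in> kernel_space (tangent_lin Y H) \<longleftrightarrow> (\<forall>v\<in>tangent_lin Y H. dot a v = 0)"
      proof
        assume *: "\<forall>v\<in>tangent_lin Y H. dot a v = 0"
        show "x \<in> kernel_space (tangent_lin Y H)"
          unfolding kernel_space_def
        proof (intro CollectI ballI)
          fix a' v assume a': "a' \<in> hcoords x" and v: "v \<in> tangent_lin Y H"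
          obtain c where "a' = c *s a" using hcoords_multiple[OF a a'] by blast
          then show "dot a' v = 0" using * v by (simp add: dot_scale_left)
        qed
      qed (use a in \<open>auto simp: kernel_space_def\<close>)
      then show "x \<in> {x. (H, x) \<in> conormal_pairs Y Y} \<longleftrightarrow> x \<in> kernel_space (tangent_lin Y H)"
        using H tangent_hyperplane[OF a, of Y H] by (auto simp: conormal_pairs_def regular_locus_def)
    qed
    have frameY: "\<exists>M Bf. det M \<noteq> 0 \<and> Bf \<noteq> {} \<and> card Bf = r \<and> tangent_lin Y H = ann ((\<lambda>i. M $ i) ` Bf)"
      if H: "H \<in> regular_locus Y" for H
    proof -
      obtain a where a: "a \<in> hcoords H" using hcoords_nonempty by blast
      have HY: "H \<in> Y" using H by (simp add: regular_locus_def)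
      obtain Bf f e where f: "\<forall>i\<in>Bf. f i \<in> ideal Y" "card Bf + pdim Y = CARD('n)"
        "mp_eval (det (frame_poly Bf f e)) (($) a) \<noteq> 0" using frame_at_regular[OF irrY H a] by blast
      have reg: "tangent_lin Y H = ann ((\<lambda>i. frame (\<lambda>x. x) Bf f e (($) a) $ i) ` Bf)"
          "det (frame (\<lambda>x. x) Bf f e (($) a)) \<noteq> 0"
        by (rule regular_if_frame[OF irrY HY a _ f(2,3)]; use f(1) in blast)+
      have "Bf \<noteq> {}" "card Bf = r" using f(2) dimY by (auto simp: r_def)
      then show ?thesis using reg by blast
    qed
    have dimK: "krull_dim zariski (kernel_space (tangent_lin Y H)) = enat (r - 1)" if H: "H \<in> regular_locus Y" for H
      using frameY[OF H] krull_dim_kernel_space by metis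
    have neK: "kernel_space (tangent_lin Y H) \<noteq> {}" if H: "H \<in> regular_locus Y" for H
      using frameY[OF H] irreducible_kernel_space unfolding irreducible_in_def by metis
    have contact_X: "contact_locus H X = kernel_space (tangent_lin Y H)" if H: "H \<in> regular_locus Y" for H
    proof -
      have "contact_locus H X = {x. (x, H) \<in> rel_conormal X X}"
        unfolding contact_locus_def conormal_rel_conormal[OF X] by force
      also have "\<dots> = {x. (H, x) \<in> conormal_pairs Y Y}"
      proof -
        have "conormal_pairs Y Y \<subseteq> rel_conormal Y Y"
          unfolding rel_conormal_eq[OF Y] by (rule closure_of_subset) simp
        then show ?thesis using B_pairs[OF _ H] bidual by blast
      qed
      finally show ?thesis by (simp add: contact[OF H])
    qed
    have "\<not> Y \<subseteq> C2" using xH0(3) C2(2) by blast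
    then have "generically_on zariski Y (\<lambda>H. krull_dim zariski (contact_locus H X) = enat (r - 1))"
      using contact_X dimK C2(2) by (intro generically_onI[OF irrY C2(1)]) auto
    then have def_X: "defect X = enat (r - 1)"
      unfolding defect_def Y_def[symmetric] by (rule the_generic[OF irrY])
    have rel_contact: "rel_contact_locus H X Z = {x. (x, H) \<in> A}" for H
      unfolding rel_contact_locus_def A_def by force
    have YZ_C2: "\<not> YZ \<subseteq> C2" using H0YZ xH0(3) C2(2) by blast
    show ?thesis
    proof
      assume refl: "reflexive_rel X Z"
      have "rel_contact_locus H X Z = kernel_space (tangent_lin Y H)" if H: "H \<in> YZ" "H \<notin> C2" for H
      proof -
        have Hr: "H \<in> regular_locus Y" using H YZ_Y C2(2) by blast
        have "{x. (x, H) \<in> A} = {x. (H, x) \<in> conormal_pairs Y Y}"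
          using refl refl_iff B_pairs[OF _ Hr] A_W pairs_B H(1) by blast
        then show ?thesis by (simp add: rel_contact contact[OF Hr])
      qed
      then have "generically_on zariski YZ (\<lambda>H. krull_dim zariski (rel_contact_locus H X Z) = enat (r - 1))"
        using dimK YZ_Y C2(2) by (intro generically_onI[OF irrYZ C2(1) YZ_C2]) auto
      then have "rel_defect X Z = enat (r - 1)"
        unfolding rel_defect_def YZ_def[symmetric] by (rule the_generic[OF irrYZ])
      then show "rel_defect X Z = defect X" by (simp add: def_X)
    next
      assume eq: "rel_defect X Z = defect X"
      \<comment> \<open>The description in \<open>rel_defect\<close> carries information only once a
        generic fibre dimension is known to exist; then the equality of defects can be compared with
        actual fibres.\<close>
      obtain C d where C: "closedin zariski C" "\<not> YZ \<subseteq> C"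
        "\<And>H. H \<in> YZ \<Longrightarrow> H \<notin> C \<Longrightarrow> krull_dim zariski {x. (x, H) \<in> A} = d"
        using generic_fibre_dim[OF clA] irrYZ unfolding YZ_eq by auto
      have "generically_on zariski YZ (\<lambda>H. krull_dim zariski (rel_contact_locus H X Z) = d)"
        using C(3) by (intro generically_onI[OF irrYZ C(1,2)]) (simp add: rel_contact)
      then have "rel_defect X Z = d"
        unfolding rel_defect_def YZ_def[symmetric] by (rule the_generic[OF irrYZ])
      then have d: "d = enat (r - 1)" using eq def_X by simp
      \<comment> \<open>The relative fibre is a closed subset of a linear space of the same
        dimension, which is irreducible.\<close>
      have full: "{x. (x, H) \<in> A} = kernel_space (tangent_lin Y H)" if H: "H \<in> YZ" "H \<notin> C" "H \<notin> C2" for H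
      proof -
        have Hr: "H \<in> regular_locus Y" using H YZ_Y C2(2) by blast
        obtain M Bf where M: "det M \<noteq> 0" "Bf \<noteq> {}" "tangent_lin Y H = ann ((\<lambda>i. M $ i) ` Bf)"
          using frameY[OF Hr] by blast
        have cl: "closedin zariski {x. (x, H) \<in> A}"
        proof -
          have "closedin zariski (fst ` (A \<inter> (UNIV \<times> {H})))"
            by (intro closed_fst_image closedin_Int clA closed_vimage univ closed_point)
          moreover have "fst ` (A \<inter> (UNIV \<times> {H})) = {x. (x, H) \<in> A}" by force
          ultimately show ?thesis by simp
        qed
        have sub: "{x. (x, H) \<in> A} \<subseteq> kernel_space (tangent_lin Y H)"
          unfolding contact[OF Hr, symmetric] using B_pairs[OF _ Hr] A_W by blast
        have ne: "{x. (x, H) \<in> A} \<noteq> {}" using H(1) unfolding YZ_eq by force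
        have "krull_dim zariski {x. (x, H) \<in> A} = krull_dim zariski (kernel_space (tangent_lin Y H))"
          using C(3)[OF H(1,2)] d dimK[OF Hr] by simp
        then show ?thesis
          using kernel_space_maximal[OF M(1,2) cl] sub ne unfolding M(3) by blast
      qed
      \<comment> \<open>A member of \<open>B\<close> outside the excluded set is needed before the
        comparison over the open part extends to all of \<open>B\<close>.\<close>
      have "\<exists>H\<in>YZ. \<forall>C'\<in>{C, C2}. H \<notin> C'"
        using C(1,2) C2(1) YZ_C2 by (intro irreducible_avoid[OF irrYZ]) auto
      then obtain H1 where H1: "H1 \<in> YZ" "H1 \<notin> C" "H1 \<notin> C2" by blast
      have H1r: "H1 \<in> regular_locus Y" using H1 YZ_Y C2(2) by blast
      obtain x1 where "x1 \<in> kernel_space (tangent_lin Y H1)" using neK[OF H1r] by blast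
      then have B1: "(H1, x1) \<in> B" using full[OF H1] AB by blast
      have clC': "closedin bizariski ((C \<union> C2) \<times> (UNIV :: ('k, 'n) proj_space set))"
        using C(1) C2(1) univ by (intro closed_vimage closedin_Un)
      have "B \<subseteq> prod.swap ` A"
      proof (rule irreducible_dense[OF irrB clC' _ closed_swap[OF clA]])
        show "\<not> B \<subseteq> (C \<union> C2) \<times> UNIV" using B1 H1 by blast
        show "B - (C \<union> C2) \<times> UNIV \<subseteq> prod.swap ` A"
        proof (rule subrelI)
          fix H x assume "(H, x) \<in> B - (C \<union> C2) \<times> UNIV"
          then have *: "(H, x) \<in> B" "(H, x) \<notin> (C \<union> C2) \<times> UNIV" by auto
          have H: "H \<in> YZ" "H \<notin> C" "H \<notin> C2" using B_YZ[OF *(1)] *(2) by auto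
          have Hr: "H \<in> regular_locus Y" using H YZ_Y C2(2) by blast
          have "(x, H) \<in> rel_conormal X X" using *(1) B_W bidual by blast
          then have "x \<in> kernel_space (tangent_lin Y H)"
            unfolding contact[OF Hr, symmetric] using B_pairs[OF _ Hr] by blast
          then have "(x, H) \<in> A" using full[OF H] by blast
          then show "(H, x) \<in> prod.swap ` A" by (rule image_eqI[rotated]) simp
        qed
      qed
      then show "reflexive_rel X Z" unfolding refl_iff by auto
    qed
  qed
  ultimately show ?thesis by blast
qed

end
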